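(* Let $\ell\ge 2$ and $r\ge 2$ be integers, and let $\lambda=(r-2)/(2\ell-2)$. Then asymptotically almost surely $$\mathrm{ex}(G^r_{n,p},\mathcal{B}^r_{2\ell})\le\begin{cases} n^{1+\frac{1}{2\ell-1}+o(1)}, & \text{if } n^{-r+1+\frac{1}{2\ell-1}}\le p\le n^{-\frac{(r-1+\lambda)(\ell-1)}{2\ell-1}+o(1)},\\ p^{\frac{1}{(r-1+\lambda)\ell}}n^{1+\frac{1}{\ell}+o(1)}, & \text{if } n^{-\frac{(r-1+\lambda)(\ell-1)}{2\ell-1}+o(1)}\le p\le 1.\end{cases}$$
   Context: $G^r_{n,p}$ is the random $r$-uniform hypergraph on $[n]$ with each $r$-subset an edge independently with probability $p$. For a family $\mathcal{F}$ of $r$-graphs, $\mathrm{ex}(G^r_{n,p},\mathcal{F})$ is the maximum number of edges in a subgraph of $G^r_{n,p}$ containing no member of $\mathcal{F}$. For $k\ge 2$, the family $\mathcal{B}^r_k$ of $r$-uniform Berge cycles of length $k$ consists of all $r$-graphs with $k$ distinct edges $e_1,\dots,e_k$ for which there are $k$ distinct vertices $v_1,\dots,v_k$ with $v_{i-1},v_i\in e_i$ for $1\le i\le k$, where $v_0=v_k$. Each $o(1)$ denotes a function of $n$ tending to $0$ as $n\to\infty$. Asymptotically almost surely means with probability tending to $1$ as $n\to\infty$. *)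

theory Defs
  imports "HOL-Probability.Probability" "HOL-Library.Ramsey"
begin

text \<open>
  A hypergraph is represented by its set of edges. Isolated vertices are irrelevant here:
  a hypergraph contains a Berge cycle together with some isolated vertices only if it contains
  the Berge cycle itself. Vertices are natural numbers, so every finite hypergraph occurs up to
  isomorphism.
\<close>

type_synonym hypergraph = "nat set set"

definition contains_copy :: "hypergraph \<Rightarrow> hypergraph \<Rightarrow> bool" where
  "contains_copy H F \<longleftrightarrow> (\<exists>\<phi>. inj_on \<phi> (\<Union>F) \<and> (\<forall>e\<in>F. \<phi> ` e \<in> H))"

text \<open>
  The extremal number of a finite host hypergraph \<open>G\<close> relative to a family; the maximum is over
  a nonempty set as soon as no member of the family is edgeless.
\<close>

definition ex_rel :: "hypergraph \<Rightarrow> hypergraph set \<Rightarrow> nat" where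
  "ex_rel G \<F> = Max {card H | H. H \<subseteq> G \<and> (\<forall>F\<in>\<F>. \<not> contains_copy H F)}"

text \<open>The indices run over \<open>1, \<dots>, k\<close>; the value \<open>v 0\<close> only serves as another name for \<open>v k\<close>.\<close>

definition berge_cycles :: "nat \<Rightarrow> nat \<Rightarrow> hypergraph set" where
  "berge_cycles r k = {F. F \<subseteq> nsets UNIV r \<and>
     (\<exists>(e :: nat \<Rightarrow> nat set) (v :: nat \<Rightarrow> nat).
        F = e ` {1..k} \<and> inj_on e {1..k} \<and> inj_on v {1..k} \<and> v 0 = v k \<and>
        (\<forall>i\<in>{1..k}. v (i - 1) \<in> e i \<and> v i \<in> e i))}"

definition random_hypergraph :: "nat \<Rightarrow> nat \<Rightarrow> real \<Rightarrow> hypergraph pmf" where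
  "random_hypergraph r n p =
     map_pmf (\<lambda>f. {e \<in> nsets {1..n} r. f e})
       (Pi_pmf (nsets {1..n} r) False (\<lambda>_. bernoulli_pmf p))"

end

theory Submission
  imports Defs "HOL-Real_Asymp.Real_Asymp"
begin

text \<open>
  Call a weight on the \<open>2l\<close>-element subsets of an edge set \<open>X\<close> spread if its codegrees decay
  geometrically. If every edge set of size at least \<open>E\<close> carries a spread weight supported on Berge
  \<open>2l\<close>-cycles, then the hypergraph container method covers the sets without Berge cycles by few sets
  of size less than \<open>E\<close>, and a union bound over the containers, with \<open>E\<close> of order \<open>m / p\<close>, shows that
  more than \<open>m\<close> edges of the random hypergraph without a Berge cycle are unlikely.

  To build the weight, fix a threshold \<open>B = \<theta> powr (1 - 1 / R)\<close> with \<open>R = r - 1 + lam\<close>. If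
  at least half of the edges contain a pair of codegree at most \<open>B\<close>, they form a multigraph of
  multiplicity at most \<open>B\<close>, and a spread weight on its \<open>2l\<close>-cycles comes from chains of short random
  walks between common end points, of the least length \<open>t\<close> for which many walks join heavily
  connected pairs. Otherwise most edges contain only pairs of codegree above \<open>B\<close>, and one glues
  random triangles along a fan and covers the sides of its boundary by random edges. The value of \<open>lam\<close>
  is the one for which both constructions give the same bound.
\<close>


section \<open>Containers\<close>

text \<open>The exponent of \<open>B\<close> balances two opposite demands. Walks see
  \<open>B\<close> as a multiplicity: \<open>2 * n * (\<theta> ^ (l - 1) * B) \<le> D ^ l\<close>,
  with \<open>D\<close> the minimum degree, forces heavily connected pairs to occur on half of the
  walks of length \<open>l\<close>, so a small \<open>B\<close> permits a large \<theta>. The fan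
  sees \<open>B\<close> as a codegree: a pair in at least \<open>B\<close> edges has at least about
  \<open>M0 = B powr (1 / (r - 2))\<close> vertices in its neighbourhood, and a completely
  prescribed cycle of the fan has relative weight about
  \<open>1 / (M0 ^ (2 * l - 2) * B ^ (2 * l - 1))\<close>. Equating this with
  \<open>(1 / \<theta>) ^ (2 * l - 1)\<close> gives the exponent \<open>1 - 1 / R\<close>.
  Minimality of \<open>t\<close> controls the price of a prescribed dart: proper subwalks obey upper
  bounds, the end pair of the whole walk obeys a lower bound, and the quotient is about
  \<open>1 / \<theta>\<close> per dart. The obstacle is that two walks of length \<open>t\<close>
  close up to a cycle of length only \<open>2 * t\<close>. The missing \<open>2 * (l - t)\<close>
  darts are final darts of further walks from the same start, so that only two kinds of end pairs
  ever have to be conditioned on.\<close>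

definition cod :: "'a set \<Rightarrow> ('a set \<Rightarrow> real) \<Rightarrow> 'a set \<Rightarrow> real" where
  "cod X w S = (\<Sum>e | e \<subseteq> X \<and> S \<subseteq> e. w e)"

text \<open>For total mass \<open>1\<close> the average degree is \<open>k / card X\<close>, so
  degrees are bounded by a constant multiple of the average, and each further prescribed element
  must save a factor \<open>\<tau>\<close>. In the container theorem \<open>\<tau>\<close> is
  \<open>L / card X\<close>, where \<open>L\<close> bounds the length of a fingerprint.\<close>

definition spread :: "nat \<Rightarrow> real \<Rightarrow> real \<Rightarrow> 'a set \<Rightarrow> ('a set \<Rightarrow> real) \<Rightarrow> bool" where
  "spread k K \<tau> X w \<longleftrightarrow> (\<forall>e. 0 \<le> w e) \<and> (\<forall>e. w e \<noteq> 0 \<longrightarrow> e \<subseteq> X \<and> card e = k) \<and>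
     1 \<le> sum w (Pow X) \<and>
     (\<forall>S\<subseteq>X. S \<noteq> {} \<longrightarrow> cod X w S \<le> K / card X * \<tau> ^ (card S - 1))"

lemma spread_nonneg: "spread k K \<tau> X w \<Longrightarrow> 0 \<le> w e"
  and spread_uniform: "spread k K \<tau> X w \<Longrightarrow> w e \<noteq> 0 \<Longrightarrow> e \<subseteq> X \<and> card e = k"
  and spread_mass: "spread k K \<tau> X w \<Longrightarrow> 1 \<le> sum w (Pow X)"
  and spread_cod: "spread k K \<tau> X w \<Longrightarrow> S \<subseteq> X \<Longrightarrow> S \<noteq> {} \<Longrightarrow> cod X w S \<le> K / card X * \<tau> ^ (card S - 1)"
  unfolding spread_def by blast+

lemma cod_nonneg: "(\<And>e. 0 \<le> w e) \<Longrightarrow> 0 \<le> cod X w S"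
  unfolding cod_def by (simp add: sum_nonneg)

lemma cod_mono: "(\<And>e. w e \<le> w' e) \<Longrightarrow> cod X w S \<le> cod X w' S"
  unfolding cod_def by (simp add: sum_mono)

lemma cod_eq_sum_Pow: "finite X \<Longrightarrow> cod X w S = (\<Sum>e\<in>Pow X. if S \<subseteq> e then w e else 0)"
  unfolding cod_def by (simp add: sum.inter_filter[symmetric])

lemma sum_cod_subsets:
  assumes "finite X" and "\<And>e. w e \<noteq> 0 \<Longrightarrow> card e = k"
  shows "(\<Sum>T | T \<subseteq> X \<and> card T = i. cod X w T) = real (k choose i) * sum w (Pow X)"
proof -
  have "(\<Sum>T | T \<subseteq> X \<and> card T = i. cod X w T)
      = (\<Sum>T | T \<subseteq> X \<and> card T = i. \<Sum>e\<in>Pow X. if T \<subseteq> e then w e else 0)"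
    using assms(1) by (simp add: cod_eq_sum_Pow)
  also have "\<dots> = (\<Sum>e\<in>Pow X. \<Sum>T | T \<subseteq> X \<and> card T = i. if T \<subseteq> e then w e else 0)"
    by (rule sum.swap)
  also have "\<dots> = (\<Sum>e\<in>Pow X. real (k choose i) * w e)"
  proof (rule sum.cong[OF refl])
    fix e assume e: "e \<in> Pow X"
    then have fe: "finite e" using assms(1) finite_subset by auto
    have "(\<Sum>T | T \<subseteq> X \<and> card T = i. if T \<subseteq> e then w e else 0) = (\<Sum>T | T \<subseteq> e \<and> card T = i. w e)"
      using e assms(1) by (intro sum.mono_neutral_cong_right) (auto dest: finite_subset)
    also have "\<dots> = real (card e choose i) * w e" using n_subsets[OF fe] by simp
    also have "\<dots> = real (k choose i) * w e" using assms(2)[of e] by (cases "w e = 0") auto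
    finally show "(\<Sum>T | T \<subseteq> X \<and> card T = i. if T \<subseteq> e then w e else 0) = real (k choose i) * w e" .
  qed
  finally show ?thesis by (simp add: sum_distrib_left)
qed

lemma sum_link_eq_cod:
  assumes "finite X" "v \<in> X" "v \<notin> T"
  shows "(\<Sum>f | f \<subseteq> X \<and> T \<subseteq> f. if v \<in> f then 0 else g (insert v f)) = cod X g (insert v T)"
proof -
  have "(\<Sum>f | f \<subseteq> X \<and> T \<subseteq> f. if v \<in> f then 0 else g (insert v f))
      = (\<Sum>f | f \<subseteq> X \<and> T \<subseteq> f \<and> v \<notin> f. g (insert v f))"
    using assms(1) by (intro sum.mono_neutral_cong_right) auto
  also have "\<dots> = (\<Sum>e | e \<subseteq> X \<and> insert v T \<subseteq> e. g e)"
    by (rule sum.reindex_bij_witness[where i = "\<lambda>e. e - {v}" and j = "insert v"])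
       (use assms in \<open>auto simp: insert_absorb\<close>)
  finally show ?thesis unfolding cod_def .
qed

text \<open>One round of the container algorithm. The list records the elements of the independent set
  that were picked so far; each pick adds its link to \<open>link_weight\<close>, except for the
  edges through a set whose codegree has already reached its cap.\<close>

definition unsat :: "nat \<Rightarrow> real \<Rightarrow> real \<Rightarrow> 'a set \<Rightarrow> ('a set \<Rightarrow> real) \<Rightarrow> ('a set \<Rightarrow> real) \<Rightarrow> 'a set \<Rightarrow> real" where
  "unsat k a \<tau> X w \<nu> e =
     (if \<exists>T\<subseteq>e. T \<noteq> {} \<and> card T \<le> k \<and> a * \<tau> ^ card T \<le> cod X \<nu> T then 0 else w e)"

fun link_weight :: "nat \<Rightarrow> real \<Rightarrow> real \<Rightarrow> 'a set \<Rightarrow> ('a set \<Rightarrow> real) \<Rightarrow> 'a list \<Rightarrow> 'a set \<Rightarrow> real" where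
  "link_weight k a \<tau> X w [] f = 0"
| "link_weight k a \<tau> X w (v # xs) f = link_weight k a \<tau> X w xs f +
     (if v \<in> f then 0 else unsat k a \<tau> X w (link_weight k a \<tau> X w xs) (insert v f))"

text \<open>The head of the list is the most recent pick, so \<open>xs\<close> is the history
  against which the degree of \<open>v\<close> is measured.\<close>

fun heavy_picks :: "real \<Rightarrow> nat \<Rightarrow> real \<Rightarrow> real \<Rightarrow> 'a set \<Rightarrow> ('a set \<Rightarrow> real) \<Rightarrow> 'a list \<Rightarrow> bool" where
  "heavy_picks h k a \<tau> X w [] \<longleftrightarrow> True"
| "heavy_picks h k a \<tau> X w (v # xs) \<longleftrightarrow> heavy_picks h k a \<tau> X w xs \<and>
     h \<le> cod X (unsat k a \<tau> X w (link_weight k a \<tau> X w xs)) {v}"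

context
  fixes X :: "'a set" and w :: "'a set \<Rightarrow> real" and k :: nat and K a \<tau> :: real
  assumes fin: "finite X" and sp: "spread (Suc k) K \<tau> X w" and tau: "0 < \<tau>" and a: "0 < a"
    and aK: "K / card X \<le> a"
begin

private abbreviation "\<nu> \<equiv> link_weight k a \<tau> X w"
private abbreviation "G \<equiv> \<lambda>xs. unsat k a \<tau> X w (link_weight k a \<tau> X w xs)"

private lemma w0: "0 \<le> w e" by (rule spread_nonneg[OF sp])

private lemma G0: "0 \<le> G xs e" and Gw: "G xs e \<le> w e" unfolding unsat_def using w0 by auto

private lemma nu0: "0 \<le> \<nu> xs f" by (induction xs) (auto intro: add_nonneg_nonneg G0)

private lemma nu_unif: "\<nu> xs f \<noteq> 0 \<Longrightarrow> f \<subseteq> X \<and> card f = k"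
proof (induction xs)
  case (Cons v xs)
  show ?case
  proof (cases "\<nu> xs f = 0")
    case True
    with Cons.prems have "v \<notin> f" "G xs (insert v f) \<noteq> 0" by (auto split: if_splits)
    then have "w (insert v f) \<noteq> 0" unfolding unsat_def by (auto split: if_splits)
    then have "insert v f \<subseteq> X" "card (insert v f) = Suc k" using spread_uniform[OF sp] by blast+
    then show ?thesis using \<open>v \<notin> f\<close> fin by (metis card_insert_disjoint finite_subset insert_subset nat.inject)
  qed (use Cons in auto)
qed simp

private lemma mass_step:
  assumes "v \<in> X"
  shows "sum (\<nu> (v # xs)) (Pow X) = sum (\<nu> xs) (Pow X) + cod X (G xs) {v}"
proof -
  have "(\<Sum>f | f \<subseteq> X \<and> {} \<subseteq> f. if v \<in> f then 0 else G xs (insert v f)) = cod X (G xs) (insert v {})"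
    by (rule sum_link_eq_cod) (use fin assms in auto)
  then show ?thesis by (simp add: sum.distrib Pow_def)
qed

private lemma deg_le: "v \<in> X \<Longrightarrow> cod X (G xs) {v} \<le> K / card X"
proof -
  assume "v \<in> X"
  then have v: "{v} \<subseteq> X" "{v} \<noteq> {}" by auto
  have "cod X (G xs) {v} \<le> cod X w {v}" by (rule cod_mono) (rule Gw)
  also have "\<dots> \<le> K / card X * \<tau> ^ (card {v} - 1)" by (rule spread_cod[OF sp v])
  also have "\<dots> = K / card X" by simp
  finally show ?thesis .
qed

private lemma mass_le: "set xs \<subseteq> X \<Longrightarrow> sum (\<nu> xs) (Pow X) \<le> length xs * (K / card X)"
proof (induction xs)
  case (Cons v xs)
  have v: "v \<in> X" using Cons.prems by simp
  have IH: "sum (\<nu> xs) (Pow X) \<le> length xs * (K / card X)"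
    by (rule Cons.IH) (use Cons.prems in simp)
  have "sum (\<nu> (v # xs)) (Pow X) \<le> length xs * (K / card X) + K / card X"
    unfolding mass_step[OF v] by (rule add_mono[OF IH deg_le[OF v]])
  also have "\<dots> = length (v # xs) * (K / card X)"
    by (simp only: length_Cons of_nat_Suc distrib_right mult_1)
  finally show ?case .
qed simp

lemma link_weight_mass_ge:
  "set xs \<subseteq> X \<Longrightarrow> heavy_picks h k a \<tau> X w xs \<Longrightarrow> real (length xs) * h \<le> sum (\<nu> xs) (Pow X)"
proof (induction xs)
  case (Cons v xs)
  have v: "v \<in> X" using Cons.prems by simp
  have IH: "real (length xs) * h \<le> sum (\<nu> xs) (Pow X)"
    by (rule Cons.IH) (use Cons.prems in auto)
  have "real (length (v # xs)) * h = real (length xs) * h + h"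
    by (simp only: length_Cons of_nat_Suc distrib_right mult_1)
  also have "\<dots> \<le> sum (\<nu> xs) (Pow X) + cod X (G xs) {v}"
    using IH Cons.prems(2) by (intro add_mono) auto
  finally show ?case unfolding mass_step[OF v] .
qed simp

text \<open>Until \<open>T\<close> reaches its cap \<open>a * \<tau> ^ card T\<close> the codegree
  is below the cap. The step that crosses it adds at most one more cap, since the link of a single
  element has codegree at most \<open>K / card X * \<tau> ^ card T\<close>. Afterwards
  \<open>unsat\<close> discards every edge through \<open>T\<close>.\<close>

private lemma cod_le:
  assumes "set xs \<subseteq> X" "T \<subseteq> X" "T \<noteq> {}" "card T \<le> k"
  shows "cod X (\<nu> xs) T \<le> 2 * a * \<tau> ^ card T"
  using assms(1)
proof (induction xs)
  case Nil then show ?case using tau a by (simp add: cod_def)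
next
  case (Cons v xs)
  let ?new = "\<Sum>f | f \<subseteq> X \<and> T \<subseteq> f. if v \<in> f then 0 else G xs (insert v f)"
  have eq: "cod X (\<nu> (v # xs)) T = cod X (\<nu> xs) T + ?new"
    unfolding cod_def by (simp add: sum.distrib)
  show ?case
  proof (cases "a * \<tau> ^ card T \<le> cod X (\<nu> xs) T")
    case True
    then have "G xs (insert v f) = 0" if "T \<subseteq> f" for f
      unfolding unsat_def using assms that by auto
    then have "?new = 0" by (intro sum.neutral) auto
    then show ?thesis using eq Cons by (simp del: link_weight.simps)
  next
    case False
    have "?new \<le> a * \<tau> ^ card T"
    proof (cases "v \<in> T")
      case True
      then have "?new = 0" by (intro sum.neutral) auto
      then show ?thesis using a tau by simp
    next
      case vT: False
      have v: "v \<in> X" using Cons.prems by simp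
      have fT: "finite T" using assms(2) fin finite_subset by auto
      have "?new = cod X (G xs) (insert v T)" by (rule sum_link_eq_cod) (use fin v vT in auto)
      also have "\<dots> \<le> cod X w (insert v T)" by (rule cod_mono) (rule Gw)
      also have "\<dots> \<le> K / card X * \<tau> ^ (card (insert v T) - 1)"
        using v assms(2) by (intro spread_cod[OF sp]) auto
      also have "\<dots> = K / card X * \<tau> ^ card T" using vT fT by simp
      also have "\<dots> \<le> a * \<tau> ^ card T" using aK tau by (intro mult_right_mono) auto
      finally show ?thesis .
    qed
    then show ?thesis using eq False by (simp del: link_weight.simps)
  qed
qed

text \<open>Capped sets are few: the links have total weight at most \<open>\<tau> * K\<close>, so
  by double counting at most \<open>2 ^ k * \<tau> * K / (a * \<tau> ^ i)\<close> sets of size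
  \<open>i\<close> are capped. Each removes at most \<open>K / card X * \<tau> ^ (i - 1)\<close>
  from \<open>w\<close>, and the lower bound on \<open>a\<close> makes the loss for each
  \<open>i\<close> at most \<open>1 / (2 * k)\<close>.\<close>

lemma unsat_mass_ge:
  assumes "set xs \<subseteq> X" "length xs \<le> card X * \<tau>"
    and aa: "2 * k * 2 ^ k * K ^ 2 \<le> a * card X" and K: "0 < K" and X: "X \<noteq> {}"
  shows "1 / 2 \<le> sum (G xs) (Pow X)"
proof -
  define Sat where "Sat i = {T. T \<subseteq> X \<and> card T = i \<and> a * \<tau> ^ i \<le> cod X (\<nu> xs) T}" for i
  have N: "0 < card X" using fin X by (simp add: card_gt_0_iff)
  have finS: "finite (Sat i)" for i
    unfolding Sat_def by (rule finite_subset[OF _ finite_Pow_iff[THEN iffD2, OF fin]]) auto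
  have cardS: "real (card (Sat i)) * (a * \<tau> ^ i) \<le> 2 ^ k * (\<tau> * K)" for i
  proof -
    have "real (card (Sat i)) * (a * \<tau> ^ i) \<le> (\<Sum>T\<in>Sat i. cod X (\<nu> xs) T)"
      using sum_bounded_below[of "Sat i" "a * \<tau> ^ i" "cod X (\<nu> xs)"] by (simp add: Sat_def)
    also have "\<dots> \<le> (\<Sum>T | T \<subseteq> X \<and> card T = i. cod X (\<nu> xs) T)"
      by (rule sum_mono2) (use fin in \<open>auto simp: Sat_def intro: cod_nonneg nu0\<close>)
    also have "\<dots> = real (k choose i) * sum (\<nu> xs) (Pow X)"
      by (rule sum_cod_subsets) (use fin nu_unif in auto)
    also have "\<dots> \<le> 2 ^ k * (length xs * (K / card X))"
    proof (intro mult_mono mass_le assms)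
      show "real (k choose i) \<le> 2 ^ k"
        using of_nat_mono[OF binomial_le_pow2[of k i], where 'a=real] by simp
    qed (auto intro: sum_nonneg nu0)
    also have "\<dots> \<le> 2 ^ k * (card X * \<tau> * (K / card X))"
      using assms(2) K by (intro mult_left_mono mult_right_mono) auto
    finally show ?thesis using N by (simp add: field_simps)
  qed
  have "sum w (Pow X) - sum (G xs) (Pow X) = (\<Sum>e\<in>Pow X. w e - G xs e)" by (simp add: sum_subtractf)
  also have "\<dots> \<le> (\<Sum>e\<in>Pow X. \<Sum>i\<in>{1..k}. \<Sum>T\<in>Sat i. if T \<subseteq> e then w e else 0)"
  proof (rule sum_mono)
    fix e assume e: "e \<in> Pow X"
    have nn: "0 \<le> (\<Sum>T\<in>Sat i. if T \<subseteq> e then w e else 0)" for i by (intro sum_nonneg) (auto intro: w0)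
    show "w e - G xs e \<le> (\<Sum>i\<in>{1..k}. \<Sum>T\<in>Sat i. if T \<subseteq> e then w e else 0)"
    proof (cases "\<exists>T\<subseteq>e. T \<noteq> {} \<and> card T \<le> k \<and> a * \<tau> ^ card T \<le> cod X (\<nu> xs) T")
      case True
      then obtain T where T: "T \<subseteq> e" "T \<noteq> {}" "card T \<le> k" "a * \<tau> ^ card T \<le> cod X (\<nu> xs) T" by blast
      have "finite T" using T(1) e fin by (meson PowD finite_subset)
      then have i: "card T \<in> {1..k}" using T by (simp add: card_gt_0_iff Suc_le_eq)
      have TS: "T \<in> Sat (card T)" using T e unfolding Sat_def by auto
      have "w e = (if T \<subseteq> e then w e else 0)" using T by simp
      also have "\<dots> \<le> (\<Sum>T\<in>Sat (card T). if T \<subseteq> e then w e else 0)"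
        using member_le_sum[OF TS, of "\<lambda>T. if T \<subseteq> e then w e else 0"] finS w0 by auto
      also have "\<dots> \<le> (\<Sum>i\<in>{1..k}. \<Sum>T\<in>Sat i. if T \<subseteq> e then w e else 0)"
        using member_le_sum[OF i, of "\<lambda>i. \<Sum>T\<in>Sat i. if T \<subseteq> e then w e else 0"] nn by auto
      finally show ?thesis using G0[of xs e] by simp
    next
      case False
      then have "G xs e = w e" unfolding unsat_def by (rule if_not_P)
      then show ?thesis using nn by (simp add: sum_nonneg)
    qed
  qed
  also have "\<dots> = (\<Sum>i\<in>{1..k}. \<Sum>T\<in>Sat i. cod X w T)"
  proof -
    have "(\<Sum>e\<in>Pow X. \<Sum>i\<in>{1..k}. \<Sum>T\<in>Sat i. if T \<subseteq> e then w e else 0)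
        = (\<Sum>i\<in>{1..k}. \<Sum>T\<in>Sat i. \<Sum>e\<in>Pow X. if T \<subseteq> e then w e else 0)"
      by (subst sum.swap, rule sum.cong[OF refl], rule sum.swap)
    also have "\<dots> = (\<Sum>i\<in>{1..k}. \<Sum>T\<in>Sat i. cod X w T)"
      using fin by (simp add: cod_eq_sum_Pow)
    finally show ?thesis .
  qed
  also have "\<dots> \<le> (\<Sum>i\<in>{1..k}. 1 / (2 * k))"
  proof (rule sum_mono)
    fix i assume i: "i \<in> {1..k}"
    have "(\<Sum>T\<in>Sat i. cod X w T) \<le> real (card (Sat i)) * (K / card X * \<tau> ^ (i - 1))"
    proof (rule sum_bounded_above[where K = "K / card X * \<tau> ^ (i - 1)" and A = "Sat i"])
      fix T assume "T \<in> Sat i"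
      then have "T \<subseteq> X" "T \<noteq> {}" "card T = i" using i unfolding Sat_def by auto
      then show "cod X w T \<le> K / card X * \<tau> ^ (i - 1)" using spread_cod[OF sp, of T] by simp
    qed
    also have "\<dots> = (real (card (Sat i)) * (a * \<tau> ^ i)) * (K / (card X * a * \<tau>))"
    proof -
      have "\<tau> ^ i = \<tau> * \<tau> ^ (i - 1)" using i by (cases i) auto
      then show ?thesis using tau a N by (simp add: field_simps)
    qed
    also have "\<dots> \<le> 2 ^ k * (\<tau> * K) * (K / (card X * a * \<tau>))"
      using tau a N K cardS by (intro mult_right_mono) auto
    also have "\<dots> = 2 ^ k * K^2 / (card X * a)" using tau by (simp add: power2_eq_square)
    also have "\<dots> \<le> 1 / (2 * k)" using aa i a N by (simp add: field_simps)
    finally show "(\<Sum>T\<in>Sat i. cod X w T) \<le> 1 / (2 * k)" .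
  qed
  also have "\<dots> \<le> 1 / 2" by simp
  finally have "sum w (Pow X) - sum (G xs) (Pow X) \<le> 1 / 2" .
  then show ?thesis using spread_mass[OF sp] by linarith
qed

text \<open>Picks of degree at least \<open>h\<close>, \<open>card X * \<tau>\<close> in number,
  give mass at least \<open>card X * \<tau> * h\<close>, which is the normalisation. Dividing the
  cap \<open>2 * a * \<tau> ^ card S\<close> by it removes one power of \<open>\<tau>\<close> and
  leaves the exponent that a spread weight needs.\<close>

lemma link_weight_spread:
  assumes "set xs \<subseteq> X" "length xs = card X * \<tau>" "heavy_picks h k a \<tau> X w xs" "0 < h" "X \<noteq> {}"
  shows "spread k (2 * a / h) \<tau> X (\<lambda>f. \<nu> xs f / (card X * \<tau> * h))"
  unfolding spread_def
proof (intro conjI allI impI)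
  have N: "0 < card X" using fin assms(5) by (simp add: card_gt_0_iff)
  let ?c = "card X * \<tau> * h"
  have c: "0 < ?c" using N tau assms(4) by simp
  show "0 \<le> \<nu> xs e / ?c" for e using nu0 c by simp
  show "e \<subseteq> X" "card e = k" if "\<nu> xs e / ?c \<noteq> 0" for e using nu_unif[of xs e] that by auto
  show "1 \<le> (\<Sum>f\<in>Pow X. \<nu> xs f / ?c)"
    using link_weight_mass_ge[OF assms(1,3)] c assms(2) by (simp flip: sum_divide_distrib)
  fix S assume S: "S \<subseteq> X" "S \<noteq> {}"
  have fS: "finite S" using S fin finite_subset by auto
  have eq: "cod X (\<lambda>f. \<nu> xs f / ?c) S = cod X (\<nu> xs) S / ?c" unfolding cod_def by (simp flip: sum_divide_distrib)
  show "cod X (\<lambda>f. \<nu> xs f / ?c) S \<le> 2 * a / h / card X * \<tau> ^ (card S - 1)"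
  proof (cases "card S \<le> k")
    case True
    have "\<tau> ^ card S = \<tau> * \<tau> ^ (card S - 1)" using S fS by (cases "card S") auto
    then have "2 * a * \<tau> ^ card S / ?c = 2 * a / h / card X * \<tau> ^ (card S - 1)"
      using tau N assms(4) by (simp add: field_simps)
    moreover have "cod X (\<nu> xs) S / ?c \<le> 2 * a * \<tau> ^ card S / ?c"
      using cod_le[OF assms(1) S True] c by (intro divide_right_mono) auto
    ultimately show ?thesis using eq by simp
  next
    case False
    have "cod X (\<nu> xs) S = 0" unfolding cod_def
    proof (rule sum.neutral, safe)
      fix e assume e: "e \<subseteq> X" "S \<subseteq> e"
      then have "card S \<le> card e" using fin by (meson card_mono finite_subset)
      then show "\<nu> xs e = 0" using nu_unif[of xs e] False by auto
    qed
    then show ?thesis using eq tau a assms(4) by simp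
  qed
qed

text \<open>A set of positive weight in the link of a pick \<open>v\<close> becomes an edge of
  positive weight for \<open>w\<close> when \<open>v\<close> is added, and \<open>v\<close> lies in
  \<open>I\<close>. Independence is therefore inherited by the links.\<close>

lemma link_weight_independent:
  assumes "set xs \<subseteq> I" "\<nu> xs f > 0" "\<And>e. w e > 0 \<Longrightarrow> \<not> e \<subseteq> I"
  shows "\<not> f \<subseteq> I"
  using assms(1,2)
proof (induction xs)
  case (Cons v xs)
  show ?case
  proof (cases "\<nu> xs f > 0")
    case False
    then have "\<nu> xs f = 0" using nu0[of xs f] by simp
    then have "v \<notin> f" "G xs (insert v f) > 0" using Cons.prems by (auto split: if_splits)
    then have "w (insert v f) > 0" using Gw less_le_trans by blast
    then show ?thesis using assms(3) Cons.prems by auto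
  qed (use Cons in auto)
qed simp

text \<open>The degrees add up to at least \<open>1 / 2\<close>. Elements of degree below
  \<open>1 / (4 * card X)\<close> contribute at most \<open>1 / 4\<close>, so the others supply
  \<open>1 / 4\<close> with at most \<open>K / card X\<close> each.\<close>

lemma small_degree_card:
  assumes "set xs \<subseteq> X" "length xs \<le> card X * \<tau>"
    and aa: "2 * k * 2 ^ k * K ^ 2 \<le> a * card X" and K: "0 < K" and X: "X \<noteq> {}"
  shows "real (card {v\<in>X. cod X (G xs) {v} < 1 / (4 * card X)}) \<le> (1 - 1 / (4 * K)) * card X"
proof -
  let ?C = "{v\<in>X. cod X (G xs) {v} < 1 / (4 * card X)}"
  have N: "0 < card X" using fin X by (simp add: card_gt_0_iff)
  have "1 / 2 \<le> sum (G xs) (Pow X)" by (rule unsat_mass_ge) (use assms in auto)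
  also have "\<dots> \<le> Suc k * sum (G xs) (Pow X)" using mult_right_mono[of 1 "real (Suc k)" "sum (G xs) (Pow X)"] by (simp add: sum_nonneg G0)
  also have "\<dots> = real (Suc k choose 1) * sum (G xs) (Pow X)" by simp
  also have "\<dots> = (\<Sum>T | T \<subseteq> X \<and> card T = 1. cod X (G xs) T)"
  proof (rule sum_cod_subsets[symmetric, OF fin])
    fix e assume "G xs e \<noteq> 0"
    then have "w e \<noteq> 0" unfolding unsat_def by (auto split: if_splits)
    then show "card e = Suc k" using spread_uniform[OF sp] by blast
  qed
  also have "\<dots> = (\<Sum>v\<in>X. cod X (G xs) {v})"
  proof -
    have "{T. T \<subseteq> X \<and> card T = 1} = (\<lambda>v. {v}) ` X" by (auto simp: card_1_singleton_iff)
    then show ?thesis by (simp add: sum.reindex)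
  qed
  also have "\<dots> = (\<Sum>v\<in>?C. cod X (G xs) {v}) + (\<Sum>v\<in>X - ?C. cod X (G xs) {v})"
    using sum.subset_diff[of ?C X "\<lambda>v. cod X (G xs) {v}"] fin by simp
  also have "\<dots> \<le> real (card X) * (1 / (4 * card X)) + real (card (X - ?C)) * (K / card X)"
  proof (rule add_mono)
    have "(\<Sum>v\<in>?C. cod X (G xs) {v}) \<le> real (card ?C) * (1 / (4 * card X))"
      by (rule sum_bounded_above) auto
    also have "\<dots> \<le> real (card X) * (1 / (4 * card X))"
      using fin by (intro mult_right_mono) (auto intro: card_mono)
    finally show "(\<Sum>v\<in>?C. cod X (G xs) {v}) \<le> real (card X) * (1 / (4 * card X))" .
    show "(\<Sum>v\<in>X - ?C. cod X (G xs) {v}) \<le> real (card (X - ?C)) * (K / card X)"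
      by (rule sum_bounded_above) (use deg_le in auto)
  qed
  finally have *: "1 / 2 \<le> real (card X) * (1 / (4 * card X)) + real (card (X - ?C)) * (K / card X)" .
  have "real (card X) * (1 / (4 * card X)) = 1 / 4" using N by simp
  then have "1 / 4 \<le> real (card (X - ?C)) * (K / card X)" using * by linarith
  then have "1 / 4 * real (card X) \<le> real (card (X - ?C)) * K"
    using N by (simp only: times_divide_eq_right pos_le_divide_eq of_nat_0_less_iff)
  then have "card X / (4 * K) \<le> real (card (X - ?C))"
    using K by (subst pos_divide_le_eq) (auto simp: ac_simps)
  moreover have "real (card (X - ?C)) = real (card X) - real (card ?C)"
    using fin by (subst card_Diff_subset) (auto simp: of_nat_diff card_mono)
  ultimately have "real (card ?C) \<le> card X - card X / (4 * K)" by linarith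
  then show ?thesis by (simp add: left_diff_distrib)
qed

text \<open>Greedy choice: elements of \<open>I\<close> are picked as long as one of large degree is
  left. If this stops early, the picks alone determine a set of low degree elements that contains
  \<open>I\<close>.\<close>

lemma heavy_picks_or_stuck:
  "(\<exists>xs. set xs \<subseteq> I \<and> length xs = m \<and> heavy_picks h k a \<tau> X w xs) \<or>
   (\<exists>xs. set xs \<subseteq> I \<and> length xs < m \<and> (\<forall>v\<in>I. cod X (G xs) {v} < h))"
proof (induction m)
  case (Suc m)
  then consider (A) xs where "set xs \<subseteq> I" "length xs = m" "heavy_picks h k a \<tau> X w xs"
    | (B) xs where "set xs \<subseteq> I" "length xs < m" "\<forall>v\<in>I. cod X (G xs) {v} < h" by blast
  then show ?case
  proof cases
    case A
    show ?thesis
    proof (cases "\<forall>v\<in>I. cod X (G xs) {v} < h")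
      case True then show ?thesis using A by auto
    next
      case False
      then obtain v where "v \<in> I" "h \<le> cod X (G xs) {v}" by force
      then have "set (v # xs) \<subseteq> I \<and> length (v # xs) = Suc m \<and> heavy_picks h k a \<tau> X w (v # xs)" using A by simp
      then show ?thesis by blast
    qed
  next
    case B then show ?thesis using less_SucI by blast
  qed
qed simp

end

section \<open>The container theorem, by induction on the uniformity\<close>

lemma sum_powers_le: "(\<Sum>i\<le>L. (N::nat) ^ i) \<le> (N + 1) ^ L"
proof -
  have "(\<Sum>i\<le>L. N ^ i) \<le> (\<Sum>i\<le>L. of_nat (L choose i) * N ^ i * 1 ^ (L - i))"
    by (intro sum_mono) (simp add: Suc_le_eq)
  also have "\<dots> = (N + 1) ^ L" by (rule binomial_ring[symmetric])
  finally show ?thesis .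
qed

text \<open>The picks are a fingerprint that determines the container. If they stop early,
  \<open>I\<close> lies among the low degree elements. Otherwise the accumulated links form a spread
  weight of uniformity one less for which \<open>I\<close> is still independent, and the induction
  hypothesis applies. Each level costs a factor \<open>2 * (card X + 1) ^ L\<close> in the number of
  containers.\<close>

theorem container_step:
  fixes K :: real
  assumes "1 \<le> K"
  shows "\<exists>c>(0::real). c \<le> 1 \<and> (\<forall>(X::'a set) L w. finite X \<longrightarrow> 0 < L \<longrightarrow> spread k K (real L / card X) X w \<longrightarrow>
    (\<exists>\<C>. finite \<C> \<and> card \<C> \<le> (2 * (card X + 1) ^ L) ^ k \<and>
      (\<forall>C\<in>\<C>. C \<subseteq> X \<and> real (card C) \<le> (1 - c) * card X) \<and>
      (\<forall>I\<subseteq>X. (\<forall>e. w e > 0 \<longrightarrow> \<not> e \<subseteq> I) \<longrightarrow> (\<exists>C\<in>\<C>. I \<subseteq> C))))"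
  using assms
proof (induction k arbitrary: K)
  case 0
  show ?case
  proof (intro exI[of _ 1] conjI allI impI)
    fix X :: "'a set" and L :: nat and w :: "'a set \<Rightarrow> real"
    assume X: "finite X" and sp: "spread 0 K (real L / card X) X w"
    \<comment> \<open>For uniformity \<open>0\<close> the only possible edge is the empty set, which
      lies in every \<open>I\<close>. No set is independent, and the empty family of containers
      suffices.\<close>
    have "w {} > 0"
    proof (rule ccontr)
      assume *: "\<not> w {} > 0"
      have "sum w (Pow X) = 0"
      proof (rule sum.neutral, rule ballI)
        fix e assume "e \<in> Pow X"
        then have "finite e" using X finite_subset by auto
        then show "w e = 0" using * spread_uniform[OF sp, of e] spread_nonneg[OF sp, of e] by fastforce
      qed
      then show False using spread_mass[OF sp] by simp
    qed
    then show "\<exists>\<C>. finite \<C> \<and> card \<C> \<le> (2 * (card X + 1) ^ L) ^ 0 \<and>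
      (\<forall>C\<in>\<C>. C \<subseteq> X \<and> real (card C) \<le> (1 - (1::real)) * card X) \<and>
      (\<forall>I\<subseteq>X. (\<forall>e. w e > 0 \<longrightarrow> \<not> e \<subseteq> I) \<longrightarrow> (\<exists>C\<in>\<C>. I \<subseteq> C))"
      by (intro exI[of _ "{}"]) auto
  qed auto
next
  case (Suc k)
  \<comment> \<open>With \<open>a = A * K / card X\<close>, the first summand yields the lower bound
    on \<open>a\<close> required by \<open>unsat_mass_ge\<close>, and the summand \<open>1\<close>
    yields \<open>K / card X \<le> a\<close>.\<close>
  define A where "A = 2 * real k * 2 ^ k * K + 1"
  have A1: "1 \<le> A" using Suc.prems unfolding A_def by simp
  have "1 \<le> 8 * A * K" using mult_mono[of 1 "8 * A" 1 K] A1 Suc.prems by simp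
  from Suc.IH[OF this] obtain c' :: real where c': "0 < c'" "c' \<le> 1"
    and IH: "\<And>X L w. finite (X::'a set) \<Longrightarrow> 0 < L \<Longrightarrow> spread k (8 * A * K) (real L / card X) X w \<Longrightarrow>
      (\<exists>\<C>. finite \<C> \<and> card \<C> \<le> (2 * (card X + 1) ^ L) ^ k \<and>
      (\<forall>C\<in>\<C>. C \<subseteq> X \<and> real (card C) \<le> (1 - c') * card X) \<and>
      (\<forall>I\<subseteq>X. (\<forall>e. w e > 0 \<longrightarrow> \<not> e \<subseteq> I) \<longrightarrow> (\<exists>C\<in>\<C>. I \<subseteq> C)))" by metis
  define c where "c = min c' (1 / (4 * K))"
  show ?case
  proof (intro exI[of _ c] conjI allI impI)
    show "0 < c" "c \<le> 1" using c' Suc.prems unfolding c_def by auto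
    fix X :: "'a set" and L :: nat and w :: "'a set \<Rightarrow> real"
    assume X: "finite X" and L: "0 < L" and sp: "spread (Suc k) K (real L / card X) X w"
    have ne: "X \<noteq> {}"
    proof
      assume "X = {}"
      then have "sum w (Pow X) = 0" using spread_uniform[OF sp, of "{}"] by auto
      then show False using spread_mass[OF sp] by simp
    qed
    then have N: "0 < card X" using X by (simp add: card_gt_0_iff)
    define \<tau> where "\<tau> = real L / card X"
    define a where "a = A * K / card X"
    \<comment> \<open>The threshold of \<open>small_degree_card\<close>. With it
      \<open>2 * a / h = 8 * A * K\<close> does not depend on \<open>X\<close>, which is why the
      induction hypothesis could be instantiated before \<open>X\<close> was fixed.\<close>
    define h where "h = 1 / (4 * real (card X))"
    have tau: "0 < \<tau>" and Ntau: "card X * \<tau> = L" using N L unfolding \<tau>_def by auto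
    have a: "0 < a" using N A1 Suc.prems unfolding a_def by simp
    have aK: "K / card X \<le> a" using A1 Suc.prems unfolding a_def by (intro divide_right_mono) auto
    have aN: "2 * k * 2 ^ k * K ^ 2 \<le> a * card X"
    proof -
      have "a * card X = A * K" using N unfolding a_def by simp
      then show ?thesis using Suc.prems unfolding A_def by (simp add: algebra_simps power2_eq_square)
    qed
    have h: "0 < h" and K': "2 * a / h = 8 * A * K" using N unfolding h_def a_def by auto
    have K: "0 < K" using Suc.prems by simp
    note ctx = X sp[folded \<tau>_def] tau a aK
    define low where "low xs = {v\<in>X. cod X (unsat k a \<tau> X w (link_weight k a \<tau> X w xs)) {v} < h}" for xs
    define LS where "LS = {xs. set xs \<subseteq> X \<and> length xs \<le> L}"
    define H where "H = {xs. set xs \<subseteq> X \<and> length xs = L \<and> heavy_picks h k a \<tau> X w xs}"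
    define nu where "nu xs = (\<lambda>f. link_weight k a \<tau> X w xs f / (card X * \<tau> * h))" for xs
    have finLS: "finite LS" unfolding LS_def using finite_lists_length_le[OF X] .
    have HLS: "H \<subseteq> LS" unfolding H_def LS_def by auto
    have cardLS: "card LS \<le> (card X + 1) ^ L"
      unfolding LS_def card_lists_length_le[OF X] by (rule sum_powers_le)
    have "spread k (8 * A * K) (real L / card X) X (nu xs)" if "xs \<in> H" for xs
      using link_weight_spread[OF ctx, of xs h] that Ntau h ne unfolding H_def nu_def K' \<tau>_def by auto
    then have "\<forall>xs\<in>H. \<exists>\<C>. finite \<C> \<and> card \<C> \<le> (2 * (card X + 1) ^ L) ^ k \<and>
      (\<forall>C\<in>\<C>. C \<subseteq> X \<and> real (card C) \<le> (1 - c') * card X) \<and>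
      (\<forall>I\<subseteq>X. (\<forall>e. nu xs e > 0 \<longrightarrow> \<not> e \<subseteq> I) \<longrightarrow> (\<exists>C\<in>\<C>. I \<subseteq> C))"
      using IH[OF X L] by blast
    then obtain \<C>' where C': "\<And>xs. xs \<in> H \<Longrightarrow> finite (\<C>' xs) \<and> card (\<C>' xs) \<le> (2 * (card X + 1) ^ L) ^ k \<and>
      (\<forall>C\<in>\<C>' xs. C \<subseteq> X \<and> real (card C) \<le> (1 - c') * card X) \<and>
      (\<forall>I\<subseteq>X. (\<forall>e. nu xs e > 0 \<longrightarrow> \<not> e \<subseteq> I) \<longrightarrow> (\<exists>C\<in>\<C>' xs. I \<subseteq> C))"
      by metis
    define \<C> where "\<C> = low ` LS \<union> (\<Union>xs\<in>H. \<C>' xs)"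
    have finH: "finite H" using finLS HLS finite_subset by blast
    show "\<exists>\<C>. finite \<C> \<and> card \<C> \<le> (2 * (card X + 1) ^ L) ^ Suc k \<and>
      (\<forall>C\<in>\<C>. C \<subseteq> X \<and> real (card C) \<le> (1 - c) * card X) \<and>
      (\<forall>I\<subseteq>X. (\<forall>e. w e > 0 \<longrightarrow> \<not> e \<subseteq> I) \<longrightarrow> (\<exists>C\<in>\<C>. I \<subseteq> C))"
    proof (intro exI[of _ \<C>] conjI ballI allI impI)
      show "finite \<C>" unfolding \<C>_def using finLS finH C' by blast
      let ?B = "(2 * (card X + 1) ^ L) ^ k"
      have B1: "1 \<le> ?B" by simp
      have "card \<C> \<le> card (low ` LS) + card (\<Union>xs\<in>H. \<C>' xs)" unfolding \<C>_def by (rule card_Un_le)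
      also have "\<dots> \<le> card LS + (\<Sum>xs\<in>H. card (\<C>' xs))"
        by (intro add_mono card_image_le finLS card_UN_le finH)
      also have "\<dots> \<le> card LS + card H * ?B"
        using sum_bounded_above[of H "\<lambda>xs. card (\<C>' xs)" ?B] C' by simp
      also have "\<dots> \<le> card LS * ?B + card LS * ?B"
        using B1 card_mono[OF finLS HLS] by (intro add_mono mult_right_mono) auto
      also have "\<dots> = 2 * (card LS * ?B)" by (rule mult_2[symmetric])
      also have "\<dots> \<le> 2 * ((card X + 1) ^ L * ?B)" by (intro mult_left_mono mult_right_mono cardLS) auto
      also have "\<dots> = (2 * (card X + 1) ^ L) ^ Suc k" by (simp only: power_Suc mult.assoc)
      finally show "card \<C> \<le> (2 * (card X + 1) ^ L) ^ Suc k" .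
    next
      fix C assume "C \<in> \<C>"
      then consider xs where "xs \<in> LS" "C = low xs" | xs where "xs \<in> H" "C \<in> \<C>' xs"
        unfolding \<C>_def by auto
      then have "C \<subseteq> X \<and> real (card C) \<le> (1 - c) * card X"
      proof cases
        case 1
        have "real (card C) \<le> (1 - 1 / (4 * K)) * card X"
          using small_degree_card[OF ctx _ _ aN K ne, of xs] 1 Ntau unfolding LS_def low_def h_def by simp
        also have "\<dots> \<le> (1 - c) * card X" unfolding c_def by (intro mult_right_mono) auto
        finally show ?thesis using 1 by (auto simp: low_def)
      next
        case 2
        then have "real (card C) \<le> (1 - c') * card X" using C' by blast
        also have "\<dots> \<le> (1 - c) * card X" unfolding c_def by (intro mult_right_mono) auto
        finally show ?thesis using 2 C' by blast
      qed
      then show "C \<subseteq> X" "real (card C) \<le> (1 - c) * card X" by auto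
    next
      fix I assume I: "I \<subseteq> X" "\<forall>e. w e > 0 \<longrightarrow> \<not> e \<subseteq> I"
      from heavy_picks_or_stuck[OF ctx, of I L h] consider
        xs where "set xs \<subseteq> I" "length xs = L" "heavy_picks h k a \<tau> X w xs"
        | xs where "set xs \<subseteq> I" "length xs < L" "\<forall>v\<in>I. cod X (unsat k a \<tau> X w (link_weight k a \<tau> X w xs)) {v} < h"
        by blast
      then show "\<exists>C\<in>\<C>. I \<subseteq> C"
      proof cases
        case 1
        then have xs: "xs \<in> H" using I unfolding H_def by auto
        have "\<not> f \<subseteq> I" if "nu xs f > 0" for f
        proof (rule link_weight_independent[OF ctx 1(1)])
          show "link_weight k a \<tau> X w xs f > 0"
            using that h N tau unfolding nu_def
            by (metis less_asym mult_pos_pos of_nat_0_less_iff zero_less_divide_iff)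
        qed (use I in blast)
        then have "\<exists>C\<in>\<C>' xs. I \<subseteq> C" using C'[OF xs] I(1) by blast
        then show ?thesis using xs unfolding \<C>_def by blast
      next
        case 2
        then have "xs \<in> LS" "I \<subseteq> low xs" using I unfolding LS_def low_def by auto
        then show ?thesis unfolding \<C>_def by blast
      qed
    qed
  qed
qed

text \<open>A container that still has at least \<open>E\<close> elements carries a spread weight of
  its own and is split again. After \<open>Q\<close> rounds the size bound
  \<open>(1 - c) ^ Q * card V\<close> has fallen below \<open>E\<close>.\<close>

theorem containers:
  fixes K :: real
  assumes "1 \<le> K"
  shows "\<exists>c>(0::real). c \<le> 1 \<and> (\<forall>(V::'a set) L E (Q::nat) (\<F>::'a set set). finite V \<longrightarrow> 0 < L \<longrightarrow>
    (\<forall>X\<subseteq>V. E \<le> real (card X) \<longrightarrow> (\<exists>w. spread k K (real L / card X) X w \<and> (\<forall>e. w e > 0 \<longrightarrow> e \<in> \<F>))) \<longrightarrow>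
    (1 - c) ^ Q * card V < E \<longrightarrow>
    (\<exists>\<C>. finite \<C> \<and> card \<C> \<le> (2 * (card V + 1) ^ L) ^ (k * Q) \<and>
      (\<forall>C\<in>\<C>. C \<subseteq> V \<and> real (card C) < E) \<and>
      (\<forall>I\<subseteq>V. (\<forall>e\<in>\<F>. \<not> e \<subseteq> I) \<longrightarrow> (\<exists>C\<in>\<C>. I \<subseteq> C))))"
proof -
  obtain c where c: "0 < (c::real)" "c \<le> 1"
    and step: "\<And>(X::'a set) L w. finite X \<Longrightarrow> 0 < L \<Longrightarrow> spread k K (real L / card X) X w \<Longrightarrow>
    (\<exists>\<C>. finite \<C> \<and> card \<C> \<le> (2 * (card X + 1) ^ L) ^ k \<and>
      (\<forall>C\<in>\<C>. C \<subseteq> X \<and> real (card C) \<le> (1 - c) * card X) \<and>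
      (\<forall>I\<subseteq>X. (\<forall>e. w e > 0 \<longrightarrow> \<not> e \<subseteq> I) \<longrightarrow> (\<exists>C\<in>\<C>. I \<subseteq> C)))"
    using container_step[OF assms, of k] by metis
  show ?thesis
  proof (intro exI[of _ c] conjI allI impI)
    fix V :: "'a set" and L :: nat and E :: real and Q :: nat and \<F> :: "'a set set"
    assume V: "finite V" and L: "0 < L" and E: "(1 - c) ^ Q * card V < E"
      and sat: "\<forall>X\<subseteq>V. E \<le> real (card X) \<longrightarrow> (\<exists>w. spread k K (real L / card X) X w \<and> (\<forall>e. w e > 0 \<longrightarrow> e \<in> \<F>))"
    let ?B = "(2 * (card V + 1) ^ L) ^ k"
    have B1: "1 \<le> ?B" by simp
    have "\<exists>\<C>. finite \<C> \<and> card \<C> \<le> ?B ^ q \<and>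
      (\<forall>C\<in>\<C>. C \<subseteq> V \<and> (real (card C) < E \<or> real (card C) \<le> (1 - c) ^ q * card V)) \<and>
      (\<forall>I\<subseteq>V. (\<forall>e\<in>\<F>. \<not> e \<subseteq> I) \<longrightarrow> (\<exists>C\<in>\<C>. I \<subseteq> C))" for q
    proof (induction q)
      case 0
      show ?case by (intro exI[of _ "{V}"]) auto
    next
      case (Suc q)
      then obtain \<C> where C: "finite \<C>" "card \<C> \<le> ?B ^ q"
        "\<And>C. C \<in> \<C> \<Longrightarrow> C \<subseteq> V \<and> (real (card C) < E \<or> real (card C) \<le> (1 - c) ^ q * card V)"
        "\<And>I. I \<subseteq> V \<Longrightarrow> (\<forall>e\<in>\<F>. \<not> e \<subseteq> I) \<Longrightarrow> (\<exists>C\<in>\<C>. I \<subseteq> C)" by metis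
      have "\<forall>X\<in>\<C>. \<exists>\<D>. finite \<D> \<and> card \<D> \<le> ?B \<and>
        (\<forall>C\<in>\<D>. C \<subseteq> V \<and> (real (card C) < E \<or> real (card C) \<le> (1 - c) ^ Suc q * card V)) \<and>
        (\<forall>I\<subseteq>X. (\<forall>e\<in>\<F>. \<not> e \<subseteq> I) \<longrightarrow> (\<exists>C\<in>\<D>. I \<subseteq> C))"
      proof
        fix X assume X: "X \<in> \<C>"
        show "\<exists>\<D>. finite \<D> \<and> card \<D> \<le> ?B \<and>
          (\<forall>C\<in>\<D>. C \<subseteq> V \<and> (real (card C) < E \<or> real (card C) \<le> (1 - c) ^ Suc q * card V)) \<and>
          (\<forall>I\<subseteq>X. (\<forall>e\<in>\<F>. \<not> e \<subseteq> I) \<longrightarrow> (\<exists>C\<in>\<D>. I \<subseteq> C))"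
        proof (cases "real (card X) < E")
          case True
          then show ?thesis using C(3)[OF X] B1 by (intro exI[of _ "{X}"]) auto
        next
          case False
          have XV: "X \<subseteq> V" using C(3)[OF X] by blast
          have fX: "finite X" using XV V finite_subset by blast
          obtain w where w: "spread k K (real L / card X) X w" "\<forall>e. w e > 0 \<longrightarrow> e \<in> \<F>"
            using sat XV False by (meson not_less)
          obtain \<D> where D: "finite \<D>" "card \<D> \<le> (2 * (card X + 1) ^ L) ^ k"
            "\<And>C. C \<in> \<D> \<Longrightarrow> C \<subseteq> X \<and> real (card C) \<le> (1 - c) * card X"
            "\<And>I. I \<subseteq> X \<Longrightarrow> (\<forall>e. w e > 0 \<longrightarrow> \<not> e \<subseteq> I) \<Longrightarrow> (\<exists>C\<in>\<D>. I \<subseteq> C)"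
            using step[OF fX L w(1)] by metis
          show ?thesis
          proof (intro exI[of _ \<D>] conjI ballI allI impI)
            have "(2 * (card X + 1) ^ L) ^ k \<le> ?B"
              using card_mono[OF V XV] by (intro power_mono mult_left_mono) auto
            then show "card \<D> \<le> ?B" using D(2) by linarith
            show "C \<subseteq> V" if "C \<in> \<D>" for C using D(3)[OF that] XV by blast
            show "real (card C) < E \<or> real (card C) \<le> (1 - c) ^ Suc q * card V" if "C \<in> \<D>" for C
            proof -
              have "real (card C) \<le> (1 - c) * card X" using D(3)[OF that] by blast
              also have "\<dots> \<le> (1 - c) * ((1 - c) ^ q * card V)"
                using C(3)[OF X] False c by (intro mult_left_mono) auto
              finally show ?thesis by (simp add: mult.assoc)
            qed
            show "\<exists>C\<in>\<D>. I \<subseteq> C" if "I \<subseteq> X" "\<forall>e\<in>\<F>. \<not> e \<subseteq> I" for I using D(4)[OF that(1)] that(2) w(2) by blast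
          qed (rule D(1))
        qed
      qed
      then obtain \<D> where D: "\<And>X. X \<in> \<C> \<Longrightarrow> finite (\<D> X) \<and> card (\<D> X) \<le> ?B \<and>
        (\<forall>C\<in>\<D> X. C \<subseteq> V \<and> (real (card C) < E \<or> real (card C) \<le> (1 - c) ^ Suc q * card V)) \<and>
        (\<forall>I\<subseteq>X. (\<forall>e\<in>\<F>. \<not> e \<subseteq> I) \<longrightarrow> (\<exists>C\<in>\<D> X. I \<subseteq> C))" by metis
      show ?case
      proof (intro exI[of _ "\<Union>X\<in>\<C>. \<D> X"] conjI)
        have "card (\<Union>X\<in>\<C>. \<D> X) \<le> (\<Sum>X\<in>\<C>. card (\<D> X))" by (rule card_UN_le[OF C(1)])
        also have "\<dots> \<le> card \<C> * ?B" using sum_bounded_above[of \<C> "\<lambda>X. card (\<D> X)" ?B] D by simp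
        also have "\<dots> \<le> ?B ^ q * ?B" using C(2) by (rule mult_right_mono) simp
        finally show "card (\<Union>X\<in>\<C>. \<D> X) \<le> ?B ^ Suc q" by (simp add: mult.commute)
        show "\<forall>I\<subseteq>V. (\<forall>e\<in>\<F>. \<not> e \<subseteq> I) \<longrightarrow> (\<exists>C\<in>\<Union>X\<in>\<C>. \<D> X. I \<subseteq> C)"
        proof (intro allI impI)
          fix I assume I: "I \<subseteq> V" "\<forall>e\<in>\<F>. \<not> e \<subseteq> I"
          then obtain X where X: "X \<in> \<C>" "I \<subseteq> X" using C(4) by blast
          then have "\<exists>C\<in>\<D> X. I \<subseteq> C" using D[OF X(1)] I(2) by blast
          then show "\<exists>C\<in>\<Union>X\<in>\<C>. \<D> X. I \<subseteq> C" using X(1) by blast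
        qed
        show "finite (\<Union>X\<in>\<C>. \<D> X)" using C(1) D by blast
        show "\<forall>C\<in>\<Union>X\<in>\<C>. \<D> X. C \<subseteq> V \<and> (real (card C) < E \<or> real (card C) \<le> (1 - c) ^ Suc q * card V)"
          using D by blast
      qed
    qed
    from this[of Q] show "\<exists>\<C>. finite \<C> \<and> card \<C> \<le> (2 * (card V + 1) ^ L) ^ (k * Q) \<and>
      (\<forall>C\<in>\<C>. C \<subseteq> V \<and> real (card C) < E) \<and>
      (\<forall>I\<subseteq>V. (\<forall>e\<in>\<F>. \<not> e \<subseteq> I) \<longrightarrow> (\<exists>C\<in>\<C>. I \<subseteq> C))"
      unfolding power_mult using E by (meson le_less_trans)
  qed (use c in auto)
qed

section \<open>Chains of states with prescribed transition keys\<close>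

lemma sum_listset_Cons:
  "(\<Sum>c\<in>listset (A # As). f c) = (\<Sum>P\<in>A. \<Sum>c\<in>listset As. f (P # c))"
proof -
  have "listset (A # As) = (\<lambda>(P, c). P # c) ` (A \<times> listset As)" by (auto simp: set_Cons_def)
  moreover have "inj_on (\<lambda>(P, c). P # c) (A \<times> listset As)" by (auto intro: inj_onI)
  ultimately show ?thesis by (simp add: sum.reindex sum.cartesian_product case_prod_unfold)
qed

lemma sum_listset_single: "(\<Sum>c\<in>listset [A]. f c) = (\<Sum>P\<in>A. f [P])"
  unfolding sum_listset_Cons by simp

lemma listset_length: "c \<in> listset Cs \<Longrightarrow> length c = length Cs"
  by (induction Cs arbitrary: c) (auto simp: set_Cons_def)

lemma finite_listset: "(\<forall>C\<in>set Cs. finite C) \<Longrightarrow> finite (listset Cs)"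
proof (induction Cs)
  case (Cons A As)
  have "listset (A # As) = (\<lambda>(P, c). P # c) ` (A \<times> listset As)" by (auto simp: set_Cons_def)
  then show ?case using Cons by simp
qed simp

lemma listset_nth: "c \<in> listset Cs \<longleftrightarrow> length c = length Cs \<and> (\<forall>i<length Cs. c ! i \<in> Cs ! i)"
proof (induction Cs arbitrary: c)
  case (Cons C Cs)
  show ?case by (cases c) (auto simp: set_Cons_def Cons All_less_Suc2)
qed auto

lemma set_listset_subset: "c \<in> listset Cs \<Longrightarrow> \<forall>D\<in>set Cs. D \<subseteq> W \<Longrightarrow> set c \<subseteq> W"
  by (induction Cs arbitrary: c) (auto simp: set_Cons_def subset_iff)

lemma sum_listset_snoc:
  "(\<Sum>c\<in>listset (As @ [A]). f c) = (\<Sum>c\<in>listset As. \<Sum>P\<in>A. f (c @ [P]))"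
proof (induction As arbitrary: f)
  case Nil
  show ?case unfolding append_Nil sum_listset_single by simp
next
  case (Cons B As)
  show ?case unfolding append_Cons sum_listset_Cons Cons.IH ..
qed

lemma sum_listset_append:
  "(\<Sum>c\<in>listset (As @ Bs). f c) = (\<Sum>a\<in>listset As. \<Sum>b\<in>listset Bs. f (a @ b))"
proof (induction As arbitrary: f)
  case (Cons A As)
  show ?case unfolding append_Cons sum_listset_Cons Cons.IH ..
qed simp

text \<open>A Markov chain on the finite state space \<open>W\<close> that is stationary for the weight \<open>\<omega>\<close>: in step
  \<open>i\<close> the next state is drawn with probability proportional to \<open>\<omega>\<close> among the states whose key
  \<open>kin i\<close> agrees with the key \<open>kout i\<close> of the current one.\<close>

locale key_chain =
  fixes W :: "'p set" and \<omega> :: "'p \<Rightarrow> real" and kout kin :: "nat \<Rightarrow> 'p \<Rightarrow> 'k"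
  assumes finW: "finite W" and om_pos: "P \<in> W \<Longrightarrow> 0 < \<omega> P"
    and balance: "sum \<omega> {P\<in>W. kout i P = a} = sum \<omega> {P\<in>W. kin i P = a}"
begin

definition mass :: "nat \<Rightarrow> 'k \<Rightarrow> real" where
  "mass i a = sum \<omega> {P\<in>W. kin i P = a}"

text \<open>Multiplied out, this is the product of \<open>\<omega>\<close> over all states divided
  by the masses of the keys at the transitions. The form is symmetric, so a chain can be read from
  either end; \<open>i\<close> is the number of its first transition.\<close>

fun cw :: "nat \<Rightarrow> 'p list \<Rightarrow> real" where
  "cw i [] = 1"
| "cw i [P] = \<omega> P"
| "cw i (P # P' # c) =
     (if kout i P = kin i P' then \<omega> P / mass i (kin i P') * cw (Suc i) (P' # c) else 0)"

lemma mass_out: "sum \<omega> {P\<in>W. kout i P = a} = mass i a"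
  unfolding mass_def by (rule balance)

lemma mass_nonneg: "0 \<le> mass i a"
  unfolding mass_def by (intro sum_nonneg) (auto intro: less_imp_le[OF om_pos])

lemma mass_pos: "P \<in> W \<Longrightarrow> 0 < mass i (kin i P)"
  unfolding mass_def by (rule sum_pos2[of _ P]) (use finW in \<open>auto intro: om_pos less_imp_le[OF om_pos]\<close>)

lemma mass_pos': "P \<in> W \<Longrightarrow> 0 < mass i (kout i P)"
  unfolding mass_out[symmetric] by (rule sum_pos2[of _ P]) (use finW in \<open>auto intro: om_pos less_imp_le[OF om_pos]\<close>)

lemma cw_nonneg: "set c \<subseteq> W \<Longrightarrow> 0 \<le> cw i c"
  by (induction i c rule: cw.induct) (auto intro!: divide_nonneg_nonneg mult_nonneg_nonneg mass_nonneg less_imp_le[OF om_pos])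

lemma cw_snoc:
  "c \<noteq> [] \<Longrightarrow> cw i (c @ [P']) = (let j = i + length c - 1; P = last c in
     if kout j P = kin j P' then cw i c * \<omega> P' / mass j (kin j P') else 0)"
proof (induction i c rule: cw.induct)
  case (3 i P Q c)
  show ?case
  proof (cases "kout i P = kin i Q")
    case True
    with 3 have "cw (Suc i) ((Q # c) @ [P']) = (let j = Suc i + length (Q # c) - 1; P = last (Q # c) in
       if kout j P = kin j P' then cw (Suc i) (Q # c) * \<omega> P' / mass j (kin j P') else 0)" by blast
    then show ?thesis using True
      by (auto simp: Let_def) (simp_all only: mult.assoc mult.commute[of "mass i (kin i Q)"])
  qed (auto simp: Let_def)
qed (auto simp: Let_def)

text \<open>With the rest of the chain fixed, the sum over the first state leaves the compatible
  weight in \<open>C\<close> divided by the mass of the key, and this quotient is at most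
  \<open>\<rho>\<close>.\<close>

lemma head_peel:
  assumes "\<And>P'. P' \<in> W \<Longrightarrow> sum \<omega> {P\<in>C. kout i P = kin i P'} \<le> \<rho> * mass i (kin i P')"
    and "finite C" and "C' \<subseteq> W" "\<forall>D\<in>set Cs. D \<subseteq> W"
  shows "sum (cw i) (listset (C # C' # Cs)) \<le> \<rho> * sum (cw (Suc i)) (listset (C' # Cs))"
proof -
  have "sum (cw i) (listset (C # C' # Cs)) = (\<Sum>c\<in>listset (C' # Cs). \<Sum>P\<in>C. cw i (P # c))"
    unfolding sum_listset_Cons[of _ C] by (rule sum.swap)
  also have "\<dots> \<le> (\<Sum>c\<in>listset (C' # Cs). \<rho> * cw (Suc i) c)"
  proof (rule sum_mono)
    fix c assume c: "c \<in> listset (C' # Cs)"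
    then obtain P' c' where c': "c = P' # c'" "P' \<in> C'" "c' \<in> listset Cs" by (auto simp: set_Cons_def)
    have W: "set c \<subseteq> W" by (rule set_listset_subset[OF c]) (use assms(3,4) in auto)
    have P': "P' \<in> W" using W c' by auto
    have "(\<Sum>P\<in>C. cw i (P # c)) = (\<Sum>P\<in>C. if kout i P = kin i P' then \<omega> P * (cw (Suc i) c / mass i (kin i P')) else 0)"
      unfolding c' by (intro sum.cong refl) auto
    also have "\<dots> = (\<Sum>P\<in>{P\<in>C. kout i P = kin i P'}. \<omega> P * (cw (Suc i) c / mass i (kin i P')))"
      using assms(2) by (rule sum.inter_filter[symmetric])
    also have "\<dots> = sum \<omega> {P\<in>C. kout i P = kin i P'} * (cw (Suc i) c / mass i (kin i P'))"
      by (rule sum_distrib_right[symmetric])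
    also have "\<dots> \<le> (\<rho> * mass i (kin i P')) * (cw (Suc i) c / mass i (kin i P'))"
      using assms(1)[OF P'] cw_nonneg[OF W] mass_nonneg by (intro mult_right_mono divide_nonneg_nonneg) auto
    also have "\<dots> = \<rho> * cw (Suc i) c" using mass_pos[OF P', of i] by simp
    finally show "(\<Sum>P\<in>C. cw i (P # c)) \<le> \<rho> * cw (Suc i) c" .
  qed
  finally show ?thesis by (simp add: sum_distrib_left)
qed

lemma last_peel:
  assumes "Cs \<noteq> []" and j: "j = i + length Cs - 1"
    and "\<And>P. P \<in> W \<Longrightarrow> sum \<omega> {P'\<in>C. kin j P' = kout j P} \<le> \<rho> * mass j (kout j P)"
    and "finite C" "\<forall>D\<in>set Cs. D \<subseteq> W"
  shows "sum (cw i) (listset (Cs @ [C])) \<le> \<rho> * sum (cw i) (listset Cs)"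
proof -
  have "sum (cw i) (listset (Cs @ [C])) = (\<Sum>c\<in>listset Cs. \<Sum>P'\<in>C. cw i (c @ [P']))"
    by (rule sum_listset_snoc)
  also have "\<dots> \<le> (\<Sum>c\<in>listset Cs. \<rho> * cw i c)"
  proof (rule sum_mono)
    fix c assume c: "c \<in> listset Cs"
    have len: "length c = length Cs" using c listset_length by blast
    then have ne: "c \<noteq> []" using assms(1) by auto
    have W: "set c \<subseteq> W" by (rule set_listset_subset[OF c assms(5)])
    let ?P = "last c"
    have P: "?P \<in> W" using W ne by auto
    have "(\<Sum>P'\<in>C. cw i (c @ [P'])) = (\<Sum>P'\<in>C. if kin j P' = kout j ?P then \<omega> P' * (cw i c / mass j (kout j ?P)) else 0)"
      using cw_snoc[OF ne] len j by (intro sum.cong refl) (auto simp: Let_def)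
    also have "\<dots> = (\<Sum>P'\<in>{P'\<in>C. kin j P' = kout j ?P}. \<omega> P' * (cw i c / mass j (kout j ?P)))"
      using assms(4) by (rule sum.inter_filter[symmetric])
    also have "\<dots> = sum \<omega> {P'\<in>C. kin j P' = kout j ?P} * (cw i c / mass j (kout j ?P))"
      by (rule sum_distrib_right[symmetric])
    also have "\<dots> \<le> (\<rho> * mass j (kout j ?P)) * (cw i c / mass j (kout j ?P))"
      using assms(3)[OF P] cw_nonneg[OF W] mass_nonneg by (intro mult_right_mono divide_nonneg_nonneg) auto
    also have "\<dots> = \<rho> * cw i c" using mass_pos'[OF P, of j] by simp
    finally show "(\<Sum>P'\<in>C. cw i (c @ [P'])) \<le> \<rho> * cw i c" .
  qed
  finally show ?thesis by (simp add: sum_distrib_left)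
qed

text \<open>By stationarity a chain may be started at any of its states, from which the constraints are
  then revealed in both directions.\<close>

lemma anchored_bound:
  assumes sub: "\<And>k. k < length Cs \<Longrightarrow> Cs ! k \<subseteq> W" and a: "a < length Cs"
    and before: "\<And>k P. k < a \<Longrightarrow> P \<in> W \<Longrightarrow>
      sum \<omega> {P'\<in>Cs ! k. kout (i + k) P' = kin (i + k) P} \<le> \<rho> k * mass (i + k) (kin (i + k) P)"
    and after: "\<And>k P. a \<le> k \<Longrightarrow> Suc k < length Cs \<Longrightarrow> P \<in> W \<Longrightarrow>
      sum \<omega> {P'\<in>Cs ! Suc k. kin (i + k) P' = kout (i + k) P} \<le> \<rho> (Suc k) * mass (i + k) (kout (i + k) P)"
    and nn: "\<And>k. 0 \<le> \<rho> k"
  shows "sum (cw i) (listset Cs) \<le> sum \<omega> (Cs ! a) * (\<Prod>k\<in>{..<length Cs} - {a}. \<rho> k)"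
  using assms
proof (induction a arbitrary: Cs i \<rho>)
  case 0
  have all: "\<forall>D\<in>set Cs. D \<subseteq> W" using 0(1) by (auto simp: in_set_conv_nth subset_iff)
  have "sum (cw i) (listset (take (Suc m) Cs)) \<le> sum \<omega> (Cs ! 0) * (\<Prod>k\<in>{1..m}. \<rho> k)" if "m < length Cs" for m
    using that
  proof (induction m)
    case 0
    have eq: "take (Suc 0) Cs = [Cs ! 0]" using 0 by (cases Cs) auto
    show ?case unfolding eq sum_listset_single by simp
  next
    case (Suc m)
    have eq: "take (Suc (Suc m)) Cs = take (Suc m) Cs @ [Cs ! Suc m]" using Suc.prems by (simp add: take_Suc_conv_app_nth)
    have "sum (cw i) (listset (take (Suc (Suc m)) Cs)) \<le> \<rho> (Suc m) * sum (cw i) (listset (take (Suc m) Cs))"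
      unfolding eq
    proof (rule last_peel[where j = "i + m"])
      show "take (Suc m) Cs \<noteq> []" "i + m = i + length (take (Suc m) Cs) - 1" using Suc.prems by auto
      show "finite (Cs ! Suc m)" using 0(1)[OF Suc.prems] finW finite_subset by blast
      show "\<forall>D\<in>set (take (Suc m) Cs). D \<subseteq> W" using all by (auto dest: in_set_takeD)
    qed (use 0(4) Suc.prems in auto)
    also have "\<dots> \<le> \<rho> (Suc m) * (sum \<omega> (Cs ! 0) * (\<Prod>k\<in>{1..m}. \<rho> k))"
      using Suc 0(5) by (intro mult_left_mono) auto
    also have "\<dots> = sum \<omega> (Cs ! 0) * (\<Prod>k\<in>{1..Suc m}. \<rho> k)" by (simp add: prod.cl_ivl_Suc)
    finally show ?case .
  qed
  from this[of "length Cs - 1"] have "sum (cw i) (listset Cs) \<le> sum \<omega> (Cs ! 0) * (\<Prod>k\<in>{1..length Cs - 1}. \<rho> k)"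
    using 0(2) by simp
  moreover have "{1..length Cs - 1} = {..<length Cs} - {0}" using 0(2) by auto
  ultimately show ?case by simp
next
  case (Suc a)
  obtain C Cs' where Cs: "Cs = C # Cs'" using Suc.prems(2) by (cases Cs) auto
  obtain C' Cs'' where Cs': "Cs' = C' # Cs''" using Suc.prems(2) Cs by (cases Cs') auto
  have all: "\<forall>D\<in>set Cs. D \<subseteq> W" using Suc.prems(1) by (auto simp: in_set_conv_nth subset_iff)
  have "sum (cw i) (listset Cs) \<le> \<rho> 0 * sum (cw (Suc i)) (listset Cs')"
    unfolding Cs Cs'
  proof (rule head_peel)
    show "sum \<omega> {P\<in>C. kout i P = kin i P'} \<le> \<rho> 0 * mass i (kin i P')" if "P' \<in> W" for P'
      using Suc.prems(3)[of 0 P'] that Cs by simp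
    show "finite C" using all Cs finW finite_subset by auto
  qed (use all Cs Cs' in auto)
  also have "\<dots> \<le> \<rho> 0 * (sum \<omega> (Cs' ! a) * (\<Prod>k\<in>{..<length Cs'} - {a}. \<rho> (Suc k)))"
  proof (intro mult_left_mono Suc.IH)
    show "Cs' ! k \<subseteq> W" if "k < length Cs'" for k using Suc.prems(1)[of "Suc k"] that Cs by simp
    show "sum \<omega> {P'\<in>Cs' ! k. kout (Suc i + k) P' = kin (Suc i + k) P} \<le> \<rho> (Suc k) * mass (Suc i + k) (kin (Suc i + k) P)"
      if "k < a" "P \<in> W" for k P using Suc.prems(3)[of "Suc k" P] that Cs by simp
    show "sum \<omega> {P'\<in>Cs' ! Suc k. kin (Suc i + k) P' = kout (Suc i + k) P} \<le> \<rho> (Suc (Suc k)) * mass (Suc i + k) (kout (Suc i + k) P)"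
      if "a \<le> k" "Suc k < length Cs'" "P \<in> W" for k P using Suc.prems(4)[of "Suc k" P] that Cs by simp
  qed (use Suc.prems Cs in auto)
  also have "\<dots> = sum \<omega> (Cs ! Suc a) * (\<Prod>k\<in>{..<length Cs} - {Suc a}. \<rho> k)"
  proof -
    have eq: "{..<length Cs} - {Suc a} = insert 0 (Suc ` ({..<length Cs'} - {a}))"
      unfolding Cs length_Cons lessThan_Suc_eq_insert_0 by auto
    have "(\<Prod>k\<in>{..<length Cs} - {Suc a}. \<rho> k) = \<rho> 0 * (\<Prod>k\<in>{..<length Cs'} - {a}. \<rho> (Suc k))"
      unfolding eq by (subst prod.insert) (auto simp: prod.reindex)
    then show ?thesis using Cs by simp
  qed
  finally show ?case .
qed

lemma free_out:
  assumes "C \<subseteq> W"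
  shows "sum \<omega> {P\<in>C. kout j P = a} \<le> 1 * mass j a"
proof -
  have "sum \<omega> {P\<in>C. kout j P = a} \<le> sum \<omega> {P\<in>W. kout j P = a}"
  proof (rule sum_mono2)
    show "0 \<le> \<omega> P" if "P \<in> {P\<in>W. kout j P = a} - {P\<in>C. kout j P = a}" for P
      using that om_pos[of P] by simp
  qed (use assms finW in auto)
  then show ?thesis unfolding mass_out by simp
qed

lemma free_in:
  assumes "C \<subseteq> W"
  shows "sum \<omega> {P\<in>C. kin j P = a} \<le> 1 * mass j a"
proof -
  have "sum \<omega> {P\<in>C. kin j P = a} \<le> sum \<omega> {P\<in>W. kin j P = a}"
  proof (rule sum_mono2)
    show "0 \<le> \<omega> P" if "P \<in> {P\<in>W. kin j P = a} - {P\<in>C. kin j P = a}" for P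
      using that om_pos[of P] by simp
  qed (use assms finW in auto)
  then show ?thesis unfolding mass_def by simp
qed

lemma total_mass: "sum (cw i) (listset (replicate (Suc m) W)) = sum \<omega> W"
proof (induction m arbitrary: i)
  case 0
  have eq: "replicate (Suc 0) W = [W]" by simp
  show ?case unfolding eq sum_listset_single by simp
next
  case (Suc m)
  have "sum (cw i) (listset (replicate (Suc (Suc m)) W)) = (\<Sum>c\<in>listset (replicate (Suc m) W). \<Sum>P\<in>W. cw i (P # c))"
    unfolding replicate_Suc[of "Suc m"] sum_listset_Cons[of _ W] by (rule sum.swap)
  also have "\<dots> = (\<Sum>c\<in>listset (replicate (Suc m) W). cw (Suc i) c)"
  proof (rule sum.cong[OF refl])
    fix c assume "c \<in> listset (replicate (Suc m) W)"
    then obtain P' c' where c: "c = P' # c'" "P' \<in> W" by (auto simp: set_Cons_def)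
    have "(\<Sum>P\<in>W. cw i (P # c)) = (\<Sum>P\<in>W. if kout i P = kin i P' then \<omega> P * (cw (Suc i) c / mass i (kin i P')) else 0)"
      unfolding c by (intro sum.cong refl) auto
    also have "\<dots> = sum \<omega> {P\<in>W. kout i P = kin i P'} * (cw (Suc i) c / mass i (kin i P'))"
      unfolding sum.inter_filter[OF finW, symmetric] by (rule sum_distrib_right[symmetric])
    also have "\<dots> = cw (Suc i) c" using mass_pos[OF c(2), of i] by (simp add: mass_out)
    finally show "(\<Sum>P\<in>W. cw i (P # c)) = cw (Suc i) c" .
  qed
  also have "\<dots> = sum \<omega> W" by (rule Suc)
  finally show ?case .
qed

text \<open>For each common value \<open>u\<close> the event splits into one constraint on state
  \<open>a\<close> and one on state \<open>b\<close>. With the chain anchored at \<open>a\<close>,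
  only the constraint on \<open>b\<close> is paid for with \<open>\<rho>\<close>, and the anchors
  for all \<open>u\<close> together have weight \<open>sum \<omega> W\<close>.\<close>

lemma coincidence_bound:
  assumes ab: "a < b" "b < m" and rho: "0 \<le> \<rho>"
    and hit: "\<And>u P. P \<in> W \<Longrightarrow> sum \<omega> {P'\<in>W. h P' = u \<and> kin (b - 1) P' = kout (b - 1) P} \<le> \<rho> * mass (b - 1) (kout (b - 1) P)"
  shows "sum (cw 0) {c \<in> listset (replicate m W). h (c ! b) = g (c ! a)} \<le> \<rho> * sum \<omega> W"
proof -
  let ?L = "listset (replicate m W)"
  define Cs where "Cs u = (replicate m W)[a := {P\<in>W. g P = u}, b := {P\<in>W. h P = u}]" for u
  have nth: "Cs u ! k = (if k = b then {P\<in>W. h P = u} else if k = a then {P\<in>W. g P = u} else W)" if "k < m" for u k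
    using that ab unfolding Cs_def by (auto simp: nth_list_update)
  have len: "length (Cs u) = m" for u unfolding Cs_def by simp
  have finL: "finite ?L" by (rule finite_listset) (use finW in auto)
  have sub: "Cs u ! k \<subseteq> W" if "k < m" for u k unfolding nth[OF that] by auto
  have L: "c \<in> ?L \<longleftrightarrow> length c = m \<and> (\<forall>i<m. c ! i \<in> W)" for c unfolding listset_nth by auto
  have mem: "c \<in> listset (Cs u) \<longleftrightarrow> c \<in> ?L \<and> g (c ! a) = u \<and> h (c ! b) = u" for c u
  proof
    assume c: "c \<in> listset (Cs u)"
    then have *: "length c = m" "\<And>i. i < m \<Longrightarrow> c ! i \<in> Cs u ! i" by (auto simp: listset_nth len)
    have "c ! i \<in> W" if "i < m" for i using *(2)[OF that] nth[OF that, of u] by (auto split: if_splits)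
    moreover have "g (c ! a) = u" "h (c ! b) = u" using *(2)[of a] *(2)[of b] nth[of a u] nth[of b u] ab by auto
    ultimately show "c \<in> ?L \<and> g (c ! a) = u \<and> h (c ! b) = u" using L *(1) by blast
  next
    assume c: "c \<in> ?L \<and> g (c ! a) = u \<and> h (c ! b) = u"
    then have "c ! i \<in> Cs u ! i" if "i < m" for i using nth[OF that, of u] that L by auto
    then show "c \<in> listset (Cs u)" using c L by (auto simp: listset_nth len)
  qed
  have eq: "{c \<in> ?L. h (c ! b) = g (c ! a)} = (\<Union>u\<in>g ` W. listset (Cs u))"
  proof (intro set_eqI iffI)
    fix c assume "c \<in> {c \<in> ?L. h (c ! b) = g (c ! a)}"
    then have c: "c \<in> ?L" "h (c ! b) = g (c ! a)" by simp_all
    have "c ! a \<in> W" using c(1) ab unfolding L by simp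
    then show "c \<in> (\<Union>u\<in>g ` W. listset (Cs u))" using c by (intro UN_I[of "g (c ! a)"] imageI) (simp_all only: mem)
  next
    fix c assume "c \<in> (\<Union>u\<in>g ` W. listset (Cs u))"
    then obtain u where "c \<in> listset (Cs u)" by (rule UN_E)
    then show "c \<in> {c \<in> ?L. h (c ! b) = g (c ! a)}" by (simp only: mem) simp
  qed
  have "sum (cw 0) {c \<in> ?L. h (c ! b) = g (c ! a)} = (\<Sum>u\<in>g ` W. sum (cw 0) (listset (Cs u)))"
    unfolding eq
  proof (rule sum.UNION_disjoint)
    show "\<forall>u\<in>g ` W. finite (listset (Cs u))"
    proof
      fix u
      have "listset (Cs u) \<subseteq> ?L" by (rule subsetI) (simp only: mem)
      then show "finite (listset (Cs u))" using finL finite_subset by blast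
    qed
    show "\<forall>u\<in>g ` W. \<forall>v\<in>g ` W. u \<noteq> v \<longrightarrow> listset (Cs u) \<inter> listset (Cs v) = {}"
      by (intro ballI impI equals0I, simp only: Int_iff mem, elim conjE) simp
  qed (use finW in auto)
  also have "\<dots> \<le> (\<Sum>u\<in>g ` W. \<rho> * sum \<omega> {P\<in>W. g P = u})"
  proof (rule sum_mono)
    fix u
    let ?\<rho> = "\<lambda>k. if k = b then \<rho> else 1"
    have "sum (cw 0) (listset (Cs u)) \<le> sum \<omega> (Cs u ! a) * (\<Prod>k\<in>{..<length (Cs u)} - {a}. ?\<rho> k)"
    proof (rule anchored_bound)
      show "Cs u ! k \<subseteq> W" if "k < length (Cs u)" for k using sub that len by simp
      show "sum \<omega> {P'\<in>Cs u ! k. kout (0 + k) P' = kin (0 + k) P} \<le> ?\<rho> k * mass (0 + k) (kin (0 + k) P)"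
        if "k < a" "P \<in> W" for k P using free_out[OF sub[of k u], of k "kin k P"] that ab by simp
      show "sum \<omega> {P'\<in>Cs u ! Suc k. kin (0 + k) P' = kout (0 + k) P} \<le> ?\<rho> (Suc k) * mass (0 + k) (kout (0 + k) P)"
        if "a \<le> k" "Suc k < length (Cs u)" "P \<in> W" for k P
      proof (cases "Suc k = b")
        case True
        have eq: "{P'\<in>Cs u ! Suc k. kin (0 + k) P' = kout (0 + k) P}
            = {P'\<in>W. h P' = u \<and> kin (b - 1) P' = kout (b - 1) P}"
        proof -
          have "Cs u ! Suc k = {P\<in>W. h P = u}" using nth[of "Suc k" u] True ab(2) by simp
          moreover have "b - 1 = k" using True by simp
          ultimately show ?thesis by simp
        qed
        show ?thesis unfolding eq using hit[OF that(3), of u] True by auto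
      next
        case False
        then show ?thesis using free_in[OF sub[of "Suc k" u], of k "kout k P"] that len by simp
      qed
    qed (use ab len rho in auto)
    also have "(\<Prod>k\<in>{..<length (Cs u)} - {a}. ?\<rho> k) = \<rho>"
      using ab len prod.delta[of "{..<length (Cs u)} - {a}" b "\<lambda>_. \<rho>"] by simp
    also have "Cs u ! a = {P\<in>W. g P = u}" using nth[of a u] ab by auto
    finally show "sum (cw 0) (listset (Cs u)) \<le> \<rho> * sum \<omega> {P\<in>W. g P = u}" by (simp add: mult.commute)
  qed
  also have "\<dots> = \<rho> * (\<Sum>u\<in>g ` W. sum \<omega> {P\<in>W. g P = u})" by (rule sum_distrib_left[symmetric])
  also have "(\<Sum>u\<in>g ` W. sum \<omega> {P\<in>W. g P = u}) = sum \<omega> W" by (rule sum.image_gen[OF finW, symmetric])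
  finally show ?thesis .
qed

end

section \<open>From weighted systems of closed walks to spread weights\<close>

text \<open>\<open>w\<close> is the image of \<open>g\<close> on \<open>\<Gamma>'\<close> under
  passing to edge sets, divided by \<open>a\<close>. For the codegree of \<open>S\<close>, members
  are sorted by a signature that records at which positions and by which darts \<open>S\<close> is
  realised. At most \<open>q * k\<close> darts lie over \<open>S\<close>, hence there are at most
  \<open>2 ^ (k * (q * k))\<close> signatures, and distinctness of the edges makes each signature
  prescribe exactly \<open>card S\<close> positions.\<close>

lemma spread_of_system:
  fixes \<Gamma> \<Gamma>' :: "'g set" and g :: "'g \<Rightarrow> real" and dl :: "'g \<Rightarrow> 'd list" and ed :: "'d \<Rightarrow> 'a"
  assumes X: "finite X" and G: "finite \<Gamma>" "\<Gamma>' \<subseteq> \<Gamma>" and g0: "\<And>\<gamma>. \<gamma> \<in> \<Gamma> \<Longrightarrow> 0 \<le> g \<gamma>"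
    and a: "0 < a" "a \<le> sum g \<Gamma>'"
    and dl: "\<And>\<gamma>. \<gamma> \<in> \<Gamma>' \<Longrightarrow> length (dl \<gamma>) = k" "\<And>\<gamma>. \<gamma> \<in> \<Gamma>' \<Longrightarrow> distinct (map ed (dl \<gamma>))"
      "\<And>\<gamma>. \<gamma> \<in> \<Gamma>' \<Longrightarrow> ed ` set (dl \<gamma>) \<subseteq> X" "\<And>\<gamma>. \<gamma> \<in> \<Gamma>' \<Longrightarrow> set (dl \<gamma>) \<subseteq> Lab"
    and Lab: "finite Lab" "\<And>e. e \<in> X \<Longrightarrow> card {d\<in>Lab. ed d = e} \<le> q"
    and b: "0 \<le> b" "0 \<le> \<tau>"
    and bound: "\<And>J d. J \<subseteq> {..<k} \<Longrightarrow> J \<noteq> {} \<Longrightarrow>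
      sum g {\<gamma>\<in>\<Gamma>. \<forall>i\<in>J. dl \<gamma> ! i = d i} \<le> b / card X * \<tau> ^ (card J - 1)"
  shows "\<exists>w. spread k (2 ^ (k * (q * k)) * b / a) \<tau> X w \<and>
    (\<forall>F. w F > 0 \<longrightarrow> (\<exists>\<gamma>\<in>\<Gamma>'. F = set (map ed (dl \<gamma>))))"
proof -
  define E where "E \<gamma> = set (map ed (dl \<gamma>))" for \<gamma>
  define w where "w F = sum g {\<gamma>\<in>\<Gamma>'. E \<gamma> = F} / a" for F
  have fin': "finite \<Gamma>'" using G finite_subset by blast
  have EX: "E \<gamma> \<subseteq> X" if "\<gamma> \<in> \<Gamma>'" for \<gamma> using dl(3)[OF that] unfolding E_def by simp
  have cardE: "card (E \<gamma>) = k" if "\<gamma> \<in> \<Gamma>'" for \<gamma>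
    using distinct_card[OF dl(2)[OF that]] dl(1)[OF that] unfolding E_def by simp
  have w0: "0 \<le> w F" for F unfolding w_def using a(1) G(2) by (intro divide_nonneg_pos sum_nonneg g0) auto
  have wne: "\<exists>\<gamma>\<in>\<Gamma>'. F = E \<gamma>" if "w F \<noteq> 0" for F
  proof (rule ccontr)
    assume "\<not> ?thesis"
    then have "{\<gamma>\<in>\<Gamma>'. E \<gamma> = F} = {}" by auto
    then have "w F = 0" unfolding w_def by (simp only: sum.empty div_0)
    then show False using that by simp
  qed
  have sum_w: "sum w \<F> = sum g {\<gamma>\<in>\<Gamma>'. E \<gamma> \<in> \<F>} / a" if "finite \<F>" for \<F>
  proof -
    have "sum g {\<gamma>\<in>\<Gamma>'. E \<gamma> \<in> \<F>} = (\<Sum>F\<in>\<F>. sum g {\<gamma>\<in>{\<gamma>\<in>\<Gamma>'. E \<gamma> \<in> \<F>}. E \<gamma> = F})"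
      using fin' that by (intro sum.group[symmetric]) auto
    also have "\<dots> = (\<Sum>F\<in>\<F>. sum g {\<gamma>\<in>\<Gamma>'. E \<gamma> = F})"
      by (intro sum.cong refl) auto
    finally show ?thesis unfolding w_def by (simp only: sum_divide_distrib)
  qed
  have finPow: "finite (Pow X)" using X by simp
  have "spread k (2 ^ (k * (q * k)) * b / a) \<tau> X w"
    unfolding spread_def
  proof (intro conjI allI impI)
    show "0 \<le> w e" for e by (rule w0)
    show "e \<subseteq> X" "card e = k" if "w e \<noteq> 0" for e using wne[OF that] EX cardE by auto
    have "{\<gamma>\<in>\<Gamma>'. E \<gamma> \<in> Pow X} = \<Gamma>'" using EX by auto
    then show "1 \<le> sum w (Pow X)" unfolding sum_w[OF finPow] using a by simp
    fix S assume S: "S \<subseteq> X" "S \<noteq> {}"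
    have fS: "finite S" using S X finite_subset by auto
    let ?b = "b / card X * \<tau> ^ (card S - 1)"
    have b0: "0 \<le> ?b" using b by simp
    define D where "D = {d\<in>Lab. ed d \<in> S}"
    define \<T> where "\<T> = {\<gamma>\<in>\<Gamma>'. S \<subseteq> E \<gamma>}"
    define sig where "sig \<gamma> = {(i, d). i < k \<and> d = dl \<gamma> ! i \<and> ed d \<in> S}" for \<gamma>
    have finT: "finite \<T>" unfolding \<T>_def using fin' by simp
    have TG: "\<T> \<subseteq> \<Gamma>" "\<T> \<subseteq> \<Gamma>'" using G(2) unfolding \<T>_def by auto
    have "cod X w S = sum w {e \<in> Pow X. S \<subseteq> e}" unfolding cod_def by (rule sum.cong) auto
    also have "\<dots> = sum g {\<gamma>\<in>\<Gamma>'. E \<gamma> \<in> {e \<in> Pow X. S \<subseteq> e}} / a" by (rule sum_w) (use finPow in simp)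
    also have "{\<gamma>\<in>\<Gamma>'. E \<gamma> \<in> {e \<in> Pow X. S \<subseteq> e}} = \<T>" unfolding \<T>_def using EX by auto
    finally have cod: "cod X w S = sum g \<T> / a" .
    show "cod X w S \<le> 2 ^ (k * (q * k)) * b / a / card X * \<tau> ^ (card S - 1)"
    proof (cases "\<T> = {}")
      case True
      have "0 \<le> 2 ^ (k * (q * k)) * b / a / card X * \<tau> ^ (card S - 1)" using a b by simp
      then show ?thesis unfolding cod True by simp
    next
      case False
      then obtain \<gamma>0 where "\<gamma>0 \<in> \<Gamma>'" "S \<subseteq> E \<gamma>0" unfolding \<T>_def by blast
      then have Sk: "card S \<le> k" using cardE[of \<gamma>0] card_mono[of "E \<gamma>0" S] EX X finite_subset by metis
      have "card D \<le> (\<Sum>e\<in>S. card {d\<in>Lab. ed d = e})"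
      proof -
        have "D = (\<Union>e\<in>S. {d\<in>Lab. ed d = e})" unfolding D_def by auto
        then show ?thesis using card_UN_le[OF fS] by metis
      qed
      also have "\<dots> \<le> card S * q" using sum_bounded_above[of S "\<lambda>e. card {d\<in>Lab. ed d = e}" q] Lab(2) S(1) by auto
      also have "\<dots> \<le> q * k" using Sk by simp
      finally have cD: "card D \<le> q * k" .
      have finD: "finite D" unfolding D_def using Lab(1) by simp
      have sigsub: "sig ` \<T> \<subseteq> Pow ({..<k} \<times> D)"
      proof (rule image_subsetI)
        fix \<gamma> assume g: "\<gamma> \<in> \<T>"
        then have g': "\<gamma> \<in> \<Gamma>'" using TG(2) by blast
        have "dl \<gamma> ! i \<in> Lab" if "i < k" for i
          using dl(4)[OF g'] dl(1)[OF g'] nth_mem[of i "dl \<gamma>"] that by auto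
        then show "sig \<gamma> \<in> Pow ({..<k} \<times> D)" unfolding sig_def D_def by auto
      qed
      have csig: "card (sig ` \<T>) \<le> 2 ^ (k * (q * k))"
      proof -
        have "card (sig ` \<T>) \<le> card (Pow ({..<k} \<times> D))" using sigsub finD by (intro card_mono) auto
        also have "\<dots> = 2 ^ (k * card D)" using finD by (simp add: card_Pow)
        also have "\<dots> \<le> 2 ^ (k * (q * k))" using cD by (intro power_increasing mult_left_mono) auto
        finally show ?thesis .
      qed
      have "sum g \<T> = (\<Sum>A\<in>sig ` \<T>. sum g {\<gamma>\<in>\<T>. sig \<gamma> = A})" by (rule sum.image_gen[OF finT])
      also have "\<dots> \<le> (\<Sum>A\<in>sig ` \<T>. ?b)"
      proof (rule sum_mono)
        fix A assume "A \<in> sig ` \<T>"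
        then obtain \<gamma>1 where g1: "\<gamma>1 \<in> \<T>" "A = sig \<gamma>1" by blast
        define J where "J = {i\<in>{..<k}. ed (dl \<gamma>1 ! i) \<in> S}"
        have len1: "length (dl \<gamma>1) = k" and dist1: "distinct (map ed (dl \<gamma>1))" and S1: "S \<subseteq> E \<gamma>1"
          using g1 dl TG(2) unfolding \<T>_def by auto
        have "bij_betw (\<lambda>i. ed (dl \<gamma>1 ! i)) J S"
        proof (rule bij_betw_imageI)
          show "inj_on (\<lambda>i. ed (dl \<gamma>1 ! i)) J"
            using dist1 len1 unfolding J_def inj_on_def distinct_conv_nth by (auto simp: nth_map)
          show "(\<lambda>i. ed (dl \<gamma>1 ! i)) ` J = S"
          proof
            show "S \<subseteq> (\<lambda>i. ed (dl \<gamma>1 ! i)) ` J"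
            proof
              fix e assume e: "e \<in> S"
              then have "e \<in> ed ` set (dl \<gamma>1)" using S1 unfolding E_def by auto
              then obtain i where "i < k" "ed (dl \<gamma>1 ! i) = e" using len1 by (metis imageE in_set_conv_nth)
              then show "e \<in> (\<lambda>i. ed (dl \<gamma>1 ! i)) ` J" using e unfolding J_def by auto
            qed
          qed (auto simp: J_def)
        qed
        then have cJ: "card J = card S" by (rule bij_betw_same_card)
        then have Jne: "J \<noteq> {}" using S(2) fS by auto
        have "sum g {\<gamma>\<in>\<T>. sig \<gamma> = A} \<le> sum g {\<gamma>\<in>\<Gamma>. \<forall>i\<in>J. dl \<gamma> ! i = dl \<gamma>1 ! i}"
        proof (rule sum_mono2)
          show "{\<gamma>\<in>\<T>. sig \<gamma> = A} \<subseteq> {\<gamma>\<in>\<Gamma>. \<forall>i\<in>J. dl \<gamma> ! i = dl \<gamma>1 ! i}"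
          proof safe
            fix \<gamma> i assume *: "\<gamma> \<in> \<T>" "A = sig \<gamma>" "i \<in> J"
            then have "(i, dl \<gamma>1 ! i) \<in> sig \<gamma>" using g1(2) unfolding sig_def J_def by auto
            then show "dl \<gamma> ! i = dl \<gamma>1 ! i" unfolding sig_def by simp
          qed (use TG in auto)
        qed (use G(1) g0 in auto)
        also have "\<dots> \<le> b / card X * \<tau> ^ (card J - 1)" by (rule bound) (use Jne in \<open>auto simp: J_def\<close>)
        finally show "sum g {\<gamma>\<in>\<T>. sig \<gamma> = A} \<le> ?b" unfolding cJ .
      qed
      also have "\<dots> = card (sig ` \<T>) * ?b" by simp
      also have "\<dots> \<le> 2 ^ (k * (q * k)) * ?b"
        using of_nat_mono[OF csig, where 'a=real] b0 by (intro mult_right_mono) auto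
      finally have "sum g \<T> \<le> 2 ^ (k * (q * k)) * ?b" .
      then have "sum g \<T> / a \<le> 2 ^ (k * (q * k)) * ?b / a" using a(1) by (intro divide_right_mono) auto
      then show ?thesis unfolding cod by (simp add: field_simps)
    qed
  qed
  moreover have "\<forall>F. w F > 0 \<longrightarrow> (\<exists>\<gamma>\<in>\<Gamma>'. F = set (map ed (dl \<gamma>)))"
    using wne unfolding E_def by (metis less_irrefl)
  ultimately show ?thesis by blast
qed

type_synonym 'e dart = "nat \<times> 'e \<times> nat"

abbreviation src :: "'e dart \<Rightarrow> nat" where "src d \<equiv> fst d"
abbreviation lab :: "'e dart \<Rightarrow> 'e" where "lab d \<equiv> fst (snd d)"
abbreviation tgt :: "'e dart \<Rightarrow> nat" where "tgt d \<equiv> snd (snd d)"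

lemma berge_cycle_of_closed_walk:
  fixes ds :: "nat set dart list"
  assumes k: "length ds = k" "0 < k"
    and inc: "\<And>d. d \<in> set ds \<Longrightarrow> src d \<in> lab d \<and> tgt d \<in> lab d \<and> lab d \<in> nsets UNIV r"
    and closed: "\<And>i. i < k \<Longrightarrow> tgt (ds ! i) = src (ds ! (Suc i mod k))"
    and dist: "distinct (map src ds)" "distinct (map lab ds)"
  shows "set (map lab ds) \<in> berge_cycles r k"
proof -
  \<comment> \<open>Edge \<open>i\<close> of the Berge cycle joins vertex \<open>i - 1\<close> to
    vertex \<open>i\<close>, hence is dart \<open>i - 1\<close> of the list; \<open>mod k\<close> in
    \<open>v\<close> identifies vertex \<open>k\<close> with vertex \<open>0\<close>.\<close>
  define e where "e i = lab (ds ! (i - 1))" for i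
  define v where "v i = src (ds ! (i mod k))" for i
  have img: "set (map lab ds) = e ` {1..k}"
  proof -
    have "{1..k} = Suc ` {..<k}" by (simp add: image_Suc_lessThan)
    then have "e ` {1..k} = (\<lambda>i. lab (ds ! i)) ` {..<k}" unfolding e_def by (simp add: image_image)
    also have "\<dots> = lab ` ((!) ds ` {..<length ds})" using k(1) by (simp add: image_image)
    also have "(!) ds ` {..<length ds} = set ds" by (auto simp: set_conv_nth)
    also have "lab ` set ds = set (map lab ds)" by simp
    finally show ?thesis ..
  qed
  have inje: "inj_on e {1..k}"
  proof (rule inj_onI)
    fix i j assume ij: "i \<in> {1..k}" "j \<in> {1..k}" "e i = e j"
    then have "i - 1 = j - 1" using nth_eq_iff_index_eq[OF dist(2), of "i - 1" "j - 1"] k unfolding e_def by auto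
    then show "i = j" using ij by auto
  qed
  have injv: "inj_on v {1..k}"
  proof (rule inj_onI)
    fix i j assume ij: "i \<in> {1..k}" "j \<in> {1..k}" "v i = v j"
    then have "i mod k = j mod k"
      using nth_eq_iff_index_eq[OF dist(1), of "i mod k" "j mod k"] k unfolding v_def by auto
    then show "i = j" using ij by (cases "i = k"; cases "j = k") auto
  qed
  have inc': "v (i - 1) \<in> e i \<and> v i \<in> e i" if i: "i \<in> {1..k}" for i
  proof -
    obtain j where j: "i = Suc j" "j < k" using i by (cases i) auto
    then have "src (ds ! j) \<in> lab (ds ! j)" "tgt (ds ! j) \<in> lab (ds ! j)" using inc[of "ds ! j"] k by auto
    then show ?thesis using closed[OF j(2)] j unfolding v_def e_def by simp
  qed
  have "v 0 = v k" unfolding v_def by simp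
  moreover have "set (map lab ds) \<subseteq> nsets UNIV r" using inc by auto
  ultimately show ?thesis unfolding berge_cycles_def using img inje injv inc' by blast
qed

section \<open>Random walks on multigraphs\<close>

context key_chain
begin

text \<open>By stationarity a chain without its first state is distributed like a chain again, with
  the transition index shifted by one.\<close>

lemma sum_tl:
  "(\<Sum>c\<in>listset (replicate (Suc (Suc m)) W). f (tl c) * cw i c) = (\<Sum>c\<in>listset (replicate (Suc m) W). f c * cw (Suc i) c)"
proof -
  have "(\<Sum>c\<in>listset (replicate (Suc (Suc m)) W). f (tl c) * cw i c)
      = (\<Sum>c\<in>listset (replicate (Suc m) W). \<Sum>P\<in>W. f c * cw i (P # c))"
    unfolding replicate_Suc[of "Suc m"] sum_listset_Cons[of _ W] list.sel by (rule sum.swap)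
  also have "\<dots> = (\<Sum>c\<in>listset (replicate (Suc m) W). f c * cw (Suc i) c)"
  proof (rule sum.cong[OF refl])
    fix c assume "c \<in> listset (replicate (Suc m) W)"
    then obtain P' c' where c: "c = P' # c'" "P' \<in> W" by (auto simp: set_Cons_def)
    have "(\<Sum>P\<in>W. cw i (P # c)) = (\<Sum>P\<in>W. if kout i P = kin i P' then \<omega> P * (cw (Suc i) c / mass i (kin i P')) else 0)"
      unfolding c by (intro sum.cong refl) auto
    also have "\<dots> = sum \<omega> {P\<in>W. kout i P = kin i P'} * (cw (Suc i) c / mass i (kin i P'))"
      unfolding sum.inter_filter[OF finW, symmetric] by (rule sum_distrib_right[symmetric])
    also have "\<dots> = cw (Suc i) c" using mass_pos[OF c(2), of i] by (simp add: mass_out)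
    finally show "(\<Sum>P\<in>W. f c * cw i (P # c)) = f c * cw (Suc i) c" by (simp only: sum_distrib_left[symmetric])
  qed
  finally show ?thesis .
qed

lemma sum_butlast:
  "(\<Sum>c\<in>listset (replicate (Suc (Suc m)) W). f (butlast c) * cw i c) = (\<Sum>c\<in>listset (replicate (Suc m) W). f c * cw i c)"
proof -
  have rep: "replicate (Suc (Suc m)) W = replicate (Suc m) W @ [W]" by (simp add: replicate_append_same)
  have "(\<Sum>c\<in>listset (replicate (Suc (Suc m)) W). f (butlast c) * cw i c)
      = (\<Sum>c\<in>listset (replicate (Suc m) W). \<Sum>P\<in>W. f c * cw i (c @ [P]))"
    unfolding rep sum_listset_snoc butlast_snoc ..
  also have "\<dots> = (\<Sum>c\<in>listset (replicate (Suc m) W). f c * cw i c)"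
  proof (rule sum.cong[OF refl])
    fix c assume c: "c \<in> listset (replicate (Suc m) W)"
    then have len: "length c = Suc m" using listset_length by fastforce
    then have ne: "c \<noteq> []" by auto
    have cW: "set c \<subseteq> W" by (rule set_listset_subset[OF c]) auto
    have P: "last c \<in> W" using cW ne by auto
    define j where "j = i + length c - 1"
    have "(\<Sum>P'\<in>W. cw i (c @ [P'])) = (\<Sum>P'\<in>W. if kin j P' = kout j (last c) then \<omega> P' * (cw i c / mass j (kout j (last c))) else 0)"
      using cw_snoc[OF ne, of i] unfolding j_def by (intro sum.cong refl) (auto simp: Let_def)
    also have "\<dots> = sum \<omega> {P'\<in>W. kin j P' = kout j (last c)} * (cw i c / mass j (kout j (last c)))"
      unfolding sum.inter_filter[OF finW, symmetric] by (rule sum_distrib_right[symmetric])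
    also have "\<dots> = cw i c" using mass_pos'[OF P, of j] by (simp add: mass_def)
    finally show "(\<Sum>P\<in>W. f c * cw i (c @ [P])) = f c * cw i c" by (simp only: sum_distrib_left[symmetric])
  qed
  finally show ?thesis .
qed

end

text \<open>Each edge occurs as two darts, one for each direction. \<open>D\<close> and
  \<open>B\<close> describe the graph; \<open>\<theta>\<close> is the branching factor per step
  against which walks are counted, and its reciprocal will be the price of a prescribed
  dart.\<close>

locale multigraph =
  fixes Dt :: "'e dart set" and D B \<theta> :: real
  assumes finDt: "finite Dt" and ne: "Dt \<noteq> {}"
    and sym: "(u, e, v) \<in> Dt \<Longrightarrow> (v, e, u) \<in> Dt"
    and noloop: "(u, e, u) \<notin> Dt"
    and mindeg: "d \<in> Dt \<Longrightarrow> D \<le> card {d'\<in>Dt. src d' = src d}"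
    and mult: "card {d\<in>Dt. src d = u \<and> tgt d = v} \<le> B"
    and B1: "1 \<le> B" and B\<theta>: "B \<le> \<theta>" and \<theta>D: "\<theta> \<le> D"
begin

abbreviation "M \<equiv> real (card Dt)"

lemma M_pos: "0 < M" using finDt ne by (simp add: card_gt_0_iff)

lemma D_pos: "0 < D" and th_pos: "0 < \<theta>" using B1 B\<theta> \<theta>D by auto

lemma card_src_tgt: "card {d\<in>Dt. tgt d = u} = card {d\<in>Dt. src d = u}"
  by (rule bij_betw_same_card[of "\<lambda>(u, e, v). (v, e, u)"], rule bij_betwI[where g = "\<lambda>(u, e, v). (v, e, u)"])
     (auto intro: sym)

text \<open>The stationary simple random walk: the next dart is uniform among those leaving the
  current end. Reversal of darts balances in-degrees and out-degrees.\<close>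

sublocale walk: key_chain Dt "\<lambda>_. 1 / M" "\<lambda>_. tgt" "\<lambda>_. src"
  by unfold_locales (use finDt M_pos in \<open>auto simp: card_src_tgt\<close>)

abbreviation (input) "om \<equiv> walk.cw 0"

definition deg :: "nat \<Rightarrow> real" where "deg u = card {d\<in>Dt. src d = u}"
definition stat :: "nat \<Rightarrow> real" where "stat u = deg u / M"
definition V :: "nat set" where "V = src ` Dt"

lemma mass_eq: "walk.mass i u = stat u"
  unfolding walk.mass_def stat_def deg_def by simp

lemma finV: "finite V" unfolding V_def using finDt by simp

lemma src_V: "d \<in> Dt \<Longrightarrow> src d \<in> V" and tgt_V: "d \<in> Dt \<Longrightarrow> tgt d \<in> V"
proof -
  show "d \<in> Dt \<Longrightarrow> src d \<in> V" unfolding V_def by simp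
  assume "d \<in> Dt"
  then have "(tgt d, lab d, src d) \<in> Dt" using sym[of "src d" "lab d" "tgt d"] by simp
  then show "tgt d \<in> V" unfolding V_def by force
qed

lemma deg_ge: "u \<in> V \<Longrightarrow> D \<le> deg u" unfolding V_def deg_def using mindeg by auto

lemma stat_pos: "u \<in> V \<Longrightarrow> 0 < stat u"
  using deg_ge[of u] D_pos M_pos unfolding stat_def by simp

lemma inv_M_le: "u \<in> V \<Longrightarrow> 1 / M \<le> stat u / D"
  using deg_ge[of u] D_pos M_pos unfolding stat_def by (simp add: field_simps)

lemma cw_shift: "walk.cw i c = om c"
proof (induction c arbitrary: i)
  case (Cons d c)
  show ?case
  proof (cases c)
    case (Cons d' c')
    have "walk.cw (Suc i) c = walk.cw (Suc 0) c" using Cons.IH[of "Suc i"] Cons.IH[of "Suc 0"] by simp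
    then show ?thesis unfolding Cons by (simp add: mass_eq)
  qed simp
qed simp

lemma om_Cons: "om (d # d' # c) = (if tgt d = src d' then om (d' # c) / (M * stat (src d')) else 0)"
  using cw_shift[of "Suc 0" "d' # c"] by (simp add: mass_eq)

lemma om_append:
  "a \<noteq> [] \<Longrightarrow> b \<noteq> [] \<Longrightarrow>
    om (a @ b) = (if tgt (last a) = src (hd b) then om a * om b / stat (src (hd b)) else 0)"
proof (induction a)
  case (Cons d a)
  obtain d'' b' where b: "b = d'' # b'" using Cons.prems by (cases b) auto
  show ?case
  proof (cases a)
    case Nil
    then show ?thesis using b om_Cons[of d d'' b'] by (simp only: append_Cons append_Nil last.simps list.sel walk.cw.simps if_True) (simp del: walk.cw.simps)
  next
    case (Cons d' a')
    have "om ((d # a) @ b) = (if tgt d = src d' then om (a @ b) / (M * stat (src d')) else 0)"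
      unfolding Cons append_Cons by (rule om_Cons)
    moreover have "om (d # a) = (if tgt d = src d' then om a / (M * stat (src d')) else 0)"
      unfolding Cons by (rule om_Cons)
    moreover have "last (d # a) = last a" using Cons by simp
    ultimately show ?thesis using Cons.IH Cons.prems(2) \<open>a = d' # a'\<close> by (simp del: walk.cw.simps)
  qed
qed simp

section \<open>Transition weights and thin walks\<close>

definition Aq :: "'e dart set list \<Rightarrow> nat \<Rightarrow> nat \<Rightarrow> real" where
  "Aq Cs x z = (\<Sum>c\<in>listset Cs. if src (hd c) = x \<and> tgt (last c) = z then om c else 0)"

abbreviation "L h \<equiv> listset (replicate h Dt)"
text \<open>A joint probability, not a conditional one: the stationary walk of length
  \<open>h\<close> starts at \<open>x\<close> and ends at \<open>z\<close>. The transition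
  probability is \<open>q h x z / stat x\<close>.\<close>

abbreviation "q h \<equiv> Aq (replicate h Dt)"

lemma L_iff: "c \<in> L h \<longleftrightarrow> length c = h \<and> set c \<subseteq> Dt"
  unfolding listset_nth subset_eq all_set_conv_all_nth by auto

lemma om_nonneg: "set c \<subseteq> Dt \<Longrightarrow> 0 \<le> om c"
  by (rule walk.cw_nonneg)

lemma Aq_nonneg: "\<forall>C\<in>set Cs. C \<subseteq> Dt \<Longrightarrow> 0 \<le> Aq Cs x z"
  unfolding Aq_def by (intro sum_nonneg) (auto intro!: om_nonneg dest: set_listset_subset)

lemma Aq_append:
  assumes "As \<noteq> []" "Bs \<noteq> []" "\<forall>C\<in>set As. C \<subseteq> Dt" "\<forall>C\<in>set Bs. C \<subseteq> Dt"
  shows "Aq (As @ Bs) x z = (\<Sum>u\<in>V. Aq As x u * Aq Bs u z / stat u)"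
proof -
  have "Aq (As @ Bs) x z = (\<Sum>a\<in>listset As. \<Sum>b\<in>listset Bs. \<Sum>u\<in>V.
      (if src (hd a) = x \<and> tgt (last a) = u then om a else 0) * (if src (hd b) = u \<and> tgt (last b) = z then om b else 0) / stat u)"
    unfolding Aq_def sum_listset_append
  proof (intro sum.cong refl)
    fix a b assume a: "a \<in> listset As" and b: "b \<in> listset Bs"
    have "length a = length As" "length b = length Bs" using a b listset_length by auto
    then have ne: "a \<noteq> []" "b \<noteq> []" using assms(1,2) by auto
    have "set a \<subseteq> Dt" "set b \<subseteq> Dt" using set_listset_subset a b assms by auto
    then have V: "src (hd b) \<in> V" using ne(2) by (intro src_V) auto
    have "(\<Sum>u\<in>V. (if src (hd a) = x \<and> tgt (last a) = u then om a else 0) * (if src (hd b) = u \<and> tgt (last b) = z then om b else 0) / stat u)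
        = (\<Sum>u\<in>V. if u = src (hd b) then (if src (hd a) = x \<and> tgt (last a) = u then om a else 0) * (if tgt (last b) = z then om b else 0) / stat u else 0)"
      by (intro sum.cong refl) auto
    also have "\<dots> = (if src (hd a) = x \<and> tgt (last a) = src (hd b) then om a else 0) * (if tgt (last b) = z then om b else 0) / stat (src (hd b))"
      using V finV by simp
    also have "\<dots> = (if src (hd (a @ b)) = x \<and> tgt (last (a @ b)) = z then om (a @ b) else 0)"
      using om_append[OF ne] ne by simp
    finally show "(if src (hd (a @ b)) = x \<and> tgt (last (a @ b)) = z then om (a @ b) else 0) =
      (\<Sum>u\<in>V. (if src (hd a) = x \<and> tgt (last a) = u then om a else 0) * (if src (hd b) = u \<and> tgt (last b) = z then om b else 0) / stat u)" ..
  qed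
  also have "\<dots> = (\<Sum>u\<in>V. \<Sum>a\<in>listset As. \<Sum>b\<in>listset Bs.
      (if src (hd a) = x \<and> tgt (last a) = u then om a else 0) * (if src (hd b) = u \<and> tgt (last b) = z then om b else 0) / stat u)"
    by (rule trans[OF sum.cong[OF refl sum.swap] sum.swap])
  also have "\<dots> = (\<Sum>u\<in>V. Aq As x u * Aq Bs u z / stat u)"
    unfolding Aq_def sum_product sum_divide_distrib ..
  finally show ?thesis .
qed

lemma Aq_single: "d \<in> Dt \<Longrightarrow> Aq [{d}] x z = (if src d = x \<and> tgt d = z then 1 / M else 0)"
  unfolding Aq_def sum_listset_single by simp

lemma Aq_append_dart:
  assumes "As \<noteq> []" "\<forall>C\<in>set As. C \<subseteq> Dt" "\<forall>C\<in>set Bs. C \<subseteq> Dt" "C \<subseteq> Dt" "\<And>d. d \<in> C \<Longrightarrow> src d = u" "u \<in> V"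
  shows "Aq (As @ C # Bs) x z = Aq As x u * Aq (C # Bs) u z / stat u"
proof -
  have 0: "Aq (C # Bs) v z = 0" if "v \<noteq> u" for v
    unfolding Aq_def by (rule sum.neutral) (use that assms(5) in \<open>auto simp: set_Cons_def\<close>)
  have "Aq (As @ C # Bs) x z = (\<Sum>v\<in>V. Aq As x v * Aq (C # Bs) v z / stat v)"
    by (rule Aq_append) (use assms in auto)
  also have "\<dots> = (\<Sum>v\<in>V. if v = u then Aq As x u * Aq (C # Bs) u z / stat u else 0)"
    using 0 by (intro sum.cong refl) auto
  finally show ?thesis using assms(6) finV by simp
qed

lemma Aq_dart_Cons:
  assumes d: "d \<in> Dt" and "Bs \<noteq> []" "\<forall>C\<in>set Bs. C \<subseteq> Dt"
  shows "Aq ({d} # Bs) (src d) z = Aq Bs (tgt d) z / (M * stat (tgt d))"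
proof -
  have "Aq ([{d}] @ Bs) (src d) z = (\<Sum>v\<in>V. Aq [{d}] (src d) v * Aq Bs v z / stat v)"
    by (rule Aq_append) (use assms in auto)
  also have "\<dots> = (\<Sum>v\<in>V. if v = tgt d then 1 / M * Aq Bs (tgt d) z / stat (tgt d) else 0)"
    unfolding Aq_single[OF d] by (intro sum.cong refl) auto
  finally show ?thesis using tgt_V[OF d] finV by simp
qed

text \<open>If all degrees were \<open>D\<close>, a transition probability of \<open>tt h\<close>
  would mean \<open>\<theta> ^ (h - 1) * B\<close> walks of length \<open>h\<close> between the two
  ends: a factor \<open>B\<close> for one dart and \<open>\<theta>\<close> for each of the
  others.\<close>

definition tt :: "nat \<Rightarrow> real" where "tt h = \<theta> ^ (h - 1) * B / D ^ h"

definition subthin :: "'e dart list \<Rightarrow> nat \<Rightarrow> nat \<Rightarrow> bool" where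
  "subthin c i j \<longleftrightarrow> q (j - i) (src (c ! i)) (tgt (c ! (j - 1))) \<le> tt (j - i) * stat (src (c ! i))"

definition thin :: "'e dart list \<Rightarrow> bool" where
  "thin c \<longleftrightarrow> (\<forall>i j. i < j \<longrightarrow> j \<le> length c \<longrightarrow> subthin c i j)"

definition gap :: "nat \<Rightarrow> real" where "gap n = (if n = 0 then 1 else \<theta> ^ (n - 1) * B)"

lemma gap_pos: "0 < gap n" unfolding gap_def using th_pos B1 by simp

text \<open>Two separate runs contribute \<open>B\<close> twice, the merged run contributes
  \<open>B\<close> once and one more \<open>\<theta>\<close>. This is where
  \<open>B \<le> \<theta>\<close> enters.\<close>

lemma gap_mult: "gap i * gap n \<le> gap (i + n)"
proof (cases "i = 0 \<or> n = 0")
  case False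
  then obtain i' n' where i: "i = Suc i'" "n = Suc n'" by (meson not0_implies_Suc)
  have "\<theta> ^ i' * B * (\<theta> ^ n' * B) = \<theta> ^ (i' + n') * (B * B)" by (simp add: power_add)
  also have "\<dots> \<le> \<theta> ^ (i' + n') * (\<theta> * B)" using th_pos B1 B\<theta> by (intro mult_left_mono mult_right_mono) auto
  also have "\<dots> = \<theta> ^ (Suc i' + Suc n' - 1) * B" by (simp add: power_add)
  finally show ?thesis unfolding gap_def i by simp
qed (auto simp: gap_def)

definition cons_sets :: "bool list \<Rightarrow> 'e dart list \<Rightarrow> 'e dart set list" where
  "cons_sets fs r = map (\<lambda>(b, d). if b then {d} else Dt) (zip fs r)"

lemma cons_sets_sub: "set r \<subseteq> Dt \<Longrightarrow> \<forall>C\<in>set (cons_sets fs r). C \<subseteq> Dt"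
  unfolding cons_sets_def by (auto split: if_splits dest: set_zip_rightD)

lemma length_cons_sets: "length (cons_sets fs r) = min (length fs) (length r)"
  unfolding cons_sets_def by simp

lemma om_pos_chain: "om c > 0 \<Longrightarrow> Suc i < length c \<Longrightarrow> tgt (c ! i) = src (c ! Suc i)"
proof (induction c arbitrary: i)
  case (Cons d c)
  then obtain d' c' where c: "c = d' # c'" by (cases c) auto
  have *: "tgt d = src d'" "om (d' # c') / (M * stat (src d')) > 0"
    using Cons.prems(1) unfolding c om_Cons by (auto split: if_splits)
  show ?case
  proof (cases i)
    case (Suc j)
    have "om c > 0"
    proof (rule ccontr)
      assume "\<not> om c > 0"
      moreover have "0 \<le> M * stat (src d')" unfolding stat_def deg_def by simp
      ultimately have "om (d' # c') / (M * stat (src d')) \<le> 0" unfolding c by (intro divide_nonpos_nonneg) auto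
      then show False using * by simp
    qed
    then show ?thesis using Cons.IH[of j] Cons.prems Suc by auto
  qed (use * c in simp)
qed simp

lemma om_pos_drop: "om (a @ b) > 0 \<Longrightarrow> set (a @ b) \<subseteq> Dt \<Longrightarrow> b \<noteq> [] \<Longrightarrow> om b > 0"
proof -
  assume *: "om (a @ b) > 0" "set (a @ b) \<subseteq> Dt" "b \<noteq> []"
  show "om b > 0"
  proof (cases "a = []")
    case False
    then have "om a * om b / stat (src (hd b)) > 0" using om_append[OF False *(3)] * by (simp split: if_splits)
    moreover have "0 \<le> om b" using * by (intro om_nonneg) auto
    ultimately show ?thesis by (cases "om b = 0") auto
  qed (use * in simp)
qed

text \<open>Walks that agree with the reference walk \<open>r\<close> on the marked positions: every maximal run of
  unmarked positions of length \<open>g\<close> contributes a factor \<open>gap g\<close>.\<close>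

lemma gap_bound:
  assumes "length fs = length r" "r \<noteq> []" "set r \<subseteq> Dt" "om r > 0"
    and "\<And>i j. i < j \<Longrightarrow> j \<le> length r \<Longrightarrow> (i, j) \<noteq> (0, length r) \<or> True \<notin> set fs \<Longrightarrow> subthin r i j"
  shows "Aq (cons_sets fs r) (src (hd r)) (tgt (last r))
    \<le> stat (src (hd r)) * gap (count_list fs False) / D ^ length r"
  using assms
proof (induction "length r" arbitrary: fs r rule: less_induct)
  case less
  have hdV: "src (hd r) \<in> V" using less.prems(2,3) by (intro src_V) auto
  show ?case
  proof (cases "True \<in> set fs")
    case False
    then have all: "fs = replicate (length r) False"
      using less.prems(1) by (metis (full_types) replicate_eqI)
    have cs: "cons_sets fs r = replicate (length r) Dt"
      unfolding cons_sets_def all by (rule nth_equalityI) auto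
    have "subthin r 0 (length r)" by (rule less.prems(5)) (use less.prems(2) False in auto)
    then have "q (length r) (src (hd r)) (tgt (last r)) \<le> tt (length r) * stat (src (hd r))"
      unfolding subthin_def using less.prems(2) by (simp add: hd_conv_nth last_conv_nth)
    moreover have "count_list fs False = length r" unfolding all by (induction r) auto
    ultimately show ?thesis unfolding cs tt_def gap_def using less.prems(2) by (simp add: mult_ac)
  next
    case True
    \<comment> \<open>The walk is cut at its first pinned dart: the free run in front of it is
      controlled by thinness, the part behind it by induction.\<close>
    then obtain fa fb where fs: "fs = fa @ True # fb" "True \<notin> set fa" by (meson split_list_first)
    define i where "i = length fa"
    have il: "i < length r" using fs(1) less.prems(1) unfolding i_def by simp
    define ra d rb where "ra = take i r" and "d = r ! i" and "rb = drop (Suc i) r"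
    have r: "r = ra @ d # rb" unfolding ra_def d_def rb_def using il by (simp add: id_take_nth_drop)
    have lra: "length ra = i" unfolding ra_def using il by simp
    have lrb: "length rb = length fb" using less.prems(1) unfolding fs(1) r i_def[symmetric] using lra i_def by simp
    have dD: "d \<in> Dt" and rbD: "set rb \<subseteq> Dt" using less.prems(3) r by auto
    have fa: "fa = replicate i False" using fs(2) unfolding i_def by (metis (full_types) replicate_eqI)
    have zipeq: "zip fs r = zip fa ra @ (True, d) # zip fb rb"
      unfolding fs(1) r using lra i_def by simp
    have cs: "cons_sets fs r = replicate i Dt @ {d} # cons_sets fb rb"
    proof -
      have "map (\<lambda>(b, d). if b then {d} else Dt) (zip fa ra) = replicate i Dt"
        unfolding fa by (rule nth_equalityI) (use lra in auto)
      then show ?thesis unfolding cons_sets_def zipeq by simp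
    qed
    have cnt: "count_list fs False = i + count_list fb False"
    proof -
      have "count_list fa False = i" unfolding fa by (induction i) auto
      then show ?thesis unfolding fs(1) by simp
    qed
    have sub: "\<forall>C\<in>set (cons_sets fb rb). C \<subseteq> Dt" by (rule cons_sets_sub[OF rbD])
    have dV: "src d \<in> V" "tgt d \<in> V" using src_V tgt_V dD by auto
    have tail: "Aq ({d} # cons_sets fb rb) (src d) (tgt (last r)) \<le> stat (src d) * gap (count_list fb False) / D ^ Suc (length rb)"
    proof (cases "rb = []")
      case True
      then have "fb = []" "last r = d" using lrb r by auto
      moreover have "1 / M \<le> stat (src d) / D" by (rule inv_M_le[OF dV(1)])
      ultimately show ?thesis using True Aq_single[OF dD] unfolding cons_sets_def gap_def by simp
    next
      case False
      have om: "om rb > 0" using om_pos_drop[of "ra @ [d]" rb] less.prems(3,4) False r by simp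
      have lastr: "last r = last rb" unfolding r using False by simp
      have hd: "tgt d = src (hd rb)"
        using om_pos_chain[OF less.prems(4), of i] False il lra unfolding r by (cases rb) (auto simp: nth_append)
      have "Aq (cons_sets fb rb) (src (hd rb)) (tgt (last rb)) \<le> stat (src (hd rb)) * gap (count_list fb False) / D ^ length rb"
      proof (rule less.hyps[OF _ _ False rbD om])
        show "length rb < length r" unfolding r by simp
        show "length fb = length rb" using lrb by simp
        fix a b assume ab: "a < b" "b \<le> length rb"
        have "subthin r (Suc i + a) (Suc i + b)" by (rule less.prems(5)) (use ab r lra in auto)
        moreover have "r ! (Suc i + a) = rb ! a" "r ! (Suc i + b - 1) = rb ! (b - 1)"
          unfolding r using lra ab by (auto simp: nth_append)
        ultimately show "subthin rb a b" unfolding subthin_def by simp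
      qed
      then have *: "Aq (cons_sets fb rb) (tgt d) (tgt (last r)) \<le> stat (tgt d) * gap (count_list fb False) / D ^ length rb"
        unfolding hd lastr .
      have "Aq ({d} # cons_sets fb rb) (src d) (tgt (last r)) = Aq (cons_sets fb rb) (tgt d) (tgt (last r)) / (M * stat (tgt d))"
        by (rule Aq_dart_Cons[OF dD _ sub]) (use False lrb in \<open>auto simp: cons_sets_def\<close>)
      also have "\<dots> \<le> (stat (tgt d) * gap (count_list fb False) / D ^ length rb) / (M * stat (tgt d))"
        using * M_pos stat_pos[OF dV(2)] by (intro divide_right_mono) auto
      also have "\<dots> = (1 / M) * (gap (count_list fb False) / D ^ length rb)" using stat_pos[OF dV(2)] by simp
      also have "\<dots> \<le> (stat (src d) / D) * (gap (count_list fb False) / D ^ length rb)"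
        using inv_M_le[OF dV(1)] gap_pos[of "count_list fb False"] D_pos by (intro mult_right_mono) auto
      finally show ?thesis by simp
    qed
    show ?thesis
    proof (cases "i = 0")
      case True
      then have "ra = []" using lra by auto
      then have h: "hd r = d" "length r = Suc (length rb)" using r by auto
      show ?thesis using tail unfolding cs cnt True h by simp
    next
      case False
      have "subthin r 0 i" by (rule less.prems(5)) (use False il in auto)
      moreover have "tgt (r ! (i - 1)) = src d"
        using om_pos_chain[OF less.prems(4), of "i - 1"] False il unfolding d_def by simp
      ultimately have qi: "q i (src (hd r)) (src d) \<le> gap i / D ^ i * stat (src (hd r))"
        unfolding subthin_def tt_def gap_def using False less.prems(2) by (simp add: hd_conv_nth)
      have "Aq (cons_sets fs r) (src (hd r)) (tgt (last r))
          = q i (src (hd r)) (src d) * Aq ({d} # cons_sets fb rb) (src d) (tgt (last r)) / stat (src d)"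
        unfolding cs by (rule Aq_append_dart) (use False sub dV dD in auto)
      also have "\<dots> \<le> (gap i / D ^ i * stat (src (hd r))) * (stat (src d) * gap (count_list fb False) / D ^ Suc (length rb)) / stat (src d)"
        using qi tail stat_pos[OF dV(1)] stat_pos[OF hdV] gap_pos[of i] D_pos
        by (intro divide_right_mono mult_mono Aq_nonneg) (use sub dD in auto)
      also have "\<dots> = stat (src (hd r)) * (gap i * gap (count_list fb False)) / D ^ (i + Suc (length rb))"
        using stat_pos[OF dV(1)] by (simp add: power_add mult_ac)
      also have "\<dots> \<le> stat (src (hd r)) * gap (i + count_list fb False) / D ^ (i + Suc (length rb))"
        using gap_mult stat_pos[OF hdV] D_pos by (intro divide_right_mono mult_left_mono) auto
      also have "i + Suc (length rb) = length r" unfolding r using lra by simp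
      finally show ?thesis unfolding cnt .
    qed
  qed
qed

text \<open>Started at one of the pinned darts, which has weight \<open>1 / M\<close>, the walk
  meets every other pinned dart with probability at most \<open>1 / D\<close>.\<close>

lemma fixed_darts_bound:
  assumes J: "J \<subseteq> {..<h}" "J \<noteq> {}"
  shows "sum om {c\<in>L h. \<forall>i\<in>J. c ! i = d i} \<le> 1 / M * (1 / D) ^ (card J - 1)"
proof (cases "\<forall>i\<in>J. d i \<in> Dt")
  case False
  then have "{c\<in>L h. \<forall>i\<in>J. c ! i = d i} = {}" using J(1) by (auto simp: listset_nth)
  then show ?thesis using D_pos by (simp only: sum.empty) simp
next
  case True
  have finJ: "finite J" using J(1) finite_subset by blast
  obtain a where a: "a \<in> J" using J(2) by blast
  define Cs where "Cs = map (\<lambda>i. if i \<in> J then {d i} else Dt) [0..<h]"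
  have nth: "Cs ! k = (if k \<in> J then {d k} else Dt)" if "k < h" for k unfolding Cs_def using that by simp
  have len: "length Cs = h" unfolding Cs_def by simp
  have eq: "{c\<in>L h. \<forall>i\<in>J. c ! i = d i} = listset Cs"
  proof (intro set_eqI iffI)
    fix c assume "c \<in> {c\<in>L h. \<forall>i\<in>J. c ! i = d i}"
    then have c: "length c = h" "\<And>i. i < h \<Longrightarrow> c ! i \<in> Dt" "\<And>i. i \<in> J \<Longrightarrow> c ! i = d i"
      by (auto simp: listset_nth)
    then have "c ! i \<in> Cs ! i" if "i < h" for i using nth[OF that] that by simp
    then show "c \<in> listset Cs" unfolding listset_nth len using c(1) by simp
  next
    fix c assume "c \<in> listset Cs"
    then have c: "length c = h" "\<And>i. i < h \<Longrightarrow> c ! i \<in> Cs ! i" unfolding listset_nth len by auto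
    have "c ! i \<in> Dt" "i \<in> J \<Longrightarrow> c ! i = d i" if "i < h" for i
      using c(2)[OF that] nth[OF that] True by (auto split: if_splits)
    then show "c \<in> {c\<in>L h. \<forall>i\<in>J. c ! i = d i}" using c(1) J(1) by (auto simp: listset_nth)
  qed
  let ?\<rho> = "\<lambda>k. if k \<in> J then 1 / D else 1"
  have one: "1 / M * card {P'\<in>{d k}. P P'} \<le> 1 / D * stat u" if "u \<in> V" for P k u
  proof -
    have "card {P'\<in>{d k}. P P'} \<le> card {d k}" by (intro card_mono) auto
    then have "1 / M * card {P'\<in>{d k}. P P'} \<le> 1 / M * 1" using M_pos by (intro mult_left_mono) auto
    also have "\<dots> \<le> 1 / D * stat u" using inv_M_le[OF that] by simp
    finally show ?thesis .
  qed
  have "sum om (listset Cs) \<le> (\<Sum>P'\<in>Cs ! a. 1 / M) * (\<Prod>k\<in>{..<length Cs} - {a}. ?\<rho> k)"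
  proof (rule walk.anchored_bound)
    show "Cs ! k \<subseteq> Dt" if "k < length Cs" for k using that nth True len by auto
    show "a < length Cs" using a J(1) len by auto
    show "(\<Sum>P' | P' \<in> Cs ! k \<and> tgt P' = src P. 1 / M) \<le> ?\<rho> k * walk.mass (0 + k) (src P)"
      if "k < a" "P \<in> Dt" for k P
    proof (cases "k \<in> J")
      case T: True
      then show ?thesis using one[OF src_V[OF that(2)], of k "\<lambda>P'. tgt P' = src P"] nth[of k] J(1) by (auto simp: mass_eq)
    next
      case F: False
      have "k < h" using that(1) a J(1) by auto
      then show ?thesis using F walk.free_out[of Dt "src P" k] nth[of k] by simp
    qed
    show "(\<Sum>P' | P' \<in> Cs ! Suc k \<and> src P' = tgt P. 1 / M) \<le> ?\<rho> (Suc k) * walk.mass (0 + k) (tgt P)"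
      if "a \<le> k" "Suc k < length Cs" "P \<in> Dt" for k P
    proof (cases "Suc k \<in> J")
      case T: True
      then show ?thesis using one[OF tgt_V[OF that(3)], of "Suc k" "\<lambda>P'. src P' = tgt P"] nth[of "Suc k"] J(1) by (auto simp: mass_eq)
    next
      case F: False
      then show ?thesis using walk.free_in[of Dt "tgt P" k] nth[of "Suc k"] that(2) len by simp
    qed
  qed (use D_pos in auto)
  also have "(\<Sum>P'\<in>Cs ! a. 1 / M) = 1 / M" using nth[of a] a J(1) by auto
  also have "(\<Prod>k\<in>{..<length Cs} - {a}. ?\<rho> k) = (1 / D) ^ (card J - 1)"
  proof -
    have "(\<Prod>k\<in>{..<length Cs} - {a}. ?\<rho> k) = (\<Prod>k\<in>J - {a}. 1 / D)"
      unfolding len using J(1) by (intro prod.mono_neutral_cong_right) auto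
    also have "\<dots> = (1 / D) ^ card (J - {a})" by simp
    finally show ?thesis using a finJ by simp
  qed
  finally show ?thesis unfolding eq .
qed

end

lemma sum_UN_le:
  fixes f :: "'a \<Rightarrow> real"
  assumes "finite I" "\<And>i. i \<in> I \<Longrightarrow> finite (A i)" "\<And>x. 0 \<le> f x"
  shows "sum f (\<Union>i\<in>I. A i) \<le> (\<Sum>i\<in>I. sum f (A i))"
  using assms(1,2)
proof (induction I rule: finite_induct)
  case (insert i I)
  have "sum f (\<Union>j\<in>insert i I. A j) = sum f (A i \<union> (\<Union>j\<in>I. A j))" by simp
  also have "\<dots> \<le> sum f (A i) + sum f (\<Union>j\<in>I. A j)"
  proof -
    have "sum f (A i \<union> (\<Union>j\<in>I. A j)) = sum f (A i) + sum f (\<Union>j\<in>I. A j) - sum f (A i \<inter> (\<Union>j\<in>I. A j))"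
      using insert by (intro sum_Un) auto
    then show ?thesis using sum_nonneg[of "A i \<inter> (\<Union>j\<in>I. A j)" f] assms(3) by simp
  qed
  also have "\<dots> \<le> sum f (A i) + (\<Sum>j\<in>I. sum f (A j))" using insert by simp
  finally show ?case using insert by simp
qed simp

section \<open>A large family of walks between heavily connected pairs\<close>

context multigraph
begin

lemma finL: "finite (L h)" by (rule finite_listset) (use finDt in auto)

lemma q_eq: "q h x z = sum om {c\<in>L h. src (hd c) = x \<and> tgt (last c) = z}"
  unfolding Aq_def by (rule sum.inter_filter[symmetric, OF finL])

lemma L_sub: "c \<in> L h \<Longrightarrow> set c \<subseteq> Dt" unfolding L_iff by simp

lemma om_L: "c \<in> L h \<Longrightarrow> 0 \<le> om c" by (rule om_nonneg[OF L_sub])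

lemma L_mass: "0 < h \<Longrightarrow> sum om (L h) = 1"
  using walk.total_mass[of 0 "h - 1"] M_pos by (cases h) auto

lemma sum_stat: "(\<Sum>x\<in>V. stat x) = 1"
proof -
  have "(\<Sum>x\<in>V. deg x) = (\<Sum>x\<in>V. \<Sum>d\<in>{d\<in>Dt. src d = x}. 1)" unfolding deg_def by simp
  also have "\<dots> = (\<Sum>d\<in>Dt. 1)" unfolding V_def by (rule sum.image_gen[OF finDt, symmetric])
  finally show ?thesis unfolding stat_def using M_pos by (simp flip: sum_divide_distrib)
qed

lemma sum_le_q:
  assumes "A \<subseteq> {c\<in>L h. src (hd c) = x \<and> tgt (last c) = z}"
  shows "sum om A \<le> q h x z"
  unfolding q_eq by (rule sum_mono2) (use assms finL om_L in auto)

definition bad :: "nat \<Rightarrow> real" where "bad h = sum om {c\<in>L h. \<not> thin c}"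

text \<open>A single dart is thin because of the bound \<open>B\<close> on the multiplicities. This
  start of the recursion forces \<open>t\<close> to be at least \<open>2\<close> later.\<close>

lemma bad_1: "bad 1 = 0"
proof -
  have "thin c" if cL: "c \<in> L 1" for c
  proof -
    obtain d where c: "c = [d]" "d \<in> Dt" using cL unfolding L_iff by (cases c) auto
    have "q 1 (src d) (tgt d) = (\<Sum>d'\<in>Dt. if src d' = src d \<and> tgt d' = tgt d then 1 / M else 0)"
    proof -
      have rep: "replicate 1 Dt = [Dt]" by simp
      show ?thesis unfolding Aq_def rep sum_listset_single by (intro sum.cong refl) simp
    qed
    also have "\<dots> = card {d'\<in>Dt. src d' = src d \<and> tgt d' = tgt d} / M"
      using finDt by (simp add: sum.inter_filter[symmetric])
    also have "\<dots> \<le> B / M" using mult[of "src d" "tgt d"] M_pos by (intro divide_right_mono) auto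
    also have "\<dots> \<le> B * (stat (src d) / D)" using mult_left_mono[OF inv_M_le[OF src_V[OF c(2)]], of B] B1 by simp
    finally have "q 1 (src d) (tgt d) \<le> tt 1 * stat (src d)" unfolding tt_def by simp
    then have "subthin c 0 1" unfolding subthin_def c by simp
    moreover have "i = 0 \<and> j = 1" if "i < j" "j \<le> length c" for i j using that unfolding c by auto
    ultimately show ?thesis unfolding thin_def by blast
  qed
  then have "{c\<in>L 1. \<not> thin c} = {}" by blast
  then show ?thesis unfolding bad_def by (simp only: sum.empty)
qed

text \<open>Thinness bounds the weight of each occurring end pair by \<open>tt h * stat x\<close>;
  the sum over the starts is \<open>1\<close> and there are \<open>card V\<close> possible ends.
  Once the bound is at most \<open>1 / 2\<close>, half of the walks of length \<open>h\<close> are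
  not thin.\<close>

lemma thin_mass_le:
  assumes "0 < h"
  shows "sum om {c\<in>L h. thin c} \<le> card V * tt h"
proof -
  let ?A = "{c\<in>L h. thin c}"
  let ?f = "\<lambda>c. (src (hd c), tgt (last c))"
  have fA: "finite ?A" using finL by simp
  have "?f ` ?A \<subseteq> V \<times> V"
  proof (rule image_subsetI)
    fix c assume "c \<in> ?A"
    then have "c \<noteq> []" "set c \<subseteq> Dt" using assms L_iff by auto
    then have "hd c \<in> Dt" "last c \<in> Dt" by auto
    then show "?f c \<in> V \<times> V" using src_V tgt_V by simp
  qed
  then have "sum om ?A = (\<Sum>p\<in>V \<times> V. sum om {c\<in>?A. ?f c = p})"
    by (intro sum.group[symmetric] fA finite_cartesian_product finV)
  also have "\<dots> \<le> (\<Sum>p\<in>V \<times> V. tt h * stat (fst p))"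
  proof (rule sum_mono)
    fix p assume p: "p \<in> V \<times> V"
    have tt0: "0 \<le> tt h * stat (fst p)"
      using stat_pos[of "fst p"] p th_pos B1 D_pos unfolding tt_def by auto
    show "sum om {c\<in>?A. ?f c = p} \<le> tt h * stat (fst p)"
    proof (cases "{c\<in>?A. ?f c = p} = {}")
      case False
      then obtain c where c: "c \<in> L h" "thin c" "src (hd c) = fst p" "tgt (last c) = snd p" by auto
      have len: "length c = h" using c(1) L_iff by blast
      then have "subthin c 0 h" using c(2) assms unfolding thin_def by auto
      moreover have "c \<noteq> []" using len assms by auto
      ultimately have "q h (fst p) (snd p) \<le> tt h * stat (fst p)"
        using c len unfolding subthin_def by (simp add: hd_conv_nth last_conv_nth)
      moreover have "sum om {c\<in>?A. ?f c = p} \<le> q h (fst p) (snd p)"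
        by (rule sum_le_q) auto
      ultimately show ?thesis by linarith
    qed (use tt0 in \<open>simp only: sum.empty\<close>)
  qed
  also have "\<dots> = (\<Sum>x\<in>V. \<Sum>z\<in>V. tt h * stat x)" by (simp only: sum.cartesian_product case_prod_unfold)
  also have "\<dots> = card V * tt h * (\<Sum>x\<in>V. stat x)" by (simp only: sum_constant sum_distrib_left sum_distrib_right mult_ac)
  finally show ?thesis unfolding sum_stat by simp
qed

definition fat :: "nat \<Rightarrow> 'e dart list \<Rightarrow> bool" where
  "fat t c \<longleftrightarrow> tt t * stat (src (hd c)) < q t (src (hd c)) (tgt (last c))"

text \<open>A subwalk that violates thinness avoids the last dart, or avoids the first dart, or is
  the whole walk. In the first two cases \<open>butlast c\<close> or \<open>tl c\<close> fails, and
  by stationarity each of them is distributed like a walk one dart shorter.\<close>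

lemma bad_step:
  "bad (Suc (Suc m)) \<le> 2 * bad (Suc m) + sum om {c\<in>L (Suc (Suc m)). thin (butlast c) \<and> thin (tl c) \<and> fat (Suc (Suc m)) c}"
proof -
  define n where "n = Suc (Suc m)"
  let ?A = "{c\<in>L n. \<not> thin (butlast c)}" and ?B = "{c\<in>L n. \<not> thin (tl c)}"
    and ?F = "{c\<in>L n. thin (butlast c) \<and> thin (tl c) \<and> fat n c}"
  have sub: "{c\<in>L n. \<not> thin c} \<subseteq> ?A \<union> ?B \<union> ?F"
  proof
    fix c assume "c \<in> {c\<in>L n. \<not> thin c}"
    then have c: "c \<in> L n" "\<not> thin c" by auto
    have len: "length c = n" using c(1) L_iff by blast
    obtain i j where ij: "i < j" "j \<le> n" "\<not> subthin c i j" using c(2) len unfolding thin_def by auto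
    consider "j < n" | "0 < i" | "i = 0" "j = n" using ij by linarith
    then show "c \<in> ?A \<union> ?B \<union> ?F"
    proof cases
      case 1
      then have "\<not> subthin (butlast c) i j" using ij len unfolding subthin_def by (simp add: nth_butlast)
      moreover have "subthin (butlast c) i j" if "thin (butlast c)"
        using that 1 ij(1) len unfolding thin_def n_def by simp
      ultimately have "\<not> thin (butlast c)" by blast
      then show ?thesis using c by blast
    next
      case 2
      obtain i' j' where i': "i = Suc i'" "j = Suc j'" using 2 ij by (metis gr0_implies_Suc less_trans)
      have "\<not> subthin (tl c) i' j'" using ij len unfolding subthin_def i' by (simp add: nth_tl)
      moreover have "subthin (tl c) i' j'" if "thin (tl c)"
        using that ij(1,2) len unfolding thin_def n_def i' by simp
      ultimately have "\<not> thin (tl c)" by blast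
      then show ?thesis using c by blast
    next
      case 3
      have "c \<noteq> []" using len unfolding n_def by auto
      then have "fat n c" using ij 3 len unfolding subthin_def fat_def by (simp add: hd_conv_nth last_conv_nth)
      then show ?thesis using c by blast
    qed
  qed
  have A: "sum om ?A = bad (Suc m)"
  proof -
    have "sum om ?A = (\<Sum>c\<in>L n. (if thin (butlast c) then 0 else 1) * om c)"
      unfolding sum.inter_filter[OF finL] by (rule sum.cong) auto
    also have "\<dots> = (\<Sum>c\<in>L (Suc m). (if thin c then 0 else 1) * om c)"
      unfolding n_def by (rule walk.sum_butlast[where f = "\<lambda>c. if thin c then 0 else 1"])
    also have "\<dots> = bad (Suc m)"
      unfolding bad_def sum.inter_filter[OF finL] by (rule sum.cong) auto
    finally show ?thesis .
  qed
  have B: "sum om ?B = bad (Suc m)"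
  proof -
    have "sum om ?B = (\<Sum>c\<in>L n. (if thin (tl c) then 0 else 1) * om c)"
      unfolding sum.inter_filter[OF finL] by (rule sum.cong) auto
    also have "\<dots> = (\<Sum>c\<in>L (Suc m). (if thin c then 0 else 1) * walk.cw (Suc 0) c)"
      unfolding n_def by (rule walk.sum_tl[where f = "\<lambda>c. if thin c then 0 else 1"])
    also have "\<dots> = bad (Suc m)"
      unfolding bad_def sum.inter_filter[OF finL] by (rule sum.cong) (auto simp: cw_shift[of "Suc 0"])
    finally show ?thesis .
  qed
  have "bad n \<le> sum om (?A \<union> ?B \<union> ?F)"
    unfolding bad_def by (rule sum_mono2) (use sub finL om_L in auto)
  also have "\<dots> \<le> sum om (?A \<union> ?B) + sum om ?F"
  proof -
    have "sum om (?A \<union> ?B \<union> ?F) = sum om (?A \<union> ?B) + sum om ?F - sum om ((?A \<union> ?B) \<inter> ?F)"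
      by (rule sum_Un) (use finL in auto)
    moreover have "0 \<le> sum om ((?A \<union> ?B) \<inter> ?F)" by (rule sum_nonneg) (auto intro: om_L)
    ultimately show ?thesis by linarith
  qed
  also have "sum om (?A \<union> ?B) \<le> sum om ?A + sum om ?B"
  proof -
    have "sum om (?A \<union> ?B) = sum om ?A + sum om ?B - sum om (?A \<inter> ?B)"
      by (rule sum_Un) (use finL in auto)
    moreover have "0 \<le> sum om (?A \<inter> ?B)" by (rule sum_nonneg) (auto intro: om_L)
    ultimately show ?thesis by linarith
  qed
  finally have "bad n \<le> 2 * bad (Suc m) + sum om ?F" unfolding A B by simp
  then show ?thesis unfolding n_def .
qed

definition vs :: "'e dart list \<Rightarrow> nat list" where "vs c = map src c @ [tgt (last c)]"

lemma vs_nth: "om c > 0 \<Longrightarrow> c \<noteq> [] \<Longrightarrow> i \<le> length c \<Longrightarrow> vs c ! i = (if i = 0 then src (hd c) else tgt (c ! (i - 1)))"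
  unfolding vs_def using om_pos_chain[of c "i - 1"] by (auto simp: nth_append hd_conv_nth last_conv_nth)

text \<open>A step from a given vertex hits a prescribed earlier vertex with probability at most
  \<open>B / D\<close>, and consecutive vertices differ because there are no loops.\<close>

lemma repeated_vertex_mass:
  "sum om {c\<in>L t. om c > 0 \<and> \<not> distinct (vs c)} \<le> real t ^ 2 * (B / D)"
proof -
  define I where "I = {(i, j). i < j \<and> j < t}"
  have Isub: "I \<subseteq> {..<t} \<times> {..<t}" unfolding I_def by auto
  then have finI: "finite I" using finite_subset by blast
  let ?A = "\<lambda>p. {c\<in>L t. tgt (c ! snd p) = src (c ! fst p)}"
  have sub: "{c\<in>L t. om c > 0 \<and> \<not> distinct (vs c)} \<subseteq> (\<Union>p\<in>I. ?A p)"
  proof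
    fix c assume "c \<in> {c\<in>L t. om c > 0 \<and> \<not> distinct (vs c)}"
    then have c: "c \<in> L t" "om c > 0" "\<not> distinct (vs c)" by auto
    have len: "length c = t" "set c \<subseteq> Dt" using c(1) L_iff by auto
    have lvs: "length (vs c) = Suc t" unfolding vs_def using len by simp
    obtain i j where ij: "i < j" "j < Suc t" "vs c ! i = vs c ! j"
      using c(3) lvs unfolding distinct_conv_nth by (metis nat_neq_iff)
    have ne: "c \<noteq> []" using ij len by auto
    have i: "vs c ! i = src (c ! i)" using ij len unfolding vs_def by (simp add: nth_append)
    have j: "vs c ! j = tgt (c ! (j - 1))" using vs_nth[OF c(2) ne, of j] ij len by simp
    have "i \<noteq> j - 1"
    proof
      assume *: "i = j - 1"
      have "c ! i \<in> Dt" using ij len by auto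
      moreover have "c ! i = (src (c ! i), lab (c ! i), tgt (c ! i))" by simp
      ultimately show False using noloop i j ij(3) * by metis
    qed
    then have "(i, j - 1) \<in> I" using ij unfolding I_def by auto
    moreover have "c \<in> ?A (i, j - 1)" using c i j ij(3) by simp
    ultimately show "c \<in> (\<Union>p\<in>I. ?A p)" by blast
  qed
  have one: "sum om (?A p) \<le> B / D" if "p \<in> I" for p
  proof -
    have "sum om {c\<in>L t. tgt (c ! snd p) = src (c ! fst p)} \<le> B / D * sum (\<lambda>_. 1 / M) Dt"
    proof (rule walk.coincidence_bound)
      show "fst p < snd p" "snd p < t" using that unfolding I_def by auto
      show "0 \<le> B / D" using B1 D_pos by simp
      fix u P assume P: "P \<in> Dt"
      have "(\<Sum>P'\<in>{P'\<in>Dt. tgt P' = u \<and> src P' = tgt P}. 1 / M) = card {P'\<in>Dt. src P' = tgt P \<and> tgt P' = u} / M"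
        by (simp add: conj_commute)
      also have "\<dots> \<le> B / M" using mult[of "tgt P" u] M_pos by (intro divide_right_mono) auto
      also have "\<dots> \<le> B * (stat (tgt P) / D)"
        using mult_left_mono[OF inv_M_le[OF tgt_V[OF P]], of B] B1 by simp
      finally show "(\<Sum>P'\<in>{P'\<in>Dt. tgt P' = u \<and> src P' = tgt P}. 1 / M) \<le> B / D * walk.mass (snd p - 1) (tgt P)"
        unfolding mass_eq by simp
    qed
    then show ?thesis using M_pos by simp
  qed
  have nn: "0 \<le> (if set x \<subseteq> Dt then om x else 0)" for x using om_nonneg by simp
  have "sum om {c\<in>L t. om c > 0 \<and> \<not> distinct (vs c)} \<le> sum om (\<Union>p\<in>I. ?A p)"
    by (rule sum_mono2) (use sub finI finL om_L in auto)
  also have "\<dots> = sum (\<lambda>x. if set x \<subseteq> Dt then om x else 0) (\<Union>p\<in>I. ?A p)"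
    by (rule sum.cong) (auto dest: L_sub)
  also have "\<dots> \<le> (\<Sum>p\<in>I. sum (\<lambda>x. if set x \<subseteq> Dt then om x else 0) (?A p))"
    by (rule sum_UN_le) (use finI finL nn in auto)
  also have "\<dots> = (\<Sum>p\<in>I. sum om (?A p))"
    by (intro sum.cong refl) (auto dest: L_sub)
  also have "\<dots> \<le> card I * (B / D)" using sum_mono[of I "\<lambda>p. sum om (?A p)" "\<lambda>_. B / D"] one by simp
  also have "\<dots> \<le> real t ^ 2 * (B / D)"
  proof (rule mult_right_mono)
    have "card I \<le> card ({..<t} \<times> {..<t})" by (rule card_mono) (use Isub in auto)
    then have "card I \<le> t ^ 2" by (simp add: card_cartesian_product power2_eq_square)
    then show "real (card I) \<le> real t ^ 2" by (metis of_nat_le_iff of_nat_power)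
  qed (use B1 D_pos in auto)
  finally show ?thesis .
qed

definition endk :: "'e dart list \<Rightarrow> nat \<times> nat" where "endk c = (src (hd c), tgt (last c))"
definition penk :: "'e dart list \<Rightarrow> nat \<times> nat" where "penk c = (src (hd c), src (last c))"

lemma sum_q: "0 < h \<Longrightarrow> finite S \<Longrightarrow> (\<Sum>p\<in>S. q h (fst p) (snd p)) \<le> 1"
proof -
  assume h: "0 < h" and S: "finite S"
  have "(\<Sum>p\<in>S. q h (fst p) (snd p)) = (\<Sum>p\<in>S. sum om {c\<in>L h. endk c = p})"
    unfolding q_eq endk_def by (intro sum.cong refl arg_cong[where f = "sum om"]) auto
  also have "\<dots> = (\<Sum>p\<in>S. sum om {c\<in>{c\<in>L h. endk c \<in> S}. endk c = p})"
    by (intro sum.cong refl arg_cong[where f = "sum om"]) auto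
  also have "\<dots> = sum om {c\<in>L h. endk c \<in> S}" by (rule sum.group) (use finL S in auto)
  also have "\<dots> \<le> sum om (L h)" by (rule sum_mono2) (use finL om_L in auto)
  finally show ?thesis using L_mass[OF h] by simp
qed

text \<open>A family maximising the functional \<open>\<Phi>\<close> cannot contain an end pair (or a start/penultimate
  pair) that carries too small a share of its walks.\<close>

lemma exists_clean_family:
  assumes W0: "W0 \<subseteq> L t" "2 \<le> t" and \<delta>: "0 < \<delta>" "4 * \<delta> \<le> sum om W0"
  shows "\<exists>W\<subseteq>W0. 2 * \<delta> \<le> sum om W \<and>
    (\<forall>c\<in>W. \<delta> * q t (src (hd c)) (tgt (last c)) \<le> sum om {c'\<in>W. endk c' = endk c}) \<and>
    (\<forall>c\<in>W. \<delta> * q (t - 1) (src (hd c)) (src (last c)) \<le> sum om {c'\<in>W. penk c' = penk c})"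
proof -
  have finW0: "finite W0" using W0 finL finite_subset by blast
  \<comment> \<open>Each penalty is at most \<open>\<delta>\<close>, since \<open>q\<close> sums to
    at most \<open>1\<close> over all pairs. Of the mass \<open>4 * \<delta>\<close> at least
    \<open>2 * \<delta>\<close> therefore survives at the maximum.\<close>
  define \<Phi> where "\<Phi> S = sum om S - \<delta> * (\<Sum>p\<in>endk ` S. q t (fst p) (snd p)) - \<delta> * (\<Sum>p\<in>penk ` S. q (t - 1) (fst p) (snd p))" for S
  have qnn: "0 \<le> q h x z" for h x z by (rule Aq_nonneg) auto
  have fin: "finite (\<Phi> ` Pow W0)" "\<Phi> ` Pow W0 \<noteq> {}" using finW0 by auto
  obtain W where W: "W \<in> Pow W0" "\<Phi> W = Max (\<Phi> ` Pow W0)" using Max_in[OF fin] by (metis imageE)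
  have max: "\<Phi> S \<le> \<Phi> W" if "S \<subseteq> W0" for S unfolding W(2) using fin(1) that by (intro Max_ge) auto
  have WW0: "W \<subseteq> W0" using W(1) by simp
  have finW: "finite W" using WW0 finW0 finite_subset by blast
  have WL: "W \<subseteq> L t" using WW0 W0 by blast
  have "sum om W0 - \<delta> - \<delta> \<le> \<Phi> W0"
    unfolding \<Phi>_def using sum_q[of t "endk ` W0"] sum_q[of "t - 1" "penk ` W0"] finW0 W0(2) \<delta>(1)
    by (intro diff_mono) (auto intro: mult_left_le)
  also have "\<dots> \<le> \<Phi> W" by (rule max) simp
  also have "\<dots> \<le> sum om W"
  proof -
    have "0 \<le> \<delta> * (\<Sum>p\<in>g ` W. q h (fst p) (snd p))" for g :: "'e dart list \<Rightarrow> nat \<times> nat" and h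
      using \<delta>(1) by (intro mult_nonneg_nonneg sum_nonneg qnn) auto
    from this[of t endk] this[of "t - 1" penk] show ?thesis unfolding \<Phi>_def by linarith
  qed
  finally have mass: "2 * \<delta> \<le> sum om W" using \<delta>(2) by linarith
  have split: "sum om W = sum om (W - C) + sum om C" if "C \<subseteq> W" for C
    by (rule sum.subset_diff[OF that finW])
  have less: "(\<Sum>p\<in>g ` (W - C). q h (fst p) (snd p)) \<le> (\<Sum>p\<in>g ` W. q h (fst p) (snd p))" for g :: "'e dart list \<Rightarrow> nat \<times> nat" and C h
    by (rule sum_mono2) (use finW qnn in auto)
  have less': "(\<Sum>p\<in>g ` (W - {c'\<in>W. g c' = g c}). q h (fst p) (snd p)) = (\<Sum>p\<in>g ` W. q h (fst p) (snd p)) - q h (fst (g c)) (snd (g c))"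
    if "c \<in> W" for g :: "'e dart list \<Rightarrow> nat \<times> nat" and c h
  proof -
    have "g ` (W - {c'\<in>W. g c' = g c}) = g ` W - {g c}" by auto
    then show ?thesis using finW that by (simp add: sum_diff1)
  qed
  show ?thesis
  proof (intro exI[of _ W] conjI ballI)
    show "W \<subseteq> W0" "2 * \<delta> \<le> sum om W" by fact+
    fix c assume c: "c \<in> W"
    let ?C = "{c'\<in>W. endk c' = endk c}"
    have "\<Phi> (W - ?C) \<le> \<Phi> W" by (rule max) (use WW0 in auto)
    moreover have "\<delta> * (\<Sum>p\<in>penk ` (W - ?C). q (t - 1) (fst p) (snd p)) \<le> \<delta> * (\<Sum>p\<in>penk ` W. q (t - 1) (fst p) (snd p))"
      using less \<delta>(1) by (intro mult_left_mono) auto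
    moreover have "\<delta> * (\<Sum>p\<in>endk ` (W - ?C). q t (fst p) (snd p)) = \<delta> * (\<Sum>p\<in>endk ` W. q t (fst p) (snd p)) - \<delta> * q t (fst (endk c)) (snd (endk c))"
      unfolding less'[OF c] by (simp add: right_diff_distrib)
    moreover have "sum om W = sum om (W - ?C) + sum om ?C" by (rule split) auto
    ultimately have "\<delta> * q t (fst (endk c)) (snd (endk c)) \<le> sum om ?C" unfolding \<Phi>_def by linarith
    then show "\<delta> * q t (src (hd c)) (tgt (last c)) \<le> sum om ?C" unfolding endk_def by simp
  next
    fix c assume c: "c \<in> W"
    let ?C = "{c'\<in>W. penk c' = penk c}"
    have "\<Phi> (W - ?C) \<le> \<Phi> W" by (rule max) (use WW0 in auto)
    moreover have "\<delta> * (\<Sum>p\<in>endk ` (W - ?C). q t (fst p) (snd p)) \<le> \<delta> * (\<Sum>p\<in>endk ` W. q t (fst p) (snd p))"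
      using less \<delta>(1) by (intro mult_left_mono) auto
    moreover have "\<delta> * (\<Sum>p\<in>penk ` (W - ?C). q (t - 1) (fst p) (snd p)) = \<delta> * (\<Sum>p\<in>penk ` W. q (t - 1) (fst p) (snd p)) - \<delta> * q (t - 1) (fst (penk c)) (snd (penk c))"
      unfolding less'[OF c] by (simp add: right_diff_distrib)
    moreover have "sum om W = sum om (W - ?C) + sum om ?C" by (rule split) auto
    ultimately have "\<delta> * q (t - 1) (fst (penk c)) (snd (penk c)) \<le> sum om ?C" unfolding \<Phi>_def by linarith
    then show "\<delta> * q (t - 1) (src (hd c)) (src (last c)) \<le> sum om ?C" unfolding penk_def by simp
  qed
qed

text \<open>\<open>bad\<close> is \<open>0\<close> at length \<open>1\<close> and at least
  \<open>1 / 2\<close> at length \<open>l\<close>, while the threshold \<open>\<eta>\<close> grows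
  by a factor \<open>4\<close> per step up to \<open>1 / 2\<close> at \<open>l\<close>. At the first
  length \<open>t\<close> at which \<open>bad\<close> reaches it, twice the previous value of
  \<open>bad\<close> accounts for less than half, so many walks of length \<open>t\<close> are fat
  although their proper subwalks are thin.\<close>

lemma exists_walk_family:
  assumes l: "2 \<le> l" and few: "2 * card V * (\<theta> ^ (l - 1) * B) \<le> D ^ l" and small: "64 * real l ^ 2 * 4 ^ l * B \<le> \<theta>"
  shows "\<exists>t W. 2 \<le> t \<and> t \<le> l \<and> W \<subseteq> L t \<and> 1 / (4 * 4 ^ l) \<le> sum om W \<and>
    (\<forall>c\<in>W. om c > 0 \<and> thin (butlast c) \<and> thin (tl c) \<and> fat t c \<and> distinct (vs c) \<and>
      1 / (8 * 4 ^ l) * q t (src (hd c)) (tgt (last c)) \<le> sum om {c'\<in>W. endk c' = endk c} \<and>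
      1 / (8 * 4 ^ l) * q (t - 1) (src (hd c)) (src (last c)) \<le> sum om {c'\<in>W. penk c' = penk c})"
proof -
  define \<eta> :: "nat \<Rightarrow> real" where "\<eta> h = 4 ^ h / (2 * 4 ^ l)" for h
  let ?F = "\<lambda>t. {c\<in>L t. thin (butlast c) \<and> thin (tl c) \<and> fat t c}"
  have bl: "\<eta> l \<le> bad l"
  proof -
    have "1 = sum om ({c\<in>L l. thin c} \<union> {c\<in>L l. \<not> thin c})" using L_mass[of l] l by (simp add: Un_def conj_disj_distribL[symmetric])
    also have "\<dots> = sum om {c\<in>L l. thin c} + bad l" unfolding bad_def by (rule sum.union_disjoint) (use finL in auto)
    finally have "1 = sum om {c\<in>L l. thin c} + bad l" .
    moreover have "sum om {c\<in>L l. thin c} \<le> card V * tt l" by (rule thin_mass_le) (use l in simp)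
    moreover have "card V * tt l \<le> 1 / 2" using few D_pos unfolding tt_def by (simp add: field_simps)
    ultimately show ?thesis unfolding \<eta>_def by simp
  qed
  define t where "t = (LEAST h. 1 \<le> h \<and> \<eta> h \<le> bad h)"
  have t: "1 \<le> t \<and> \<eta> t \<le> bad t" unfolding t_def by (rule LeastI[of _ l]) (use bl l in auto)
  have tl: "t \<le> l" unfolding t_def by (rule Least_le) (use bl l in auto)
  have "0 < \<eta> t" unfolding \<eta>_def by simp
  have "t \<noteq> 1"
  proof
    assume "t = 1"
    then have "\<eta> t \<le> 0" using t bad_1 by metis
    then show False using \<open>0 < \<eta> t\<close> by linarith
  qed
  then have t2: "2 \<le> t" using t by linarith
  define m where "m = t - 2"
  have m: "t = Suc (Suc m)" unfolding m_def using t2 by linarith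
  have "\<not> (1 \<le> Suc m \<and> \<eta> (Suc m) \<le> bad (Suc m))" using not_less_Least[of "Suc m" "\<lambda>h. 1 \<le> h \<and> \<eta> h \<le> bad h"] m unfolding t_def by simp
  then have "bad (Suc m) < \<eta> t / 4" unfolding \<eta>_def m by simp
  then have "\<eta> t / 2 \<le> sum om (?F t)" using bad_step[of m] t unfolding m by simp
  moreover have "1 / 4 ^ l \<le> \<eta> t / 2"
  proof -
    have "(4::real) ^ 2 \<le> 4 ^ t" by (rule power_increasing) (use t2 in simp_all)
    then show ?thesis unfolding \<eta>_def by (simp add: field_simps)
  qed
  ultimately have F: "1 / 4 ^ l \<le> sum om (?F t)" by linarith
  define W0 where "W0 = {c\<in>?F t. om c > 0 \<and> distinct (vs c)}"
  have W0L: "W0 \<subseteq> L t" unfolding W0_def by auto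
  define R where "R = {c\<in>?F t. om c > 0 \<and> \<not> distinct (vs c)}"
  define R' where "R' = {c\<in>L t. om c > 0 \<and> \<not> distinct (vs c)}"
  have RL: "R \<subseteq> L t" "R' \<subseteq> L t" "R \<subseteq> R'" unfolding R_def R'_def by auto
  have fin: "finite W0" "finite R" "finite R'" using W0L RL finL finite_subset by blast+
  have "sum om (?F t) \<le> sum om W0 + sum om R'"
  proof -
    have "sum om (?F t) = sum om (W0 \<union> R)"
    proof (rule sum.mono_neutral_right)
      show "finite (?F t)" using finL[of t] by simp
      show "W0 \<union> R \<subseteq> ?F t" unfolding W0_def R_def by blast
      show "\<forall>c\<in>?F t - (W0 \<union> R). om c = 0"
      proof
        fix c assume c: "c \<in> ?F t - (W0 \<union> R)"
        then have "\<not> om c > 0" unfolding W0_def R_def by blast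
        moreover have "0 \<le> om c" using c by (intro om_L[of c t]) blast
        ultimately show "om c = 0" by linarith
      qed
    qed
    moreover have "sum om (W0 \<union> R) = sum om W0 + sum om R"
      by (rule sum.union_disjoint[OF fin(1,2)]) (auto simp: W0_def R_def)
    moreover have "sum om R \<le> sum om R'"
      by (rule sum_mono2[OF fin(3) RL(3)]) (use RL(2) om_L in blast)
    ultimately show ?thesis by linarith
  qed
  moreover have "real t ^ 2 * (B / D) \<le> 1 / (2 * 4 ^ l)"
  proof -
    have "2 * 4 ^ l * (real t ^ 2 * B) \<le> 64 * real l ^ 2 * 4 ^ l * B"
    proof -
      have "real t ^ 2 * B \<le> real l ^ 2 * B" using tl B1 by (intro mult_right_mono power_mono) auto
      then have "2 * 4 ^ l * (real t ^ 2 * B) \<le> 2 * 4 ^ l * (real l ^ 2 * B)" by (intro mult_left_mono) auto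
      also have "\<dots> \<le> 64 * 4 ^ l * (real l ^ 2 * B)" using B1 by (intro mult_right_mono) auto
      finally show ?thesis by (simp add: mult_ac)
    qed
    then have "2 * 4 ^ l * (real t ^ 2 * B) \<le> D" using small \<theta>D by linarith
    then show ?thesis using D_pos by (simp add: field_simps)
  qed
  ultimately have "1 / (2 * 4 ^ l) \<le> sum om W0"
  proof -
    have "1 / (2 * 4 ^ l) = 1 / 4 ^ l - 1 / (2 * 4 ^ l :: real)" by (simp add: field_simps)
    moreover have "sum om (?F t) \<le> sum om W0 + real t ^ 2 * (B / D)"
      using \<open>sum om (?F t) \<le> _\<close> repeated_vertex_mass[of t] unfolding R'_def by linarith
    ultimately show ?thesis using F \<open>real t ^ 2 * (B / D) \<le> _\<close> by linarith
  qed
  \<comment> \<open>The mass \<open>1 / (2 * 4 ^ l)\<close> that is left without repeated vertices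
    is four times the \<open>\<delta>\<close> used for cleaning.\<close>
  then obtain W where W: "W \<subseteq> W0" "2 * (1 / (8 * 4 ^ l)) \<le> sum om W"
    "\<forall>c\<in>W. 1 / (8 * 4 ^ l) * q t (src (hd c)) (tgt (last c)) \<le> sum om {c'\<in>W. endk c' = endk c}"
    "\<forall>c\<in>W. 1 / (8 * 4 ^ l) * q (t - 1) (src (hd c)) (src (last c)) \<le> sum om {c'\<in>W. penk c' = penk c}"
    using exists_clean_family[OF W0L t2, of "1 / (8 * 4 ^ l)"] by auto
  show ?thesis
  proof (intro exI[of _ t] exI[of _ W] conjI)
    show "2 \<le> t" by (rule t2)
    show "t \<le> l" by (rule tl)
    show "W \<subseteq> L t" using W(1) W0L by blast
    show "1 / (4 * 4 ^ l) \<le> sum om W" using W(2) by (simp add: field_simps)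
    show "\<forall>c\<in>W. om c > 0 \<and> thin (butlast c) \<and> thin (tl c) \<and> fat t c \<and> distinct (vs c) \<and>
      1 / (8 * 4 ^ l) * q t (src (hd c)) (tgt (last c)) \<le> sum om {c'\<in>W. endk c' = endk c} \<and>
      1 / (8 * 4 ^ l) * q (t - 1) (src (hd c)) (src (last c)) \<le> sum om {c'\<in>W. penk c' = penk c}"
      using W(1,3,4) unfolding W0_def by blast
  qed
qed

end

section \<open>Conditional weights given an end pair or a penultimate pair\<close>

lemma count_list_map_mem: "count_list (map (\<lambda>i. i \<in> J) [0..<t]) False = card ({..<t} - J)"
proof (induction t)
  case (Suc t)
  have "{..<Suc t} - J = (if t \<in> J then {..<t} - J else insert t ({..<t} - J))"
    by (auto simp: less_Suc_eq)
  then show ?case using Suc by simp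
qed simp

text \<open>The outcome of \<open>exists_walk_family\<close>. Thin proper subwalks provide the
  numerators of conditional weights, the fat end pair and the two cleaning conditions
  \<open>endW\<close> and \<open>penW\<close> provide the denominators.\<close>

locale walk_family = multigraph Dt D B \<theta>
  for Dt :: "'e dart set" and D B \<theta> :: real +
  fixes t l :: nat and W :: "'e dart list set"
  assumes t2: "2 \<le> t" and tl: "t \<le> l" and WL: "W \<subseteq> L t"
    and small: "64 * real l ^ 2 * 4 ^ l * B \<le> \<theta>"
    and massW: "1 / (4 * 4 ^ l) \<le> sum om W"
    and omW: "c \<in> W \<Longrightarrow> 0 < om c"
    and thinW: "c \<in> W \<Longrightarrow> thin (butlast c)" "c \<in> W \<Longrightarrow> thin (tl c)"
    and fatW: "c \<in> W \<Longrightarrow> fat t c"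
    and distW: "c \<in> W \<Longrightarrow> distinct (vs c)"
    and endW: "c \<in> W \<Longrightarrow> 1 / (8 * 4 ^ l) * q t (src (hd c)) (tgt (last c)) \<le> sum om {c'\<in>W. endk c' = endk c}"
    and penW: "c \<in> W \<Longrightarrow> 1 / (8 * 4 ^ l) * q (t - 1) (src (hd c)) (src (last c)) \<le> sum om {c'\<in>W. penk c' = penk c}"
begin

text \<open>Walks \<open>i\<close> and \<open>i + 1\<close> of a chain share both ends if
  \<open>i\<close> is even, and the start and the last but one vertex if \<open>i\<close> is odd.
  The alternation turns their final darts into a zigzag.\<close>

definition key :: "nat \<Rightarrow> 'e dart list \<Rightarrow> nat \<times> nat" where "key i = (if even i then endk else penk)"

definition \<delta> :: real where "\<delta> = 1 / (8 * 4 ^ l)"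

lemma delta: "0 < \<delta>" "\<delta> \<le> 1"
proof -
  have "(1::real) \<le> 4 ^ l" by simp
  then have "(1::real) \<le> 8 * 4 ^ l" by linarith
  then show "0 < \<delta>" "\<delta> \<le> 1" unfolding \<delta>_def by simp_all
qed

lemma finW: "finite W" using WL finL finite_subset by blast

sublocale ch: key_chain W om key key
  by unfold_locales (use finW omW in auto)

lemma W_props:
  assumes "c \<in> W"
  shows "length c = t" "set c \<subseteq> Dt" "c \<noteq> []" "hd c = c ! 0" "last c = c ! (t - 1)"
proof -
  show len: "length c = t" and "set c \<subseteq> Dt" using assms WL L_iff by blast+
  then show "c \<noteq> []" using t2 by auto
  then show "hd c = c ! 0" "last c = c ! (t - 1)" using len by (auto simp: hd_conv_nth last_conv_nth)
qed

lemma W_subthin: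
  assumes c: "c \<in> W" and ij: "i < j" "j \<le> t" "(i, j) \<noteq> (0, t)"
  shows "subthin c i j"
proof (cases "j < t")
  case True
  have "subthin (butlast c) i j" using thinW(1)[OF c] ij(1) True W_props(1)[OF c] unfolding thin_def by simp
  then show ?thesis using ij(1) True W_props(1)[OF c] unfolding subthin_def by (simp add: nth_butlast)
next
  case False
  then obtain i' j' where i': "i = Suc i'" "j = Suc j'" using ij t2 by (cases i; cases j) auto
  have "subthin (tl c) i' j'" using thinW(2)[OF c] ij(1,2) W_props(1)[OF c] unfolding thin_def i' by simp
  then show ?thesis using ij(1,2) W_props(1)[OF c] unfolding subthin_def i' by (simp add: nth_tl)
qed

lemma mass_even: "ch.mass i (key i P) = sum om {c\<in>W. endk c = endk P}" if "even i"
  unfolding ch.mass_def key_def using that by simp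

lemma mass_odd: "ch.mass i (key i P) = sum om {c\<in>W. penk c = penk P}" if "odd i"
  unfolding ch.mass_def key_def using that by simp

lemma hdV: "c \<in> W \<Longrightarrow> src (hd c) \<in> V" and last_Dt: "c \<in> W \<Longrightarrow> last c \<in> Dt"
proof -
  assume c: "c \<in> W"
  have "hd c \<in> Dt" "last c \<in> Dt" using W_props(2,3)[OF c] by auto
  then show "src (hd c) \<in> V" "last c \<in> Dt" using src_V by auto
qed

text \<open>Fatness bounds \<open>q t\<close> of the end pair from below, and the family keeps a
  share \<open>\<delta>\<close> of it. This is the denominator of every conditional weight given the
  end pair.\<close>

lemma end_mass_ge:
  assumes "P \<in> W"
  shows "\<delta> * (tt t * stat (src (hd P))) \<le> sum om {c\<in>W. endk c = endk P}"
proof -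
  have "\<delta> * (tt t * stat (src (hd P))) \<le> \<delta> * q t (src (hd P)) (tgt (last P))"
    using fatW[OF assms] delta unfolding fat_def by (intro mult_left_mono) auto
  then show ?thesis using endW[OF assms] unfolding \<delta>_def by linarith
qed

lemma om_sum_le_Aq:
  assumes "A \<subseteq> {c\<in>listset Cs. src (hd c) = x \<and> tgt (last c) = z}" "\<forall>C\<in>set Cs. C \<subseteq> Dt"
  shows "sum om A \<le> Aq Cs x z"
proof -
  have fin: "finite (listset Cs)" by (rule finite_listset) (use assms(2) finDt finite_subset in blast)
  have "Aq Cs x z = sum om {c\<in>listset Cs. src (hd c) = x \<and> tgt (last c) = z}"
    unfolding Aq_def by (rule sum.inter_filter[symmetric, OF fin])
  moreover have "sum om A \<le> sum om {c\<in>listset Cs. src (hd c) = x \<and> tgt (last c) = z}"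
  proof (rule sum_mono2[OF _ assms(1)])
    show "finite {c\<in>listset Cs. src (hd c) = x \<and> tgt (last c) = z}" using fin by simp
    fix c assume "c \<in> {c\<in>listset Cs. src (hd c) = x \<and> tgt (last c) = z} - A"
    then have "c \<in> listset Cs" by blast
    then have "set c \<subseteq> Dt" using set_listset_subset assms(2) by blast
    then show "0 \<le> om c" by (rule om_nonneg)
  qed
  ultimately show ?thesis by simp
qed

text \<open>The conditional price of pinning the darts \<open>J\<close> of a walk with given ends:
  \<open>1 / \<theta>\<close> for each, except that all \<open>t\<close> darts together cost
  \<open>1 / (\<theta> ^ (t - 1) * B)\<close>, because \<open>gap 0\<close> is \<open>1\<close> and
  not \<open>B / \<theta>\<close>. The loss in this one case shapes the proof of
  \<open>system_bound\<close>.\<close>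

definition r0 :: "nat set \<Rightarrow> real" where
  "r0 J = (if J = {..<t} then 1 / (\<theta> ^ (t - 1) * B) else (1 / \<theta>) ^ card J) / \<delta>"

lemma r0_pos: "0 < r0 J" unfolding r0_def using delta th_pos B1 by simp

text \<open>\<open>gap_bound\<close> with a walk of the family as reference gives the numerator,
  \<open>end_mass_ge\<close> the denominator. The whole walk is the only one of its subwalks that is
  not subthin, and a pinned dart exempts it in \<open>gap_bound\<close>.\<close>

lemma end_darts:
  assumes P: "P \<in> W" and J: "J \<subseteq> {..<t}"
  shows "sum om {P'\<in>W. endk P' = endk P \<and> (\<forall>i\<in>J. P' ! i = d i)} \<le> r0 J * sum om {P'\<in>W. endk P' = endk P}"
proof -
  let ?S = "{P'\<in>W. endk P' = endk P \<and> (\<forall>i\<in>J. P' ! i = d i)}"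
  let ?m = "sum om {P'\<in>W. endk P' = endk P}"
  have m0: "0 \<le> ?m" by (rule sum_nonneg) (use omW in \<open>auto intro: less_imp_le\<close>)
  show ?thesis
  proof (cases "?S = {}")
    case True
    then show ?thesis using m0 r0_pos[of J] by (simp only: sum.empty) simp
  next
    case False
    show ?thesis
    proof (cases "J = {}")
      case J0: True
      have "sum om ?S \<le> ?m" by (rule sum_mono2) (use finW omW in \<open>auto intro: less_imp_le\<close>)
      also have "?m \<le> r0 J * ?m"
      proof -
        have "0 \<in> {..<t}" using t2 by simp
        then have "J \<noteq> {..<t}" using J0 by blast
        then have "r0 J = 1 / \<delta>" unfolding r0_def J0 by simp
        then show ?thesis using m0 delta mult_right_mono[of 1 "1 / \<delta>" ?m] by simp
      qed
      finally show ?thesis .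
    next
      case Jne: False
      obtain r where r: "r \<in> W" "endk r = endk P" "\<forall>i\<in>J. r ! i = d i" using False by blast
      note rp = W_props[OF r(1)]
      define fs where "fs = map (\<lambda>i. i \<in> J) [0..<t]"
      have lfs: "length fs = length r" unfolding fs_def using rp(1) by simp
      have Tfs: "True \<in> set fs" unfolding fs_def using Jne J by auto
      define x z where "x = src (hd r)" and "z = tgt (last r)"
      have sub: "?S \<subseteq> {c\<in>listset (cons_sets fs r). src (hd c) = x \<and> tgt (last c) = z}"
      proof
        fix c assume c: "c \<in> ?S"
        have "c ! i \<in> cons_sets fs r ! i" if "i < t" for i
        proof -
          have "c ! i \<in> Dt" using c W_props(1,2)[of c] that by auto
          then show ?thesis using c r(3) that rp(1) unfolding cons_sets_def fs_def by auto
        qed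
        moreover have "length c = t" using c W_props(1) by blast
        moreover have "length (cons_sets fs r) = t" unfolding length_cons_sets using lfs rp(1) by simp
        ultimately have "c \<in> listset (cons_sets fs r)" unfolding listset_nth by simp
        moreover have "endk c = (x, z)" using c r(2) unfolding x_def z_def endk_def by simp
        ultimately show "c \<in> {c\<in>listset (cons_sets fs r). src (hd c) = x \<and> tgt (last c) = z}" unfolding endk_def by simp
      qed
      have "sum om ?S \<le> Aq (cons_sets fs r) x z"
        by (rule om_sum_le_Aq[OF sub]) (rule cons_sets_sub[OF rp(2)])
      also have "\<dots> \<le> stat x * gap (count_list fs False) / D ^ length r"
        unfolding x_def z_def
      proof (rule gap_bound[OF lfs rp(3,2) omW[OF r(1)]])
        fix i j assume "i < j" "j \<le> length r" "(i, j) \<noteq> (0, length r) \<or> True \<notin> set fs"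
        then show "subthin r i j" using W_subthin[OF r(1)] Tfs rp(1) by auto
      qed
      also have "\<dots> = stat x * gap (t - card J) / D ^ t"
      proof -
        have "finite J" using J finite_subset by blast
        then have "card ({..<t} - J) = t - card J" using J by (simp add: card_Diff_subset)
        then show ?thesis unfolding fs_def count_list_map_mem rp(1) by simp
      qed
      also have "\<dots> = r0 J * (\<delta> * (tt t * stat x))"
      proof -
        have t1: "t - 1 = card J + (t - card J - 1)" if "J \<noteq> {..<t}"
        proof -
          have "J \<subset> {..<t}" using J that by blast
          then have "card J < card {..<t}" by (intro psubset_card_mono) auto
          then show ?thesis by simp
        qed
        show ?thesis
        proof (cases "J = {..<t}")
          case True
          then show ?thesis unfolding r0_def gap_def tt_def using delta(1) th_pos B1 D_pos by simp
        next
          case nf: False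
          have "J \<subset> {..<t}" using J nf by blast
          then have "card J < card {..<t}" by (intro psubset_card_mono) auto
          then have nz: "t - card J \<noteq> 0" by simp
          have p: "\<theta> ^ (t - 1) = \<theta> ^ card J * \<theta> ^ (t - card J - 1)"
            using t1[OF nf] by (metis power_add)
          have "r0 J * (\<delta> * (tt t * stat x)) = (1 / \<theta>) ^ card J * (\<theta> ^ (t - 1) * B / D ^ t * stat x)"
            unfolding r0_def tt_def using nf delta(1) by simp
          also have "\<dots> = ((1 / \<theta>) ^ card J * \<theta> ^ card J) * (\<theta> ^ (t - card J - 1) * B) * stat x / D ^ t"
            unfolding p by simp
          also have "(1 / \<theta>) ^ card J * \<theta> ^ card J = 1" using th_pos by (simp add: power_mult_distrib[symmetric])
          finally show ?thesis unfolding gap_def using nz by simp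
        qed
      qed
      also have "\<dots> \<le> r0 J * ?m"
      proof -
        have "\<delta> * (tt t * stat x) \<le> sum om {c\<in>W. endk c = endk r}" unfolding x_def by (rule end_mass_ge[OF r(1)])
        then show ?thesis using r0_pos[of J] unfolding r(2) by (intro mult_left_mono) auto
      qed
      finally show ?thesis .
    qed
  qed
qed

lemma Aq_mono:
  assumes "length Cs = length Cs'" "\<And>i. i < length Cs \<Longrightarrow> Cs ! i \<subseteq> Cs' ! i" "\<forall>C\<in>set Cs'. C \<subseteq> Dt"
  shows "Aq Cs x z \<le> Aq Cs' x z"
proof -
  have sub: "listset Cs \<subseteq> listset Cs'" 
  proof
    fix c assume "c \<in> listset Cs"
    then have c: "length c = length Cs" "\<forall>i<length Cs. c ! i \<in> Cs ! i" unfolding listset_nth by blast+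
    have "c ! i \<in> Cs' ! i" if "i < length Cs" for i using c(2) assms(2)[OF that] that by blast
    then show "c \<in> listset Cs'" unfolding listset_nth using c(1) assms(1) by simp
  qed
  have fin: "finite (listset Cs')" by (rule finite_listset) (use assms(3) finDt finite_subset in blast)
  show ?thesis unfolding Aq_def
  proof (rule sum_mono2[OF fin sub])
    fix c assume "c \<in> listset Cs' - listset Cs"
    then have "set c \<subseteq> Dt" using set_listset_subset assms(3) by blast
    then show "0 \<le> (if src (hd c) = x \<and> tgt (last c) = z then om c else 0)" using om_nonneg by simp
  qed
qed

text \<open>Cut at the vertex, the walk falls into two thin pieces, and
  \<open>tt i * tt (t - i)\<close> is \<open>B / \<theta>\<close> times \<open>tt t\<close>.\<close>

lemma end_vertex:
  assumes P: "P \<in> W" and i: "0 < i" "i < t"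
  shows "sum om {P'\<in>W. endk P' = endk P \<and> src (P' ! i) = u} \<le> B / (\<delta> * \<theta>) * sum om {P'\<in>W. endk P' = endk P}"
proof -
  let ?S = "{P'\<in>W. endk P' = endk P \<and> src (P' ! i) = u}"
  let ?m = "sum om {P'\<in>W. endk P' = endk P}"
  have m0: "0 \<le> ?m" by (rule sum_nonneg) (use omW in \<open>auto intro: less_imp_le\<close>)
  have c0: "0 \<le> B / (\<delta> * \<theta>)" using delta B1 th_pos by simp
  show ?thesis
  proof (cases "?S = {}")
    case True
    show ?thesis unfolding True sum.empty by (rule mult_nonneg_nonneg[OF c0 m0])
  next
    case False
    then obtain r where r: "r \<in> W" "endk r = endk P" "src (r ! i) = u" by blast
    note rp = W_props[OF r(1)]
    define x z where "x = src (hd r)" and "z = tgt (last r)"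
    define C where "C = {d\<in>Dt. src d = u}"
    have "r ! i \<in> Dt" using rp(1,2) i nth_mem by blast
    then have uV: "u \<in> V" using src_V r(3) by blast
    have xV: "x \<in> V" unfolding x_def by (rule hdV[OF r(1)])
    let ?Cs = "replicate i Dt @ C # replicate (t - i - 1) Dt"
    have sub: "?S \<subseteq> {c\<in>listset ?Cs. src (hd c) = x \<and> tgt (last c) = z}"
    proof
      fix c assume c: "c \<in> ?S"
      note cp = W_props[of c]
      have "c ! j \<in> ?Cs ! j" if "j < t" for j
      proof -
        have "c ! j \<in> Dt" using c cp that by auto
        then show ?thesis using c unfolding C_def using that i by (cases "j < i"; cases "j = i") (auto simp: nth_append nth_Cons')
      qed
      moreover have "length ?Cs = t" using i by simp
      ultimately have "c \<in> listset ?Cs" unfolding listset_nth using c cp by simp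
      moreover have "endk c = (x, z)" using c r(2) unfolding x_def z_def endk_def by simp
      ultimately show "c \<in> {c\<in>listset ?Cs. src (hd c) = x \<and> tgt (last c) = z}" unfolding endk_def by simp
    qed
    have "sum om ?S \<le> Aq ?Cs x z" by (rule om_sum_le_Aq[OF sub]) (auto simp: C_def)
    also have "Aq ?Cs x z = q i x u * Aq (C # replicate (t - i - 1) Dt) u z / stat u"
      by (rule Aq_append_dart) (use i uV in \<open>auto simp: C_def\<close>)
    also have "\<dots> \<le> q i x u * q (t - i) u z / stat u"
    proof -
      have "Aq (C # replicate (t - i - 1) Dt) u z \<le> Aq (replicate (t - i) Dt) u z"
      proof (rule Aq_mono)
        show "length (C # replicate (t - i - 1) Dt) = length (replicate (t - i) Dt)" using i by simp
        show "(C # replicate (t - i - 1) Dt) ! j \<subseteq> replicate (t - i) Dt ! j" if "j < length (C # replicate (t - i - 1) Dt)" for j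
          using that i by (cases j) (auto simp: C_def)
      qed auto
      moreover have "0 \<le> q i x u" by (rule Aq_nonneg) auto
      ultimately show ?thesis using stat_pos[OF uV] by (intro divide_right_mono mult_left_mono) auto
    qed
    also have "\<dots> \<le> (tt i * stat x) * (tt (t - i) * stat u) / stat u"
    proof -
      have "subthin r 0 i" "subthin r i t" by (rule W_subthin[OF r(1)]; use i in simp)+
      moreover have "tgt (r ! (i - 1)) = u" using om_pos_chain[OF omW[OF r(1)], of "i - 1"] i rp(1) r(3) by simp
      ultimately have "q i x u \<le> tt i * stat x" "q (t - i) u z \<le> tt (t - i) * stat u"
        unfolding subthin_def x_def z_def using rp(4,5) r(3) by simp_all
      moreover have "0 \<le> q (t - i) u z" by (rule Aq_nonneg) auto
      moreover have "0 \<le> tt i * stat x" using stat_pos[OF xV] th_pos B1 D_pos unfolding tt_def by simp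
      ultimately show ?thesis using stat_pos[OF uV] by (intro divide_right_mono mult_mono) auto
    qed
    also have "\<dots> = B / (\<delta> * \<theta>) * (\<delta> * (tt t * stat x))"
    proof -
      obtain i' where i': "i = Suc i'" using i by (cases i) auto
      obtain j' where j': "t = Suc (Suc (i' + j'))" using i i' by (metis add_Suc less_iff_Suc_add)
      show ?thesis unfolding tt_def i' j' using delta(1) th_pos D_pos stat_pos[OF uV]
        by (simp add: field_simps power_add)
    qed
    also have "\<dots> \<le> B / (\<delta> * \<theta>) * ?m"
    proof -
      have "\<delta> * (tt t * stat x) \<le> sum om {c\<in>W. endk c = endk r}" unfolding x_def by (rule end_mass_ge[OF r(1)])
      then show ?thesis using c0 unfolding r(2) by (intro mult_left_mono) auto
    qed
    finally show ?thesis .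
  qed
qed

text \<open>From the last but one vertex the walk continues uniformly over at least \<open>D\<close>
  darts, so \<open>b\<close> of them have share at most \<open>b / D\<close>. The factor
  \<open>1 / \<delta>\<close> is the price for restricting to the family.\<close>

lemma pen_step:
  fixes b :: real
  assumes P: "P \<in> W" and C: "C \<subseteq> {d\<in>Dt. src d = src (last P) \<and> tgt d = u}" and cC: "card C \<le> b"
  shows "sum om {P'\<in>W. penk P' = penk P \<and> last P' \<in> C} \<le> b / (\<delta> * D) * sum om {P'\<in>W. penk P' = penk P}"
proof -
  define x y where "x = src (hd P)" and "y = src (last P)"
  let ?S = "{P'\<in>W. penk P' = penk P \<and> last P' \<in> C}"
  let ?Cs = "replicate (t - 1) Dt @ [C]"
  have yV: "y \<in> V" unfolding y_def by (rule src_V[OF last_Dt[OF P]])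
  have CD: "C \<subseteq> Dt" using C by blast
  have t1: "t - 1 \<noteq> 0" "Suc (t - 1) = t" using t2 by auto
  have sub: "?S \<subseteq> {c\<in>listset ?Cs. src (hd c) = x \<and> tgt (last c) = u}"
  proof
    fix c assume c: "c \<in> ?S"
    then have cW: "c \<in> W" by blast
    note cp = W_props[OF cW]
    have "c ! j \<in> ?Cs ! j" if "j < t" for j
    proof (cases "j = t - 1")
      case True then show ?thesis using c cp(5) by (simp add: nth_append)
    next
      case False
      then have "j < t - 1" using that by simp
      moreover have "c ! j \<in> Dt" using cp that by auto
      ultimately show ?thesis by (simp add: nth_append)
    qed
    then have "c \<in> listset ?Cs" unfolding listset_nth using cp(1) t1 by simp
    moreover have "src (hd c) = x" using c unfolding penk_def x_def by simp
    moreover have "tgt (last c) = u" using c C by blast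
    ultimately show "c \<in> {c\<in>listset ?Cs. src (hd c) = x \<and> tgt (last c) = u}" by simp
  qed
  have q0: "0 \<le> q (t - 1) x y" by (rule Aq_nonneg) auto
  have "sum om ?S \<le> Aq ?Cs x u" by (rule om_sum_le_Aq[OF sub]) (use CD in auto)
  also have "Aq ?Cs x u = q (t - 1) x y * Aq [C] y u / stat y"
    by (rule Aq_append_dart) (use t1 CD C yV in \<open>auto simp: y_def\<close>)
  also have "\<dots> \<le> q (t - 1) x y * (b * (stat y / D)) / stat y"
  proof -
    have "Aq [C] y u = (\<Sum>d\<in>C. if src d = y \<and> tgt d = u then 1 / M else 0)"
      unfolding Aq_def sum_listset_single by (intro sum.cong refl) simp
    also have "\<dots> \<le> (\<Sum>d\<in>C. 1 / M)" by (rule sum_mono) (use M_pos in simp)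
    also have "\<dots> = card C * (1 / M)" by simp
    also have "\<dots> \<le> b * (stat y / D)" using cC inv_M_le[OF yV] M_pos by (intro mult_mono) auto
    finally have "Aq [C] y u \<le> b * (stat y / D)" .
    then show ?thesis using q0 stat_pos[OF yV] by (intro divide_right_mono mult_left_mono) auto
  qed
  also have "\<dots> = b / (\<delta> * D) * (\<delta> * q (t - 1) x y)" using stat_pos[OF yV] delta(1) D_pos by simp
  also have "\<dots> \<le> b / (\<delta> * D) * sum om {P'\<in>W. penk P' = penk P}"
  proof (rule mult_left_mono)
    show "\<delta> * q (t - 1) x y \<le> sum om {P'\<in>W. penk P' = penk P}"
      using penW[OF P] unfolding \<delta>_def x_def y_def .
    have "0 \<le> b" using cC by linarith
    then show "0 \<le> b / (\<delta> * D)" using delta D_pos by simp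
  qed
  finally show ?thesis .
qed

lemma pen_dart:
  assumes P: "P \<in> W"
  shows "sum om {P'\<in>W. penk P' = penk P \<and> last P' = d} \<le> 1 / (\<delta> * D) * sum om {P'\<in>W. penk P' = penk P}"
proof -
  define C where "C = {d} \<inter> {d'\<in>Dt. src d' = src (last P) \<and> tgt d' = tgt d}"
  have "card C \<le> card {d}" unfolding C_def by (intro card_mono) auto
  then have "real (card C) \<le> 1" by simp
  moreover have "C \<subseteq> {d'\<in>Dt. src d' = src (last P) \<and> tgt d' = tgt d}" unfolding C_def by blast
  ultimately have "sum om {P'\<in>W. penk P' = penk P \<and> last P' \<in> C} \<le> 1 / (\<delta> * D) * sum om {P'\<in>W. penk P' = penk P}"
    using pen_step[OF P] by blast
  moreover have "{P'\<in>W. penk P' = penk P \<and> last P' \<in> C} = {P'\<in>W. penk P' = penk P \<and> last P' = d}"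
    using last_Dt unfolding C_def penk_def by auto
  ultimately show ?thesis by simp
qed

lemma pen_vertex:
  assumes P: "P \<in> W"
  shows "sum om {P'\<in>W. penk P' = penk P \<and> tgt (last P') = u} \<le> B / (\<delta> * \<theta>) * sum om {P'\<in>W. penk P' = penk P}"
proof -
  define C where "C = {d\<in>Dt. src d = src (last P) \<and> tgt d = u}"
  have "sum om {P'\<in>W. penk P' = penk P \<and> last P' \<in> C} \<le> B / (\<delta> * D) * sum om {P'\<in>W. penk P' = penk P}"
    by (rule pen_step[OF P]) (use mult in \<open>auto simp: C_def\<close>)
  moreover have "{P'\<in>W. penk P' = penk P \<and> last P' \<in> C} = {P'\<in>W. penk P' = penk P \<and> tgt (last P') = u}"
    using last_Dt unfolding C_def penk_def by auto
  moreover have "B / (\<delta> * D) * sum om {P'\<in>W. penk P' = penk P} \<le> B / (\<delta> * \<theta>) * sum om {P'\<in>W. penk P' = penk P}"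
  proof (rule mult_right_mono)
    show "B / (\<delta> * D) \<le> B / (\<delta> * \<theta>)" using \<theta>D th_pos delta(1) B1 by (intro divide_left_mono mult_left_mono) auto
    show "0 \<le> sum om {P'\<in>W. penk P' = penk P}" by (rule sum_nonneg) (use omW in \<open>auto intro: less_imp_le\<close>)
  qed
  ultimately show ?thesis by simp
qed

lemma last_dart:
  assumes P: "P \<in> W"
  shows "sum om {P'\<in>W. last P' = d \<and> key i P' = key i P} \<le> 1 / (\<delta> * \<theta>) * ch.mass i (key i P)"
proof (cases "even i")
  case True
  have ne: "{t - 1} \<noteq> {..<t}"
  proof
    assume "{t - 1} = {..<t}"
    moreover have "0 \<in> {..<t}" using t2 by simp
    ultimately have "0 = t - 1" by blast
    then show False using t2 by simp
  qed
  have "{P'\<in>W. last P' = d \<and> key i P' = key i P} = {P'\<in>W. endk P' = endk P \<and> (\<forall>j\<in>{t - 1}. P' ! j = d)}"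
    using True W_props(5) unfolding key_def by auto
  moreover have "r0 {t - 1} = 1 / (\<delta> * \<theta>)" unfolding r0_def using ne by simp
  ultimately show ?thesis using end_darts[OF P, of "{t - 1}" "\<lambda>_. d"] t2 unfolding mass_even[OF True] by simp
next
  case False
  have "{P'\<in>W. last P' = d \<and> key i P' = key i P} = {P'\<in>W. penk P' = penk P \<and> last P' = d}"
    using False unfolding key_def by auto
  moreover have "1 / (\<delta> * D) * sum om {P'\<in>W. penk P' = penk P} \<le> 1 / (\<delta> * \<theta>) * sum om {P'\<in>W. penk P' = penk P}"
  proof (rule mult_right_mono)
    show "1 / (\<delta> * D) \<le> 1 / (\<delta> * \<theta>)" using \<theta>D th_pos delta(1) by (intro divide_left_mono mult_left_mono) auto
    show "0 \<le> sum om {P'\<in>W. penk P' = penk P}" by (rule sum_nonneg) (use omW in \<open>auto intro: less_imp_le\<close>)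
  qed
  ultimately show ?thesis using pen_dart[OF P, of d] unfolding mass_odd[OF False] by simp
qed

end

section \<open>The closed walk of a chain of walks\<close>

lemma (in key_chain) cw_pos_key:
  "0 < cw j c \<Longrightarrow> set c \<subseteq> W \<Longrightarrow> Suc i < length c \<Longrightarrow> kout (j + i) (c ! i) = kin (j + i) (c ! Suc i)"
proof (induction c arbitrary: j i)
  case (Cons P c)
  then obtain P' c' where c: "c = P' # c'" by (cases c) auto
  have k: "kout j P = kin j P'" using Cons.prems(1) unfolding c by (auto split: if_splits)
  show ?case
  proof (cases i)
    case (Suc i')
    have "0 \<le> cw (Suc j) c" using cw_nonneg Cons.prems(2) by simp
    moreover have "cw (Suc j) c \<noteq> 0" using Cons.prems(1) unfolding c by (auto split: if_splits)
    ultimately have "0 < cw (Suc j) c" by simp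
    then have "kout (Suc j + i') (c ! i') = kin (Suc j + i') (c ! Suc i')"
      using Cons.IH[of "Suc j" i'] Cons.prems Suc by simp
    then show ?thesis using Suc by simp
  qed (use k c in simp)
qed simp

lemma map_butlast_last: "P \<noteq> [] \<Longrightarrow> map f P = map f (butlast P) @ [f (last P)]"
  by (induction P rule: rev_induct) auto

lemma map_hd_tl: "P \<noteq> [] \<Longrightarrow> map f P = f (hd P) # map f (tl P)"
  by (cases P) auto

lemma spread_mono_K:
  assumes "spread k K \<tau> X w" "K \<le> K'" "0 \<le> \<tau>"
  shows "spread k K' \<tau> X w"
  unfolding spread_def
proof (intro conjI allI impI)
  show "0 \<le> w e" for e by (rule spread_nonneg[OF assms(1)])
  show "e \<subseteq> X" "card e = k" if "w e \<noteq> 0" for e using spread_uniform[OF assms(1) that] by auto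
  show "1 \<le> sum w (Pow X)" by (rule spread_mass[OF assms(1)])
  fix S assume "S \<subseteq> X" "S \<noteq> {}"
  then have "cod X w S \<le> K / card X * \<tau> ^ (card S - 1)" by (rule spread_cod[OF assms(1)])
  also have "\<dots> \<le> K' / card X * \<tau> ^ (card S - 1)" using assms(2,3) by (intro mult_right_mono divide_right_mono) auto
  finally show "cod X w S \<le> K' / card X * \<tau> ^ (card S - 1)" .
qed

text \<open>Equal labels mean equal vertex pairs, and a closed walk through \<open>k \<ge> 3\<close>
  distinct vertices never uses the same pair in two steps.\<close>

lemma closed_walk_labels_distinct:
  fixes ds :: "'e dart list"
  assumes k: "length ds = k" "3 \<le> k" and dist: "distinct (map src ds)"
    and closed: "map tgt ds = rotate1 (map src ds)"
    and pair: "\<And>d d'. d \<in> set ds \<Longrightarrow> d' \<in> set ds \<Longrightarrow> lab d = lab d' \<Longrightarrow> {src d, tgt d} = {src d', tgt d'}"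
  shows "distinct (map lab ds)"
proof -
  have t: "tgt (ds ! i) = src (ds ! (Suc i mod k))" if "i < k" for i
  proof -
    have "tgt (ds ! i) = map tgt ds ! i" using that k by simp
    also have "\<dots> = map src ds ! (Suc i mod k)" unfolding closed using nth_rotate1[of i "map src ds"] that k by simp
    finally show ?thesis using k by simp
  qed
  have inj: "i = j" if "src (ds ! i) = src (ds ! j)" "i < k" "j < k" for i j
    using nth_eq_iff_index_eq[OF dist, of i j] that k by simp
  have neq: "lab (ds ! i) \<noteq> lab (ds ! j)" if ij: "i < j" "j < k" for i j
  proof
    assume "lab (ds ! i) = lab (ds ! j)"
    then have "{src (ds ! i), tgt (ds ! i)} = {src (ds ! j), tgt (ds ! j)}"
      using pair[of "ds ! i" "ds ! j"] ij k by simp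
    then have "src (ds ! i) = src (ds ! j) \<or> (src (ds ! i) = tgt (ds ! j) \<and> tgt (ds ! i) = src (ds ! j))"
      by (auto simp: doubleton_eq_iff)
    then have "i = Suc j mod k" "Suc i mod k = j"
      using inj[of i j] inj[of i "Suc j mod k"] inj[of "Suc i mod k" j] t[of i] t[of j] ij by auto
    moreover have "Suc i mod k = Suc i" using ij by simp
    ultimately have "i = Suc (Suc i) mod k" by simp
    moreover have "Suc (Suc i) mod k \<noteq> i"
    proof (cases "Suc (Suc i) < k")
      case False
      then have "Suc (Suc i) = k" using ij by linarith
      then show ?thesis using k by auto
    qed simp
    ultimately show False by simp
  qed
  have "map lab ds ! i \<noteq> map lab ds ! j" if "i < length (map lab ds)" "j < length (map lab ds)" "i \<noteq> j" for i j
    using that k neq[of i j] neq[of j i] by (cases "i < j") auto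
  then show ?thesis unfolding distinct_conv_nth by blast
qed

context walk_family
begin

definition s :: nat where "s = l - t"
text \<open>Two walks supply \<open>2 * t\<close> darts; the remaining \<open>2 * s\<close> are
  supplied by one further walk each.\<close>

definition mm :: nat where "mm = 2 * s + 2"
definition \<Gamma> :: "'e dart list list set" where "\<Gamma> = listset (replicate mm W)"
definition flip :: "'e dart \<Rightarrow> 'e dart" where "flip d = (tgt d, lab d, src d)"
text \<open>For odd \<open>k\<close> the last dart is traversed from its target, shared with walk
  \<open>k - 1\<close>, to its source, shared with walk \<open>k + 1\<close>. For even
  \<open>k\<close> the roles of source and target are exchanged.\<close>

definition zd :: "nat \<Rightarrow> 'e dart list \<Rightarrow> 'e dart" where "zd k P = (if odd k then flip (last P) else last P)"

text \<open>The closed walk of a chain: the first walk, then a zigzag formed by the last darts of the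
  intermediate walks, then the last walk backwards.\<close>

definition dl :: "'e dart list list \<Rightarrow> 'e dart list" where
  "dl c = c ! 0 @ map (\<lambda>k. zd k (c ! k)) [1..<2 * s + 1] @ rev (map flip (c ! (2 * s + 1)))"

text \<open>The second component of the key shared by walks \<open>k\<close> and
  \<open>k + 1\<close>, hence the vertex at which the zigzag passes from the dart of walk
  \<open>k\<close> to the next dart.\<close>

definition wv :: "nat \<Rightarrow> 'e dart list \<Rightarrow> nat" where "wv k P = snd (key k P)"

lemma flip_flip [simp]: "flip (flip d) = d" unfolding flip_def by simp
lemma flip_sel [simp]: "src (flip d) = tgt d" "tgt (flip d) = src d" "lab (flip d) = lab d"
  unfolding flip_def by simp_all

lemma flip_Dt: "d \<in> Dt \<Longrightarrow> flip d \<in> Dt" unfolding flip_def using sym[of "src d" "lab d" "tgt d"] by simp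

lemma l_eq: "2 * l = t + 2 * s + t" unfolding s_def using tl by simp

lemma wv_eq: "wv k P = (if odd k then src (last P) else tgt (last P))"
  unfolding wv_def key_def endk_def penk_def by simp

lemma Gamma_iff: "c \<in> \<Gamma> \<longleftrightarrow> length c = mm \<and> (\<forall>k<mm. c ! k \<in> W)"
  unfolding \<Gamma>_def listset_nth by auto

lemma Gamma_set: "c \<in> \<Gamma> \<Longrightarrow> set c \<subseteq> W"
  unfolding \<Gamma>_def by (rule set_listset_subset) auto

lemma finGamma: "finite \<Gamma>" unfolding \<Gamma>_def by (rule finite_listset) (use finW in auto)

lemma cw_nn: "c \<in> \<Gamma> \<Longrightarrow> 0 \<le> ch.cw 0 c" by (rule ch.cw_nonneg[OF Gamma_set])

lemma Gamma_len: "c \<in> \<Gamma> \<Longrightarrow> k < mm \<Longrightarrow> length (c ! k) = t"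
  using Gamma_iff W_props(1) by blast

lemma length_dl: "c \<in> \<Gamma> \<Longrightarrow> length (dl c) = 2 * l"
  unfolding dl_def using Gamma_len[of c 0] Gamma_len[of c "2 * s + 1"] l_eq by (simp add: mm_def)

lemma dl_nth_0: "c \<in> \<Gamma> \<Longrightarrow> i < t \<Longrightarrow> dl c ! i = c ! 0 ! i"
  unfolding dl_def using Gamma_len[of c 0] by (simp add: nth_append mm_def)

lemma dl_nth_mid: "c \<in> \<Gamma> \<Longrightarrow> 1 \<le> k \<Longrightarrow> k \<le> 2 * s \<Longrightarrow> dl c ! (t + k - 1) = zd k (c ! k)"
proof -
  assume c: "c \<in> \<Gamma>" and k: "1 \<le> k" "k \<le> 2 * s"
  have len: "length (c ! 0) = t" using Gamma_len[OF c, of 0] by (simp add: mm_def)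
  have "t + k - 1 = t + (k - 1)" using k by simp
  then have "dl c ! (t + k - 1) = (map (\<lambda>k. zd k (c ! k)) [1..<2 * s + 1] @ rev (map flip (c ! (2 * s + 1)))) ! (k - 1)"
    unfolding dl_def using len by (simp add: nth_append)
  also have "\<dots> = map (\<lambda>k. zd k (c ! k)) [1..<2 * s + 1] ! (k - 1)"
  proof -
    have "k - 1 < length (map (\<lambda>k. zd k (c ! k)) [1..<2 * s + 1])" using k by simp
    then show ?thesis by (simp only: nth_append if_True)
  qed
  also have "\<dots> = zd k (c ! k)"
  proof -
    have "k - 1 < length [1..<2 * s + 1]" "[1..<2 * s + 1] ! (k - 1) = k" using k by (simp_all del: upt_Suc)
    then show ?thesis by (simp only: nth_map)
  qed
  finally show ?thesis .
qed

lemma dl_nth_last: "c \<in> \<Gamma> \<Longrightarrow> i < t \<Longrightarrow> dl c ! (2 * l - 1 - i) = flip (c ! (2 * s + 1) ! i)"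
proof -
  assume c: "c \<in> \<Gamma>" and i: "i < t"
  have len: "length (c ! 0) = t" "length (c ! (2 * s + 1)) = t"
    using Gamma_len[OF c, of 0] Gamma_len[OF c, of "2 * s + 1"] by (auto simp: mm_def)
  have e: "2 * l - 1 - i = t + (2 * s + (t - 1 - i))" using l_eq i by simp
  have "dl c ! (2 * l - 1 - i) = rev (map flip (c ! (2 * s + 1))) ! (t - 1 - i)"
  proof -
    have gen: "(A @ B @ C) ! (length A + (length B + n)) = C ! n" for A B C :: "'e dart list" and n by simp
    have lm: "length (map (\<lambda>k. zd k (c ! k)) [1..<2 * s + 1]) = 2 * s" by (simp del: upt_Suc)
    show ?thesis unfolding dl_def e
      by (rule gen[of "c ! 0" "map (\<lambda>k. zd k (c ! k)) [1..<2 * s + 1]", unfolded len(1) lm])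
  qed
  also have "\<dots> = flip (c ! (2 * s + 1) ! i)" using len(2) i by (simp add: rev_nth)
  finally show ?thesis .
qed

lemma key_link: "c \<in> \<Gamma> \<Longrightarrow> 0 < ch.cw 0 c \<Longrightarrow> Suc k < mm \<Longrightarrow> key k (c ! k) = key k (c ! Suc k)"
  using ch.cw_pos_key[of 0 c k] Gamma_set[of c] Gamma_iff[of c] by simp

text \<open>For odd \<open>k\<close> the ends shared with walk \<open>k - 1\<close> leave the last
  but one vertex open, for even \<open>k\<close> the shared start and last but one vertex leave the
  end open. One new vertex thus costs the same in both cases.\<close>

lemma wv_hit:
  assumes P: "P \<in> W" and k: "1 \<le> k"
  shows "sum om {P'\<in>W. wv k P' = u \<and> key (k - 1) P' = key (k - 1) P} \<le> B / (\<delta> * \<theta>) * ch.mass (k - 1) (key (k - 1) P)"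
proof (cases "odd k")
  case True
  then have ev: "even (k - 1)" by simp
  have "{P'\<in>W. wv k P' = u \<and> key (k - 1) P' = key (k - 1) P} = {P'\<in>W. endk P' = endk P \<and> src (P' ! (t - 1)) = u}"
    using True ev W_props(5) unfolding wv_eq key_def by auto
  then show ?thesis using end_vertex[OF P, of "t - 1" u] t2 unfolding mass_even[OF ev] by simp
next
  case False
  then have od: "odd (k - 1)" using k by simp
  have "{P'\<in>W. wv k P' = u \<and> key (k - 1) P' = key (k - 1) P} = {P'\<in>W. penk P' = penk P \<and> tgt (last P') = u}"
    using False od unfolding wv_eq key_def by auto
  then show ?thesis using pen_vertex[OF P, of u] unfolding mass_odd[OF od] by simp
qed

definition vert :: "nat \<times> nat \<Rightarrow> 'e dart list \<Rightarrow> nat" where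
  "vert p P = (if fst p = 0 then vs P ! snd p else if fst p \<le> 2 * s then wv (fst p) P else src (P ! snd p))"

text \<open>Each vertex of the closed walk is charged to the walk in which it is new: the
  \<open>t + 1\<close> vertices of the first walk, one vertex for each zigzag walk, and the
  \<open>t - 1\<close> interior vertices of the last walk in reverse order.\<close>

definition KL :: "(nat \<times> nat) list" where
  "KL = map (Pair 0) [0..<Suc t] @ map (\<lambda>b. (b, 0)) [1..<2 * s + 1] @ map (Pair (2 * s + 1)) (rev [1..<t])"

lemma map_src_dl:
  assumes c: "c \<in> \<Gamma>" "0 < ch.cw 0 c"
  shows "map src (dl c) = map (\<lambda>p. vert p (c ! fst p)) KL"
    and "map tgt (dl c) = rotate1 (map src (dl c))"
proof -
  let ?P = "c ! 0" and ?Q = "c ! (2 * s + 1)"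
  have PW: "?P \<in> W" "?Q \<in> W" using c(1) unfolding Gamma_iff mm_def by auto
  note Pp = W_props[OF PW(1)] and Qp = W_props[OF PW(2)]
  have link: "key k (c ! k) = key k (c ! Suc k)" if "k \<le> 2 * s" for k
    using key_link[OF c, of k] that by (simp add: mm_def)
  have st: "src (hd (c ! k)) = src (hd ?P)" if "k \<le> 2 * s + 1" for k
    using that
  proof (induction k)
    case (Suc k)
    have "fst (key k (c ! k)) = fst (key k (c ! Suc k))" using link[of k] Suc.prems by simp
    then show ?case using Suc unfolding key_def endk_def penk_def by (auto split: if_splits)
  qed simp
  have tgt_src: "map tgt (butlast P) = map src (tl P)" if "P \<in> W" for P
  proof (rule nth_equalityI)
    show "map tgt (butlast P) ! i = map src (tl P) ! i" if i: "i < length (map tgt (butlast P))" for i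
      using om_pos_chain[OF omW[OF \<open>P \<in> W\<close>], of i] i by (simp add: nth_butlast nth_tl)
  qed simp
  let ?r = "rev (map (\<lambda>i. src (?Q ! i)) [1..<t])"
  have tlQ: "map src (tl ?Q) = map (\<lambda>i. src (?Q ! i)) [1..<t]"
    by (rule nth_equalityI) (use Qp(1) in \<open>auto simp: nth_tl\<close>)
  have zs: "src (zd k P) = wv (k - 1) P" if "1 \<le> k" for k P using that unfolding zd_def wv_eq by auto
  have zt: "tgt (zd k P) = wv k P" for k P unfolding zd_def wv_eq by auto
  have wl: "wv k (c ! k) = wv k (c ! Suc k)" if "k \<le> 2 * s" for k using link[OF that] unfolding wv_def by simp
  have mids: "map src (map (\<lambda>k. zd k (c ! k)) [1..<2 * s + 1]) = map (\<lambda>j. wv j (c ! j)) [0..<2 * s]"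
  proof (rule nth_equalityI)
    fix j assume "j < length (map src (map (\<lambda>k. zd k (c ! k)) [1..<2 * s + 1]))"
    then have j: "j < 2 * s" by (simp del: upt_Suc)
    then have "map src (map (\<lambda>k. zd k (c ! k)) [1..<2 * s + 1]) ! j = src (zd (Suc j) (c ! Suc j))" by (simp del: upt_Suc)
    also have "\<dots> = wv j (c ! j)" using zs[of "Suc j"] wl[of j] j by simp
    finally show "map src (map (\<lambda>k. zd k (c ! k)) [1..<2 * s + 1]) ! j = map (\<lambda>j. wv j (c ! j)) [0..<2 * s] ! j" using j by simp
  qed simp
  have midt: "map tgt (map (\<lambda>k. zd k (c ! k)) [1..<2 * s + 1]) = map (\<lambda>j. wv j (c ! j)) [1..<2 * s + 1]"
    using zt by simp
  have Qt: "map tgt ?Q = map src (tl ?Q) @ [wv (2 * s) (c ! (2 * s))]"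
  proof -
    have "map tgt ?Q = map tgt (butlast ?Q) @ [tgt (last ?Q)]" by (rule map_butlast_last[OF Qp(3)])
    moreover have "tgt (last ?Q) = wv (2 * s) (c ! (2 * s))" using wl[of "2 * s"] by (simp add: wv_eq)
    ultimately show ?thesis using tgt_src[OF PW(2)] by simp
  qed
  have Pt: "map tgt ?P = map src (tl ?P) @ [wv 0 ?P]"
  proof -
    have "map tgt ?P = map tgt (butlast ?P) @ [tgt (last ?P)]" by (rule map_butlast_last[OF Pp(3)])
    then show ?thesis using tgt_src[OF PW(1)] by (simp add: wv_eq)
  qed
  have upt0: "map (\<lambda>j. wv j (c ! j)) [0..<2 * s] @ [wv (2 * s) (c ! (2 * s))] = wv 0 ?P # map (\<lambda>j. wv j (c ! j)) [1..<2 * s + 1]"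
  proof -
    have "[0..<2 * s] @ [2 * s] = 0 # [1..<2 * s + 1]" by (simp add: upt_conv_Cons[symmetric])
    from arg_cong[OF this, of "map (\<lambda>j. wv j (c ! j))"] show ?thesis by simp
  qed
  have rsrc: "map src (rev (map flip ?Q)) = wv (2 * s) (c ! (2 * s)) # ?r"
  proof -
    have "map src (rev (map flip ?Q)) = rev (map tgt ?Q)" by (simp add: rev_map comp_def)
    then show ?thesis unfolding Qt tlQ by simp
  qed
  have rtgt: "map tgt (rev (map flip ?Q)) = ?r @ [src (hd ?P)]"
  proof -
    have "map src ?Q = src (hd ?Q) # map src (tl ?Q)" by (rule map_hd_tl[OF Qp(3)])
    moreover have "map tgt (rev (map flip ?Q)) = rev (map src ?Q)" by (simp add: rev_map comp_def)
    ultimately show ?thesis unfolding tlQ using st[of "2 * s + 1"] by simp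
  qed
  have vsP: "vs ?P = map src ?P @ [wv 0 ?P]" unfolding vs_def wv_eq by simp
  have S: "map src (dl c) = vs ?P @ map (\<lambda>j. wv j (c ! j)) [1..<2 * s + 1] @ ?r"
    unfolding dl_def map_append mids rsrc vsP using upt0 by simp
  have "map (\<lambda>p. vert p (c ! fst p)) KL = map (\<lambda>i. vs ?P ! i) [0..<Suc t] @ map (\<lambda>j. wv j (c ! j)) [1..<2 * s + 1] @ ?r"
  proof -
    have "map (\<lambda>p. vert p (c ! fst p)) (map (\<lambda>b. (b, 0)) [1..<2 * s + 1]) = map (\<lambda>j. wv j (c ! j)) [1..<2 * s + 1]"
      unfolding map_map by (rule map_cong) (auto simp: vert_def)
    then show ?thesis unfolding KL_def map_append by (simp add: vert_def comp_def rev_map)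
  qed
  also have "map (\<lambda>i. vs ?P ! i) [0..<Suc t] = vs ?P"
    using map_nth[of "vs ?P"] Pp(1) unfolding vs_def by simp
  finally show "map src (dl c) = map (\<lambda>p. vert p (c ! fst p)) KL" unfolding S by simp
  have hdP: "vs ?P = src (hd ?P) # map src (tl ?P) @ [wv 0 ?P]"
  proof -
    have "map src ?P = src (hd ?P) # map src (tl ?P)" by (rule map_hd_tl[OF Pp(3)])
    then show ?thesis unfolding vsP by simp
  qed
  show "map tgt (dl c) = rotate1 (map src (dl c))"
    unfolding S hdP unfolding dl_def map_append midt rtgt Pt by simp
qed

definition good :: "'e dart list list set" where
  "good = {c\<in>\<Gamma>. 0 < ch.cw 0 c \<and> distinct (map src (dl c))}"

text \<open>Positions charged to the same walk cannot coincide, since the walks of the family have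
  distinct vertices. For different walks the later vertex is still open given the key shared with
  the preceding walk, so each of at most \<open>4 * l ^ 2\<close> pairs costs
  \<open>B / (\<delta> * \<theta>)\<close>, and \<open>small\<close> keeps the total at most one
  half.\<close>

lemma bad_chain_mass: "sum (ch.cw 0) {c\<in>\<Gamma>. 0 < ch.cw 0 c \<and> \<not> distinct (map src (dl c))} \<le> sum om W / 2"
proof -
  define K where "K = {(p, p'). p \<in> set KL \<and> p' \<in> set KL \<and> fst p < fst p'}"
  have lKL: "length KL = 2 * l" unfolding KL_def using l_eq t2 by simp
  have distKL: "distinct KL" unfolding KL_def by (auto simp: distinct_map inj_on_def)
  have memKL: "fst p < mm" "fst p = 2 * s + 1 \<Longrightarrow> 0 < snd p \<and> snd p < t" "fst p = 0 \<Longrightarrow> snd p \<le> t"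
    if "p \<in> set KL" for p using that unfolding KL_def mm_def by auto
  have KLeq: "snd p = 0" if "p \<in> set KL" "fst p \<noteq> 0" "fst p \<noteq> 2 * s + 1" for p
    using that unfolding KL_def by auto
  have Ksub: "K \<subseteq> set KL \<times> set KL" unfolding K_def by auto
  then have finK: "finite K" using finite_subset by blast
  have cK: "card K \<le> (2 * l) ^ 2"
  proof -
    have "card K \<le> card (set KL \<times> set KL)" by (rule card_mono) (use Ksub in auto)
    also have "\<dots> = (2 * l) ^ 2" using distinct_card[OF distKL] lKL by (simp add: card_cartesian_product power2_eq_square)
    finally show ?thesis .
  qed
  let ?A = "\<lambda>pp. {c\<in>\<Gamma>. vert (snd pp) (c ! fst (snd pp)) = vert (fst pp) (c ! fst (fst pp))}"
  have sub: "{c\<in>\<Gamma>. 0 < ch.cw 0 c \<and> \<not> distinct (map src (dl c))} \<subseteq> (\<Union>pp\<in>K. ?A pp)"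
  proof
    fix c assume "c \<in> {c\<in>\<Gamma>. 0 < ch.cw 0 c \<and> \<not> distinct (map src (dl c))}"
    then have c: "c \<in> \<Gamma>" "0 < ch.cw 0 c" "\<not> distinct (map src (dl c))" by blast+
    have "\<not> inj_on (\<lambda>p. vert p (c ! fst p)) (set KL)"
      using c(3) distKL unfolding map_src_dl(1)[OF c(1,2)] distinct_map by blast
    then obtain p p' where pp: "p \<in> set KL" "p' \<in> set KL" "p \<noteq> p'" "vert p (c ! fst p) = vert p' (c ! fst p')"
      unfolding inj_on_def by blast
    have "fst p \<noteq> fst p'"
    proof
      assume f: "fst p = fst p'"
      have cW: "c ! fst p \<in> W" using c(1) memKL(1)[OF pp(1)] Gamma_iff by blast
      note Wp = W_props[OF cW]
      have lvs: "length (vs (c ! fst p)) = Suc t" unfolding vs_def using Wp(1) by simp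
      have sneq: "snd p \<noteq> snd p'" using f pp(3) by (simp add: prod_eq_iff)
      consider "fst p = 0" | "fst p = 2 * s + 1" | "fst p \<noteq> 0" "fst p \<noteq> 2 * s + 1" by blast
      then show False
      proof cases
        case 1
        then have "vs (c ! fst p) ! snd p = vs (c ! fst p) ! snd p'" using pp(4) f unfolding vert_def by simp
        then show False using nth_eq_iff_index_eq[OF distW[OF cW]] lvs memKL(3)[OF pp(1)] memKL(3)[OF pp(2)] 1 f sneq
          by (simp add: less_Suc_eq_le)
      next
        case 2
        have v: "vs (c ! fst p) ! i = src (c ! fst p ! i)" if "i < t" for i using that Wp(1) unfolding vs_def by (simp add: nth_append)
        have i: "snd p < t" "snd p' < t" using memKL(2) pp(1,2) 2 f by auto
        have "src (c ! fst p ! snd p) = src (c ! fst p ! snd p')" using pp(4) f 2 unfolding vert_def by simp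
        then have "vs (c ! fst p) ! snd p = vs (c ! fst p) ! snd p'" using v i by simp
        then show False using nth_eq_iff_index_eq[OF distW[OF cW], of "snd p" "snd p'"] lvs i sneq by simp
      next
        case 3
        then show False using KLeq[OF pp(1)] KLeq[OF pp(2)] f sneq by simp
      qed
    qed
    then consider "fst p < fst p'" | "fst p' < fst p" by linarith
    then show "c \<in> (\<Union>pp\<in>K. ?A pp)"
    proof cases
      case 1
      then have "(p, p') \<in> K" "c \<in> ?A (p, p')" using pp c(1) unfolding K_def by auto
      then show ?thesis by blast
    next
      case 2
      then have "(p', p) \<in> K" "c \<in> ?A (p', p)" using pp c(1) unfolding K_def by auto
      then show ?thesis by blast
    qed
  qed
  have one: "sum (ch.cw 0) (?A pp) \<le> B / (\<delta> * \<theta>) * sum om W" if ppK: "pp \<in> K" for pp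
  proof -
    obtain p p' where pp: "pp = (p, p')" "p \<in> set KL" "p' \<in> set KL" "fst p < fst p'" using ppK unfolding K_def by blast
    have "sum (ch.cw 0) {c\<in>listset (replicate mm W). vert p' (c ! fst p') = vert p (c ! fst p)} \<le> B / (\<delta> * \<theta>) * sum om W"
    proof (rule ch.coincidence_bound)
      show "fst p < fst p'" "fst p' < mm" using pp memKL(1) by auto
      show "0 \<le> B / (\<delta> * \<theta>)" using B1 delta th_pos by simp
      fix u P assume P: "P \<in> W"
      show "sum om {P'\<in>W. vert p' P' = u \<and> key (fst p' - 1) P' = key (fst p' - 1) P} \<le> B / (\<delta> * \<theta>) * ch.mass (fst p' - 1) (key (fst p' - 1) P)"
      proof (cases "fst p' \<le> 2 * s")
        case True
        then have "vert p' P' = wv (fst p') P'" for P' using pp(4) unfolding vert_def by simp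
        then show ?thesis using wv_hit[OF P, of "fst p'" u] pp(4) by simp
      next
        case False
        then have f: "fst p' = 2 * s + 1" using memKL(1)[OF pp(3)] unfolding mm_def by simp
        then have v: "vert p' P' = src (P' ! snd p')" for P' unfolding vert_def by simp
        have ev: "even (fst p' - 1)" using f by simp
        have "{P'\<in>W. vert p' P' = u \<and> key (fst p' - 1) P' = key (fst p' - 1) P} = {P'\<in>W. endk P' = endk P \<and> src (P' ! snd p') = u}"
          unfolding v key_def using ev by auto
        then show ?thesis using end_vertex[OF P, of "snd p'" u] memKL(2)[OF pp(3) f] unfolding mass_even[OF ev] by simp
      qed
    qed
    then show ?thesis unfolding pp(1) \<Gamma>_def by simp
  qed
  define f where "f c = (if c \<in> \<Gamma> then ch.cw 0 c else 0)" for c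
  have f0: "0 \<le> f c" for c unfolding f_def using cw_nn by simp
  have ff: "sum (ch.cw 0) A = sum f A" if "A \<subseteq> \<Gamma>" for A by (rule sum.cong) (use that in \<open>auto simp: f_def\<close>)
  have finA: "finite (?A pp)" for pp using finGamma by simp
  have "sum (ch.cw 0) {c\<in>\<Gamma>. 0 < ch.cw 0 c \<and> \<not> distinct (map src (dl c))} = sum f {c\<in>\<Gamma>. 0 < ch.cw 0 c \<and> \<not> distinct (map src (dl c))}"
    by (rule ff) blast
  moreover have "\<dots> \<le> sum f (\<Union>pp\<in>K. ?A pp)"
    by (rule sum_mono2[OF finite_UN_I[OF finK finA] sub f0])
  moreover have "\<dots> \<le> (\<Sum>pp\<in>K. sum f (?A pp))" by (rule sum_UN_le[OF finK finA f0])
  moreover have "\<dots> \<le> (\<Sum>pp\<in>K. B / (\<delta> * \<theta>) * sum om W)"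
  proof (rule sum_mono)
    fix pp assume "pp \<in> K"
    moreover have "sum f (?A pp) = sum (ch.cw 0) (?A pp)" by (rule ff[symmetric]) blast
    ultimately show "sum f (?A pp) \<le> B / (\<delta> * \<theta>) * sum om W" using one by simp
  qed
  moreover have "(\<Sum>pp\<in>K. B / (\<delta> * \<theta>) * sum om W) = card K * (B / (\<delta> * \<theta>)) * sum om W" by simp
  moreover have "card K * (B / (\<delta> * \<theta>)) * sum om W \<le> 1 / 2 * sum om W"
  proof (rule mult_right_mono)
    have "real (card K) \<le> real ((2 * l) ^ 2)" using cK by (simp only: of_nat_le_iff)
    then have "real (card K) * (B / (\<delta> * \<theta>)) \<le> real ((2 * l) ^ 2) * (B / (\<delta> * \<theta>))"
      using B1 delta th_pos by (intro mult_right_mono) auto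
    also have "\<dots> = (64 * real l ^ 2 * 4 ^ l * B) / (2 * \<theta>)" unfolding \<delta>_def by (simp add: power2_eq_square)
    also have "\<dots> \<le> \<theta> / (2 * \<theta>)" using small th_pos by (intro divide_right_mono) auto
    finally show "real (card K) * (B / (\<delta> * \<theta>)) \<le> 1 / 2" using th_pos by simp
    show "0 \<le> sum om W" by (rule sum_nonneg) (use omW in \<open>auto intro: less_imp_le\<close>)
  qed
  ultimately show ?thesis by linarith
qed

lemma good_mass: "\<delta> \<le> sum (ch.cw 0) good"
proof -
  define R where "R = {c\<in>\<Gamma>. 0 < ch.cw 0 c \<and> \<not> distinct (map src (dl c))}"
  have "sum om W = sum (ch.cw 0) \<Gamma>" unfolding \<Gamma>_def mm_def using ch.total_mass[of 0 "2 * s + 1"] by simp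
  moreover have "sum (ch.cw 0) \<Gamma> = sum (ch.cw 0) (good \<union> R)"
  proof (rule sum.mono_neutral_right[OF finGamma])
    show "good \<union> R \<subseteq> \<Gamma>" unfolding good_def R_def by blast
    show "\<forall>c\<in>\<Gamma> - (good \<union> R). ch.cw 0 c = 0"
    proof
      fix c assume c: "c \<in> \<Gamma> - (good \<union> R)"
      then have "\<not> 0 < ch.cw 0 c" unfolding good_def R_def by blast
      then show "ch.cw 0 c = 0" using cw_nn[of c] c by simp
    qed
  qed
  moreover have "sum (ch.cw 0) (good \<union> R) = sum (ch.cw 0) good + sum (ch.cw 0) R"
    by (rule sum.union_disjoint) (use finGamma in \<open>auto simp: good_def R_def\<close>)
  moreover have "sum (ch.cw 0) R \<le> sum om W / 2" unfolding R_def by (rule bad_chain_mass)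
  moreover have "2 * \<delta> \<le> sum om W" using massW unfolding \<delta>_def by (simp add: field_simps)
  ultimately show ?thesis by linarith
qed

end

section \<open>Weight of the closed walks through prescribed darts\<close>

context walk_family
begin

text \<open>\<open>J0\<close>, \<open>JB\<close> and \<open>JQ\<close> translate positions of the
  closed walk into darts of the first walk, numbers of zigzag walks, and darts of the last walk. The
  last walk is traversed backwards, hence \<open>2 * l - 1 - i\<close>.\<close>

definition J0 :: "nat set \<Rightarrow> nat set" where "J0 J = {i\<in>{..<t}. i \<in> J}"
definition JB :: "nat set \<Rightarrow> nat set" where "JB J = {k\<in>{1..2 * s}. t + k - 1 \<in> J}"
definition JQ :: "nat set \<Rightarrow> nat set" where "JQ J = {i\<in>{..<t}. 2 * l - 1 - i \<in> J}"

definition dk :: "(nat \<Rightarrow> 'e dart) \<Rightarrow> nat \<Rightarrow> 'e dart" where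
  "dk d k = (if odd k then flip (d (t + k - 1)) else d (t + k - 1))"

definition con :: "nat set \<Rightarrow> (nat \<Rightarrow> 'e dart) \<Rightarrow> nat \<Rightarrow> 'e dart list \<Rightarrow> bool" where
  "con J d k P \<longleftrightarrow> (if k = 0 then \<forall>i\<in>J0 J. P ! i = d i
     else if k \<le> 2 * s then k \<in> JB J \<longrightarrow> last P = dk d k
     else \<forall>i\<in>JQ J. P ! i = flip (d (2 * l - 1 - i)))"

definition \<rho> :: "nat set \<Rightarrow> nat \<Rightarrow> real" where
  "\<rho> J k = (if k = 0 then r0 (J0 J) else if k \<le> 2 * s then (if k \<in> JB J then 1 / (\<delta> * \<theta>) else 1) else r0 (JQ J))"

lemma card_split:
  assumes "J \<subseteq> {..<2 * l}"
  shows "card J = card (J0 J) + card (JB J) + card (JQ J)"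
proof -
  have fin: "finite (J0 J)" "finite (JB J)" "finite (JQ J)" unfolding J0_def JB_def JQ_def by auto
  have eq: "J = J0 J \<union> (\<lambda>k. t + k - 1) ` JB J \<union> (\<lambda>i. 2 * l - 1 - i) ` JQ J"
  proof
    show "J \<subseteq> J0 J \<union> (\<lambda>k. t + k - 1) ` JB J \<union> (\<lambda>i. 2 * l - 1 - i) ` JQ J"
    proof
      fix i assume i: "i \<in> J"
      then have i2: "i < 2 * l" using assms by auto
      consider "i < t" | "t \<le> i" "i < t + 2 * s" | "t + 2 * s \<le> i" by linarith
      then show "i \<in> J0 J \<union> (\<lambda>k. t + k - 1) ` JB J \<union> (\<lambda>i. 2 * l - 1 - i) ` JQ J"
      proof cases
        case 1 then show ?thesis using i unfolding J0_def by simp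
      next
        case 2
        then have "i = t + (i - t + 1) - 1" "i - t + 1 \<in> JB J" using i unfolding JB_def by auto
        then show ?thesis by blast
      next
        case 3
        then have "i = 2 * l - 1 - (2 * l - 1 - i)" "2 * l - 1 - i \<in> JQ J" using i i2 l_eq unfolding JQ_def by auto
        then show ?thesis by blast
      qed
    qed
  qed (auto simp: J0_def JB_def JQ_def)
  have i1: "card ((\<lambda>k. t + k - 1) ` JB J) = card (JB J)"
    by (rule card_image) (auto simp: inj_on_def JB_def)
  have i2: "card ((\<lambda>i. 2 * l - 1 - i) ` JQ J) = card (JQ J)"
    by (rule card_image) (use l_eq in \<open>auto simp: inj_on_def JQ_def\<close>)
  have d1: "J0 J \<inter> (\<lambda>k. t + k - 1) ` JB J = {}" unfolding J0_def JB_def by auto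
  have d2: "(J0 J \<union> (\<lambda>k. t + k - 1) ` JB J) \<inter> (\<lambda>i. 2 * l - 1 - i) ` JQ J = {}"
    using l_eq unfolding J0_def JB_def JQ_def by auto
  have "card J = card (J0 J \<union> (\<lambda>k. t + k - 1) ` JB J \<union> (\<lambda>i. 2 * l - 1 - i) ` JQ J)" using eq by simp
  also have "\<dots> = card (J0 J \<union> (\<lambda>k. t + k - 1) ` JB J) + card (JQ J)"
    using card_Un_disjoint[OF _ _ d2] fin i2 by simp
  also have "\<dots> = card (J0 J) + card (JB J) + card (JQ J)"
    using card_Un_disjoint[OF _ _ d1] fin i1 by simp
  finally show ?thesis .
qed

lemma match_con:
  assumes c: "c \<in> \<Gamma>" and m: "\<forall>i\<in>J. dl c ! i = d i" and k: "k < mm"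
  shows "con J d k (c ! k)"
proof -
  have "dl c ! i = c ! 0 ! i" if "i \<in> J0 J" for i using dl_nth_0[OF c] that unfolding J0_def by simp
  moreover have "last (c ! k) = dk d k" if "k \<in> JB J"
  proof -
    have k': "1 \<le> k" "k \<le> 2 * s" "t + k - 1 \<in> J" using that unfolding JB_def by auto
    have "zd k (c ! k) = d (t + k - 1)" using dl_nth_mid[OF c k'(1,2)] m k'(3) by simp
    then have "(if odd k then flip (zd k (c ! k)) else zd k (c ! k)) = dk d k" unfolding dk_def by simp
    then show ?thesis unfolding zd_def by (simp split: if_splits)
  qed
  moreover have "c ! (2 * s + 1) ! i = flip (d (2 * l - 1 - i))" if "i \<in> JQ J" for i
  proof -
    have i: "i < t" "2 * l - 1 - i \<in> J" using that unfolding JQ_def by auto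
    have "flip (c ! (2 * s + 1) ! i) = d (2 * l - 1 - i)" using dl_nth_last[OF c i(1)] m i(2) by simp
    then have "flip (flip (c ! (2 * s + 1) ! i)) = flip (d (2 * l - 1 - i))" by (rule arg_cong)
    then show ?thesis by simp
  qed
  moreover have "k = 2 * s + 1" if "\<not> k \<le> 2 * s" using k that unfolding mm_def by simp
  ultimately show ?thesis using m unfolding con_def J0_def by auto
qed

lemma rho_pos: "0 < \<rho> J k"
  unfolding \<rho>_def using r0_pos delta th_pos by simp

text \<open>The first and the last walk are linked to their neighbours by end pairs, whose
  transition index is even, so their price is \<open>r0\<close>. The final dart of a zigzag walk
  costs at most \<open>1 / (\<delta> * \<theta>)\<close> for either kind of key.\<close>

lemma con_hit:
  assumes P: "P \<in> W" and k: "k < mm" and i: "k = 0 \<or> k = 2 * s + 1 \<Longrightarrow> even i"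
  shows "sum om {P'\<in>{P\<in>W. con J d k P}. key i P' = key i P} \<le> \<rho> J k * ch.mass i (key i P)"
proof -
  consider "k = 0" | "k \<noteq> 0" "k \<le> 2 * s" | "k \<noteq> 0" "\<not> k \<le> 2 * s" by blast
  then show ?thesis
  proof cases
    case 1
    then have ev: "even i" using i by simp
    have "{P'\<in>{P\<in>W. con J d k P}. key i P' = key i P} = {P'\<in>W. endk P' = endk P \<and> (\<forall>i\<in>J0 J. P' ! i = d i)}"
      using 1 ev unfolding con_def key_def by auto
    moreover have "J0 J \<subseteq> {..<t}" unfolding J0_def by auto
    ultimately show ?thesis using end_darts[OF P, of "J0 J" d] 1 unfolding mass_even[OF ev] \<rho>_def by simp
  next
    case 2
    show ?thesis
    proof (cases "k \<in> JB J")
      case True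
      then have "{P'\<in>{P\<in>W. con J d k P}. key i P' = key i P} = {P'\<in>W. last P' = dk d k \<and> key i P' = key i P}"
        using 2 unfolding con_def by auto
      then show ?thesis using last_dart[OF P, of "dk d k" i] True 2 unfolding \<rho>_def by simp
    next
      case False
      then have "\<rho> J k = 1" using 2 unfolding \<rho>_def by simp
      then show ?thesis using ch.free_in[of "{P\<in>W. con J d k P}" i "key i P"] by simp
    qed
  next
    case 3
    then have k': "k = 2 * s + 1" using k unfolding mm_def by simp
    then have ev: "even i" using i by simp
    have "{P'\<in>{P\<in>W. con J d k P}. key i P' = key i P} = {P'\<in>W. endk P' = endk P \<and> (\<forall>i\<in>JQ J. P' ! i = flip (d (2 * l - 1 - i)))}"
      using 3 ev unfolding con_def key_def by auto
    moreover have "JQ J \<subseteq> {..<t}" unfolding JQ_def by auto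
    ultimately show ?thesis using end_darts[OF P, of "JQ J" "\<lambda>i. flip (d (2 * l - 1 - i))"] 3 unfolding mass_even[OF ev] \<rho>_def by simp
  qed
qed

definition Cs :: "nat set \<Rightarrow> (nat \<Rightarrow> 'e dart) \<Rightarrow> 'e dart list set list" where
  "Cs J d = map (\<lambda>k. {P\<in>W. con J d k P}) [0..<mm]"

lemma Cs_nth: "k < mm \<Longrightarrow> Cs J d ! k = {P\<in>W. con J d k P}" and Cs_len: "length (Cs J d) = mm"
  unfolding Cs_def by simp_all

lemma match_sub: "{c\<in>\<Gamma>. \<forall>i\<in>J. dl c ! i = d i} \<subseteq> listset (Cs J d)"
proof
  fix c assume "c \<in> {c\<in>\<Gamma>. \<forall>i\<in>J. dl c ! i = d i}"
  then have c: "c \<in> \<Gamma>" "\<forall>i\<in>J. dl c ! i = d i" by auto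
  have "c ! k \<in> Cs J d ! k" if "k < mm" for k
    using match_con[OF c that] c(1) that unfolding Gamma_iff Cs_nth[OF that] by simp
  then show "c \<in> listset (Cs J d)" unfolding listset_nth Cs_len using c(1) Gamma_iff by simp
qed

lemma listset_fin_nn:
  assumes "\<And>k. k < length Ds \<Longrightarrow> Ds ! k \<subseteq> W"
  shows "finite (listset Ds)" "c \<in> listset Ds \<Longrightarrow> 0 \<le> ch.cw 0 c"
proof -
  have all: "\<forall>C\<in>set Ds. C \<subseteq> W" using assms by (auto simp: in_set_conv_nth subset_iff)
  show "finite (listset Ds)" by (rule finite_listset) (use all finW finite_subset in blast)
  show "c \<in> listset Ds \<Longrightarrow> 0 \<le> ch.cw 0 c" by (rule ch.cw_nonneg) (rule set_listset_subset[OF _ all])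
qed

lemma match_anchor:
  assumes a: "a < mm"
  shows "sum (ch.cw 0) {c\<in>\<Gamma>. \<forall>i\<in>J. dl c ! i = d i}
    \<le> sum om {P\<in>W. con J d a P} * (\<Prod>k\<in>{..<mm} - {a}. \<rho> J k)"
proof -
  have sub: "Cs J d ! k \<subseteq> W" if "k < length (Cs J d)" for k using Cs_nth[of k J d] that Cs_len[of J d] by auto
  have "sum (ch.cw 0) {c\<in>\<Gamma>. \<forall>i\<in>J. dl c ! i = d i} \<le> sum (ch.cw 0) (listset (Cs J d))"
  proof (rule sum_mono2[OF _ match_sub])
    show "finite (listset (Cs J d))" by (rule listset_fin_nn(1)[OF sub])
    show "0 \<le> ch.cw 0 c" if "c \<in> listset (Cs J d) - {c\<in>\<Gamma>. \<forall>i\<in>J. dl c ! i = d i}" for c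
      by (rule listset_fin_nn(2)[OF sub]) (use that in auto)
  qed
  also have "\<dots> \<le> sum om (Cs J d ! a) * (\<Prod>k\<in>{..<length (Cs J d)} - {a}. \<rho> J k)"
  proof (rule ch.anchored_bound)
    show "a < length (Cs J d)" using a Cs_len by simp
    show "sum om {P'\<in>Cs J d ! k. key (0 + k) P' = key (0 + k) P} \<le> \<rho> J k * ch.mass (0 + k) (key (0 + k) P)"
      if "k < a" "P \<in> W" for k P
      using con_hit[OF that(2), of k k J d] that(1) a Cs_nth[of k J d] unfolding mm_def by simp
    show "sum om {P'\<in>Cs J d ! Suc k. key (0 + k) P' = key (0 + k) P} \<le> \<rho> J (Suc k) * ch.mass (0 + k) (key (0 + k) P)"
      if "a \<le> k" "Suc k < length (Cs J d)" "P \<in> W" for k P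
      using con_hit[OF that(3), of "Suc k" k J d] that(2) Cs_nth[of "Suc k" J d] Cs_len[of J d] unfolding mm_def by simp
    show "0 \<le> \<rho> J k" for k by (rule less_imp_le[OF rho_pos])
  qed (rule sub)
  finally show ?thesis unfolding Cs_nth[OF a] Cs_len .
qed

lemma prod_mid: "(\<Prod>k\<in>{1..2 * s}. \<rho> J k) = (1 / (\<delta> * \<theta>)) ^ card (JB J)"
proof -
  have "(\<Prod>k\<in>{1..2 * s}. \<rho> J k) = (\<Prod>k\<in>{1..2 * s}. if k \<in> JB J then 1 / (\<delta> * \<theta>) else 1)"
    by (rule prod.cong) (auto simp: \<rho>_def)
  also have "\<dots> = (\<Prod>k\<in>{1..2 * s} \<inter> JB J. 1 / (\<delta> * \<theta>))" by (rule prod.inter_restrict[symmetric]) simp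
  also have "{1..2 * s} \<inter> JB J = JB J" unfolding JB_def by auto
  finally show ?thesis by simp
qed

lemma idx: "{..<mm} - {0} = insert (2 * s + 1) {1..2 * s}" "{..<mm} - {2 * s + 1} = insert 0 {1..2 * s}"
  unfolding mm_def by auto

lemma om_start_darts:
  assumes "S \<subseteq> {..<t}" "S \<noteq> {}"
  shows "sum om {P\<in>W. \<forall>i\<in>S. P ! i = d i} \<le> 1 / M * (1 / D) ^ (card S - 1)"
proof -
  have "sum om {P\<in>W. \<forall>i\<in>S. P ! i = d i} \<le> sum om {c\<in>L t. \<forall>i\<in>S. c ! i = d i}"
    by (rule sum_mono2) (use WL finL om_L in auto)
  then show ?thesis using fixed_darts_bound[OF assms, of d] by linarith
qed

lemma power_count:
  assumes tau: "1 / \<theta> \<le> \<tau>" and j: "1 \<le> j0" and b: "jb + 2 \<le> 2 * l + 2"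
  shows "1 / M * (1 / D) ^ (j0 - 1) * (1 / (\<delta> * \<theta>)) ^ jb * ((1 / \<theta>) ^ jq / \<delta>) \<le> (1 / \<delta>) ^ (2 * l + 2) / M * \<tau> ^ (j0 + jb + jq - 1)"
proof -
  have D\<theta>: "1 / D \<le> 1 / \<theta>" using \<theta>D th_pos by (intro divide_left_mono) auto
  have x0: "0 < 1 / \<theta>" using th_pos by simp
  have \<tau>0: "0 < \<tau>" using x0 tau by linarith
  have "1 / M * (1 / D) ^ (j0 - 1) * (1 / (\<delta> * \<theta>)) ^ jb * ((1 / \<theta>) ^ jq / \<delta>)
      = (1 / \<delta>) ^ (jb + 1) / M * ((1 / D) ^ (j0 - 1) * (1 / \<theta>) ^ (jb + jq))"
    by (simp add: power_add power_mult_distrib power_divide)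
  also have "\<dots> \<le> (1 / \<delta>) ^ (2 * l + 2) / M * (\<tau> ^ (j0 - 1) * \<tau> ^ (jb + jq))"
  proof (intro mult_mono divide_right_mono)
    show "(1 / \<delta>) ^ (jb + 1) \<le> (1 / \<delta>) ^ (2 * l + 2)" using delta b by (intro power_increasing) auto
    show "(1 / D) ^ (j0 - 1) \<le> \<tau> ^ (j0 - 1)" using D\<theta> tau D_pos by (intro power_mono) auto
    show "(1 / \<theta>) ^ (jb + jq) \<le> \<tau> ^ (jb + jq)" using tau x0 by (intro power_mono) auto
  qed (use M_pos delta x0 \<tau>0 D_pos in auto)
  also have "\<tau> ^ (j0 - 1) * \<tau> ^ (jb + jq) = \<tau> ^ (j0 + jb + jq - 1)"
  proof -
    have "j0 - 1 + (jb + jq) = j0 + jb + jq - 1" using j by simp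
    then show ?thesis by (simp only: power_add[symmetric])
  qed
  finally show ?thesis .
qed

lemma prod_first: "(\<Prod>k\<in>insert (2 * s + 1) {1..2 * s}. f k) = f (2 * s + 1) * (\<Prod>k\<in>{1..2 * s}. f k)"
  and prod_last: "(\<Prod>k\<in>insert 0 {1..2 * s}. f k) = f 0 * (\<Prod>k\<in>{1..2 * s}. f k)" for f :: "nat \<Rightarrow> real"
  by (rule prod.insert; simp)+

lemma rho_ends: "\<rho> J (2 * s + 1) = r0 (JQ J)" "\<rho> J 0 = r0 (J0 J)"
  unfolding \<rho>_def by simp_all

lemma card_JB: "card (JB J) \<le> 2 * s"
proof -
  have "card (JB J) \<le> card {1..2 * s}" by (rule card_mono) (auto simp: JB_def)
  then show ?thesis by simp
qed

text \<open>The chain is anchored at a walk with a pinned dart: one dart costs \<open>1 / M\<close>,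
  every other one about \<open>1 / \<theta>\<close> or less. The deficient case is that both end
  walks are pinned completely, for then the one that is not the anchor saves only
  \<open>1 / (\<theta> ^ (t - 1) * B)\<close>. The missing \<open>B / \<theta>\<close> is recovered
  from a free dart of the zigzag, and if there is none, \<open>tau2\<close> provides exactly what is
  needed.\<close>

lemma system_bound:
  assumes J: "J \<subseteq> {..<2 * l}" "J \<noteq> {}" and tau: "1 / \<theta> \<le> \<tau>"
    and tau2: "1 / (D ^ (l - 1) * \<theta> ^ (l - 1) * B) \<le> \<tau> ^ (2 * l - 1)"
  shows "sum (ch.cw 0) {c\<in>\<Gamma>. \<forall>i\<in>J. dl c ! i = d i} \<le> (1 / \<delta>) ^ (2 * l + 2) / M * \<tau> ^ (card J - 1)"
proof -
  define \<Sigma> where "\<Sigma> = sum (ch.cw 0) {c\<in>\<Gamma>. \<forall>i\<in>J. dl c ! i = d i}"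
  have cJ: "card J = card (J0 J) + card (JB J) + card (JQ J)" by (rule card_split[OF J(1)])
  have J0t: "J0 J \<subseteq> {..<t}" and JQt: "JQ J \<subseteq> {..<t}" unfolding J0_def JQ_def by auto
  have sl: "2 * s + 2 \<le> 2 * l" using l_eq t2 by simp
  have jb: "card (JB J) + 2 \<le> 2 * l + 2" using card_JB[of J] sl by linarith
  have x0: "0 < 1 / \<theta>" and D0: "0 < 1 / D" using th_pos D_pos by auto
  have \<tau>0: "0 < \<tau>" using x0 tau by linarith
  have net: "{..<t} \<noteq> {}"
  proof -
    have "0 \<in> {..<t}" using t2 by simp
    then show ?thesis by blast
  qed
  have r0n: "r0 S = (1 / \<theta>) ^ card S / \<delta>" if "S \<noteq> {..<t}" for S unfolding r0_def using that by simp
  \<comment> \<open>In (A) and (B) the end walk that is not the anchor has a free dart. In (C) only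
    zigzag darts are pinned and one of them is the anchor. In (F) both end walks are pinned
    completely.\<close>
  consider (A) "J0 J \<noteq> {}" "JQ J \<noteq> {..<t}" | (B) "JQ J \<noteq> {}" "J0 J \<noteq> {..<t}" | (C) "J0 J = {}" "JQ J = {}"
    | (F) "J0 J = {..<t}" "JQ J = {..<t}"
    using net by (cases "J0 J = {}"; cases "JQ J = {}"; cases "J0 J = {..<t}"; cases "JQ J = {..<t}") simp_all
  then have "\<Sigma> \<le> (1 / \<delta>) ^ (2 * l + 2) / M * \<tau> ^ (card J - 1)"
  proof cases
    case A
    have j0: "1 \<le> card (J0 J)" using A(1) J0t finite_subset[OF J0t] by (simp add: card_gt_0_iff Suc_le_eq)
    have "\<Sigma> \<le> sum om {P\<in>W. con J d 0 P} * (\<Prod>k\<in>{..<mm} - {0}. \<rho> J k)"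
      unfolding \<Sigma>_def by (rule match_anchor) (simp add: mm_def)
    also have "(\<Prod>k\<in>{..<mm} - {0}. \<rho> J k) = (1 / (\<delta> * \<theta>)) ^ card (JB J) * ((1 / \<theta>) ^ card (JQ J) / \<delta>)"
      unfolding idx(1) prod_first prod_mid rho_ends r0n[OF A(2)] by (rule mult.commute)
    also have "sum om {P\<in>W. con J d 0 P} * ((1 / (\<delta> * \<theta>)) ^ card (JB J) * ((1 / \<theta>) ^ card (JQ J) / \<delta>))
        \<le> 1 / M * (1 / D) ^ (card (J0 J) - 1) * ((1 / (\<delta> * \<theta>)) ^ card (JB J) * ((1 / \<theta>) ^ card (JQ J) / \<delta>))"
    proof (rule mult_right_mono)
      show "sum om {P\<in>W. con J d 0 P} \<le> 1 / M * (1 / D) ^ (card (J0 J) - 1)"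
        using om_start_darts[OF J0t A(1), of d] unfolding con_def by simp
    qed (use delta th_pos in simp)
    finally show ?thesis using power_count[OF tau j0 jb, of "card (JQ J)"] unfolding cJ by (simp only: mult.assoc)
  next
    case B
    have j0: "1 \<le> card (JQ J)" using B(1) JQt finite_subset[OF JQt] by (simp add: card_gt_0_iff Suc_le_eq)
    have "\<Sigma> \<le> sum om {P\<in>W. con J d (2 * s + 1) P} * (\<Prod>k\<in>{..<mm} - {2 * s + 1}. \<rho> J k)"
      unfolding \<Sigma>_def by (rule match_anchor) (simp add: mm_def)
    also have "(\<Prod>k\<in>{..<mm} - {2 * s + 1}. \<rho> J k) = (1 / (\<delta> * \<theta>)) ^ card (JB J) * ((1 / \<theta>) ^ card (J0 J) / \<delta>)"
      unfolding idx(2) prod_last prod_mid rho_ends r0n[OF B(2)] by (rule mult.commute)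
    also have "sum om {P\<in>W. con J d (2 * s + 1) P} * ((1 / (\<delta> * \<theta>)) ^ card (JB J) * ((1 / \<theta>) ^ card (J0 J) / \<delta>))
        \<le> 1 / M * (1 / D) ^ (card (JQ J) - 1) * ((1 / (\<delta> * \<theta>)) ^ card (JB J) * ((1 / \<theta>) ^ card (J0 J) / \<delta>))"
    proof (rule mult_right_mono)
      show "sum om {P\<in>W. con J d (2 * s + 1) P} \<le> 1 / M * (1 / D) ^ (card (JQ J) - 1)"
        using om_start_darts[OF JQt B(1), of "\<lambda>i. flip (d (2 * l - 1 - i))"] unfolding con_def by simp
    qed (use delta th_pos in simp)
    finally show ?thesis using power_count[OF tau j0 jb, of "card (J0 J)"] unfolding cJ by (simp only: mult.assoc add.commute add.left_commute)
  next
    case C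
    have "card J = card (JB J)" using cJ C by simp
    moreover have "0 < card J" using J finite_subset by (metis card_gt_0_iff finite_lessThan)
    ultimately have cJB: "0 < card (JB J)" by simp
    then obtain a where a: "a \<in> JB J" by (metis card_gt_0_iff equals0I)
    have a': "1 \<le> a" "a \<le> 2 * s" using a unfolding JB_def by auto
    note ne = net
    have "\<Sigma> \<le> sum om {P\<in>W. con J d a P} * (\<Prod>k\<in>{..<mm} - {a}. \<rho> J k)"
      unfolding \<Sigma>_def by (rule match_anchor) (use a' in \<open>simp add: mm_def\<close>)
    also have "(\<Prod>k\<in>{..<mm} - {a}. \<rho> J k) = (1 / (\<delta> * \<theta>)) ^ (card (JB J) - 1) * (1 / \<delta>) ^ 2"
    proof -
      have i: "{..<mm} - {a} = insert 0 (insert (2 * s + 1) ({1..2 * s} - {a}))" using a' unfolding mm_def by auto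
      have "(\<Prod>k\<in>{1..2 * s}. \<rho> J k) = \<rho> J a * (\<Prod>k\<in>{1..2 * s} - {a}. \<rho> J k)" by (rule prod.remove) (use a' in auto)
      moreover have ra: "\<rho> J a = 1 / (\<delta> * \<theta>)" using a a' unfolding \<rho>_def by simp
      ultimately have "(1 / (\<delta> * \<theta>)) * (\<Prod>k\<in>{1..2 * s} - {a}. \<rho> J k) = (1 / (\<delta> * \<theta>)) * (1 / (\<delta> * \<theta>)) ^ (card (JB J) - 1)"
        using prod_mid[of J] cJB by (simp add: power_eq_if)
      then have m: "(\<Prod>k\<in>{1..2 * s} - {a}. \<rho> J k) = (1 / (\<delta> * \<theta>)) ^ (card (JB J) - 1)"
        using delta th_pos by simp
      have e: "\<rho> J 0 = 1 / \<delta>" "\<rho> J (2 * s + 1) = 1 / \<delta>" unfolding \<rho>_def C using r0n[of "{}"] ne by auto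
      have "(\<Prod>k\<in>{..<mm} - {a}. \<rho> J k) = \<rho> J 0 * (\<rho> J (2 * s + 1) * (\<Prod>k\<in>{1..2 * s} - {a}. \<rho> J k))"
        unfolding i by (subst prod.insert, simp, simp, subst prod.insert) auto
      then show ?thesis unfolding e m by (simp add: power2_eq_square)
    qed
    also have "sum om {P\<in>W. con J d a P} * ((1 / (\<delta> * \<theta>)) ^ (card (JB J) - 1) * (1 / \<delta>) ^ 2)
        \<le> 1 / M * ((1 / (\<delta> * \<theta>)) ^ (card (JB J) - 1) * (1 / \<delta>) ^ 2)"
    proof (rule mult_right_mono)
      have "{P\<in>W. con J d a P} = {P\<in>W. \<forall>i\<in>{t - 1}. P ! i = dk d a}"
        using a a' W_props(5) unfolding con_def by auto
      then show "sum om {P\<in>W. con J d a P} \<le> 1 / M" using om_start_darts[of "{t - 1}" "\<lambda>_. dk d a"] t2 by simp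
    qed (use delta th_pos in simp)
    also have "\<dots> = (1 / \<delta>) ^ (card (JB J) + 1) / M * (1 / \<theta>) ^ (card (JB J) - 1)"
    proof -
      obtain b where b: "card (JB J) = Suc b" using cJB by (metis not0_implies_Suc less_irrefl)
      show ?thesis unfolding b by (simp add: power_mult_distrib power_divide power2_eq_square)
    qed
    also have "\<dots> \<le> (1 / \<delta>) ^ (2 * l + 2) / M * \<tau> ^ (card (JB J) - 1)"
    proof (intro mult_mono divide_right_mono)
      show "(1 / \<delta>) ^ (card (JB J) + 1) \<le> (1 / \<delta>) ^ (2 * l + 2)" using delta jb by (intro power_increasing) auto
      show "(1 / \<theta>) ^ (card (JB J) - 1) \<le> \<tau> ^ (card (JB J) - 1)" using tau x0 by (intro power_mono) auto
    qed (use M_pos delta x0 in auto)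
    finally show ?thesis using \<open>card J = card (JB J)\<close> by simp
  next
    case F
    have c0: "card (J0 J) = t" "card (JQ J) = t" using F by simp_all
    note ne = net
    have startb: "sum om {P\<in>W. con J d 0 P} \<le> 1 / M * (1 / D) ^ (t - 1)"
      using om_start_darts[of "J0 J" d] F(1) ne unfolding con_def by simp
    have rQ: "r0 (JQ J) = 1 / (\<theta> ^ (t - 1) * B) / \<delta>" unfolding r0_def using F(2) by simp
    show ?thesis
    proof (cases "JB J = {1..2 * s}")
      case True
      \<comment> \<open>Everything is pinned. A zigzag walk of even number is reached through a
        penultimate pair, so its final dart costs \<open>1 / (\<delta> * D)\<close>. These
        \<open>s\<close> factors \<open>1 / D\<close>, with the \<open>t - 1\<close> factors from
        the anchor, make up \<open>D ^ (l - 1)\<close> in \<open>tau2\<close>.\<close>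
      define \<rho>' where "\<rho>' k = (if k = 2 * s + 1 then r0 (JQ J) else if odd k then 1 / (\<delta> * \<theta>) else 1 / (\<delta> * D))" for k
      have sub: "Cs J d ! k \<subseteq> W" if "k < length (Cs J d)" for k using Cs_nth[of k J d] that Cs_len[of J d] by auto
      have "\<Sigma> \<le> sum (ch.cw 0) (listset (Cs J d))"
        unfolding \<Sigma>_def
      proof (rule sum_mono2[OF _ match_sub])
        show "finite (listset (Cs J d))" by (rule listset_fin_nn(1)[OF sub])
        show "0 \<le> ch.cw 0 c" if "c \<in> listset (Cs J d) - {c\<in>\<Gamma>. \<forall>i\<in>J. dl c ! i = d i}" for c
          by (rule listset_fin_nn(2)[OF sub]) (use that in auto)
      qed
      also have "\<dots> \<le> sum om (Cs J d ! 0) * (\<Prod>k\<in>{..<length (Cs J d)} - {0}. \<rho>' k)"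
      proof (rule ch.anchored_bound)
        show "0 < length (Cs J d)" using Cs_len by (simp add: mm_def)
        show "0 \<le> \<rho>' k" for k unfolding \<rho>'_def using r0_pos[of "JQ J"] delta th_pos D_pos by simp
        show "sum om {P'\<in>Cs J d ! Suc k. key (0 + k) P' = key (0 + k) P} \<le> \<rho>' (Suc k) * ch.mass (0 + k) (key (0 + k) P)"
          if k: "0 \<le> k" "Suc k < length (Cs J d)" and P: "P \<in> W" for k P
        proof -
          have kmm: "Suc k < mm" using k(2) Cs_len by simp
          consider "Suc k = 2 * s + 1" | "Suc k \<le> 2 * s" "even k" | "Suc k \<le> 2 * s" "odd k" using kmm unfolding mm_def by linarith
          then show ?thesis
          proof cases
            case 1
            then show ?thesis using con_hit[OF P kmm, of k J d] Cs_nth[OF kmm, of J d] unfolding \<rho>'_def \<rho>_def by simp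
          next
            case 2
            then have "\<rho>' (Suc k) = \<rho> J (Suc k)" unfolding \<rho>'_def \<rho>_def True by simp
            then show ?thesis using con_hit[OF P kmm, of k J d] Cs_nth[OF kmm, of J d] 2 by simp
          next
            case 3
            have "{P'\<in>Cs J d ! Suc k. key k P' = key k P} = {P'\<in>W. penk P' = penk P \<and> last P' = dk d (Suc k)}"
              using 3 unfolding Cs_nth[OF kmm] con_def key_def True by auto
            then show ?thesis using pen_dart[OF P, of "dk d (Suc k)"] 3 mass_odd[OF 3(2), of P] unfolding \<rho>'_def by simp
          qed
        qed
      qed (use sub in auto)
      also have "Cs J d ! 0 = {P\<in>W. con J d 0 P}" by (rule Cs_nth) (simp add: mm_def)
      also have "(\<Prod>k\<in>{..<length (Cs J d)} - {0}. \<rho>' k) = r0 (JQ J) * ((1 / (\<delta> * \<theta>)) ^ s * (1 / (\<delta> * D)) ^ s)"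
      proof -
        have mid: "(\<Prod>k\<in>{1..2 * n}. if odd k then x else y) = x ^ n * y ^ n" for n and x y :: real
        proof (induction n)
          case (Suc n)
          have "{1..2 * Suc n} = insert (Suc (Suc (2 * n))) (insert (Suc (2 * n)) {1..2 * n})" by auto
          then show ?case using Suc by simp
        qed simp
        have "(\<Prod>k\<in>{1..2 * s}. \<rho>' k) = (\<Prod>k\<in>{1..2 * s}. if odd k then 1 / (\<delta> * \<theta>) else 1 / (\<delta> * D))"
          by (rule prod.cong) (auto simp: \<rho>'_def)
        moreover have "\<rho>' (2 * s + 1) = r0 (JQ J)" unfolding \<rho>'_def by simp
        ultimately show ?thesis unfolding Cs_len idx(1) prod_first by (simp only: mid)
      qed
      also have "sum om {P\<in>W. con J d 0 P} * (r0 (JQ J) * ((1 / (\<delta> * \<theta>)) ^ s * (1 / (\<delta> * D)) ^ s))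
          \<le> 1 / M * (1 / D) ^ (t - 1) * (r0 (JQ J) * ((1 / (\<delta> * \<theta>)) ^ s * (1 / (\<delta> * D)) ^ s))"
        by (rule mult_right_mono[OF startb]) (use r0_pos[of "JQ J"] delta th_pos D_pos in simp)
      also have "\<dots> = (1 / \<delta>) ^ (2 * s + 1) / M * (1 / (D ^ (l - 1) * \<theta> ^ (l - 1) * B))"
      proof -
        have ls: "l - 1 = s + (t - 1)" using tl t2 unfolding s_def by simp
        show ?thesis unfolding rQ ls by (simp add: power_add power_mult_distrib power_divide mult_2)
      qed
      also have "\<dots> \<le> (1 / \<delta>) ^ (2 * l + 2) / M * \<tau> ^ (2 * l - 1)"
      proof (intro mult_mono divide_right_mono tau2)
        show "(1 / \<delta>) ^ (2 * s + 1) \<le> (1 / \<delta>) ^ (2 * l + 2)" using delta sl by (intro power_increasing) auto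
      qed (use M_pos delta th_pos D_pos B1 in auto)
      also have "2 * l - 1 = card J - 1" using cJ c0 True l_eq by simp
      finally show ?thesis .
    next
      case False
      define G where "G = {1..2 * s} - JB J"
      have Gne: "G \<noteq> {}" "finite G" using False unfolding G_def JB_def by auto
      \<comment> \<open>\<open>g\<close> is the last zigzag walk whose dart is free. The next dart
        is pinned and fixes the vertex \<open>wv g\<close>, so that walk \<open>g\<close> must hit a
        given vertex. The price \<open>B / (\<delta> * \<theta>)\<close> supplies the factor missing
        at the last walk.\<close>
      define g where "g = Max G"
      have gG: "g \<in> G" unfolding g_def by (rule Max_in[OF Gne(2,1)])
      have g: "1 \<le> g" "g \<le> 2 * s" "g \<notin> JB J" using gG unfolding G_def by auto
      have gmax: "k \<in> JB J" if "g < k" "k \<le> 2 * s" for k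
      proof (rule ccontr)
        assume "k \<notin> JB J"
        then have "k \<in> G" using that g unfolding G_def by auto
        then have "k \<le> g" unfolding g_def by (rule Max_ge[OF Gne(2)])
        then show False using that by simp
      qed
      \<comment> \<open>If \<open>g = 2 * s\<close>, the next dart of the closed walk is the
        reversed final dart of the last walk.\<close>
      define d' where "d' = (if g < 2 * s then dk d (Suc g) else flip (d (2 * l - 1 - (t - 1))))"
      define v where "v = (if odd g then src d' else tgt d')"
      have gmm: "g < mm" "Suc g < mm" using g unfolding mm_def by auto
      define Ds where "Ds = (Cs J d)[g := {P\<in>W. wv g P = v}]"
      have Dlen: "length Ds = mm" unfolding Ds_def using Cs_len by simp
      have Dnth: "Ds ! k = (if k = g then {P\<in>W. wv g P = v} else {P\<in>W. con J d k P})" if "k < mm" for k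
        unfolding Ds_def using that gmm Cs_len Cs_nth[OF that] by (simp add: nth_list_update)
      have sub: "Ds ! k \<subseteq> W" if "k < length Ds" for k using Dnth[of k] that Dlen by auto
      define \<rho>' where "\<rho>' k = (if k = g then B / (\<delta> * \<theta>) else \<rho> J k)" for k
      have "\<Sigma> = sum (ch.cw 0) {c\<in>\<Gamma>. 0 < ch.cw 0 c \<and> (\<forall>i\<in>J. dl c ! i = d i)}"
        unfolding \<Sigma>_def
      proof (rule sum.mono_neutral_right)
        show "\<forall>c\<in>{c\<in>\<Gamma>. \<forall>i\<in>J. dl c ! i = d i} - {c\<in>\<Gamma>. 0 < ch.cw 0 c \<and> (\<forall>i\<in>J. dl c ! i = d i)}. ch.cw 0 c = 0"
        proof
          fix c assume "c \<in> {c\<in>\<Gamma>. \<forall>i\<in>J. dl c ! i = d i} - {c\<in>\<Gamma>. 0 < ch.cw 0 c \<and> (\<forall>i\<in>J. dl c ! i = d i)}"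
          then have "c \<in> \<Gamma>" "\<not> 0 < ch.cw 0 c" by blast+
          then show "ch.cw 0 c = 0" using cw_nn[of c] by simp
        qed
      qed (use finGamma in auto)
      also have "\<dots> \<le> sum (ch.cw 0) (listset Ds)"
      proof (rule sum_mono2)
        show "finite (listset Ds)" by (rule listset_fin_nn(1)[OF sub])
        show "0 \<le> ch.cw 0 c" if "c \<in> listset Ds - {c\<in>\<Gamma>. 0 < ch.cw 0 c \<and> (\<forall>i\<in>J. dl c ! i = d i)}" for c
          by (rule listset_fin_nn(2)[OF sub]) (use that in auto)
        show "{c\<in>\<Gamma>. 0 < ch.cw 0 c \<and> (\<forall>i\<in>J. dl c ! i = d i)} \<subseteq> listset Ds"
        proof
          fix c assume "c \<in> {c\<in>\<Gamma>. 0 < ch.cw 0 c \<and> (\<forall>i\<in>J. dl c ! i = d i)}"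
          then have c: "c \<in> \<Gamma>" "0 < ch.cw 0 c" "\<forall>i\<in>J. dl c ! i = d i" by blast+
          have cW: "c ! k \<in> W" if "k < mm" for k using c(1) that Gamma_iff by blast
          have "last (c ! Suc g) = d'"
          proof (cases "g < 2 * s")
            case True
            then have "Suc g \<in> JB J" using gmax[of "Suc g"] by simp
            then show ?thesis using match_con[OF c(1,3) gmm(2)] True unfolding con_def d'_def by simp
          next
            case False
            then have g2: "Suc g = 2 * s + 1" using g by simp
            have "t - 1 \<in> JQ J" using F(2) t2 by simp
            then have "c ! Suc g ! (t - 1) = flip (d (2 * l - 1 - (t - 1)))" using match_con[OF c(1,3) gmm(2)] g2 unfolding con_def by simp
            then show ?thesis using W_props(5)[OF cW[OF gmm(2)]] False unfolding d'_def by simp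
          qed
          then have "wv g (c ! Suc g) = v" unfolding wv_eq v_def by simp
          moreover have "wv g (c ! g) = wv g (c ! Suc g)" using key_link[OF c(1,2) gmm(2)] unfolding wv_def by simp
          ultimately have wg: "wv g (c ! g) = v" by simp
          have "c ! k \<in> Ds ! k" if "k < mm" for k
            using match_con[OF c(1,3) that] cW[OF that] wg unfolding Dnth[OF that] by auto
          then show "c \<in> listset Ds" unfolding listset_nth Dlen using c(1) Gamma_iff by simp
        qed
      qed
      also have "\<dots> \<le> sum om (Ds ! 0) * (\<Prod>k\<in>{..<length Ds} - {0}. \<rho>' k)"
      proof (rule ch.anchored_bound)
        show "0 < length Ds" using Dlen by (simp add: mm_def)
        show "0 \<le> \<rho>' k" for k unfolding \<rho>'_def using rho_pos[of J k] delta th_pos B1 by simp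
        show "sum om {P'\<in>Ds ! Suc k. key (0 + k) P' = key (0 + k) P} \<le> \<rho>' (Suc k) * ch.mass (0 + k) (key (0 + k) P)"
          if k: "0 \<le> k" "Suc k < length Ds" and P: "P \<in> W" for k P
        proof (cases "Suc k = g")
          case True
          have "{P'\<in>Ds ! Suc k. key (0 + k) P' = key (0 + k) P} = {P'\<in>W. wv g P' = v \<and> key (g - 1) P' = key (g - 1) P}"
            using Dnth[OF gmm(1)] True by auto
          then show ?thesis using wv_hit[OF P g(1), of v] True unfolding \<rho>'_def by auto
        next
          case False
          have kmm: "Suc k < mm" using k(2) Dlen by simp
          show ?thesis using con_hit[OF P kmm, of k J d] Dnth[OF kmm] False unfolding \<rho>'_def by simp
        qed
      qed (use sub in auto)
      also have "Ds ! 0 = {P\<in>W. con J d 0 P}" using Dnth[of 0] g by (simp add: mm_def)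
      also have "(\<Prod>k\<in>{..<length Ds} - {0}. \<rho>' k) = r0 (JQ J) * (B / (\<delta> * \<theta>) * (1 / (\<delta> * \<theta>)) ^ card (JB J))"
      proof -
        have "(\<Prod>k\<in>{1..2 * s}. \<rho>' k) = \<rho>' g * (\<Prod>k\<in>{1..2 * s} - {g}. \<rho>' k)" by (rule prod.remove) (use g in auto)
        moreover have "(\<Prod>k\<in>{1..2 * s} - {g}. \<rho>' k) = (\<Prod>k\<in>{1..2 * s} - {g}. \<rho> J k)" by (rule prod.cong) (auto simp: \<rho>'_def)
        moreover have "(\<Prod>k\<in>{1..2 * s}. \<rho> J k) = \<rho> J g * (\<Prod>k\<in>{1..2 * s} - {g}. \<rho> J k)" by (rule prod.remove) (use g in auto)
        moreover have "\<rho> J g = 1" using g unfolding \<rho>_def by simp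
        ultimately have "(\<Prod>k\<in>{1..2 * s}. \<rho>' k) = B / (\<delta> * \<theta>) * (1 / (\<delta> * \<theta>)) ^ card (JB J)"
          unfolding prod_mid by (simp add: \<rho>'_def)
        moreover have "\<rho>' (2 * s + 1) = r0 (JQ J)" using g unfolding \<rho>'_def \<rho>_def by simp
        ultimately show ?thesis unfolding Dlen idx(1) prod_first by (simp only:)
      qed
      also have "sum om {P\<in>W. con J d 0 P} * (r0 (JQ J) * (B / (\<delta> * \<theta>) * (1 / (\<delta> * \<theta>)) ^ card (JB J)))
          \<le> 1 / M * (1 / D) ^ (t - 1) * (r0 (JQ J) * (B / (\<delta> * \<theta>) * (1 / (\<delta> * \<theta>)) ^ card (JB J)))"
        by (rule mult_right_mono[OF startb]) (use r0_pos[of "JQ J"] delta th_pos B1 in simp)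
      also have "\<dots> = (1 / \<delta>) * (1 / M * (1 / D) ^ (t - 1) * (1 / (\<delta> * \<theta>)) ^ card (JB J) * ((1 / \<theta>) ^ t / \<delta>))"
      proof -
        have pt: "(1 / \<theta>) ^ t = 1 / \<theta> * (1 / \<theta>) ^ (t - 1)" using t2 by (simp add: power_eq_if)
        show ?thesis unfolding rQ pt using B1 by (simp add: power_divide)
      qed
      also have "\<dots> \<le> (1 / \<delta>) ^ (2 * l + 2) / M * \<tau> ^ (t + card (JB J) + t - 1)"
      proof -
        have cb: "card (JB J) < 2 * s"
        proof -
          have "JB J \<subset> {1..2 * s}" using False unfolding JB_def by auto
          then show ?thesis using psubset_card_mono[of "{1..2 * s}" "JB J"] by simp
        qed
        have "1 / M * (1 / D) ^ (t - 1) * (1 / (\<delta> * \<theta>)) ^ card (JB J) * ((1 / \<theta>) ^ t / \<delta>)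
            = (1 / \<delta>) ^ (card (JB J) + 1) / M * ((1 / D) ^ (t - 1) * (1 / \<theta>) ^ (card (JB J) + t))"
          by (simp add: power_add power_mult_distrib power_divide)
        then have "(1 / \<delta>) * (1 / M * (1 / D) ^ (t - 1) * (1 / (\<delta> * \<theta>)) ^ card (JB J) * ((1 / \<theta>) ^ t / \<delta>))
            = (1 / \<delta>) ^ (card (JB J) + 2) / M * ((1 / D) ^ (t - 1) * (1 / \<theta>) ^ (card (JB J) + t))" by simp
        also have "\<dots> \<le> (1 / \<delta>) ^ (2 * l + 2) / M * (\<tau> ^ (t - 1) * \<tau> ^ (card (JB J) + t))"
        proof (intro mult_mono divide_right_mono)
          show "(1 / \<delta>) ^ (card (JB J) + 2) \<le> (1 / \<delta>) ^ (2 * l + 2)" using delta jb by (intro power_increasing) auto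
          have "1 / D \<le> 1 / \<theta>" using \<theta>D th_pos by (intro divide_left_mono) auto
          then show "(1 / D) ^ (t - 1) \<le> \<tau> ^ (t - 1)" using tau D_pos by (intro power_mono) auto
          show "(1 / \<theta>) ^ (card (JB J) + t) \<le> \<tau> ^ (card (JB J) + t)" using tau x0 by (intro power_mono) auto
        qed (use M_pos delta x0 \<tau>0 D_pos in auto)
        also have "\<tau> ^ (t - 1) * \<tau> ^ (card (JB J) + t) = \<tau> ^ (t + card (JB J) + t - 1)"
        proof -
          have "t - 1 + (card (JB J) + t) = t + card (JB J) + t - 1" using t2 by simp
          then show ?thesis by (simp only: power_add[symmetric])
        qed
        finally show ?thesis .
      qed
      finally show ?thesis unfolding cJ c0 .
    qed
  qed
  then show ?thesis unfolding \<Sigma>_def .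
qed

end

text \<open>At most two darts lie over an edge, which determines the power of \<open>2\<close>. Of
  the factors \<open>8 * 4 ^ l = 1 / \<delta>\<close>, \<open>2 * l + 2\<close> come from
  \<open>system_bound\<close> and one from the mass \<open>\<delta>\<close> of the good chains;
  \<open>a\<close> converts \<open>1 / M\<close> into \<open>1 / card X\<close>.\<close>

theorem (in multigraph) thin_case:
  fixes X :: "'e set"
  assumes l: "2 \<le> l" and few: "2 * card V * (\<theta> ^ (l - 1) * B) \<le> D ^ l" and small: "64 * real l ^ 2 * 4 ^ l * B \<le> \<theta>"
    and tau: "1 / \<theta> \<le> \<tau>" "1 / (D ^ (l - 1) * \<theta> ^ (l - 1) * B) \<le> \<tau> ^ (2 * l - 1)"
    and X: "finite X" "\<And>d. d \<in> Dt \<Longrightarrow> lab d \<in> X" "card X \<le> a * M"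
    and pair: "\<And>d d'. d \<in> Dt \<Longrightarrow> d' \<in> Dt \<Longrightarrow> lab d = lab d' \<Longrightarrow> {src d, tgt d} = {src d', tgt d'}"
  shows "\<exists>w. spread (2 * l) (2 ^ (2 * l * (2 * (2 * l))) * a * (8 * 4 ^ l) ^ (2 * l + 3)) \<tau> X w \<and>
    (\<forall>F. w F > 0 \<longrightarrow> (\<exists>ds. length ds = 2 * l \<and> set ds \<subseteq> Dt \<and> distinct (map src ds) \<and> distinct (map lab ds) \<and>
      map tgt ds = rotate1 (map src ds) \<and> F = set (map lab ds)))"
proof -
  obtain t W where W: "2 \<le> t" "t \<le> l" "W \<subseteq> L t" "1 / (4 * 4 ^ l) \<le> sum om W"
    "\<forall>c\<in>W. om c > 0 \<and> thin (butlast c) \<and> thin (tl c) \<and> fat t c \<and> distinct (vs c) \<and>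
      1 / (8 * 4 ^ l) * q t (src (hd c)) (tgt (last c)) \<le> sum om {c'\<in>W. endk c' = endk c} \<and>
      1 / (8 * 4 ^ l) * q (t - 1) (src (hd c)) (src (last c)) \<le> sum om {c'\<in>W. penk c' = penk c}"
    using exists_walk_family[OF l few small] by (elim exE conjE) (rule that)
  interpret wf: walk_family Dt D B \<theta> t l W
  proof unfold_locales
    show "2 \<le> t" "t \<le> l" "W \<subseteq> L t" "64 * real l ^ 2 * 4 ^ l * B \<le> \<theta>" "1 / (4 * 4 ^ l) \<le> sum om W"
      by (rule W small)+
  qed (use W(5) in blast)+
  have \<tau>0: "0 \<le> \<tau>" using tau(1) th_pos by (meson less_imp_le order_trans zero_le_divide_1_iff)
  have a0: "0 \<le> a"
  proof -
    have "0 \<le> a * M" using X(3) by (meson of_nat_0_le_iff order_trans)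
    then show ?thesis using M_pos by (simp add: zero_le_mult_iff)
  qed
  have dlDt: "set (wf.dl c) \<subseteq> Dt" if c: "c \<in> wf.\<Gamma>" for c
  proof -
    have cW: "c ! k \<in> W" if "k < wf.mm" for k using c that wf.Gamma_iff by blast
    have "wf.zd k (c ! k) \<in> Dt" if "k < wf.mm" for k
      using wf.last_Dt[OF cW[OF that]] wf.flip_Dt unfolding wf.zd_def by auto
    moreover have "set (c ! 0) \<subseteq> Dt" "set (c ! (2 * wf.s + 1)) \<subseteq> Dt"
      using wf.W_props(2)[OF cW[of 0]] wf.W_props(2)[OF cW[of "2 * wf.s + 1"]] by (auto simp: wf.mm_def)
    ultimately show ?thesis unfolding wf.dl_def using wf.flip_Dt by (auto simp: wf.mm_def)
  qed
  have card2: "card {d\<in>Dt. lab d = e} \<le> 2" for e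
  proof (cases "{d\<in>Dt. lab d = e} = {}")
    case True
    then show ?thesis by (simp only: card.empty)
  next
    case False
    then obtain d where d: "d \<in> Dt" "lab d = e" by blast
    have "{d\<in>Dt. lab d = e} \<subseteq> {d, (tgt d, e, src d)}"
    proof
      fix d' assume "d' \<in> {d\<in>Dt. lab d = e}"
      then have d': "d' \<in> Dt" "lab d' = e" by auto
      have "{src d, tgt d} = {src d', tgt d'}" using pair[OF d(1) d'(1)] d d' by simp
      then have "src d' = src d \<and> tgt d' = tgt d \<or> src d' = tgt d \<and> tgt d' = src d" by (auto simp: doubleton_eq_iff)
      then show "d' \<in> {d, (tgt d, e, src d)}" using d(2) d'(2) by (auto simp: prod_eq_iff)
    qed
    then have "card {d\<in>Dt. lab d = e} \<le> card {d, (tgt d, e, src d)}" by (intro card_mono) auto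
    then show ?thesis by (rule le_trans) (simp add: card_insert_if)
  qed
  have goodG: "wf.good \<subseteq> wf.\<Gamma>" unfolding wf.good_def by blast
  have closed: "map tgt (wf.dl c) = rotate1 (map src (wf.dl c))" "distinct (map src (wf.dl c))" "distinct (map lab (wf.dl c))"
    if "c \<in> wf.good" for c
  proof -
    have c: "c \<in> wf.\<Gamma>" "0 < wf.ch.cw 0 c" "distinct (map src (wf.dl c))" using that unfolding wf.good_def by auto
    show cl: "map tgt (wf.dl c) = rotate1 (map src (wf.dl c))" by (rule wf.map_src_dl(2)[OF c(1,2)])
    show "distinct (map src (wf.dl c))" by (rule c(3))
    show "distinct (map lab (wf.dl c))"
    proof (rule closed_walk_labels_distinct[OF wf.length_dl[OF c(1)] _ c(3) cl])
      show "3 \<le> 2 * l" using l by simp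
      show "{src d, tgt d} = {src d', tgt d'}" if "d \<in> set (wf.dl c)" "d' \<in> set (wf.dl c)" "lab d = lab d'" for d d'
        using pair dlDt[OF c(1)] that by blast
    qed
  qed
  let ?b = "(1 / wf.\<delta>) ^ (2 * l + 2) * a"
  obtain w where w: "spread (2 * l) (2 ^ (2 * l * (2 * (2 * l))) * ?b / wf.\<delta>) \<tau> X w"
    "\<forall>F. w F > 0 \<longrightarrow> (\<exists>\<gamma>\<in>wf.good. F = set (map lab (wf.dl \<gamma>)))"
  proof -
    have "\<exists>w. spread (2 * l) (2 ^ (2 * l * (2 * (2 * l))) * ?b / wf.\<delta>) \<tau> X w \<and>
      (\<forall>F. w F > 0 \<longrightarrow> (\<exists>\<gamma>\<in>wf.good. F = set (map lab (wf.dl \<gamma>))))"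
    proof (rule spread_of_system[where \<Gamma> = wf.\<Gamma> and \<Gamma>' = wf.good and g = "wf.ch.cw 0" and Lab = Dt])
      show "finite X" by (rule X(1))
      show "finite wf.\<Gamma>" by (rule wf.finGamma)
      show "wf.good \<subseteq> wf.\<Gamma>" by (rule goodG)
      show "0 \<le> wf.ch.cw 0 \<gamma>" if "\<gamma> \<in> wf.\<Gamma>" for \<gamma> by (rule wf.cw_nn[OF that])
      show "0 < wf.\<delta>" "wf.\<delta> \<le> sum (wf.ch.cw 0) wf.good" using wf.delta wf.good_mass by auto
      show "length (wf.dl \<gamma>) = 2 * l" if "\<gamma> \<in> wf.good" for \<gamma> using wf.length_dl goodG that by blast
      show "distinct (map lab (wf.dl \<gamma>))" if "\<gamma> \<in> wf.good" for \<gamma> by (rule closed(3)[OF that])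
      show "lab ` set (wf.dl \<gamma>) \<subseteq> X" if "\<gamma> \<in> wf.good" for \<gamma> using dlDt goodG that X(2) by blast
      show "set (wf.dl \<gamma>) \<subseteq> Dt" if "\<gamma> \<in> wf.good" for \<gamma> using dlDt goodG that by blast
      show "finite Dt" by (rule finDt)
      show "card {d\<in>Dt. lab d = e} \<le> 2" for e by (rule card2)
      show "0 \<le> ?b" using wf.delta a0 by simp
      show "0 \<le> \<tau>" by (rule \<tau>0)
      fix J and d :: "nat \<Rightarrow> 'e dart" assume J: "J \<subseteq> {..<2 * l}" "J \<noteq> {}"
      have "sum (wf.ch.cw 0) {\<gamma>\<in>wf.\<Gamma>. \<forall>i\<in>J. wf.dl \<gamma> ! i = d i} \<le> (1 / wf.\<delta>) ^ (2 * l + 2) / M * \<tau> ^ (card J - 1)"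
        by (rule wf.system_bound[OF J tau])
      also have "\<dots> \<le> ?b / card X * \<tau> ^ (card J - 1)"
      proof (rule mult_right_mono)
        have "0 < card X"
        proof -
          obtain d where "d \<in> Dt" using ne by blast
          then have "X \<noteq> {}" using X(2) by blast
          then show ?thesis using X(1) by (simp add: card_gt_0_iff)
        qed
        then have "1 / M \<le> a / card X" using X(3) M_pos by (simp add: field_simps)
        then have "(1 / wf.\<delta>) ^ (2 * l + 2) * (1 / M) \<le> (1 / wf.\<delta>) ^ (2 * l + 2) * (a / card X)"
          using wf.delta by (intro mult_left_mono) auto
        then show "(1 / wf.\<delta>) ^ (2 * l + 2) / M \<le> ?b / card X" by simp
      qed (use \<tau>0 in simp)
      finally show "sum (wf.ch.cw 0) {\<gamma>\<in>wf.\<Gamma>. \<forall>i\<in>J. wf.dl \<gamma> ! i = d i} \<le> ?b / card X * \<tau> ^ (card J - 1)" .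
    qed
    then show ?thesis using that by blast
  qed
  have K: "2 ^ (2 * l * (2 * (2 * l))) * ?b / wf.\<delta> = 2 ^ (2 * l * (2 * (2 * l))) * a * (8 * 4 ^ l) ^ (2 * l + 3)"
    unfolding wf.\<delta>_def by (simp add: eval_nat_numeral)
  show ?thesis
  proof (intro exI[of _ w] conjI allI impI)
    show "spread (2 * l) (2 ^ (2 * l * (2 * (2 * l))) * a * (8 * 4 ^ l) ^ (2 * l + 3)) \<tau> X w" using w(1) unfolding K .
    fix F assume "0 < w F"
    then obtain \<gamma> where g: "\<gamma> \<in> wf.good" "F = set (map lab (wf.dl \<gamma>))" using w(2) by blast
    show "\<exists>ds. length ds = 2 * l \<and> set ds \<subseteq> Dt \<and> distinct (map src ds) \<and> distinct (map lab ds) \<and>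
      map tgt ds = rotate1 (map src ds) \<and> F = set (map lab ds)"
      using closed[OF g(1)] g(2) dlDt[of \<gamma>] wf.length_dl[of \<gamma>] goodG g(1) by blast
  qed
qed

section \<open>Hypergraphs in which all pairs have large codegree\<close>

definition cd :: "nat set set \<Rightarrow> nat set \<Rightarrow> real" where
  "cd X A = real (card {e\<in>X. A \<subseteq> e})"

lemma cd_nonneg: "0 \<le> cd X A" unfolding cd_def by simp

lemma sum_cd_subsets:
  assumes "finite X" "\<And>e. e \<in> X \<Longrightarrow> finite e \<and> card e = r"
  shows "(\<Sum>p | p \<subseteq> \<Union>X \<and> card p = i. cd X p) = real (r choose i) * card X"
proof -
  have fU: "finite (\<Union>X)" using assms by auto
  let ?w = "\<lambda>e. if e \<in> X then 1 else 0 :: real"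
  have "cod (\<Union>X) ?w p = cd X p" for p
  proof -
    have "cod (\<Union>X) ?w p = (\<Sum>e\<in>{e. e \<subseteq> \<Union>X \<and> p \<subseteq> e} \<inter> X. 1)"
      unfolding cod_def using fU by (intro sum.mono_neutral_cong_right) auto
    also have "{e. e \<subseteq> \<Union>X \<and> p \<subseteq> e} \<inter> X = {e\<in>X. p \<subseteq> e}" by auto
    finally show ?thesis unfolding cd_def by simp
  qed
  then have "(\<Sum>p | p \<subseteq> \<Union>X \<and> card p = i. cd X p) = (\<Sum>p | p \<subseteq> \<Union>X \<and> card p = i. cod (\<Union>X) ?w p)" by simp
  also have "\<dots> = real (r choose i) * sum ?w (Pow (\<Union>X))"
    by (rule sum_cod_subsets[OF fU]) (use assms(2) in \<open>auto split: if_splits\<close>)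
  also have "sum ?w (Pow (\<Union>X)) = card X"
  proof -
    have "sum ?w (Pow (\<Union>X)) = (\<Sum>e\<in>X. 1)" using fU by (intro sum.mono_neutral_cong_right) auto
    then show ?thesis by simp
  qed
  finally show ?thesis .
qed

lemma sum_cd_extensions:
  assumes "finite X" "\<And>e. e \<in> X \<Longrightarrow> finite e \<and> card e = r" and p: "card p = 2"
  shows "(\<Sum>w\<in>\<Union>X - p. cd X (insert w p)) = real (r - 2) * cd X p"
proof -
  have fU: "finite (\<Union>X)" using assms by auto
  have fp: "finite p" using p by (simp add: card_ge_0_finite)
  have "(\<Sum>w\<in>\<Union>X - p. cd X (insert w p)) = (\<Sum>w\<in>\<Union>X - p. \<Sum>e\<in>{e\<in>X. p \<subseteq> e}. if w \<in> e then 1 else 0)"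
  proof (rule sum.cong[OF refl])
    fix w assume "w \<in> \<Union>X - p"
    have "{e\<in>X. insert w p \<subseteq> e} = {e\<in>{e\<in>X. p \<subseteq> e}. w \<in> e}" by auto
    then show "cd X (insert w p) = (\<Sum>e\<in>{e\<in>X. p \<subseteq> e}. if w \<in> e then 1 else 0)"
      unfolding cd_def using assms(1) by (simp add: sum.inter_filter[symmetric])
  qed
  also have "\<dots> = (\<Sum>e\<in>{e\<in>X. p \<subseteq> e}. \<Sum>w\<in>\<Union>X - p. if w \<in> e then 1 else 0)" by (rule sum.swap)
  also have "\<dots> = (\<Sum>e\<in>{e\<in>X. p \<subseteq> e}. real (r - 2))"
  proof (rule sum.cong[OF refl])
    fix e assume e: "e \<in> {e\<in>X. p \<subseteq> e}"
    have "(\<Sum>w\<in>\<Union>X - p. if w \<in> e then 1 else 0 :: real) = (\<Sum>w\<in>e - p. 1)"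
      using e fU by (intro sum.mono_neutral_cong_right) auto
    also have "\<dots> = card (e - p)" by simp
    also have "card (e - p) = r - 2" using e assms(2)[of e] p fp by (simp add: card_Diff_subset)
    finally show "(\<Sum>w\<in>\<Union>X - p. if w \<in> e then 1 else 0 :: real) = real (r - 2)" .
  qed
  finally show ?thesis unfolding cd_def by simp
qed

lemma card_subset_pow_le:
  assumes "finite S"
  shows "card {A. A \<subseteq> S \<and> card A = k} \<le> card S ^ k"
proof -
  have "card {A. A \<subseteq> S \<and> card A = k} = card S choose k" by (rule n_subsets[OF assms])
  also have "\<dots> \<le> card S ^ k" by (cases "k \<le> card S") (auto simp: binomial_le_pow binomial_eq_0)
  finally show ?thesis .
qed

text \<open>The codegrees of all extensions of \<open>p\<close> add up to
  \<open>(r - 2) * cd X p\<close>, so at most \<open>M0 / (4 * r ^ 2)\<close> extensions are heavy.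
  An edge counted here consists of \<open>p\<close> and heavy vertices, so the number of such edges
  is at most the \<open>(r - 2)\<close>-th power of this, and
  \<open>M0 ^ (r - 2) \<le> cd X p\<close>.\<close>

lemma bad_extension_count:
  assumes X: "finite X" "\<And>e. e \<in> X \<Longrightarrow> finite e \<and> card e = r" and r: "3 \<le> r"
    and p: "card p = 2" and M0: "1 \<le> M0" "M0 ^ (r - 2) \<le> cd X p"
  shows "real (card {e\<in>X. p \<subseteq> e \<and> (\<forall>w\<in>e - p. 4 * real r ^ 3 * cd X p / M0 < cd X (insert w p))}) \<le> cd X p / (4 * real r ^ 2)"
proof -
  define S where "S = {w\<in>\<Union>X - p. 4 * real r ^ 3 * cd X p / M0 < cd X (insert w p)}"
  let ?E = "{e\<in>X. p \<subseteq> e \<and> (\<forall>w\<in>e - p. 4 * real r ^ 3 * cd X p / M0 < cd X (insert w p))}"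
  have fU: "finite (\<Union>X)" using X by auto
  have fS: "finite S" by (rule finite_subset[OF _ fU]) (auto simp: S_def)
  have fp: "finite p" using p by (simp add: card_ge_0_finite)
  have cp: "0 < cd X p" using M0 by (meson less_le_trans one_le_power zero_less_one)
  have rpos: "0 < real r" using r by simp
  have "card S * (4 * real r ^ 3 * cd X p / M0) \<le> (\<Sum>w\<in>S. cd X (insert w p))"
    using sum_bounded_below[of S "4 * real r ^ 3 * cd X p / M0" "\<lambda>w. cd X (insert w p)"] unfolding S_def by auto
  also have "\<dots> \<le> (\<Sum>w\<in>\<Union>X - p. cd X (insert w p))"
    by (rule sum_mono2) (use fU in \<open>auto simp: S_def cd_nonneg\<close>)
  also have "\<dots> = real (r - 2) * cd X p" by (rule sum_cd_extensions[OF X p])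
  also have "\<dots> \<le> real r * cd X p" using cp by (intro mult_right_mono) auto
  finally have "card S * (4 * real r ^ 3) * cd X p \<le> real r * M0 * cd X p" using M0(1) by (simp add: field_simps)
  then have "card S * (4 * real r ^ 3) \<le> real r * M0" using cp by (simp only: mult_le_cancel_right_pos)
  then have "(card S * (4 * real r ^ 2)) * real r \<le> M0 * real r" by (simp add: power3_eq_cube power2_eq_square mult_ac)
  then have S1: "card S * (4 * real r ^ 2) \<le> M0" using rpos by (simp only: mult_le_cancel_right_pos)
  have inj: "inj_on (\<lambda>e. e - p) ?E" by (rule inj_onI) blast
  have "card ?E = card ((\<lambda>e. e - p) ` ?E)" by (rule card_image[OF inj, symmetric])
  also have "\<dots> \<le> card {A. A \<subseteq> S \<and> card A = r - 2}"
  proof (rule card_mono)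
    show "finite {A. A \<subseteq> S \<and> card A = r - 2}" using fS by simp
    show "(\<lambda>e. e - p) ` ?E \<subseteq> {A. A \<subseteq> S \<and> card A = r - 2}"
    proof (rule image_subsetI)
      fix e assume e: "e \<in> ?E"
      then have "card (e - p) = r - 2" using X(2)[of e] p fp by (simp add: card_Diff_subset)
      then show "e - p \<in> {A. A \<subseteq> S \<and> card A = r - 2}" using e unfolding S_def by auto
    qed
  qed
  also have "\<dots> \<le> card S ^ (r - 2)" by (rule card_subset_pow_le[OF fS])
  finally have "card ?E \<le> card S ^ (r - 2)" .
  then have "real (card ?E) \<le> real (card S ^ (r - 2))" by (simp only: of_nat_le_iff)
  also have "\<dots> = real (card S) ^ (r - 2)" by (rule of_nat_power)
  also have "\<dots> = (card S * (4 * real r ^ 2)) ^ (r - 2) / (4 * real r ^ 2) ^ (r - 2)"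
    using rpos by (simp add: power_mult_distrib)
  also have "\<dots> \<le> M0 ^ (r - 2) / (4 * real r ^ 2)"
  proof (rule frac_le)
    show "(card S * (4 * real r ^ 2)) ^ (r - 2) \<le> M0 ^ (r - 2)" by (rule power_mono[OF S1]) simp
    have "1 \<le> real r ^ 2" using r by simp
    then have "1 \<le> 4 * real r ^ 2" by linarith
    then have "(4 * real r ^ 2) ^ 1 \<le> (4 * real r ^ 2) ^ (r - 2)" using r by (intro power_increasing) auto
    then show "4 * real r ^ 2 \<le> (4 * real r ^ 2) ^ (r - 2)" by simp
  qed (use M0 rpos in auto)
  also have "\<dots> \<le> cd X p / (4 * real r ^ 2)" using M0 by (intro divide_right_mono) auto
  finally show ?thesis .
qed

text \<open>Each edge selects a triple of least codegree inside it. If a pair \<open>p\<close> of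
  this triple has some light extension within the edge, minimality transfers the bound to the
  triple; edges without a light extension are rare by \<open>bad_extension_count\<close>. The weight
  of a triple is the number of edges selecting it, and a subfamily maximising \<open>\<Phi>\<close>
  keeps a fixed share of the codegree at each of its pairs.\<close>

lemma exists_triple_family:
  assumes X: "finite X" "\<And>e. e \<in> X \<Longrightarrow> finite e \<and> card e = r" and r: "3 \<le> r"
    and Y: "Y \<subseteq> X" "card X \<le> 2 * card Y" and M0: "1 \<le> M0"
    and pairs: "\<And>e p. e \<in> Y \<Longrightarrow> p \<subseteq> e \<Longrightarrow> card p = 2 \<Longrightarrow> M0 ^ (r - 2) \<le> cd X p"
  shows "\<exists>\<T> \<nu>. finite \<T> \<and> real (card X) / 8 \<le> sum \<nu> \<T> \<and>
    (\<forall>T\<in>\<T>. card T = 3 \<and> 0 < \<nu> T \<and> \<nu> T \<le> cd X T \<and> (\<exists>e\<in>Y. T \<subseteq> e)) \<and>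
    (\<forall>T\<in>\<T>. \<forall>p\<subseteq>T. card p = 2 \<longrightarrow> cd X T \<le> 4 * real r ^ 3 * cd X p / M0 \<and>
       1 / (8 * real r ^ 2) * cd X p \<le> sum \<nu> {T'\<in>\<T>. p \<subseteq> T'}) \<and>
    (\<forall>p. sum \<nu> {T\<in>\<T>. p \<subseteq> T} \<le> cd X p)"
proof -
  define bad where "bad p = {e\<in>X. p \<subseteq> e \<and> (\<forall>w\<in>e - p. 4 * real r ^ 3 * cd X p / M0 < cd X (insert w p))}" for p
  define Pr where "Pr = {p. p \<subseteq> \<Union>X \<and> card p = 2}"
  have fU: "finite (\<Union>X)" using X by auto
  have finPr: "finite Pr" unfolding Pr_def using fU by simp
  define PY where "PY = {p\<in>Pr. M0 ^ (r - 2) \<le> cd X p}"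
  define Z where "Z = Y - (\<Union>p\<in>PY. bad p)"
  have rpos: "0 < real r" "1 \<le> real r ^ 2" using r by auto
  have cbad: "real (card (\<Union>p\<in>PY. bad p)) \<le> card X / 4"
  proof -
    have "card (\<Union>p\<in>PY. bad p) \<le> (\<Sum>p\<in>PY. card (bad p))" by (rule card_UN_le) (use finPr in \<open>auto simp: PY_def\<close>)
    then have "real (card (\<Union>p\<in>PY. bad p)) \<le> real (\<Sum>p\<in>PY. card (bad p))" by (simp only: of_nat_le_iff)
    also have "\<dots> = (\<Sum>p\<in>PY. real (card (bad p)))" by (rule of_nat_sum)
    also have "\<dots> \<le> (\<Sum>p\<in>PY. cd X p / (4 * real r ^ 2))"
      by (rule sum_mono) (use bad_extension_count[OF X r _ M0] in \<open>auto simp: PY_def Pr_def bad_def\<close>)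
    also have "\<dots> \<le> (\<Sum>p\<in>Pr. cd X p / (4 * real r ^ 2))"
      by (rule sum_mono2[OF finPr]) (auto simp: PY_def cd_nonneg)
    also have "\<dots> = real (r choose 2) * card X / (4 * real r ^ 2)"
      using sum_cd_subsets[OF X, of 2] unfolding Pr_def by (simp only: sum_divide_distrib[symmetric])
    also have "\<dots> \<le> real r ^ 2 * card X / (4 * real r ^ 2)"
    proof -
      have "r choose 2 \<le> r ^ 2" using r by (intro binomial_le_pow) auto
      then have "real (r choose 2) \<le> real (r ^ 2)" by (simp only: of_nat_le_iff)
      then have "real (r choose 2) \<le> real r ^ 2" by (simp only: of_nat_power)
      then show ?thesis by (intro divide_right_mono mult_right_mono) auto
    qed
    also have "\<dots> = card X / 4" using rpos by simp
    finally show ?thesis .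
  qed
  have fY: "finite Y" using Y(1) X(1) finite_subset by blast
  have cZ: "card X / 4 \<le> card Z"
  proof -
    have "card Y \<le> card Z + card (\<Union>p\<in>PY. bad p)"
    proof -
      have "finite (\<Union>p\<in>PY. bad p)" by (rule finite_subset[OF _ X(1)]) (auto simp: bad_def)
      then have "card Y \<le> card (Z \<union> (\<Union>p\<in>PY. bad p))" unfolding Z_def using fY by (intro card_mono) auto
      also have "\<dots> \<le> card Z + card (\<Union>p\<in>PY. bad p)" by (rule card_Un_le)
      finally show ?thesis .
    qed
    then have "real (card Y) \<le> card Z + real (card (\<Union>p\<in>PY. bad p))" by (simp flip: of_nat_add)
    moreover have "real (card X) \<le> 2 * real (card Y)" using Y(2) by linarith
    ultimately show ?thesis using cbad by linarith
  qed
  have ZY: "Z \<subseteq> Y" "Z \<subseteq> X" unfolding Z_def using Y(1) by auto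
  have fZ: "finite Z" using ZY fY finite_subset by blast
  define tri where "tri e = {T. T \<subseteq> e \<and> card T = 3}" for e :: "nat set"
  have tri_fin: "finite (tri e)" "tri e \<noteq> {}" if eX: "e \<in> X" for e
  proof -
    show "finite (tri e)" unfolding tri_def using X(2)[OF eX] by simp
    have "3 \<le> card e" using X(2)[OF eX] r by simp
    then obtain T where "T \<subseteq> e" "card T = 3" by (rule obtain_subset_with_card_n)
    then show "tri e \<noteq> {}" unfolding tri_def by blast
  qed
  define tr where "tr e = arg_min_on (cd X) (tri e)" for e
  have tr: "tr e \<subseteq> e" "card (tr e) = 3" "\<And>T. T \<subseteq> e \<Longrightarrow> card T = 3 \<Longrightarrow> cd X (tr e) \<le> cd X T" if eX: "e \<in> X" for e
  proof -
    have "tr e \<in> tri e" unfolding tr_def by (rule arg_min_if_finite(1)[OF tri_fin[OF eX]])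
    then show "tr e \<subseteq> e" "card (tr e) = 3" unfolding tri_def by auto
    show "cd X (tr e) \<le> cd X T" if "T \<subseteq> e" "card T = 3" for T
      unfolding tr_def by (rule arg_min_least[OF tri_fin[OF eX]]) (use that in \<open>auto simp: tri_def\<close>)
  qed
  have trsmall: "cd X (tr e) \<le> 4 * real r ^ 3 * cd X p / M0" if e: "e \<in> Z" and p: "p \<subseteq> tr e" "card p = 2" for e p
  proof -
    have eX: "e \<in> X" "e \<in> Y" using e ZY by auto
    have pe: "p \<subseteq> e" using p tr(1)[OF eX(1)] by blast
    have "p \<in> PY" using pairs[OF eX(2) pe p(2)] pe eX(1) p(2) unfolding PY_def Pr_def by auto
    then have "e \<notin> bad p" using e unfolding Z_def by blast
    then obtain w where w: "w \<in> e - p" "\<not> 4 * real r ^ 3 * cd X p / M0 < cd X (insert w p)"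
      using eX(1) pe unfolding bad_def by blast
    have "card (insert w p) = 3" using w p(2) by (simp add: card_ge_0_finite)
    then have "cd X (tr e) \<le> cd X (insert w p)" using tr(3)[OF eX(1)] w(1) pe by simp
    then show ?thesis using w(2) by linarith
  qed
  define \<nu> where "\<nu> T = real (card {e\<in>Z. tr e = T})" for T
  define \<T>0 where "\<T>0 = tr ` Z"
  have fin0: "finite \<T>0" unfolding \<T>0_def using fZ by simp
  have sum_nu: "sum \<nu> S = card {e\<in>Z. tr e \<in> S}" if "finite S" for S
  proof -
    have "card {e\<in>Z. tr e \<in> S} = card (\<Union>T\<in>S. {e\<in>Z. tr e = T})" by (rule arg_cong[where f = card]) auto
    also have "\<dots> = (\<Sum>T\<in>S. card {e\<in>Z. tr e = T})" by (rule card_UN_disjoint) (use that fZ in auto)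
    finally show ?thesis unfolding \<nu>_def by simp
  qed
  have nu_le: "sum \<nu> {T\<in>S. p \<subseteq> T} \<le> cd X p" if "finite S" for S p
  proof -
    have "sum \<nu> {T\<in>S. p \<subseteq> T} = card {e\<in>Z. tr e \<in> {T\<in>S. p \<subseteq> T}}" by (rule sum_nu) (use that in simp)
    also have "\<dots> \<le> cd X p" unfolding cd_def
    proof (intro of_nat_mono card_mono)
      show "finite {e\<in>X. p \<subseteq> e}" using X(1) by simp
      show "{e\<in>Z. tr e \<in> {T\<in>S. p \<subseteq> T}} \<subseteq> {e\<in>X. p \<subseteq> e}" using ZY(2) tr(1) by blast
    qed
    finally show ?thesis .
  qed
  \<comment> \<open>\<open>\<delta> * (r choose 2) \<le> 1 / 8\<close>, so the penalty in
    \<open>\<Phi>\<close> takes at most half of the mass, which is at least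
    \<open>card X / 4\<close>.\<close>
  define \<delta> where "\<delta> = 1 / (8 * real r ^ 2)"
  have \<delta>: "0 < \<delta>" unfolding \<delta>_def using rpos by simp
  define prs where "prs S = {p. card p = 2 \<and> (\<exists>T\<in>S. p \<subseteq> T)}" for S :: "nat set set"
  have prs_sub: "prs S \<subseteq> Pr" if SS: "S \<subseteq> \<T>0" for S
  proof
    fix p assume "p \<in> prs S"
    then obtain T where T: "T \<in> S" "p \<subseteq> T" "card p = 2" unfolding prs_def by blast
    then obtain e where "e \<in> Z" "T = tr e" using SS unfolding \<T>0_def by blast
    then show "p \<in> Pr" using T tr(1)[of e] ZY unfolding Pr_def by blast
  qed
  define \<Phi> where "\<Phi> S = sum \<nu> S - \<delta> * (\<Sum>p\<in>prs S. cd X p)" for S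
  have finPhi: "finite (\<Phi> ` Pow \<T>0)" "\<Phi> ` Pow \<T>0 \<noteq> {}" using fin0 by auto
  obtain \<T> where T: "\<T> \<in> Pow \<T>0" "\<Phi> \<T> = Max (\<Phi> ` Pow \<T>0)" using Max_in[OF finPhi] by (metis imageE)
  have max: "\<Phi> S \<le> \<Phi> \<T>" if "S \<subseteq> \<T>0" for S unfolding T(2) using finPhi(1) that by (intro Max_ge) auto
  have TT0: "\<T> \<subseteq> \<T>0" using T(1) by simp
  have fT: "finite \<T>" using TT0 fin0 finite_subset by blast
  have finprs: "finite (prs S)" if "S \<subseteq> \<T>0" for S using prs_sub[OF that] finPr finite_subset by blast
  have massT: "card X / 8 \<le> sum \<nu> \<T>"
  proof -
    have s0: "sum \<nu> \<T>0 = card Z"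
    proof -
      have "{e\<in>Z. tr e \<in> \<T>0} = Z" unfolding \<T>0_def by auto
      then show ?thesis using sum_nu[OF fin0] by simp
    qed
    have "(\<Sum>p\<in>prs \<T>0. cd X p) \<le> (\<Sum>p\<in>Pr. cd X p)"
      by (rule sum_mono2[OF finPr prs_sub]) (auto simp: cd_nonneg)
    also have "\<dots> = real (r choose 2) * card X" unfolding Pr_def by (rule sum_cd_subsets[OF X])
    also have "\<dots> \<le> real r ^ 2 * card X"
    proof -
      have "r choose 2 \<le> r ^ 2" using r by (intro binomial_le_pow) auto
      then have "real (r choose 2) \<le> real (r ^ 2)" by (simp only: of_nat_le_iff)
      then have "real (r choose 2) \<le> real r ^ 2" by (simp only: of_nat_power)
      then show ?thesis by (intro mult_right_mono) auto
    qed
    finally have "\<delta> * (\<Sum>p\<in>prs \<T>0. cd X p) \<le> \<delta> * (real r ^ 2 * card X)" using \<delta> by (intro mult_left_mono) auto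
    also have "\<dots> = card X / 8" unfolding \<delta>_def using rpos by simp
    finally have "card X / 8 \<le> \<Phi> \<T>0" unfolding \<Phi>_def s0 using cZ by linarith
    also have "\<dots> \<le> \<Phi> \<T>" by (rule max) simp
    also have "\<dots> \<le> sum \<nu> \<T>"
    proof -
      have "0 \<le> \<delta> * (\<Sum>p\<in>prs \<T>. cd X p)" using \<delta> by (intro mult_nonneg_nonneg sum_nonneg cd_nonneg) auto
      then show ?thesis unfolding \<Phi>_def by linarith
    qed
    finally show ?thesis .
  qed
  have clean: "\<delta> * cd X p \<le> sum \<nu> {T'\<in>\<T>. p \<subseteq> T'}" if T': "T' \<in> \<T>" "p \<subseteq> T'" "card p = 2" for T' p
  proof -
    let ?S = "\<T> - {T'\<in>\<T>. p \<subseteq> T'}"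
    have SS: "?S \<subseteq> \<T>0" using TT0 by blast
    have "\<Phi> ?S \<le> \<Phi> \<T>" by (rule max[OF SS])
    moreover have "sum \<nu> \<T> = sum \<nu> ?S + sum \<nu> {T'\<in>\<T>. p \<subseteq> T'}"
      by (rule sum.subset_diff[OF _ fT]) blast
    moreover have "(\<Sum>p\<in>prs ?S. cd X p) + cd X p \<le> (\<Sum>p\<in>prs \<T>. cd X p)"
    proof -
      have "p \<notin> prs ?S" unfolding prs_def by blast
      then have "(\<Sum>p\<in>prs ?S. cd X p) + cd X p = (\<Sum>p\<in>insert p (prs ?S). cd X p)" using finprs[OF SS] by simp
      also have "\<dots> \<le> (\<Sum>p\<in>prs \<T>. cd X p)"
        by (rule sum_mono2[OF finprs[OF TT0]]) (use T' in \<open>auto simp: prs_def cd_nonneg\<close>)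
      finally show ?thesis .
    qed
    then have "\<delta> * (\<Sum>p\<in>prs ?S. cd X p) + \<delta> * cd X p \<le> \<delta> * (\<Sum>p\<in>prs \<T>. cd X p)"
      using mult_left_mono[of _ _ \<delta>] \<delta> by (simp only: distrib_left[symmetric] less_imp_le)
    ultimately show ?thesis unfolding \<Phi>_def by linarith
  qed
  show ?thesis
  proof (intro exI[of _ \<T>] exI[of _ \<nu>] conjI)
    show "finite \<T>" "real (card X) / 8 \<le> sum \<nu> \<T>" by fact+
    show "\<forall>p. sum \<nu> {T\<in>\<T>. p \<subseteq> T} \<le> cd X p" using nu_le[OF fT] by blast
    have Te: "\<exists>e\<in>Z. T = tr e" if "T \<in> \<T>" for T using that TT0 unfolding \<T>0_def by blast
    show "\<forall>T\<in>\<T>. card T = 3 \<and> 0 < \<nu> T \<and> \<nu> T \<le> cd X T \<and> (\<exists>e\<in>Y. T \<subseteq> e)"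
    proof
      fix T assume "T \<in> \<T>"
      then obtain e where e: "e \<in> Z" "T = tr e" using Te by blast
      have eX: "e \<in> X" "e \<in> Y" using e ZY by auto
      have "card {e} \<le> card {e\<in>Z. tr e = T}" using e fZ by (intro card_mono) auto
      then have "0 < \<nu> T" unfolding \<nu>_def by simp
      moreover have "\<nu> T \<le> cd X T" unfolding \<nu>_def cd_def
      proof (intro of_nat_mono card_mono)
        show "finite {e\<in>X. T \<subseteq> e}" using X(1) by simp
        show "{e\<in>Z. tr e = T} \<subseteq> {e\<in>X. T \<subseteq> e}" using ZY(2) tr(1) by blast
      qed
      ultimately show "card T = 3 \<and> 0 < \<nu> T \<and> \<nu> T \<le> cd X T \<and> (\<exists>e\<in>Y. T \<subseteq> e)"
        using tr(1,2)[OF eX(1)] eX(2) e(2) by blast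
    qed
    show "\<forall>T\<in>\<T>. \<forall>p\<subseteq>T. card p = 2 \<longrightarrow> cd X T \<le> 4 * real r ^ 3 * cd X p / M0 \<and>
       1 / (8 * real r ^ 2) * cd X p \<le> sum \<nu> {T'\<in>\<T>. p \<subseteq> T'}"
    proof (intro ballI allI impI conjI)
      fix T p assume T: "T \<in> \<T>" "p \<subseteq> T" "card p = 2"
      obtain e where e: "e \<in> Z" "T = tr e" using Te[OF T(1)] by blast
      show "cd X T \<le> 4 * real r ^ 3 * cd X p / M0" unfolding e(2) by (rule trsmall[OF e(1)]) (use T e in auto)
      show "1 / (8 * real r ^ 2) * cd X p \<le> sum \<nu> {T'\<in>\<T>. p \<subseteq> T'}"
        using clean[OF T] unfolding \<delta>_def .
    qed
  qed
qed

section \<open>Fans of triangles\<close>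

lemma card_listset: "card (listset As) = (\<Prod>i<length As. card (As ! i))"
proof (induction As)
  case (Cons A As)
  have eq: "listset (A # As) = (\<lambda>(P, c). P # c) ` (A \<times> listset As)" by (auto simp: set_Cons_def)
  have "inj_on (\<lambda>(P, c). P # c) (A \<times> listset As)" by (auto intro: inj_onI)
  then have "card (listset (A # As)) = card A * card (listset As)"
    unfolding eq by (simp add: card_image card_cartesian_product)
  also have "\<dots> = (\<Prod>i<length (A # As). card ((A # As) ! i))"
    unfolding Cons length_Cons lessThan_Suc_eq_insert_0 by (subst prod.insert) (auto simp: prod.reindex)
  finally show ?case .
qed simp

text \<open>A nonempty set of residues that is closed under successors is everything. For the
  boundary of a fan: a proper nonempty set of sides touches at least one more vertex than it has
  sides.\<close>

lemma cyclic_closure_card: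
  assumes J: "J \<subseteq> {..<n}" "J \<noteq> {}" "J \<noteq> {..<n}"
  shows "card J + 1 \<le> card (J \<union> (\<lambda>j. Suc j mod n) ` J)"
proof (rule ccontr)
  let ?f = "\<lambda>j. Suc j mod n"
  assume "\<not> ?thesis"
  moreover have fJ: "finite J" using J(1) finite_subset by blast
  ultimately have "card (J \<union> ?f ` J) \<le> card J" by simp
  then have "J \<union> ?f ` J = J" using fJ by (intro card_seteq[symmetric]) auto
  then have step: "?f j \<in> J" if "j \<in> J" for j using that by blast
  obtain j where j: "j \<in> J" using J(2) by blast
  then have n: "j < n" "0 < n" using J(1) by auto
  have all: "(j + i) mod n \<in> J" for i
  proof (induction i)
    case (Suc i)
    have "?f ((j + i) mod n) \<in> J" by (rule step[OF Suc])
    then show ?case by (simp add: mod_Suc_eq)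
  qed (use j n in simp)
  have "{..<n} \<subseteq> J"
  proof
    fix i assume "i \<in> {..<n}"
    then have "(j + (n - j + i)) mod n = i" using n by simp
    then show "i \<in> J" using all[of "n - j + i"] by simp
  qed
  then show False using J(1,3) by blast
qed

text \<open>The states of the chain are triangles with a distinguished apex \<open>pa\<close>, and consecutive triangles
  share the apex and the vertex that is new in the earlier one. A chain of \<open>2 * l - 2\<close> of them is a fan,
  whose boundary is a cycle of length \<open>2 * l\<close>; its sides are then covered by independent uniformly
  random edges of \<open>X\<close>.\<close>

locale fat_family =
  fixes X :: "nat set set" and r l :: nat and \<T> :: "nat set set" and \<nu> :: "nat set \<Rightarrow> real" and M0 \<kappa> B :: real
  assumes finX: "finite X" and unif: "e \<in> X \<Longrightarrow> finite e \<and> card e = r" and l2: "2 \<le> l"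
    and finT: "finite \<T>" and T3: "T \<in> \<T> \<Longrightarrow> card T = 3" and nu_pos: "T \<in> \<T> \<Longrightarrow> 0 < \<nu> T"
    and pairB: "T \<in> \<T> \<Longrightarrow> p \<subseteq> T \<Longrightarrow> card p = 2 \<Longrightarrow> B \<le> cd X p"
    and ratio: "T \<in> \<T> \<Longrightarrow> p \<subseteq> T \<Longrightarrow> card p = 2 \<Longrightarrow> \<nu> T \<le> \<kappa> / M0 * sum \<nu> {T'\<in>\<T>. p \<subseteq> T'}"
    and pair_le: "sum \<nu> {T\<in>\<T>. p \<subseteq> T} \<le> cd X p"
    and kappa: "1 \<le> \<kappa>" and M0B: "M0 \<le> B" and big: "16 * real l ^ 2 * \<kappa> \<le> M0"
    and massT: "card X / 8 \<le> sum \<nu> \<T>" and Xne: "X \<noteq> {}"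
begin

definition pa :: "nat \<times> nat \<times> nat \<Rightarrow> nat" where "pa P = fst P"
text \<open>The two vertices besides the apex are stored by the parity of the step in which they are
  new. In state \<open>k\<close> the new vertex is \<open>nw k\<close> and the old one is
  \<open>nw (Suc k)\<close>. One function then serves as outgoing and as incoming key, and the chain
  is balanced for trivial reasons.\<close>

definition nw :: "nat \<Rightarrow> nat \<times> nat \<times> nat \<Rightarrow> nat" where "nw k P = (if odd k then fst (snd P) else snd (snd P))"
definition tset :: "nat \<times> nat \<times> nat \<Rightarrow> nat set" where "tset P = {fst P, fst (snd P), snd (snd P)}"

definition W :: "(nat \<times> nat \<times> nat) set" where
  "W = {P. tset P \<in> \<T> \<and> fst P \<noteq> fst (snd P) \<and> fst P \<noteq> snd (snd P) \<and> fst (snd P) \<noteq> snd (snd P)}"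

definition om :: "nat \<times> nat \<times> nat \<Rightarrow> real" where "om P = \<nu> (tset P)"

definition key :: "nat \<Rightarrow> nat \<times> nat \<times> nat \<Rightarrow> nat \<times> nat" where "key i P = (pa P, nw i P)"

lemma M0_pos: "0 < M0" "1 \<le> M0" and B_pos: "0 < B" and x1: "0 < \<kappa> / M0" "\<kappa> / M0 \<le> 1"
proof -
  have "1 \<le> real l ^ 2" using l2 by simp
  then have "16 * 1 * \<kappa> \<le> 16 * real l ^ 2 * \<kappa>" using kappa by (intro mult_right_mono mult_left_mono) auto
  then have *: "16 * \<kappa> \<le> M0" using big by simp
  then show M: "0 < M0" "1 \<le> M0" using kappa by auto
  then show "0 < B" using M0B by linarith
  show "0 < \<kappa> / M0" "\<kappa> / M0 \<le> 1" using * kappa M by auto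
qed

lemma finW: "finite W"
proof (rule finite_subset)
  have "finite (\<Union>\<T>)" using finT T3 by (metis card_ge_0_finite finite_Union zero_less_numeral)
  then show "finite (\<Union>\<T> \<times> \<Union>\<T> \<times> \<Union>\<T>)" by simp
  show "W \<subseteq> \<Union>\<T> \<times> \<Union>\<T> \<times> \<Union>\<T>" unfolding W_def tset_def by auto
qed

lemma om_pos: "P \<in> W \<Longrightarrow> 0 < om P" unfolding W_def om_def using nu_pos by simp

lemma tset_eq: "tset P = {pa P, nw k P, nw (Suc k) P}"
  unfolding tset_def pa_def nw_def by auto

lemma W_dist: "P \<in> W \<Longrightarrow> pa P \<noteq> nw k P" "P \<in> W \<Longrightarrow> nw k P \<noteq> nw (Suc k) P"
  unfolding W_def pa_def nw_def by auto

lemma W_T: "P \<in> W \<Longrightarrow> tset P \<in> \<T>" unfolding W_def by simp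

lemma P_eqI: "pa P = pa P' \<Longrightarrow> nw k P = nw k P' \<Longrightarrow> nw (Suc k) P = nw (Suc k) P' \<Longrightarrow> P = P'"
  unfolding pa_def nw_def by (auto simp: prod_eq_iff split: if_splits)

sublocale ch: key_chain W om key key
  by unfold_locales (use finW om_pos in auto)

lemma sum_inj_le:
  assumes "S \<subseteq> W" "inj_on tset S" "\<And>P. P \<in> S \<Longrightarrow> p \<subseteq> tset P"
  shows "sum om S \<le> sum \<nu> {T\<in>\<T>. p \<subseteq> T}"
proof -
  have "sum om S = sum \<nu> (tset ` S)" unfolding om_def using assms(2) by (simp add: sum.reindex)
  also have "\<dots> \<le> sum \<nu> {T\<in>\<T>. p \<subseteq> T}"
  proof (rule sum_mono2)
    show "tset ` S \<subseteq> {T\<in>\<T>. p \<subseteq> T}" using assms(1,3) W_T by blast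
    show "0 \<le> \<nu> T" if "T \<in> {T\<in>\<T>. p \<subseteq> T} - tset ` S" for T using that nu_pos[of T] by simp
  qed (use finT in simp)
  finally show ?thesis .
qed

text \<open>Each triple through the pair yields a state with this key when its third vertex is
  placed in the open coordinate, and different triples yield different states.\<close>

lemma mass_ge:
  assumes P: "P \<in> W"
  shows "sum \<nu> {T\<in>\<T>. {pa P, nw i P} \<subseteq> T} \<le> ch.mass i (key i P)"
proof -
  define f where "f T = (THE v. T = {pa P, nw i P, v} \<and> v \<noteq> pa P \<and> v \<noteq> nw i P)" for T
  define mk where "mk v = (if odd i then (pa P, nw i P, v) else (pa P, v, nw i P))" for v
  have ne: "pa P \<noteq> nw i P" by (rule W_dist(1)[OF P])
  have ex: "\<exists>v. T = {pa P, nw i P, v} \<and> v \<noteq> pa P \<and> v \<noteq> nw i P" if T: "T \<in> \<T>" "{pa P, nw i P} \<subseteq> T" for T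
  proof -
    have fT: "finite T" using T3[OF T(1)] by (simp add: card_ge_0_finite)
    have "card (T - {pa P, nw i P}) = 1" using T3[OF T(1)] T(2) ne by (simp add: card_Diff_subset)
    then obtain v where "T - {pa P, nw i P} = {v}" by (auto simp: card_1_singleton_iff)
    then have "T = {pa P, nw i P, v} \<and> v \<noteq> pa P \<and> v \<noteq> nw i P" using T(2) by blast
    then show ?thesis by blast
  qed
  obtain g where g: "\<And>T. T \<in> \<T> \<Longrightarrow> {pa P, nw i P} \<subseteq> T \<Longrightarrow> T = {pa P, nw i P, g T} \<and> g T \<noteq> pa P \<and> g T \<noteq> nw i P"
    using ex by metis
  let ?S = "{T\<in>\<T>. {pa P, nw i P} \<subseteq> T}"
  have tm: "tset (mk v) = {pa P, nw i P, v}" for v unfolding mk_def tset_def by auto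
  have inj: "inj_on (\<lambda>T. mk (g T)) ?S"
  proof (rule inj_onI)
    fix T T' assume T: "T \<in> ?S" "T' \<in> ?S" "mk (g T) = mk (g T')"
    have "T = tset (mk (g T))" "T' = tset (mk (g T'))" unfolding tm using g T(1,2) by blast+
    then show "T = T'" using T(3) by simp
  qed
  have "sum \<nu> ?S = sum om ((\<lambda>T. mk (g T)) ` ?S)"
  proof -
    have "sum om ((\<lambda>T. mk (g T)) ` ?S) = (\<Sum>T\<in>?S. om (mk (g T)))" using inj by (simp add: sum.reindex)
    also have "\<dots> = sum \<nu> ?S" by (rule sum.cong[OF refl]) (use g in \<open>auto simp: om_def tm\<close>)
    finally show ?thesis ..
  qed
  also have "\<dots> \<le> ch.mass i (key i P)"
    unfolding ch.mass_def
  proof (rule sum_mono2)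
    show "finite {P'\<in>W. key i P' = key i P}" using finW by simp
    show "(\<lambda>T. mk (g T)) ` ?S \<subseteq> {P'\<in>W. key i P' = key i P}"
    proof (rule image_subsetI)
      fix T assume "T \<in> ?S"
      then have T: "T \<in> \<T>" "T = {pa P, nw i P, g T}" "g T \<noteq> pa P" "g T \<noteq> nw i P" using g by blast+
      have "tset (mk (g T)) \<in> \<T>" unfolding tm using T(1,2) by simp
      then have "mk (g T) \<in> W" unfolding W_def using T(3,4) ne unfolding mk_def by auto
      moreover have "key i (mk (g T)) = key i P" unfolding key_def mk_def pa_def nw_def by auto
      ultimately show "mk (g T) \<in> {P'\<in>W. key i P' = key i P}" by simp
    qed
    show "0 \<le> om P'" if "P' \<in> {P'\<in>W. key i P' = key i P} - (\<lambda>T. mk (g T)) ` ?S" for P'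
      using that om_pos[of P'] by simp
  qed
  finally show ?thesis .
qed

text \<open>A key and the new vertex determine the state, so at most one triangle contributes, and
  \<open>ratio\<close> bounds its share.\<close>

lemma hit:
  assumes P: "P \<in> W"
  shows "sum om {P'\<in>W. nw (Suc i) P' = u \<and> key i P' = key i P} \<le> \<kappa> / M0 * ch.mass i (key i P)"
proof (cases "{P'\<in>W. nw (Suc i) P' = u \<and> key i P' = key i P} = {}")
  case True
  show ?thesis unfolding True sum.empty
    by (rule mult_nonneg_nonneg[OF less_imp_le[OF x1(1)] less_imp_le[OF ch.mass_pos[OF P]]])
next
  case False
  then obtain Q where Q: "Q \<in> W" "nw (Suc i) Q = u" "key i Q = key i P" by blast
  have one: "{P'\<in>W. nw (Suc i) P' = u \<and> key i P' = key i P} = {Q}"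
  proof
    show "{P'\<in>W. nw (Suc i) P' = u \<and> key i P' = key i P} \<subseteq> {Q}"
    proof
      fix P' assume "P' \<in> {P'\<in>W. nw (Suc i) P' = u \<and> key i P' = key i P}"
      then have "nw (Suc i) P' = u" "key i P' = key i P" by auto
      then have "P' = Q" using Q P_eqI[of P' Q i] unfolding key_def by simp
      then show "P' \<in> {Q}" by simp
    qed
  qed (use Q in auto)
  have "om Q \<le> \<kappa> / M0 * sum \<nu> {T'\<in>\<T>. {pa Q, nw i Q} \<subseteq> T'}"
    unfolding om_def by (rule ratio[OF W_T[OF Q(1)]]) (use W_dist(1)[OF Q(1), of i] tset_eq[of Q i] in auto)
  also have "\<dots> \<le> \<kappa> / M0 * ch.mass i (key i Q)"
    using mass_ge[OF Q(1), of i] x1 by (intro mult_left_mono) auto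
  finally show ?thesis unfolding one Q(3) by simp
qed

definition mm :: nat where "mm = 2 * l - 2"
definition \<Gamma>c :: "(nat \<times> nat \<times> nat) list set" where "\<Gamma>c = {c\<in>listset (replicate mm W). 0 < ch.cw 0 c}"
text \<open>Vertices \<open>0\<close> and \<open>1\<close> are the apex and the old vertex of the
  first triangle, vertex \<open>j \<ge> 2\<close> is the new vertex of triangle
  \<open>j - 2\<close>. Truncated subtraction makes \<open>vtx\<close> read vertices
  \<open>0\<close> and \<open>1\<close> from triangle \<open>0\<close>.\<close>

definition cf :: "nat \<Rightarrow> nat \<times> nat \<times> nat \<Rightarrow> nat" where
  "cf j P = (if j = 0 then pa P else if j = 1 then nw 1 P else nw (j - 2) P)"
definition vtx :: "(nat \<times> nat \<times> nat) list \<Rightarrow> nat \<Rightarrow> nat" where "vtx c j = cf j (c ! (j - 2))"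
definition st :: "nat \<Rightarrow> nat" where "st j = (if j = 0 then 0 else min (j - 1) (mm - 1))"
definition pr :: "(nat \<times> nat \<times> nat) list \<Rightarrow> nat \<Rightarrow> nat set" where
  "pr c j = {vtx c j, vtx c (Suc j mod (2 * l))}"

lemma mm_pos: "0 < mm" "2 * l = mm + 2" unfolding mm_def using l2 by auto

lemma Gc: "c \<in> \<Gamma>c \<Longrightarrow> length c = mm" "c \<in> \<Gamma>c \<Longrightarrow> k < mm \<Longrightarrow> c ! k \<in> W" "c \<in> \<Gamma>c \<Longrightarrow> 0 < ch.cw 0 c"
  "c \<in> \<Gamma>c \<Longrightarrow> set c \<subseteq> W"
proof -
  assume c: "c \<in> \<Gamma>c"
  then have L: "c \<in> listset (replicate mm W)" and "0 < ch.cw 0 c" unfolding \<Gamma>c_def by auto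
  then show "length c = mm" "k < mm \<Longrightarrow> c ! k \<in> W" "0 < ch.cw 0 c" unfolding listset_nth by auto
  show "set c \<subseteq> W" by (rule set_listset_subset[OF L]) auto
qed

lemma finGc: "finite \<Gamma>c"
proof -
  have "finite (listset (replicate mm W))" by (rule finite_listset) (use finW in auto)
  then show ?thesis unfolding \<Gamma>c_def by simp
qed

lemma link: "c \<in> \<Gamma>c \<Longrightarrow> Suc k < mm \<Longrightarrow> key k (c ! k) = key k (c ! Suc k)"
  using ch.cw_pos_key[of 0 c k] Gc[of c] by simp

lemma nw_parity: "nw (Suc (Suc k)) P = nw k P" unfolding nw_def by simp

lemma coords:
  assumes c: "c \<in> \<Gamma>c" and k: "k < mm"
  shows "pa (c ! k) = vtx c 0" "nw k (c ! k) = vtx c (k + 2)" "nw (Suc k) (c ! k) = vtx c (k + 1)"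
proof -
  show "pa (c ! k) = vtx c 0" using k
  proof (induction k)
    case 0 then show ?case unfolding vtx_def cf_def by simp
  next
    case (Suc k)
    then show ?case using link[OF c, of k] unfolding key_def by simp
  qed
  show "nw k (c ! k) = vtx c (k + 2)" unfolding vtx_def cf_def by simp
  show "nw (Suc k) (c ! k) = vtx c (k + 1)"
  proof (cases k)
    case 0 then show ?thesis unfolding vtx_def cf_def by simp
  next
    case (Suc k')
    have "nw (Suc k) (c ! k) = nw k' (c ! k)" unfolding Suc by (rule nw_parity)
    also have "\<dots> = nw k' (c ! k')" using link[OF c, of k'] k unfolding Suc key_def by simp
    also have "\<dots> = vtx c (k + 1)" unfolding vtx_def cf_def Suc by simp
    finally show ?thesis .
  qed
qed

lemma st_mm: "st j < mm" unfolding st_def using mm_pos by auto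

text \<open>The \<open>j\<close>-th side of the boundary of the fan is a side of the triangle \<open>st j\<close>.\<close>

lemma pr_cases:
  assumes "j < 2 * l"
  obtains "j = 0" "st j = 0" "Suc j mod (2 * l) = st j + 1"
    | "j = st j + 1" "Suc j mod (2 * l) = st j + 2"
    | "j = st j + 2" "Suc j mod (2 * l) = 0"
proof -
  consider "j = 0" | "0 < j" "j \<le> mm" | "j = mm + 1" using assms mm_pos by linarith
  then show ?thesis
  proof cases
    case 1 then show ?thesis using that(1) mm_pos unfolding st_def by simp
  next
    case 2 then show ?thesis using that(2) mm_pos unfolding st_def by simp
  next
    case 3 then show ?thesis using that(3) mm_pos unfolding st_def by simp
  qed
qed

lemma pr_props:
  assumes c: "c \<in> \<Gamma>c" and j: "j < 2 * l"
  shows "pr c j \<subseteq> tset (c ! st j)" "card (pr c j) = 2" "B \<le> cd X (pr c j)"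
proof -
  note co = coords[OF c st_mm[of j]]
  note te = tset_eq[of "c ! st j" "st j"]
  have cW: "c ! st j \<in> W" by (rule Gc(2)[OF c st_mm])
  note d = W_dist(1)[OF cW, of "st j"] W_dist(1)[OF cW, of "Suc (st j)"] W_dist(2)[OF cW, of "st j"]
  have *: "pr c j \<subseteq> tset (c ! st j) \<and> card (pr c j) = 2"
    using j
  proof (cases rule: pr_cases)
    case 1
    then have "pr c j = {pa (c ! st j), nw (Suc (st j)) (c ! st j)}" unfolding pr_def co by simp
    then show ?thesis unfolding te using d by auto
  next
    case 2
    then have "pr c j = {nw (Suc (st j)) (c ! st j), nw (st j) (c ! st j)}" unfolding pr_def co by simp
    then show ?thesis unfolding te using d by auto
  next
    case 3
    then have "pr c j = {nw (st j) (c ! st j), pa (c ! st j)}" unfolding pr_def co by simp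
    then show ?thesis unfolding te using d by auto
  qed
  then show "pr c j \<subseteq> tset (c ! st j)" "card (pr c j) = 2" by auto
  then show "B \<le> cd X (pr c j)" using pairB[OF W_T[OF cW]] by blast
qed

text \<open>Once both ends of side \<open>j\<close> are pinned, a state is determined by its
  triangle, so \<open>pair_le\<close> bounds the weight by the codegree of the side. If the third
  vertex is pinned too, one state remains and \<open>ratio\<close> gains
  \<open>\<kappa> / M0\<close>.\<close>

lemma anchor_mass:
  assumes c: "c \<in> \<Gamma>c" and j: "j < 2 * l" and S: "j \<in> S" "Suc j mod (2 * l) \<in> S"
  defines "A \<equiv> st j"
  shows "sum om {P\<in>W. (0 \<in> S \<longrightarrow> pa P = vtx c 0) \<and> (A + 1 \<in> S \<longrightarrow> nw (Suc A) P = vtx c (A + 1)) \<and> (A + 2 \<in> S \<longrightarrow> nw A P = vtx c (A + 2))}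
    \<le> cd X (pr c j) * (\<kappa> / M0) ^ (card (S \<inter> {0, A + 1, A + 2}) - 2)"
    and "2 \<le> card (S \<inter> {0, A + 1, A + 2})"
proof -
  let ?S = "{P\<in>W. (0 \<in> S \<longrightarrow> pa P = vtx c 0) \<and> (A + 1 \<in> S \<longrightarrow> nw (Suc A) P = vtx c (A + 1)) \<and> (A + 2 \<in> S \<longrightarrow> nw A P = vtx c (A + 2))}"
  let ?I = "S \<inter> {0, A + 1, A + 2}"
  note co = coords[OF c st_mm[of j], folded A_def]
  have cW: "c ! A \<in> W" unfolding A_def by (rule Gc(2)[OF c st_mm])
  have two: "{0, A + 1} \<subseteq> S \<and> pr c j = {pa (c ! A), nw (Suc A) (c ! A)} \<or> {A + 1, A + 2} \<subseteq> S \<and> pr c j = {nw (Suc A) (c ! A), nw A (c ! A)}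
    \<or> {A + 2, 0} \<subseteq> S \<and> pr c j = {nw A (c ! A), pa (c ! A)}"
    using j
  proof (cases rule: pr_cases)
    case 1
    then have "{0, A + 1} \<subseteq> S" using S unfolding A_def by auto
    moreover have "pr c j = {pa (c ! A), nw (Suc A) (c ! A)}" 
      unfolding pr_def co using 1(1,3)[folded A_def] by simp
    ultimately show ?thesis by blast
  next
    case 2
    then have "{A + 1, A + 2} \<subseteq> S" using S unfolding A_def by auto
    moreover have "pr c j = {nw (Suc A) (c ! A), nw A (c ! A)}" 
      unfolding pr_def co using 2(1,2)[folded A_def] by simp
    ultimately show ?thesis by blast
  next
    case 3
    then have "{A + 2, 0} \<subseteq> S" using S unfolding A_def by auto
    moreover have "pr c j = {nw A (c ! A), pa (c ! A)}" 
      unfolding pr_def co using 3(1,2)[folded A_def] by simp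
    ultimately show ?thesis by blast
  qed
  have finI: "finite ?I" by simp
  show c2: "2 \<le> card ?I"
  proof -
    have "card {0, A + 1} = 2" "card {A + 1, A + 2} = 2" "card {A + 2, 0} = 2" by auto
    moreover have "{0, A + 1} \<subseteq> ?I \<or> {A + 1, A + 2} \<subseteq> ?I \<or> {A + 2, 0} \<subseteq> ?I" using two by blast
    ultimately show ?thesis using card_mono[OF finI] by metis
  qed
  have sub: "pr c j \<subseteq> tset P" if "P \<in> ?S" for P using two that tset_eq[of P A] unfolding co by auto
  have inj: "inj_on tset ?S"
  proof (rule inj_onI)
    fix P Q assume PQ: "P \<in> ?S" "Q \<in> ?S" "tset P = tset Q"
    have PW: "P \<in> W" "Q \<in> W" using PQ by auto
    note tP = tset_eq[of P A] and tQ = tset_eq[of Q A]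
    note dP = W_dist(1)[OF PW(1), of A] W_dist(1)[OF PW(1), of "Suc A"] W_dist(2)[OF PW(1), of A]
      and dQ = W_dist(1)[OF PW(2), of A] W_dist(1)[OF PW(2), of "Suc A"] W_dist(2)[OF PW(2), of A]
    have third: "z = z'" if "{x, y, z} = {x, y, z'}" "z \<noteq> x" "z \<noteq> y" "z' \<noteq> x" "z' \<noteq> y" for x y z z' :: nat
      using that by blast
    show "P = Q"
      using two
    proof (elim disjE conjE)
      assume "{0, A + 1} \<subseteq> S"
      then have e: "pa P = pa Q" "nw (Suc A) P = nw (Suc A) Q" using PQ by auto
      have "nw A P = nw A Q" by (rule third[of "pa P" "nw (Suc A) P"]) (use PQ(3) tP tQ e dP dQ in auto)
      then show ?thesis using P_eqI e by blast
    next
      assume "{A + 1, A + 2} \<subseteq> S"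
      then have e: "nw A P = nw A Q" "nw (Suc A) P = nw (Suc A) Q" using PQ by auto
      have "pa P = pa Q" by (rule third[of "nw A P" "nw (Suc A) P"]) (use PQ(3) tP tQ e dP dQ in auto)
      then show ?thesis using P_eqI e by blast
    next
      assume "{A + 2, 0} \<subseteq> S"
      then have e: "pa P = pa Q" "nw A P = nw A Q" using PQ by auto
      have "nw (Suc A) P = nw (Suc A) Q" by (rule third[of "pa P" "nw A P"]) (use PQ(3) tP tQ e dP dQ in auto)
      then show ?thesis using P_eqI e by blast
    qed
  qed
  have SW: "?S \<subseteq> W" by blast
  have le_cd: "sum om ?S \<le> cd X (pr c j)"
    using sum_inj_le[OF SW inj sub] pair_le[of "pr c j"] by linarith
  show "sum om ?S \<le> cd X (pr c j) * (\<kappa> / M0) ^ (card ?I - 2)"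
  proof (cases "card ?I = 2")
    case True
    then show ?thesis using le_cd by simp
  next
    case False
    have "card ?I \<le> card {0, A + 1, A + 2}" by (intro card_mono) auto
    also have "\<dots> = 3" by simp
    finally have c3: "card ?I = 3" using False c2 by linarith
    then have "?I = {0, A + 1, A + 2}" by (intro card_seteq) auto
    then have all: "0 \<in> S" "A + 1 \<in> S" "A + 2 \<in> S" by auto
    have "?S \<subseteq> {c ! A}"
    proof
      fix P assume "P \<in> ?S"
      then have "P = c ! A" using P_eqI[of P "c ! A" A] all co by simp
      then show "P \<in> {c ! A}" by simp
    qed
    then have "sum om ?S \<le> sum om {c ! A}" by (rule sum_mono2[rotated]) (use om_pos[OF cW] in auto)
    also have "\<dots> = \<nu> (tset (c ! A))" unfolding om_def by simp
    also have "\<dots> \<le> \<kappa> / M0 * sum \<nu> {T'\<in>\<T>. pr c j \<subseteq> T'}"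
      by (rule ratio[OF W_T[OF cW]]) (use pr_props(1,2)[OF c j] in \<open>auto simp: A_def\<close>)
    also have "\<dots> \<le> \<kappa> / M0 * cd X (pr c j)" using pair_le x1 by (intro mult_left_mono) auto
    finally show ?thesis using c3 by (simp add: mult.commute)
  qed
qed

text \<open>Revealed from the triangle of side \<open>j\<close>, a later triangle \<open>k\<close>
  brings the new vertex \<open>k + 2\<close> and an earlier one the vertex \<open>k + 1\<close>.
  Together with the three vertices of the anchor these are all vertices of the boundary, each
  exactly once. Every pinned vertex beyond the two ends of the side costs
  \<open>\<kappa> / M0\<close>.\<close>

lemma chain_bound:
  assumes c0: "c0 \<in> \<Gamma>c" and j: "j < 2 * l" and S: "S \<subseteq> {..<2 * l}" "j \<in> S" "Suc j mod (2 * l) \<in> S"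
  shows "sum (ch.cw 0) {c\<in>\<Gamma>c. \<forall>i\<in>S. vtx c i = vtx c0 i} \<le> cd X (pr c0 j) * (\<kappa> / M0) ^ (card S - 2)"
proof -
  define A where "A = st j"
  have Amm: "A < mm" unfolding A_def by (rule st_mm)
  define con where "con k P \<longleftrightarrow> (0 \<in> S \<longrightarrow> pa P = vtx c0 0) \<and> (k + 1 \<in> S \<longrightarrow> nw (Suc k) P = vtx c0 (k + 1)) \<and> (k + 2 \<in> S \<longrightarrow> nw k P = vtx c0 (k + 2))" for k P
  define Cs where "Cs = map (\<lambda>k. {P\<in>W. con k P}) [0..<mm]"
  have len: "length Cs = mm" and nth: "\<And>k. k < mm \<Longrightarrow> Cs ! k = {P\<in>W. con k P}" unfolding Cs_def by simp_all
  have sub: "Cs ! k \<subseteq> W" if "k < length Cs" for k using that len nth by auto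
  have all: "\<forall>C\<in>set Cs. C \<subseteq> W" unfolding Cs_def by auto
  have "sum (ch.cw 0) {c\<in>\<Gamma>c. \<forall>i\<in>S. vtx c i = vtx c0 i} \<le> sum (ch.cw 0) (listset Cs)"
  proof (rule sum_mono2)
    show "finite (listset Cs)" by (rule finite_listset) (use all finW finite_subset in blast)
    show "{c\<in>\<Gamma>c. \<forall>i\<in>S. vtx c i = vtx c0 i} \<subseteq> listset Cs"
    proof
      fix c assume "c \<in> {c\<in>\<Gamma>c. \<forall>i\<in>S. vtx c i = vtx c0 i}"
      then have c: "c \<in> \<Gamma>c" "\<forall>i\<in>S. vtx c i = vtx c0 i" by auto
      have "c ! k \<in> Cs ! k" if "k < mm" for k
        unfolding nth[OF that] con_def using Gc(2)[OF c(1) that] coords[OF c(1) that] c(2) by auto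
      then show "c \<in> listset Cs" unfolding listset_nth len using Gc(1)[OF c(1)] by simp
    qed
    show "0 \<le> ch.cw 0 c" if "c \<in> listset Cs - {c\<in>\<Gamma>c. \<forall>i\<in>S. vtx c i = vtx c0 i}" for c
      by (rule ch.cw_nonneg) (use that set_listset_subset[OF _ all] in blast)
  qed
  also have "\<dots> \<le> sum om (Cs ! A) * (\<Prod>k\<in>{..<length Cs} - {A}. if (if k < A then k + 1 else k + 2) \<in> S then \<kappa> / M0 else 1)"
  proof (rule ch.anchored_bound)
    show "A < length Cs" using Amm len by simp
    show "0 \<le> (if (if k < A then k + 1 else k + 2) \<in> S then \<kappa> / M0 else 1)" for k using x1 by simp
    fix k P assume P: "P \<in> W"
    have free: "sum om {P'\<in>Cs ! k'. key i P' = key i P} \<le> 1 * ch.mass i (key i P)" if "k' < mm" for k' i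
      by (rule ch.free_in) (use that nth in auto)
    have hitle: "sum om {P'\<in>Cs ! k'. key i P' = key i P} \<le> \<kappa> / M0 * ch.mass i (key i P)"
      if k': "k' < mm" and imp: "\<And>P'. con k' P' \<Longrightarrow> nw (Suc i) P' = u" for k' i u
    proof -
      have "sum om {P'\<in>Cs ! k'. key i P' = key i P} \<le> sum om {P'\<in>W. nw (Suc i) P' = u \<and> key i P' = key i P}"
      proof (rule sum_mono2)
        show "finite {P'\<in>W. nw (Suc i) P' = u \<and> key i P' = key i P}" using finW by simp
        show "{P'\<in>Cs ! k'. key i P' = key i P} \<subseteq> {P'\<in>W. nw (Suc i) P' = u \<and> key i P' = key i P}"
          unfolding nth[OF k'] using imp by auto
        show "0 \<le> om P'" if "P' \<in> {P'\<in>W. nw (Suc i) P' = u \<and> key i P' = key i P} - {P'\<in>Cs ! k'. key i P' = key i P}" for P'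
          using that om_pos[of P'] by simp
      qed
      then show ?thesis using hit[OF P, of i u] by linarith
    qed
    show "sum om {P'\<in>Cs ! k. key (0 + k) P' = key (0 + k) P}
      \<le> (if (if k < A then k + 1 else k + 2) \<in> S then \<kappa> / M0 else 1) * ch.mass (0 + k) (key (0 + k) P)" if k: "k < A"
    proof (cases "k + 1 \<in> S")
      case True
      then show ?thesis using hitle[of k k "vtx c0 (k + 1)"] k Amm unfolding con_def by auto
    next
      case False
      then show ?thesis using free[of k k] k Amm by simp
    qed
    show "sum om {P'\<in>Cs ! Suc k. key (0 + k) P' = key (0 + k) P}
      \<le> (if (if Suc k < A then Suc k + 1 else Suc k + 2) \<in> S then \<kappa> / M0 else 1) * ch.mass (0 + k) (key (0 + k) P)"
      if k: "A \<le> k" "Suc k < length Cs"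
    proof (cases "Suc k + 2 \<in> S")
      case True
      then show ?thesis using hitle[of "Suc k" k "vtx c0 (Suc k + 2)"] k len unfolding con_def by auto
    next
      case False
      then show ?thesis using free[of "Suc k" k] k len by simp
    qed
  qed (rule sub)
  also have "\<dots> = sum om (Cs ! A) * (\<kappa> / M0) ^ card {k\<in>{..<mm} - {A}. (if k < A then k + 1 else k + 2) \<in> S}"
  proof -
    have "(\<Prod>k\<in>{..<mm} - {A}. if (if k < A then k + 1 else k + 2) \<in> S then \<kappa> / M0 else 1)
        = (\<Prod>k\<in>{k\<in>{..<mm} - {A}. (if k < A then k + 1 else k + 2) \<in> S}. \<kappa> / M0)"
      by (rule prod.inter_filter[symmetric]) simp
    then show ?thesis unfolding len by simp
  qed
  also have "card {k\<in>{..<mm} - {A}. (if k < A then k + 1 else k + 2) \<in> S} = card (S - {0, A + 1, A + 2})"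
  proof (rule bij_betw_same_card[of "\<lambda>k. if k < A then k + 1 else k + 2"], rule bij_betwI[where g = "\<lambda>i. if i \<le> A then i - 1 else i - 2"])
    show "(\<lambda>k. if k < A then k + 1 else k + 2) \<in> {k\<in>{..<mm} - {A}. (if k < A then k + 1 else k + 2) \<in> S} \<rightarrow> S - {0, A + 1, A + 2}" by auto
    show "(\<lambda>i. if i \<le> A then i - 1 else i - 2) \<in> S - {0, A + 1, A + 2} \<rightarrow> {k\<in>{..<mm} - {A}. (if k < A then k + 1 else k + 2) \<in> S}"
    proof
      fix i assume i: "i \<in> S - {0, A + 1, A + 2}"
      then have "i < mm + 2" "i \<noteq> 0" "i \<noteq> A + 1" "i \<noteq> A + 2" "i \<in> S" using S(1) mm_pos(2) by auto
      then show "(if i \<le> A then i - 1 else i - 2) \<in> {k\<in>{..<mm} - {A}. (if k < A then k + 1 else k + 2) \<in> S}"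
      proof (cases "i \<le> A")
        case True
        then show ?thesis using \<open>i \<in> S\<close> \<open>i \<noteq> 0\<close> Amm by auto
      next
        case False
        then have "2 \<le> i" "A + 2 < i" using \<open>i \<noteq> A + 1\<close> \<open>i \<noteq> 0\<close> \<open>i \<noteq> A + 2\<close> by linarith+
        then have "\<not> i - 2 < A" "i - 2 \<noteq> A" "i - 2 < mm" "i - 2 + 2 = i" using \<open>i < mm + 2\<close> by linarith+
        then show ?thesis unfolding if_not_P[OF False] mem_Collect_eq using \<open>i \<in> S\<close> by (simp only: if_False) simp
      qed
    qed
  qed auto
  also have "sum om (Cs ! A) * (\<kappa> / M0) ^ card (S - {0, A + 1, A + 2})
      \<le> cd X (pr c0 j) * (\<kappa> / M0) ^ (card (S \<inter> {0, A + 1, A + 2}) - 2) * (\<kappa> / M0) ^ card (S - {0, A + 1, A + 2})"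
    unfolding nth[OF Amm] con_def
    by (rule mult_right_mono[OF anchor_mass(1)[OF c0 j S(2,3), folded A_def]]) (use x1 in simp)
  also have "\<dots> = cd X (pr c0 j) * (\<kappa> / M0) ^ (card S - 2)"
  proof -
    have fS: "finite S" using S(1) finite_subset by blast
    have "card S = card (S \<inter> {0, A + 1, A + 2}) + card (S - {0, A + 1, A + 2})"
      using card_Un_disjoint[of "S \<inter> {0, A + 1, A + 2}" "S - {0, A + 1, A + 2}"] fS by (simp add: Int_Diff_Un Int_Diff_disjoint)
    moreover have "2 \<le> card (S \<inter> {0, A + 1, A + 2})" using anchor_mass(2)[OF c0 j S(2,3)] unfolding A_def .
    ultimately have "card S - 2 = (card (S \<inter> {0, A + 1, A + 2}) - 2) + card (S - {0, A + 1, A + 2})" by linarith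
    then show ?thesis by (simp only: power_add mult.assoc)
  qed
  finally show ?thesis .
qed

end

section \<open>Random edges over the sides of the fan\<close>

context fat_family
begin

definition Hs :: "(nat \<times> nat \<times> nat) list \<Rightarrow> nat set set list" where
  "Hs c = map (\<lambda>j. {e\<in>X. pr c j \<subseteq> e}) [0..<2 * l]"
text \<open>The edges over the sides are independent and uniform, so that all choices for one fan
  have this same probability.\<close>

definition hw :: "(nat \<times> nat \<times> nat) list \<Rightarrow> real" where "hw c = (\<Prod>j<2 * l. 1 / cd X (pr c j))"
definition \<Gamma> :: "((nat \<times> nat \<times> nat) list \<times> nat set list) set" where "\<Gamma> = (SIGMA c:\<Gamma>c. listset (Hs c))"
definition gw :: "(nat \<times> nat \<times> nat) list \<times> nat set list \<Rightarrow> real" where "gw \<gamma> = ch.cw 0 (fst \<gamma>) * hw (fst \<gamma>)"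
definition dl :: "(nat \<times> nat \<times> nat) list \<times> nat set list \<Rightarrow> nat set dart list" where
  "dl \<gamma> = map (\<lambda>j. (vtx (fst \<gamma>) j, snd \<gamma> ! j, vtx (fst \<gamma>) (Suc j mod (2 * l)))) [0..<2 * l]"

lemma Hs_props: "length (Hs c) = 2 * l" "j < 2 * l \<Longrightarrow> Hs c ! j = {e\<in>X. pr c j \<subseteq> e}"
  unfolding Hs_def by simp_all

lemma fin_H: "finite (listset (Hs c))" by (rule finite_listset) (use finX in \<open>auto simp: Hs_def\<close>)

lemma H_mem: "h \<in> listset (Hs c) \<Longrightarrow> j < 2 * l \<Longrightarrow> h ! j \<in> X \<and> pr c j \<subseteq> h ! j" "h \<in> listset (Hs c) \<Longrightarrow> length h = 2 * l"
  unfolding listset_nth Hs_props(1) using Hs_props(2) by auto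

lemma finGamma: "finite \<Gamma>" unfolding \<Gamma>_def using finGc fin_H by blast

lemma cd_pr_pos: "c \<in> \<Gamma>c \<Longrightarrow> j < 2 * l \<Longrightarrow> 0 < cd X (pr c j)"
  using pr_props(3) B_pos by fastforce

lemma hw_pos: "c \<in> \<Gamma>c \<Longrightarrow> 0 < hw c"
  unfolding hw_def using cd_pr_pos by (intro prod_pos) simp

lemma gw_nonneg: "\<gamma> \<in> \<Gamma> \<Longrightarrow> 0 \<le> gw \<gamma>"
  unfolding gw_def \<Gamma>_def using Gc(3) hw_pos by (metis less_imp_le mem_Sigma_iff mult_nonneg_nonneg prod.collapse)

lemma Gamma_sum: "sum gw {\<gamma>\<in>\<Gamma>. P (fst \<gamma>) (snd \<gamma>)} = (\<Sum>c\<in>\<Gamma>c. ch.cw 0 c * (card {h\<in>listset (Hs c). P c h} * hw c))"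
proof -
  have eq: "{\<gamma>\<in>\<Gamma>. P (fst \<gamma>) (snd \<gamma>)} = (SIGMA c:\<Gamma>c. {h\<in>listset (Hs c). P c h})" unfolding \<Gamma>_def by auto
  have "sum gw (SIGMA c:\<Gamma>c. {h\<in>listset (Hs c). P c h}) = (\<Sum>c\<in>\<Gamma>c. \<Sum>h\<in>{h\<in>listset (Hs c). P c h}. gw (c, h))"
    by (subst sum.Sigma) (use finGc fin_H in auto)
  also have "\<dots> = (\<Sum>c\<in>\<Gamma>c. ch.cw 0 c * (card {h\<in>listset (Hs c). P c h} * hw c))"
    by (rule sum.cong[OF refl]) (simp add: gw_def mult_ac)
  finally show ?thesis unfolding eq .
qed

text \<open>A side with a prescribed edge keeps at most one of its \<open>cd X (pr c j)\<close>
  choices, the other sides contribute a factor \<open>1\<close>.\<close>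

lemma H_count:
  assumes c: "c \<in> \<Gamma>c" and J: "J \<subseteq> {..<2 * l}"
  shows "card {h\<in>listset (Hs c). \<forall>j\<in>J. h ! j = f j} * hw c \<le> (\<Prod>j\<in>J. 1 / cd X (pr c j))"
proof -
  let ?A = "map (\<lambda>j. if j \<in> J then {f j} else {e\<in>X. pr c j \<subseteq> e}) [0..<2 * l]"
  have "card {h\<in>listset (Hs c). \<forall>j\<in>J. h ! j = f j} \<le> card (listset ?A)"
  proof (rule card_mono)
    show "finite (listset ?A)" by (rule finite_listset) (use finX in auto)
    show "{h\<in>listset (Hs c). \<forall>j\<in>J. h ! j = f j} \<subseteq> listset ?A"
    proof
      fix h assume h: "h \<in> {h\<in>listset (Hs c). \<forall>j\<in>J. h ! j = f j}"
      then have "h \<in> listset (Hs c)" by blast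
      note m = H_mem[OF this]
      have "\<forall>i<2 * l. h ! i \<in> ?A ! i" using h m(1) by simp
      then show "h \<in> listset ?A" unfolding listset_nth using m(2) by simp
    qed
  qed
  also have "\<dots> = (\<Prod>j<2 * l. card (?A ! j))" by (simp add: card_listset)
  finally have "card {h\<in>listset (Hs c). \<forall>j\<in>J. h ! j = f j} * hw c \<le> real (\<Prod>j<2 * l. card (?A ! j)) * hw c"
    by (rule mult_right_mono[OF of_nat_mono less_imp_le[OF hw_pos[OF c]]])
  also have "\<dots> = (\<Prod>j<2 * l. real (card (?A ! j)) * (1 / cd X (pr c j)))"
    unfolding hw_def of_nat_prod prod.distrib ..
  also have "\<dots> = (\<Prod>j<2 * l. if j \<in> J then 1 / cd X (pr c j) else 1)"
  proof (rule prod.cong[OF refl])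
    fix j assume "j \<in> {..<2 * l}"
    then have j: "j < 2 * l" by simp
    show "real (card (?A ! j)) * (1 / cd X (pr c j)) = (if j \<in> J then 1 / cd X (pr c j) else 1)"
      using j cd_pr_pos[OF c j] by (simp add: cd_def)
  qed
  also have "\<dots> = (\<Prod>j\<in>J. 1 / cd X (pr c j))"
    using J by (simp add: prod.inter_restrict[symmetric] Int_absorb1 flip: prod.inter_restrict)
  finally show ?thesis .
qed

lemma H_total: "c \<in> \<Gamma>c \<Longrightarrow> card (listset (Hs c)) * hw c = 1"
proof -
  assume c: "c \<in> \<Gamma>c"
  have "card (listset (Hs c)) = (\<Prod>j<2 * l. card (Hs c ! j))" by (simp add: card_listset Hs_props)
  then have "card (listset (Hs c)) * hw c = (\<Prod>j<2 * l. real (card (Hs c ! j)) * (1 / cd X (pr c j)))"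
    unfolding hw_def prod.distrib by simp
  also have "\<dots> = 1"
    by (rule prod.neutral) (use Hs_props(2) cd_pr_pos[OF c] in \<open>auto simp: cd_def\<close>)
  finally show ?thesis .
qed

lemma sum_cw_Gc: "(\<Sum>c\<in>{c\<in>\<Gamma>c. P c}. ch.cw 0 c) = (\<Sum>c\<in>{c\<in>listset (replicate mm W). P c}. ch.cw 0 c)"
proof (rule sum.mono_neutral_left)
  have f: "finite (listset (replicate mm W))" by (rule finite_listset) (use finW in auto)
  then show "finite {c\<in>listset (replicate mm W). P c}" by simp
  show "{c\<in>\<Gamma>c. P c} \<subseteq> {c\<in>listset (replicate mm W). P c}" unfolding \<Gamma>c_def by blast
  show "\<forall>c\<in>{c\<in>listset (replicate mm W). P c} - {c\<in>\<Gamma>c. P c}. ch.cw 0 c = 0"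
  proof
    fix c assume c: "c \<in> {c\<in>listset (replicate mm W). P c} - {c\<in>\<Gamma>c. P c}"
    then have L: "c \<in> listset (replicate mm W)" by blast
    have "set c \<subseteq> W" by (rule set_listset_subset[OF L]) auto
    then have "0 \<le> ch.cw 0 c" by (rule ch.cw_nonneg)
    moreover have "\<not> 0 < ch.cw 0 c" using c unfolding \<Gamma>c_def by blast
    ultimately show "ch.cw 0 c = 0" by simp
  qed
qed

lemma chain_total: "sum (ch.cw 0) \<Gamma>c = sum om W"
proof -
  have "sum (ch.cw 0) \<Gamma>c = sum (ch.cw 0) (listset (replicate mm W))" using sum_cw_Gc[of "\<lambda>_. True"] by simp
  moreover obtain m where "mm = Suc m" using mm_pos(1) gr0_conv_Suc by blast
  ultimately show ?thesis using ch.total_mass[of 0 m] by simp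
qed

lemma total: "sum gw \<Gamma> = sum om W"
proof -
  have "sum gw \<Gamma> = (\<Sum>c\<in>\<Gamma>c. ch.cw 0 c * (card (listset (Hs c)) * hw c))" using Gamma_sum[of "\<lambda>_ _. True"] by simp
  also have "\<dots> = sum (ch.cw 0) \<Gamma>c" by (rule sum.cong[OF refl]) (simp add: H_total)
  finally show ?thesis unfolding chain_total .
qed

lemma om_W: "card X / 8 \<le> sum om W"
proof -
  have "\<exists>P\<in>W. tset P = T" if T: "T \<in> \<T>" for T
  proof -
    obtain x y z where "T = {x, y, z}" "x \<noteq> y" "x \<noteq> z" "y \<noteq> z"
      using T3[OF T] by (metis card_3_iff)
    then have "tset (x, y, z) = T" "(x, y, z) \<in> W" using T unfolding W_def tset_def by auto
    then show ?thesis by blast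
  qed
  then obtain f where f: "\<And>T. T \<in> \<T> \<Longrightarrow> f T \<in> W \<and> tset (f T) = T" by metis
  have inj: "inj_on f \<T>" using f by (metis inj_onI)
  have "card X / 8 \<le> sum \<nu> \<T>" by (rule massT)
  also have "\<dots> = (\<Sum>T\<in>\<T>. om (f T))" by (rule sum.cong[OF refl]) (use f in \<open>simp add: om_def\<close>)
  also have "\<dots> = sum om (f ` \<T>)" using inj by (simp add: sum.reindex)
  also have "\<dots> \<le> sum om W"
    by (rule sum_mono2) (use finW f om_pos in \<open>auto intro: less_imp_le\<close>)
  finally show ?thesis .
qed

lemma om_W_nonneg: "0 \<le> sum om W" by (rule sum_nonneg) (use om_pos less_imp_le in blast)

lemma vtx_012:
  assumes c: "c \<in> \<Gamma>c" shows "vtx c 0 \<noteq> vtx c 1" "vtx c 0 \<noteq> vtx c 2" "vtx c 1 \<noteq> vtx c 2"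
proof -
  have "c ! 0 \<in> W" by (rule Gc(2)[OF c mm_pos(1)])
  note d = W_dist(1)[OF this, of 0] W_dist(1)[OF this, of 1] W_dist(2)[OF this, of 0]
  show "vtx c 0 \<noteq> vtx c 1" "vtx c 0 \<noteq> vtx c 2" "vtx c 1 \<noteq> vtx c 2"
    using d unfolding vtx_def cf_def by auto
qed

lemma vertex_coincidence:
  assumes ij: "i < j" "j < 2 * l"
  shows "sum gw {\<gamma>\<in>\<Gamma>. vtx (fst \<gamma>) i = vtx (fst \<gamma>) j} \<le> \<kappa> / M0 * sum om W"
proof -
  have "sum gw {\<gamma>\<in>\<Gamma>. vtx (fst \<gamma>) i = vtx (fst \<gamma>) j}
      = (\<Sum>c\<in>\<Gamma>c. ch.cw 0 c * (card {h\<in>listset (Hs c). vtx c i = vtx c j} * hw c))"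
    using Gamma_sum[of "\<lambda>c _. vtx c i = vtx c j"] .
  also have "\<dots> = (\<Sum>c\<in>\<Gamma>c. if vtx c i = vtx c j then ch.cw 0 c else 0)"
    by (rule sum.cong[OF refl]) (simp add: H_total)
  also have "\<dots> = sum (ch.cw 0) {c\<in>\<Gamma>c. vtx c i = vtx c j}" using finGc by (simp add: sum.inter_filter)
  also have "\<dots> \<le> \<kappa> / M0 * sum om W"
  \<comment> \<open>Vertices \<open>0\<close>, \<open>1\<close>, \<open>2\<close> belong to the
    first triangle and differ. Every later vertex is new in its triangle and hits an earlier one
    with probability at most \<open>\<kappa> / M0\<close>.\<close>
  proof (cases "j \<le> 2")
    case True
    have "{c\<in>\<Gamma>c. vtx c i = vtx c j} = {}"
    proof (rule equals0I)
      fix c assume c: "c \<in> {c\<in>\<Gamma>c. vtx c i = vtx c j}"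
      then have "c \<in> \<Gamma>c" by blast
      note v = vtx_012[OF this]
      have "i = 0 \<and> j = 1 \<or> i = 0 \<and> j = 2 \<or> i = 1 \<and> j = 2" using True ij by linarith
      then show False using c v by auto
    qed
    then show ?thesis using x1 om_W_nonneg by (metis less_imp_le mult_nonneg_nonneg sum.empty)
  next
    case False
    then have b: "i - 2 < j - 2" "j - 2 < mm" "Suc (j - 2 - 1) = j - 2" using ij mm_pos(2) by linarith+
    have "sum (ch.cw 0) {c\<in>\<Gamma>c. vtx c i = vtx c j} = sum (ch.cw 0) {c\<in>listset (replicate mm W). nw (j - 2) (c ! (j - 2)) = cf i (c ! (i - 2))}"
      unfolding sum_cw_Gc vtx_def using False by (intro sum.cong refl) (auto simp: cf_def)
    also have "\<dots> \<le> \<kappa> / M0 * sum om W"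
    proof (rule ch.coincidence_bound[OF b(1,2) less_imp_le[OF x1(1)]])
      fix u P assume "P \<in> W"
      then show "sum om {P'\<in>W. nw (j - 2) P' = u \<and> key (j - 2 - 1) P' = key (j - 2 - 1) P}
        \<le> \<kappa> / M0 * ch.mass (j - 2 - 1) (key (j - 2 - 1) P)"
        using hit[of P "j - 2 - 1" u] unfolding b(3) by simp
    qed
    finally show ?thesis .
  qed
  finally show ?thesis .
qed

lemma edge_coincidence:
  assumes ij: "i < j" "j < 2 * l"
  shows "sum gw {\<gamma>\<in>\<Gamma>. snd \<gamma> ! i = snd \<gamma> ! j} \<le> \<kappa> / M0 * sum om W"
proof -
  have "sum gw {\<gamma>\<in>\<Gamma>. snd \<gamma> ! i = snd \<gamma> ! j}
      = (\<Sum>c\<in>\<Gamma>c. ch.cw 0 c * (card {h\<in>listset (Hs c). h ! i = h ! j} * hw c))"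
    using Gamma_sum[of "\<lambda>_ h. h ! i = h ! j"] .
  also have "\<dots> \<le> (\<Sum>c\<in>\<Gamma>c. ch.cw 0 c * (\<kappa> / M0))"
  proof (intro sum_mono mult_left_mono)
    fix c assume c: "c \<in> \<Gamma>c"
    let ?E = "{e\<in>X. pr c i \<subseteq> e}"
    have i: "i < 2 * l" using ij by simp
    have eq: "{h\<in>listset (Hs c). h ! i = h ! j} = (\<Union>e\<in>?E. {h\<in>listset (Hs c). \<forall>k\<in>{i, j}. h ! k = e})"
    proof
      show "{h\<in>listset (Hs c). h ! i = h ! j} \<subseteq> (\<Union>e\<in>?E. {h\<in>listset (Hs c). \<forall>k\<in>{i, j}. h ! k = e})"
      proof
        fix h assume "h \<in> {h\<in>listset (Hs c). h ! i = h ! j}"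
        then have h: "h \<in> listset (Hs c)" "h ! j = h ! i" by auto
        show "h \<in> (\<Union>e\<in>?E. {h\<in>listset (Hs c). \<forall>k\<in>{i, j}. h ! k = e})"
          by (rule UN_I[of "h ! i"]) (use H_mem(1)[OF h(1) i] h in auto)
      qed
    qed auto
    have "card {h\<in>listset (Hs c). h ! i = h ! j} \<le> (\<Sum>e\<in>?E. card {h\<in>listset (Hs c). \<forall>k\<in>{i, j}. h ! k = e})"
      unfolding eq by (rule card_UN_le) (use finX in simp)
    then have "card {h\<in>listset (Hs c). h ! i = h ! j} * hw c
        \<le> real (\<Sum>e\<in>?E. card {h\<in>listset (Hs c). \<forall>k\<in>{i, j}. h ! k = e}) * hw c"
      using hw_pos[OF c] by (intro mult_right_mono of_nat_mono) auto
    also have "\<dots> = (\<Sum>e\<in>?E. card {h\<in>listset (Hs c). \<forall>k\<in>{i, j}. h ! k = e} * hw c)"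
      by (simp only: of_nat_sum sum_distrib_right)
    also have "\<dots> \<le> (\<Sum>e\<in>?E. (\<Prod>k\<in>{i, j}. 1 / cd X (pr c k)))"
      by (intro sum_mono H_count[OF c]) (use ij in auto)
    also have "\<dots> = 1 / cd X (pr c j)"
      using ij cd_pr_pos[OF c i] by (simp add: cd_def)
    also have "\<dots> \<le> 1 / M0"
      using pr_props(3)[OF c ij(2)] M0B M0_pos by (intro divide_left_mono mult_pos_pos) auto
    also have "\<dots> \<le> \<kappa> / M0" using kappa M0_pos by (intro divide_right_mono) auto
    finally show "card {h\<in>listset (Hs c). h ! i = h ! j} * hw c \<le> \<kappa> / M0" .
    show "0 \<le> ch.cw 0 c" using Gc(3)[OF c] by simp
  qed
  also have "\<dots> = \<kappa> / M0 * sum om W" unfolding sum_distrib_right[symmetric] chain_total by (rule mult.commute)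
  finally show ?thesis .
qed

text \<open>Coincidences are excluded for edges as well as for vertices: the label of a side does
  not determine its ends here, so distinct vertices alone would not give distinct edges.\<close>

definition good :: "((nat \<times> nat \<times> nat) list \<times> nat set list) set" where
  "good = {\<gamma>\<in>\<Gamma>. \<forall>i j. i < j \<and> j < 2 * l \<longrightarrow> vtx (fst \<gamma>) i \<noteq> vtx (fst \<gamma>) j \<and> snd \<gamma> ! i \<noteq> snd \<gamma> ! j}"

lemma good_mass: "card X / 16 \<le> sum gw good"
proof -
  define g' where "g' \<gamma> = (if \<gamma> \<in> \<Gamma> then gw \<gamma> else 0)" for \<gamma>
  define I where "I = {(i, j). i < j \<and> j < 2 * l}"
  have IS: "I \<subseteq> {..<2 * l} \<times> {..<2 * l}" unfolding I_def by auto
  then have finI: "finite I" using finite_subset by blast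
  have "card I \<le> card ({..<2 * l} \<times> {..<2 * l})" using IS by (intro card_mono) auto
  then have cI: "real (card I) \<le> 4 * real l ^ 2"
  proof -
    have "card I \<le> 2 * l * (2 * l)" using \<open>card I \<le> card ({..<2 * l} \<times> {..<2 * l})\<close> by (simp only: card_cartesian_product card_lessThan)
    then have "real (card I) \<le> real (2 * l * (2 * l))" by (rule of_nat_mono)
    then show ?thesis by (simp add: power2_eq_square)
  qed
  define bad where "bad ij = {\<gamma>\<in>\<Gamma>. vtx (fst \<gamma>) (fst ij) = vtx (fst \<gamma>) (snd ij)} \<union> {\<gamma>\<in>\<Gamma>. snd \<gamma> ! fst ij = snd \<gamma> ! snd ij}" for ij
  have gg: "sum g' S = sum gw S" if "S \<subseteq> \<Gamma>" for S unfolding g'_def using that by (intro sum.cong refl) auto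
  have g0: "0 \<le> g' \<gamma>" for \<gamma> unfolding g'_def using gw_nonneg by simp
  have badG: "bad ij \<subseteq> \<Gamma>" for ij unfolding bad_def by blast
  have "\<Gamma> - good \<subseteq> (\<Union>ij\<in>I. bad ij)"
  proof
    fix \<gamma> assume g: "\<gamma> \<in> \<Gamma> - good"
    then obtain i j where ij: "i < j" "j < 2 * l" "vtx (fst \<gamma>) i = vtx (fst \<gamma>) j \<or> snd \<gamma> ! i = snd \<gamma> ! j"
      unfolding good_def by blast
    then have "\<gamma> \<in> bad (i, j)" "(i, j) \<in> I" using g unfolding bad_def I_def by auto
    then show "\<gamma> \<in> (\<Union>ij\<in>I. bad ij)" by blast
  qed
  then have "sum g' (\<Gamma> - good) \<le> sum g' (\<Union>ij\<in>I. bad ij)"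
    by (intro sum_mono2) (use finI badG finite_subset[OF badG finGamma] g0 in auto)
  also have "\<dots> \<le> (\<Sum>ij\<in>I. sum g' (bad ij))"
    by (rule sum_UN_le[OF finI finite_subset[OF badG finGamma] g0])
  also have "\<dots> \<le> (\<Sum>ij\<in>I. 2 * (\<kappa> / M0 * sum om W))"
  proof (rule sum_mono)
    fix ij assume "ij \<in> I"
    then have ij: "fst ij < snd ij" "snd ij < 2 * l" unfolding I_def by auto
    let ?V = "{\<gamma>\<in>\<Gamma>. vtx (fst \<gamma>) (fst ij) = vtx (fst \<gamma>) (snd ij)}" and ?H = "{\<gamma>\<in>\<Gamma>. snd \<gamma> ! fst ij = snd \<gamma> ! snd ij}"
    have f: "finite ?V" "finite ?H" using finGamma by auto
    have "sum g' (bad ij) + sum g' (?V \<inter> ?H) = sum g' ?V + sum g' ?H"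
      unfolding bad_def by (rule sum.union_inter[OF f])
    moreover have "0 \<le> sum g' (?V \<inter> ?H)" using g0 by (intro sum_nonneg) auto
    moreover have "sum g' ?V = sum gw ?V" "sum g' ?H = sum gw ?H" by (rule gg, blast)+
    ultimately show "sum g' (bad ij) \<le> 2 * (\<kappa> / M0 * sum om W)"
      using vertex_coincidence[OF ij] edge_coincidence[OF ij] by linarith
  qed
  also have "\<dots> = card I * (2 * (\<kappa> / M0 * sum om W))" by simp
  also have "\<dots> \<le> 4 * real l ^ 2 * (2 * (\<kappa> / M0 * sum om W))"
    by (rule mult_right_mono[OF cI]) (intro mult_nonneg_nonneg less_imp_le[OF x1(1)] om_W_nonneg, simp)
  also have "\<dots> = (16 * real l ^ 2 * \<kappa> / M0) * (sum om W / 2)" by simp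
  also have "\<dots> \<le> 1 * (sum om W / 2)"
    using big M0_pos om_W_nonneg by (intro mult_right_mono) auto
  finally have b: "sum gw (\<Gamma> - good) \<le> sum om W / 2" using gg[of "\<Gamma> - good"] by simp
  have "sum gw \<Gamma> = sum gw (\<Gamma> - good) + sum gw good"
    by (rule sum.subset_diff[OF _ finGamma]) (auto simp: good_def)
  then show ?thesis using b om_W total by linarith
qed

text \<open>The codegree of the anchor side cancels one factor of the product over \<open>J\<close>.
  What remains is \<open>1 / B\<close> for all prescribed sides but one and
  \<open>\<kappa> / M0\<close> for all touched vertices but two. A proper set of sides touches at
  least one vertex more than it has sides, so every step after the first costs
  \<open>\<kappa> / (M0 * B)\<close>; for the complete cycle one factor \<open>1 / M0\<close> is
  missing.\<close>

lemma system_bound: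
  assumes J: "J \<subseteq> {..<2 * l}" "J \<noteq> {}"
    and tau: "1 / (M0 * B) \<le> \<tau>" "1 / (M0 ^ (2 * l - 2) * B ^ (2 * l - 1)) \<le> \<tau> ^ (2 * l - 1)"
  shows "sum gw {\<gamma>\<in>\<Gamma>. \<forall>i\<in>J. dl \<gamma> ! i = d i} \<le> \<kappa> ^ (2 * l) * \<tau> ^ (card J - 1)"
proof (cases "{\<gamma>\<in>\<Gamma>. \<forall>i\<in>J. dl \<gamma> ! i = d i} = {}")
  case True
  have "0 \<le> \<tau>" using tau(1) M0_pos B_pos by (meson less_imp_le mult_pos_pos order_trans zero_le_divide_1_iff)
  then show ?thesis unfolding True using kappa by simp
next
  case False
  then obtain \<gamma>0 where g0: "\<gamma>0 \<in> \<Gamma>" "\<And>i. i \<in> J \<Longrightarrow> dl \<gamma>0 ! i = d i" by blast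
  define c0 h0 where "c0 = fst \<gamma>0" and "h0 = snd \<gamma>0"
  have c0: "c0 \<in> \<Gamma>c" using g0(1) unfolding c0_def \<Gamma>_def by (metis mem_Sigma_iff prod.collapse)
  define S where "S = J \<union> (\<lambda>j. Suc j mod (2 * l)) ` J"
  have fJ: "finite J" using J(1) finite_subset by blast
  have SL: "S \<subseteq> {..<2 * l}" unfolding S_def using J(1) l2 by auto
  have dln: "dl \<gamma> ! j = (vtx (fst \<gamma>) j, snd \<gamma> ! j, vtx (fst \<gamma>) (Suc j mod (2 * l)))" if "j \<in> J" for \<gamma> j
    using that J(1) unfolding dl_def by auto
  obtain j1 where j1: "j1 \<in> J" using J(2) by blast
  have j1l: "j1 < 2 * l" using j1 J(1) by auto
  have sub: "{\<gamma>\<in>\<Gamma>. \<forall>i\<in>J. dl \<gamma> ! i = d i} \<subseteq> {\<gamma>\<in>\<Gamma>. (\<forall>i\<in>S. vtx (fst \<gamma>) i = vtx c0 i) \<and> (\<forall>j\<in>J. snd \<gamma> ! j = h0 ! j)}"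
  proof
    fix \<gamma> assume "\<gamma> \<in> {\<gamma>\<in>\<Gamma>. \<forall>i\<in>J. dl \<gamma> ! i = d i}"
    then have g: "\<gamma> \<in> \<Gamma>" "\<And>i. i \<in> J \<Longrightarrow> dl \<gamma> ! i = d i" by auto
    have "vtx (fst \<gamma>) j = vtx c0 j \<and> snd \<gamma> ! j = h0 ! j \<and> vtx (fst \<gamma>) (Suc j mod (2 * l)) = vtx c0 (Suc j mod (2 * l))" if "j \<in> J" for j
      using g(2)[OF that] g0(2)[OF that] unfolding dln[OF that] c0_def h0_def by (metis prod.inject)
    then show "\<gamma> \<in> {\<gamma>\<in>\<Gamma>. (\<forall>i\<in>S. vtx (fst \<gamma>) i = vtx c0 i) \<and> (\<forall>j\<in>J. snd \<gamma> ! j = h0 ! j)}"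
      using g(1) unfolding S_def by blast
  qed
  let ?\<Pi> = "\<Prod>j\<in>J. 1 / cd X (pr c0 j)"
  have P0: "0 \<le> ?\<Pi>" by (intro prod_nonneg) (simp add: cd_nonneg)
  have "sum gw {\<gamma>\<in>\<Gamma>. \<forall>i\<in>J. dl \<gamma> ! i = d i} \<le> sum gw {\<gamma>\<in>\<Gamma>. (\<forall>i\<in>S. vtx (fst \<gamma>) i = vtx c0 i) \<and> (\<forall>j\<in>J. snd \<gamma> ! j = h0 ! j)}"
    by (rule sum_mono2[OF _ sub]) (use finGamma gw_nonneg in auto)
  also have "\<dots> = (\<Sum>c\<in>\<Gamma>c. ch.cw 0 c * (card {h\<in>listset (Hs c). (\<forall>i\<in>S. vtx c i = vtx c0 i) \<and> (\<forall>j\<in>J. h ! j = h0 ! j)} * hw c))"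
    using Gamma_sum[of "\<lambda>c h. (\<forall>i\<in>S. vtx c i = vtx c0 i) \<and> (\<forall>j\<in>J. h ! j = h0 ! j)"] .
  also have "\<dots> \<le> (\<Sum>c\<in>\<Gamma>c. if \<forall>i\<in>S. vtx c i = vtx c0 i then ch.cw 0 c * ?\<Pi> else 0)"
  proof (rule sum_mono)
    fix c assume c: "c \<in> \<Gamma>c"
    show "ch.cw 0 c * (card {h\<in>listset (Hs c). (\<forall>i\<in>S. vtx c i = vtx c0 i) \<and> (\<forall>j\<in>J. h ! j = h0 ! j)} * hw c)
      \<le> (if \<forall>i\<in>S. vtx c i = vtx c0 i then ch.cw 0 c * ?\<Pi> else 0)"
    proof (cases "\<forall>i\<in>S. vtx c i = vtx c0 i")
      case True
      have "pr c j = pr c0 j" if "j \<in> J" for j using True that unfolding pr_def S_def by simp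
      then have "?\<Pi> = (\<Prod>j\<in>J. 1 / cd X (pr c j))" by (intro prod.cong) auto
      moreover have "0 \<le> ch.cw 0 c" using Gc(3)[OF c] by simp
      ultimately show ?thesis using H_count[OF c J(1), of "\<lambda>j. h0 ! j"] True by (simp add: mult_left_mono)
    next
      case False
      then have "{h\<in>listset (Hs c). (\<forall>i\<in>S. vtx c i = vtx c0 i) \<and> (\<forall>j\<in>J. h ! j = h0 ! j)} = {}" by blast
      then show ?thesis using False by (simp only: card.empty if_False)
    qed
  qed
  also have "\<dots> = sum (ch.cw 0) {c\<in>\<Gamma>c. \<forall>i\<in>S. vtx c i = vtx c0 i} * ?\<Pi>"
    using finGc by (simp only: sum.inter_filter[symmetric] sum_distrib_right)
  also have "\<dots> \<le> cd X (pr c0 j1) * (\<kappa> / M0) ^ (card S - 2) * ?\<Pi>"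
    by (rule mult_right_mono[OF chain_bound[OF c0 j1l SL] P0]) (use j1 in \<open>auto simp: S_def\<close>)
  also have "\<dots> = (\<kappa> / M0) ^ (card S - 2) * (\<Prod>j\<in>J - {j1}. 1 / cd X (pr c0 j))"
    using prod.remove[OF fJ j1, of "\<lambda>j. 1 / cd X (pr c0 j)"] cd_pr_pos[OF c0 j1l] by simp
  also have "\<dots> \<le> (\<kappa> / M0) ^ (card S - 2) * (1 / B) ^ (card J - 1)"
  proof (rule mult_left_mono)
    have "(\<Prod>j\<in>J - {j1}. 1 / cd X (pr c0 j)) \<le> (\<Prod>j\<in>J - {j1}. 1 / B)"
    proof (rule prod_mono)
      fix j assume "j \<in> J - {j1}"
      then have j: "j < 2 * l" using J(1) by auto
      show "0 \<le> 1 / cd X (pr c0 j) \<and> 1 / cd X (pr c0 j) \<le> 1 / B"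
        using pr_props(3)[OF c0 j] B_pos by (auto intro!: divide_left_mono simp: cd_nonneg)
    qed
    then show "(\<Prod>j\<in>J - {j1}. 1 / cd X (pr c0 j)) \<le> (1 / B) ^ (card J - 1)" using j1 fJ by simp
  qed (use x1 in simp)
  also have "\<dots> \<le> \<kappa> ^ (2 * l) * \<tau> ^ (card J - 1)"
  proof (cases "J = {..<2 * l}")
    case True
    have "J \<subseteq> S" unfolding S_def by blast
    then have "S = {..<2 * l}" using True SL by blast
    then have cc: "card S = 2 * l" "card J = 2 * l" using True by auto
    have "(\<kappa> / M0) ^ (2 * l - 2) * (1 / B) ^ (2 * l - 1) = \<kappa> ^ (2 * l - 2) * (1 / (M0 ^ (2 * l - 2) * B ^ (2 * l - 1)))"
      by (simp add: power_divide)
    also have "\<dots> \<le> \<kappa> ^ (2 * l) * \<tau> ^ (2 * l - 1)"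
      using kappa tau(2) M0_pos B_pos by (intro mult_mono power_increasing) auto
    finally show ?thesis unfolding cc .
  next
    case False
    then have "card J + 1 \<le> card S" using cyclic_closure_card[OF J(1) J(2)] unfolding S_def by simp
    then have "(\<kappa> / M0) ^ (card S - 2) \<le> (\<kappa> / M0) ^ (card J - 1)"
      using x1 by (intro power_decreasing) auto
    then have "(\<kappa> / M0) ^ (card S - 2) * (1 / B) ^ (card J - 1) \<le> (\<kappa> / M0) ^ (card J - 1) * (1 / B) ^ (card J - 1)"
      using B_pos by (intro mult_right_mono) auto
    also have "\<dots> = \<kappa> ^ (card J - 1) * (1 / (M0 * B)) ^ (card J - 1)"
      by (simp add: power_divide power_mult_distrib)
    also have "\<dots> \<le> \<kappa> ^ (2 * l) * \<tau> ^ (card J - 1)"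
    proof (intro mult_mono power_increasing power_mono)
      have "card J \<le> card {..<2 * l}" using J(1) by (intro card_mono) auto
      then show "card J - 1 \<le> 2 * l" by simp
    qed (use kappa tau(1) M0_pos B_pos in auto)
    finally show ?thesis .
  qed
  finally show ?thesis .
qed

lemma dl_closed:
  assumes g: "\<gamma> \<in> good"
  shows "length (dl \<gamma>) = 2 * l" "set (dl \<gamma>) \<subseteq> {d. lab d \<in> X \<and> src d \<in> lab d \<and> tgt d \<in> lab d}"
    "distinct (map src (dl \<gamma>))" "distinct (map lab (dl \<gamma>))" "map tgt (dl \<gamma>) = rotate1 (map src (dl \<gamma>))"
proof -
  have ms: "map src (dl \<gamma>) = map (vtx (fst \<gamma>)) [0..<2 * l]"
    and mt: "map tgt (dl \<gamma>) = map (\<lambda>j. vtx (fst \<gamma>) (Suc j mod (2 * l))) [0..<2 * l]"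
    and ml: "map lab (dl \<gamma>) = map (\<lambda>j. snd \<gamma> ! j) [0..<2 * l]"
    unfolding dl_def map_map comp_def by simp_all
  show "length (dl \<gamma>) = 2 * l" unfolding dl_def by simp
  have h: "snd \<gamma> \<in> listset (Hs (fst \<gamma>))" using g unfolding good_def \<Gamma>_def by (metis (no_types, lifting) mem_Collect_eq mem_Sigma_iff prod.collapse)
  have dist: "vtx (fst \<gamma>) i \<noteq> vtx (fst \<gamma>) j \<and> snd \<gamma> ! i \<noteq> snd \<gamma> ! j" if "i < j" "j < 2 * l" for i j
    using g that unfolding good_def by blast
  show "distinct (map src (dl \<gamma>))"
    unfolding ms distinct_map by (auto intro!: linorder_inj_onI dest: dist)
  show "distinct (map lab (dl \<gamma>))"
    unfolding ml distinct_map by (auto intro!: linorder_inj_onI dest: dist)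
  show "map tgt (dl \<gamma>) = rotate1 (map src (dl \<gamma>))"
    unfolding ms mt by (rule nth_equalityI) (use l2 in \<open>auto simp: nth_rotate1\<close>)
  show "set (dl \<gamma>) \<subseteq> {d. lab d \<in> X \<and> src d \<in> lab d \<and> tgt d \<in> lab d}"
  proof
    fix d assume "d \<in> set (dl \<gamma>)"
    then obtain j where j: "j < 2 * l" "d = (vtx (fst \<gamma>) j, snd \<gamma> ! j, vtx (fst \<gamma>) (Suc j mod (2 * l)))"
      unfolding dl_def by auto
    then show "d \<in> {d. lab d \<in> X \<and> src d \<in> lab d \<and> tgt d \<in> lab d}"
      using H_mem(1)[OF h j(1)] unfolding pr_def by simp
  qed
qed

text \<open>A dart over an edge is given by an ordered pair of vertices of that edge, hence
  \<open>r ^ 2\<close>; the factor \<open>16\<close> reflects the mass \<open>card X / 16\<close> of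
  the good members.\<close>

theorem fat_case:
  assumes tau: "1 / (M0 * B) \<le> \<tau>" "1 / (M0 ^ (2 * l - 2) * B ^ (2 * l - 1)) \<le> \<tau> ^ (2 * l - 1)"
  shows "\<exists>w. spread (2 * l) (2 ^ (2 * l * (r ^ 2 * (2 * l))) * 16 * \<kappa> ^ (2 * l)) \<tau> X w \<and>
    (\<forall>F. w F > 0 \<longrightarrow> (\<exists>ds. length ds = 2 * l \<and> set ds \<subseteq> {d. lab d \<in> X \<and> src d \<in> lab d \<and> tgt d \<in> lab d} \<and>
      distinct (map src ds) \<and> distinct (map lab ds) \<and> map tgt ds = rotate1 (map src ds) \<and> F = set (map lab ds)))"
proof -
  let ?Lab = "{d :: nat set dart. lab d \<in> X \<and> src d \<in> lab d \<and> tgt d \<in> lab d}"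
  let ?b = "\<kappa> ^ (2 * l) * card X"
  have cX: "0 < real (card X)" using Xne finX by (simp add: card_gt_0_iff)
  have \<tau>0: "0 \<le> \<tau>" using tau(1) M0_pos B_pos by (meson less_imp_le mult_pos_pos order_trans zero_le_divide_1_iff)
  have "\<exists>w. spread (2 * l) (2 ^ (2 * l * (r ^ 2 * (2 * l))) * ?b / (card X / 16)) \<tau> X w \<and>
      (\<forall>F. w F > 0 \<longrightarrow> (\<exists>\<gamma>\<in>good. F = set (map lab (dl \<gamma>))))"
  proof (rule spread_of_system[where \<Gamma> = \<Gamma> and g = gw and Lab = ?Lab])
    show "good \<subseteq> \<Gamma>" unfolding good_def by blast
    show "length (dl \<gamma>) = 2 * l" "distinct (map lab (dl \<gamma>))" "set (dl \<gamma>) \<subseteq> ?Lab" if "\<gamma> \<in> good" for \<gamma>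
      using dl_closed[OF that] by blast+
    then show "lab ` set (dl \<gamma>) \<subseteq> X" if "\<gamma> \<in> good" for \<gamma> using that by blast
    show "finite ?Lab"
    proof (rule finite_subset)
      show "?Lab \<subseteq> \<Union>X \<times> X \<times> \<Union>X" by auto
      show "finite (\<Union>X \<times> X \<times> \<Union>X)" using finX unif by simp
    qed
    show "card {d\<in>?Lab. lab d = e} \<le> r ^ 2" if "e \<in> X" for e
    proof -
      have "{d\<in>?Lab. lab d = e} \<subseteq> e \<times> {e} \<times> e" by auto
      then have "card {d\<in>?Lab. lab d = e} \<le> card (e \<times> {e} \<times> e)" using unif[OF that] by (intro card_mono) auto
      also have "\<dots> = r ^ 2" using unif[OF that] by (simp add: card_cartesian_product power2_eq_square)
      finally show ?thesis .
    qed
    show "sum gw {\<gamma>\<in>\<Gamma>. \<forall>i\<in>J. dl \<gamma> ! i = d i} \<le> ?b / card X * \<tau> ^ (card J - 1)"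
      if "J \<subseteq> {..<2 * l}" "J \<noteq> {}" for J d
      using system_bound[OF that tau, of d] cX by simp
    show "0 < real (card X) / 16" "card X / 16 \<le> sum gw good" using cX good_mass by auto
    show "0 \<le> ?b" "0 \<le> \<tau>" using kappa \<tau>0 by auto
  qed (use finX finGamma gw_nonneg in auto)
  moreover have "2 ^ (2 * l * (r ^ 2 * (2 * l))) * ?b / (card X / 16) = 2 ^ (2 * l * (r ^ 2 * (2 * l))) * 16 * \<kappa> ^ (2 * l)"
    using cX by simp
  ultimately obtain w where w: "spread (2 * l) (2 ^ (2 * l * (r ^ 2 * (2 * l))) * 16 * \<kappa> ^ (2 * l)) \<tau> X w"
    "\<forall>F. w F > 0 \<longrightarrow> (\<exists>\<gamma>\<in>good. F = set (map lab (dl \<gamma>)))" by auto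
  show ?thesis
  proof (intro exI[of _ w] conjI allI impI)
    show "spread (2 * l) (2 ^ (2 * l * (r ^ 2 * (2 * l))) * 16 * \<kappa> ^ (2 * l)) \<tau> X w" by (rule w(1))
    fix F assume "0 < w F"
    then obtain \<gamma> where g: "\<gamma> \<in> good" "F = set (map lab (dl \<gamma>))" using w(2) by blast
    show "\<exists>ds. length ds = 2 * l \<and> set ds \<subseteq> ?Lab \<and>
      distinct (map src ds) \<and> distinct (map lab ds) \<and> map tgt ds = rotate1 (map src ds) \<and> F = set (map lab ds)"
      by (rule exI[of _ "dl \<gamma>"]) (intro conjI dl_closed[OF g(1)] g(2))
  qed
qed

end

section \<open>Balanced supersaturation\<close>

text \<open>A vertex set maximising \<open>card (ed U) - D * card U\<close> has minimum degree at
  least \<open>D\<close>, since deleting a vertex of smaller degree would increase the value.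
  Comparison with the full vertex set shows that at most \<open>D * n\<close>, hence at most half,
  of the edges are lost.\<close>

lemma exists_dense_darts:
  fixes D :: real and \<pi> :: "'e \<Rightarrow> nat set"
  assumes Y: "finite Y" "\<And>e. e \<in> Y \<Longrightarrow> \<pi> e \<subseteq> {1..n} \<and> card (\<pi> e) = 2" and D: "0 < D" "0 < n" "2 * D * n \<le> card Y"
  shows "\<exists>Dt. finite Dt \<and> Dt \<noteq> {} \<and> (\<forall>d\<in>Dt. lab d \<in> Y \<and> {src d, tgt d} = \<pi> (lab d) \<and> src d \<in> {1..n}) \<and>
    (\<forall>u e v. (u, e, v) \<in> Dt \<longrightarrow> (v, e, u) \<in> Dt) \<and> (\<forall>d\<in>Dt. D \<le> card {d'\<in>Dt. src d' = src d}) \<and> card Y \<le> 2 * real (card Dt)"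
proof -
  define ed where "ed U = {e\<in>Y. \<pi> e \<subseteq> U}" for U
  define f where "f U = real (card (ed U)) - D * card U" for U
  have fin: "finite (ed U)" for U unfolding ed_def using Y(1) by simp
  have "Max (f ` Pow {1..n}) \<in> f ` Pow {1..n}" by (rule Max_in) auto
  then obtain U where U: "U \<subseteq> {1..n}" and fU: "Max (f ` Pow {1..n}) = f U" by blast
  have max: "f U' \<le> f U" if "U' \<subseteq> {1..n}" for U'
    unfolding fU[symmetric] by (rule Max_ge) (use that in auto)
  have finU: "finite U" using U finite_subset by blast
  have full: "ed {1..n} = Y" unfolding ed_def using Y(2) by auto
  have "0 < 2 * D * n" using D by simp
  then have Ypos: "0 < real (card Y)" using D(3) by linarith
  have "f {1..n} \<le> f U" by (rule max) simp
  then have "real (card Y) - D * n \<le> real (card (ed U)) - D * card U" unfolding f_def full by simp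
  moreover have "0 \<le> D * card U" using D by simp
  ultimately have big: "card Y \<le> 2 * real (card (ed U))" using D(3) by linarith
  define Dt where "Dt = {d. lab d \<in> ed U \<and> {src d, tgt d} = \<pi> (lab d)}"
  have srcU: "src d \<in> U \<and> tgt d \<in> U" if "d \<in> Dt" for d using that unfolding Dt_def ed_def by blast
  have mem: "\<exists>v. (u, e, v) \<in> Dt" if "e \<in> ed U" "u \<in> \<pi> e" for u e
  proof -
    have "card (\<pi> e) = 2" using that(1) Y(2) unfolding ed_def by blast
    then obtain a b where ab: "\<pi> e = {a, b}" "a \<noteq> b" by (meson card_2_iff)
    then have "u = a \<or> u = b" using that(2) by blast
    then show ?thesis
    proof
      assume "u = a" then have "(u, e, b) \<in> Dt" using that(1) ab unfolding Dt_def by simp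
      then show ?thesis ..
    next
      assume "u = b" then have "(u, e, a) \<in> Dt" using that(1) ab unfolding Dt_def by (simp add: insert_commute)
      then show ?thesis ..
    qed
  qed
  have finDt: "finite Dt"
  proof (rule finite_subset)
    show "Dt \<subseteq> U \<times> ed U \<times> U"
    proof
      fix d assume d: "d \<in> Dt"
      then show "d \<in> U \<times> ed U \<times> U" using srcU[OF d] unfolding Dt_def by (auto simp: mem_Times_iff)
    qed
    show "finite (U \<times> ed U \<times> U)" using finU fin by simp
  qed
  have "ed U \<subseteq> lab ` Dt"
  proof
    fix e assume e: "e \<in> ed U"
    then have "card (\<pi> e) = 2" using Y(2) unfolding ed_def by blast
    then have "\<pi> e \<noteq> {}" by auto
    then obtain u where "u \<in> \<pi> e" by blast
    then obtain v where "(u, e, v) \<in> Dt" using mem[OF e] by blast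
    then show "e \<in> lab ` Dt" by force
  qed
  then have "card (ed U) \<le> card Dt" using finDt by (rule surj_card_le[rotated])
  then have cY: "card Y \<le> 2 * real (card Dt)" using big by linarith
  have deg: "D \<le> card {d'\<in>Dt. src d' = u}" if u: "u \<in> U" for u
  proof -
    have "f (U - {u}) \<le> f U" by (rule max) (use U in blast)
    moreover have "card U = Suc (card (U - {u}))" using u finU by (metis card_Suc_Diff1)
    ultimately have "D \<le> real (card (ed U)) - real (card (ed (U - {u})))" unfolding f_def by (simp add: algebra_simps)
    also have "\<dots> = card (ed U - ed (U - {u}))"
    proof -
      have "ed (U - {u}) \<subseteq> ed U" unfolding ed_def by blast
      then show ?thesis using fin by (simp add: card_Diff_subset card_mono)
    qed
    also have "\<dots> \<le> card {d'\<in>Dt. src d' = u}"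
    proof -
      have "ed U - ed (U - {u}) \<subseteq> lab ` {d'\<in>Dt. src d' = u}"
      proof
        fix e assume "e \<in> ed U - ed (U - {u})"
        then have e: "e \<in> ed U" "u \<in> \<pi> e" unfolding ed_def by auto
        then obtain v where "(u, e, v) \<in> Dt" using mem by blast
        then show "e \<in> lab ` {d'\<in>Dt. src d' = u}" by force
      qed
      moreover have "finite {d'\<in>Dt. src d' = u}" using finDt by simp
      ultimately show ?thesis by (intro of_nat_mono) (rule surj_card_le)
    qed
    finally show ?thesis .
  qed
  show ?thesis
  proof (intro exI[of _ Dt] conjI ballI allI impI)
    show "finite Dt" by (rule finDt)
    show "Dt \<noteq> {}" using cY Ypos by auto
    fix d assume d: "d \<in> Dt"
    show "lab d \<in> Y" "{src d, tgt d} = \<pi> (lab d)" using d unfolding Dt_def ed_def by blast+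
    show "src d \<in> {1..n}" using srcU[OF d] U by blast
    show "D \<le> card {d'\<in>Dt. src d' = src d}" by (rule deg) (use srcU[OF d] in blast)
  next
    show "(v, e, u) \<in> Dt" if "(u, e, v) \<in> Dt" for u e v using that unfolding Dt_def by (simp add: insert_commute)
    show "card Y \<le> 2 * real (card Dt)" by (rule cY)
  qed
qed

lemma berge_of_rotation:
  assumes "2 \<le> l" and len: "length ds = 2 * l" and D: "set ds \<subseteq> {d. lab d \<in> X \<and> src d \<in> lab d \<and> tgt d \<in> lab d}"
    and X: "X \<subseteq> nsets {1..n} r" and dist: "distinct (map src ds)" "distinct (map lab ds)"
    and rot: "map tgt ds = rotate1 (map src ds)"
  shows "set (map lab ds) \<in> berge_cycles r (2 * l)"
proof (rule berge_cycle_of_closed_walk[OF len _ _ _ dist])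
  show "0 < 2 * l" using assms(1) by simp
  show "src d \<in> lab d \<and> tgt d \<in> lab d \<and> lab d \<in> nsets UNIV r" if "d \<in> set ds" for d
  proof -
    have "lab d \<in> X" "src d \<in> lab d" "tgt d \<in> lab d" using that D by blast+
    then show ?thesis using X unfolding nsets_def by blast
  qed
  show "tgt (ds ! i) = src (ds ! (Suc i mod (2 * l)))" if i: "i < 2 * l" for i
  proof -
    have "map tgt ds ! i = rotate1 (map src ds) ! i" unfolding rot ..
    then show ?thesis using i len assms(1) by (simp add: nth_rotate1)
  qed
qed

text \<open>The value of \<open>lam\<close> is decided here: it gives
  \<open>R - 1 = (r - 2) * (2 * l - 1) / (2 * l - 2)\<close>, which is what turns the denominator of
  the complete cycle in the fan into an exact power of \<open>\<theta>\<close>.\<close>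

lemma theta_exponents:
  fixes \<theta> R B M0 :: real
  assumes l: "2 \<le> l" and r: "3 \<le> r" and R: "R = real r - 1 + (real r - 2) / (2 * real l - 2)" and th: "1 \<le> \<theta>"
    and B: "B = \<theta> powr (1 - 1 / R)" and M0: "M0 = B powr (1 / (real r - 2))"
  shows "1 \<le> M0" "M0 ^ (r - 2) = B" "M0 \<le> B" "M0 ^ (2 * l - 2) * B ^ (2 * l - 1) = \<theta> ^ (2 * l - 1)" "\<theta> \<le> M0 * B"
    "1 < R"
proof -
  have r': "1 \<le> real r - 2" "real (r - 2) = real r - 2" using r by auto
  have l': "2 \<le> 2 * real l - 2" "real (2 * l - 2) = 2 * real l - 2" "real (2 * l - 1) = 2 * real l - 1" using l by auto
  have "0 \<le> (real r - 2) / (2 * real l - 2)" using r' l' by simp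
  then show R1: "1 < R" unfolding R using r' by linarith
  have a0: "0 \<le> 1 - 1 / R" using R1 by simp
  have B1: "1 \<le> B" unfolding B using th a0 by (rule ge_one_powr_ge_zero)
  show M1: "1 \<le> M0" unfolding M0 by (rule ge_one_powr_ge_zero[OF B1]) (use r' in simp)
  show MB: "M0 ^ (r - 2) = B"
  proof -
    have "M0 ^ (r - 2) = M0 powr real (r - 2)" using M1 by (simp add: powr_realpow)
    also have "\<dots> = B powr 1" unfolding M0 powr_powr r'(2) using r' by simp
    finally show ?thesis using B1 by simp
  qed
  show "M0 \<le> B" unfolding MB[symmetric] using M1 r by (intro self_le_power) auto
  have key: "(1 - 1 / R) * ((2 * real l - 2) / (real r - 2) + (2 * real l - 1)) = 2 * real l - 1"
  proof -
    have R1': "R - 1 = (real r - 2) * (2 * real l - 1) / (2 * real l - 2)" unfolding R using l' by (simp add: field_simps)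
    define A where "A = (2 * real l - 2) / (real r - 2)"
    have A: "2 * real l - 1 = A * (R - 1)" unfolding R1' A_def using l' r' by simp
    have "(1 - 1 / R) * (A + A * (R - 1)) = A * (R - 1)" using R1 by (simp add: field_simps)
    then show ?thesis unfolding A_def[symmetric] A .
  qed
  show eq: "M0 ^ (2 * l - 2) * B ^ (2 * l - 1) = \<theta> ^ (2 * l - 1)"
  proof -
    have "M0 ^ (2 * l - 2) = M0 powr real (2 * l - 2)" "B ^ (2 * l - 1) = B powr real (2 * l - 1)"
      using M1 B1 by (simp_all only: powr_realpow)
    then have "M0 ^ (2 * l - 2) * B ^ (2 * l - 1) = B powr ((2 * real l - 2) / (real r - 2) + (2 * real l - 1))"
      unfolding M0 l' powr_powr powr_add by simp
    also have "\<dots> = \<theta> powr (2 * real l - 1)" unfolding B powr_powr key ..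
    also have "\<dots> = \<theta> ^ (2 * l - 1)" unfolding l'(3)[symmetric] using th by (subst powr_realpow) auto
    finally show ?thesis .
  qed
  show "\<theta> \<le> M0 * B"
  proof (rule power_le_imp_le_base)
    have "M0 ^ (2 * l - 2) \<le> M0 ^ (2 * l - 1)" using M1 by (intro power_increasing) auto
    then have "\<theta> ^ (2 * l - 1) \<le> M0 ^ (2 * l - 1) * B ^ (2 * l - 1)" unfolding eq[symmetric] using B1 by (intro mult_right_mono) auto
    then show "\<theta> ^ Suc (2 * l - 2) \<le> (M0 * B) ^ Suc (2 * l - 2)" using l by (simp add: power_mult_distrib Suc_diff_Suc numeral_2_eq_2)
  qed (use M1 B1 in simp)
qed

text \<open>\<open>card X / (4 * n)\<close> is the minimum degree that can be retained when at least
  half of \<open>X\<close> contains a pair of small codegree, and the remaining conditions are then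
  those of \<open>thin_case\<close>. For the fan both bounds on \<open>\<tau>\<close> follow from
  \<open>1 / \<theta> \<le> \<tau>\<close> by \<open>theta_exponents\<close>.\<close>

theorem supersaturation:
  fixes l r :: nat and R :: real
  assumes l: "2 \<le> l" and r: "2 \<le> r" and R: "R = real r - 1 + (real r - 2) / (2 * real l - 2)"
  shows "\<exists>K\<ge>1. \<exists>\<theta>0\<ge>1. \<forall>n X \<theta> \<tau>. X \<subseteq> nsets {1..n} r \<longrightarrow> \<theta>0 \<le> \<theta> \<longrightarrow> \<theta> \<le> card X / (4 * real n) \<longrightarrow>
    2 * real n * (\<theta> ^ (l - 1) * \<theta> powr (1 - 1 / R)) \<le> (card X / (4 * real n)) ^ l \<longrightarrow> 1 / \<theta> \<le> \<tau> \<longrightarrow>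
    1 / ((card X / (4 * real n)) ^ (l - 1) * \<theta> ^ (l - 1) * \<theta> powr (1 - 1 / R)) \<le> \<tau> ^ (2 * l - 1) \<longrightarrow>
    (\<exists>w. spread (2 * l) K \<tau> X w \<and> (\<forall>F. w F > 0 \<longrightarrow> F \<in> berge_cycles r (2 * l)))"
proof -
  \<comment> \<open>The product of the two constants \<open>4 * r ^ 3\<close> and
    \<open>8 * r ^ 2\<close> of \<open>exists_triple_family\<close>.\<close>
  define \<kappa> where "\<kappa> = 32 * real r ^ 5"
  define K1 :: real where "K1 = 2 ^ (2 * l * (2 * (2 * l))) * 4 * (8 * 4 ^ l) ^ (2 * l + 3)"
  define K2 where "K2 = 2 ^ (2 * l * (r ^ 2 * (2 * l))) * 16 * \<kappa> ^ (2 * l)"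
  define c1 where "c1 = 64 * real l ^ 2 * 4 ^ l"
  define c2 where "c2 = 16 * real l ^ 2 * \<kappa>"
  \<comment> \<open>Since \<open>\<theta> / B = \<theta> powr (1 / R)\<close>, the bound
    \<open>c1 powr R \<le> \<theta>\<close> gives \<open>c1 * B \<le> \<theta>\<close>; the last
    entry gives \<open>c2 \<le> M0\<close>. For \<open>r = 2\<close> its exponent is
    \<open>0 / 0\<close>, which is \<open>0\<close>, and the entry is \<open>1\<close>.\<close>
  define \<theta>0 where "\<theta>0 = max 1 (max (c1 powr R) (c2 powr ((real r - 2) / (1 - 1 / R))))"
  have R1: "1 \<le> R"
  proof -
    have "0 \<le> (real r - 2) / (2 * real l - 2)" using l r by simp
    then show ?thesis unfolding R using r by linarith
  qed
  have "1 \<le> real r ^ 5" using r by (intro one_le_power) simp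
  then have kap: "1 \<le> \<kappa>" unfolding \<kappa>_def by simp
  have c0: "0 < c1" "0 < c2" unfolding c1_def c2_def using l kap by auto
  show ?thesis
  proof (rule exI[of _ "max 1 (max K1 K2)"], rule conjI, simp, rule exI[of _ \<theta>0], rule conjI, simp add: \<theta>0_def, intro allI impI)
    fix n and X :: "nat set set" and \<theta> \<tau> :: real
    let ?D = "card X / (4 * real n)"
    define B where "B = \<theta> powr (1 - 1 / R)"
    assume X: "X \<subseteq> nsets {1..n} r" and th0: "\<theta>0 \<le> \<theta>" and thD: "\<theta> \<le> ?D"
      and few: "2 * real n * (\<theta> ^ (l - 1) * \<theta> powr (1 - 1 / R)) \<le> ?D ^ l" and tau1: "1 / \<theta> \<le> \<tau>"
      and tau2: "1 / (?D ^ (l - 1) * \<theta> ^ (l - 1) * \<theta> powr (1 - 1 / R)) \<le> \<tau> ^ (2 * l - 1)"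
    note few = few[folded B_def] and tau2 = tau2[folded B_def]
    have th: "1 \<le> \<theta>" "c1 powr R \<le> \<theta>" "c2 powr ((real r - 2) / (1 - 1 / R)) \<le> \<theta>" using th0 unfolding \<theta>0_def by auto
    have D1: "1 \<le> ?D" using th(1) thD by linarith
    then have n0: "0 < n" by (cases "n = 0") auto
    have X0: "0 < card X" using D1 by (cases "card X = 0") auto
    then have finX: "finite X" and Xne: "X \<noteq> {}" using card_ge_0_finite by auto
    have \<tau>0: "0 \<le> \<tau>" using tau1 th(1) by (meson order_trans zero_le_divide_1_iff zero_le_one)
    have B1: "1 \<le> B" unfolding B_def using th(1) R1 by (intro ge_one_powr_ge_zero) auto
    have B\<theta>: "B \<le> \<theta>" unfolding B_def using th(1) R1 powr_mono[of "1 - 1 / R" 1 \<theta>] by simp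
    have Xe: "finite e \<and> card e = r \<and> e \<subseteq> {1..n}" if "e \<in> X" for e using X that unfolding nsets_def by blast
    define Th where "Th = {e\<in>X. \<exists>p\<subseteq>e. card p = 2 \<and> cd X p \<le> B}"
    have ThX: "Th \<subseteq> X" unfolding Th_def by blast
    then have finTh: "finite Th" using finX finite_subset by blast
    have "\<exists>w. (spread (2 * l) K1 \<tau> X w \<or> spread (2 * l) K2 \<tau> X w) \<and> (\<forall>F. w F > 0 \<longrightarrow> F \<in> berge_cycles r (2 * l))"
    proof (cases "card X \<le> 2 * card Th")
      case True
      \<comment> \<open>Each edge is represented by one of its pairs of small codegree. Parallel
        darts come from different edges of \<open>X\<close> through the same pair, so multiplicities
        are bounded by the codegree.\<close>
      obtain \<pi> where \<pi>: "\<And>e. e \<in> Th \<Longrightarrow> \<pi> e \<subseteq> e \<and> card (\<pi> e) = 2 \<and> cd X (\<pi> e) \<le> B"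
      proof -
        have "\<forall>e\<in>Th. \<exists>p. p \<subseteq> e \<and> card p = 2 \<and> cd X p \<le> B" unfolding Th_def by blast
        from bchoice[OF this] show thesis using that by blast
      qed
      have "\<exists>Dt. finite Dt \<and> Dt \<noteq> {} \<and> (\<forall>d\<in>Dt. lab d \<in> Th \<and> {src d, tgt d} = \<pi> (lab d) \<and> src d \<in> {1..n}) \<and>
        (\<forall>u e v. (u, e, v) \<in> Dt \<longrightarrow> (v, e, u) \<in> Dt) \<and> (\<forall>d\<in>Dt. ?D \<le> card {d'\<in>Dt. src d' = src d}) \<and> card Th \<le> 2 * real (card Dt)"
      proof (rule exists_dense_darts[OF finTh])
        show "\<pi> e \<subseteq> {1..n} \<and> card (\<pi> e) = 2" if "e \<in> Th" for e using \<pi>[OF that] Xe[of e] that ThX by blast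
        show "0 < ?D" using D1 by linarith
        show "0 < n" by (rule n0)
        have "real (card X) \<le> 2 * real (card Th)" using True by linarith
        then show "2 * ?D * n \<le> card Th" using n0 by simp
      qed
      then obtain Dt where Dt: "finite Dt" "Dt \<noteq> {}"
        "\<And>d. d \<in> Dt \<Longrightarrow> lab d \<in> Th \<and> {src d, tgt d} = \<pi> (lab d) \<and> src d \<in> {1..n}"
        "\<And>u e v. (u, e, v) \<in> Dt \<Longrightarrow> (v, e, u) \<in> Dt" "\<And>d. d \<in> Dt \<Longrightarrow> ?D \<le> card {d'\<in>Dt. src d' = src d}"
        "card Th \<le> 2 * real (card Dt)"
      proof (elim exE conjE, goal_cases)
        case (1 Dt)
        show ?case
        proof (rule 1(1)[OF 1(2,3)])
          show "lab d \<in> Th \<and> {src d, tgt d} = \<pi> (lab d) \<and> src d \<in> {1..n}" if "d \<in> Dt" for d by (rule bspec[OF 1(4) that])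
          show "(v, e, u) \<in> Dt" if "(u, e, v) \<in> Dt" for u e v by (rule 1(5)[rule_format, OF that])
          show "?D \<le> card {d'\<in>Dt. src d' = src d}" if "d \<in> Dt" for d by (rule bspec[OF 1(6) that])
          show "card Th \<le> 2 * real (card Dt)" by (rule 1(7))
        qed
      qed
      interpret g: multigraph Dt ?D B \<theta>
      proof unfold_locales
        show "finite Dt" "Dt \<noteq> {}" "1 \<le> B" "B \<le> \<theta>" "\<theta> \<le> ?D" by (fact Dt B1 B\<theta> thD)+
        show "(v, e, u) \<in> Dt" if "(u, e, v) \<in> Dt" for u e v by (rule Dt(4)[OF that])
        show "?D \<le> card {d'\<in>Dt. src d' = src d}" if "d \<in> Dt" for d by (rule Dt(5)[OF that])
        show "(u, e, u) \<notin> Dt" for u e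
        proof
          assume "(u, e, u) \<in> Dt"
          from Dt(3)[OF this] have "e \<in> Th" "\<pi> e = {u}" by auto
          then show False using \<pi>[of e] by simp
        qed
        show "card {d\<in>Dt. src d = u \<and> tgt d = v} \<le> B" for u v
        proof (cases "{d\<in>Dt. src d = u \<and> tgt d = v} = {}")
          case True
          then show ?thesis using B1 by (simp only: card.empty)
        next
          case False
          then obtain d0 where d0: "d0 \<in> Dt" "src d0 = u" "tgt d0 = v" by blast
          then have p0: "lab d0 \<in> Th" "\<pi> (lab d0) = {u, v}" using Dt(3)[OF d0(1)] by auto
          have "card {d\<in>Dt. src d = u \<and> tgt d = v} \<le> card {e\<in>X. {u, v} \<subseteq> e}"
          proof (rule card_inj_on_le[of lab])
            show "inj_on lab {d\<in>Dt. src d = u \<and> tgt d = v}" by (rule inj_onI) (auto simp: prod_eq_iff)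
            show "lab ` {d\<in>Dt. src d = u \<and> tgt d = v} \<subseteq> {e\<in>X. {u, v} \<subseteq> e}"
            proof (rule image_subsetI)
              fix d assume "d \<in> {d\<in>Dt. src d = u \<and> tgt d = v}"
              then have d: "d \<in> Dt" "src d = u" "tgt d = v" by auto
              then have "lab d \<in> Th" "\<pi> (lab d) = {u, v}" using Dt(3)[OF d(1)] by auto
              then show "lab d \<in> {e\<in>X. {u, v} \<subseteq> e}" using \<pi>[of "lab d"] ThX by auto
            qed
            show "finite {e\<in>X. {u, v} \<subseteq> e}" using finX by simp
          qed
          then have "real (card {d\<in>Dt. src d = u \<and> tgt d = v}) \<le> cd X {u, v}" unfolding cd_def by simp
          also have "\<dots> \<le> B" using \<pi>[OF p0(1)] p0(2) by simp
          finally show ?thesis .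
        qed
      qed
      have "\<exists>w. spread (2 * l) (2 ^ (2 * l * (2 * (2 * l))) * 4 * (8 * 4 ^ l) ^ (2 * l + 3)) \<tau> X w \<and>
        (\<forall>F. w F > 0 \<longrightarrow> (\<exists>ds. length ds = 2 * l \<and> set ds \<subseteq> Dt \<and> distinct (map src ds) \<and> distinct (map lab ds) \<and>
        map tgt ds = rotate1 (map src ds) \<and> F = set (map lab ds)))"
      proof (rule g.thin_case)
        show "2 * card g.V * (\<theta> ^ (l - 1) * B) \<le> ?D ^ l"
        proof -
          have "card (src ` Dt) \<le> card {1..n}" using Dt(3) by (intro card_mono) auto
          then have "2 * real (card (src ` Dt)) * (\<theta> ^ (l - 1) * B) \<le> 2 * real n * (\<theta> ^ (l - 1) * B)"
            using th(1) B1 by (intro mult_right_mono) auto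
          then show ?thesis using few unfolding g.V_def by simp
        qed
        show "64 * real l ^ 2 * 4 ^ l * B \<le> \<theta>"
        proof -
          have "c1 = (c1 powr R) powr (1 / R)" unfolding powr_powr using R1 c0 by simp
          also have "\<dots> \<le> \<theta> powr (1 / R)" using th(2) R1 by (intro powr_mono2) auto
          finally have "c1 * B \<le> \<theta> powr (1 / R) * B" using B1 by (intro mult_right_mono) auto
          also have "\<dots> = \<theta>" unfolding B_def powr_add[symmetric] using th(1) by simp
          finally show ?thesis unfolding c1_def .
        qed
        show "2 \<le> l" "1 / \<theta> \<le> \<tau>" "1 / (?D ^ (l - 1) * \<theta> ^ (l - 1) * B) \<le> \<tau> ^ (2 * l - 1)" "finite X"
          by (fact l tau1 tau2 finX)+
        show "lab d \<in> X" if "d \<in> Dt" for d using Dt(3)[OF that] ThX by blast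
        have "real (card X) \<le> 2 * real (card Th)" using True by linarith
        then show "card X \<le> 4 * real (card Dt)" using Dt(6) by linarith
        show "{src d, tgt d} = {src d', tgt d'}" if "d \<in> Dt" "d' \<in> Dt" "lab d = lab d'" for d d'
          using Dt(3)[OF that(1)] Dt(3)[OF that(2)] that(3) by simp
      qed
      then obtain w where w: "spread (2 * l) K1 \<tau> X w"
        "\<And>F. w F > 0 \<Longrightarrow> (\<exists>ds. length ds = 2 * l \<and> set ds \<subseteq> Dt \<and> distinct (map src ds) \<and> distinct (map lab ds) \<and>
        map tgt ds = rotate1 (map src ds) \<and> F = set (map lab ds))" unfolding K1_def by blast
      have "F \<in> berge_cycles r (2 * l)" if wF: "0 < w F" for F
      proof -
        obtain ds where ds: "length ds = 2 * l" "set ds \<subseteq> Dt" "distinct (map src ds)" "distinct (map lab ds)"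
          "map tgt ds = rotate1 (map src ds)" "F = set (map lab ds)" using w(2)[OF wF] by blast
        have "Dt \<subseteq> {d. lab d \<in> X \<and> src d \<in> lab d \<and> tgt d \<in> lab d}"
        proof
          fix d assume "d \<in> Dt"
          from Dt(3)[OF this] have "lab d \<in> Th" "{src d, tgt d} = \<pi> (lab d)" by auto
          then have "lab d \<in> X" "src d \<in> lab d" "tgt d \<in> lab d" using \<pi>[of "lab d"] ThX by blast+
          then show "d \<in> {d. lab d \<in> X \<and> src d \<in> lab d \<and> tgt d \<in> lab d}" by simp
        qed
        then have "set ds \<subseteq> {d. lab d \<in> X \<and> src d \<in> lab d \<and> tgt d \<in> lab d}" using ds(2) by (rule order_trans[rotated])
        then show ?thesis unfolding ds(6) by (rule berge_of_rotation[OF l ds(1) _ X ds(3,4,5)])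
      qed
      then show ?thesis using w(1) by blast
    next
      case False
      define Y where "Y = X - Th"
      have YX: "Y \<subseteq> X" unfolding Y_def by blast
      have "card Y = card X - card Th" unfolding Y_def using finTh ThX by (rule card_Diff_subset)
      then have cY: "card X \<le> 2 * card Y" using False by linarith
      have Yp: "B < cd X p" if "e \<in> Y" "p \<subseteq> e" "card p = 2" for e p
        using that unfolding Y_def Th_def by (auto simp: not_le)
      \<comment> \<open>For \<open>r = 2\<close> a pair lies in at most one edge, its codegree does
        not exceed \<open>B\<close>, and every edge would belong to \<open>Th\<close>.\<close>
      have r3: "3 \<le> r"
      proof (rule ccontr)
        assume "\<not> 3 \<le> r"
        then have r2: "r = 2" using r by linarith
        have "Y \<noteq> {}" using cY X0 by (cases "Y = {}") auto
        then obtain e where e: "e \<in> Y" by blast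
        then have ce: "card e = 2" "e \<in> X" using YX Xe r2 by auto
        have "{e'\<in>X. e \<subseteq> e'} \<subseteq> {e}"
        proof
          fix e' assume "e' \<in> {e'\<in>X. e \<subseteq> e'}"
          then have "e \<subseteq> e'" "finite e'" "card e' = 2" using Xe[of e'] r2 by auto
          then have "e = e'" using ce card_subset_eq by metis
          then show "e' \<in> {e}" by simp
        qed
        then have "card {e'\<in>X. e \<subseteq> e'} \<le> card {e}" by (intro card_mono) auto
        then have "cd X e \<le> 1" unfolding cd_def by simp
        then show False using Yp[OF e subset_refl ce(1)] B1 by linarith
      qed
      define M0 where "M0 = B powr (1 / (real r - 2))"
      note ex = theta_exponents[OF l r3 R th(1) B_def M0_def]
      obtain \<T> \<nu> where T: "finite \<T>" "real (card X) / 8 \<le> sum \<nu> \<T>"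
        "\<And>T. T \<in> \<T> \<Longrightarrow> card T = 3 \<and> 0 < \<nu> T \<and> \<nu> T \<le> cd X T \<and> (\<exists>e\<in>Y. T \<subseteq> e)"
        "\<And>T p. T \<in> \<T> \<Longrightarrow> p \<subseteq> T \<Longrightarrow> card p = 2 \<Longrightarrow> cd X T \<le> 4 * real r ^ 3 * cd X p / M0 \<and>
          1 / (8 * real r ^ 2) * cd X p \<le> sum \<nu> {T'\<in>\<T>. p \<subseteq> T'}"
        "\<And>p. sum \<nu> {T\<in>\<T>. p \<subseteq> T} \<le> cd X p"
      proof -
        have "\<exists>\<T> \<nu>. finite \<T> \<and> real (card X) / 8 \<le> sum \<nu> \<T> \<and>
          (\<forall>T\<in>\<T>. card T = 3 \<and> 0 < \<nu> T \<and> \<nu> T \<le> cd X T \<and> (\<exists>e\<in>Y. T \<subseteq> e)) \<and>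
          (\<forall>T\<in>\<T>. \<forall>p\<subseteq>T. card p = 2 \<longrightarrow> cd X T \<le> 4 * real r ^ 3 * cd X p / M0 \<and>
             1 / (8 * real r ^ 2) * cd X p \<le> sum \<nu> {T'\<in>\<T>. p \<subseteq> T'}) \<and>
          (\<forall>p. sum \<nu> {T\<in>\<T>. p \<subseteq> T} \<le> cd X p)"
        proof (rule exists_triple_family[OF finX _ r3 YX cY ex(1)])
          show "finite e \<and> card e = r" if "e \<in> X" for e using Xe[OF that] by blast
          show "M0 ^ (r - 2) \<le> cd X p" if "e \<in> Y" "p \<subseteq> e" "card p = 2" for e p
            unfolding ex(2) using Yp[OF that] by simp
        qed
        then show thesis
        proof (elim exE conjE, goal_cases)
          case (1 \<T> \<nu>)
          show ?case
          proof (rule that[OF 1(1,2)])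
            show "card T = 3 \<and> 0 < \<nu> T \<and> \<nu> T \<le> cd X T \<and> (\<exists>e\<in>Y. T \<subseteq> e)" if "T \<in> \<T>" for T by (rule bspec[OF 1(3) that])
            show "cd X T \<le> 4 * real r ^ 3 * cd X p / M0 \<and> 1 / (8 * real r ^ 2) * cd X p \<le> sum \<nu> {T'\<in>\<T>. p \<subseteq> T'}"
              if "T \<in> \<T>" "p \<subseteq> T" "card p = 2" for T p by (rule 1(4)[rule_format, OF that])
            show "sum \<nu> {T\<in>\<T>. p \<subseteq> T} \<le> cd X p" for p by (rule spec[OF 1(5)])
          qed
        qed
      qed
      interpret ff: fat_family X r l \<T> \<nu> M0 \<kappa> B
      proof unfold_locales
        show "finite X" "finite \<T>" "2 \<le> l" "1 \<le> \<kappa>" "M0 \<le> B" "X \<noteq> {}" by (fact finX T l kap ex Xne)+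
        show "real (card X) / 8 \<le> sum \<nu> \<T>" by (rule T(2))
        show "finite e \<and> card e = r" if "e \<in> X" for e using Xe[OF that] by blast
        show "card T = 3" "0 < \<nu> T" if "T \<in> \<T>" for T using T(3)[OF that] by blast+
        show "B \<le> cd X p" if Tp: "T \<in> \<T>" "p \<subseteq> T" "card p = 2" for T p
        proof -
          obtain e where e: "e \<in> Y" "T \<subseteq> e" using T(3)[OF Tp(1)] by blast
          have "B < cd X p" by (rule Yp[OF e(1) order_trans[OF Tp(2) e(2)] Tp(3)])
          then show ?thesis by simp
        qed
        show "sum \<nu> {T\<in>\<T>. p \<subseteq> T} \<le> cd X p" for p by (rule T(5))
        show "\<nu> T \<le> \<kappa> / M0 * sum \<nu> {T'\<in>\<T>. p \<subseteq> T'}" if Tp: "T \<in> \<T>" "p \<subseteq> T" "card p = 2" for T p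
        proof -
          have r0: "0 < real r" using r by simp
          have "\<nu> T \<le> cd X T" using T(3)[OF Tp(1)] by blast
          also have "\<dots> \<le> 4 * real r ^ 3 * cd X p / M0" using T(4)[OF Tp] by blast
          also have "\<dots> = \<kappa> / M0 * (1 / (8 * real r ^ 2) * cd X p)" unfolding \<kappa>_def using r0 by (simp add: field_simps eval_nat_numeral)
          also have "\<dots> \<le> \<kappa> / M0 * sum \<nu> {T'\<in>\<T>. p \<subseteq> T'}"
            using T(4)[OF Tp] kap ex(1) by (intro mult_left_mono) auto
          finally show ?thesis .
        qed
        show "16 * real l ^ 2 * \<kappa> \<le> M0"
        proof -
          have a: "0 < 1 - 1 / R" "0 < real r - 2" using ex(6) r3 by auto
          have "c2 = (c2 powr ((real r - 2) / (1 - 1 / R))) powr ((1 - 1 / R) / (real r - 2))"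
          proof -
            have "(real r - 2) / (1 - 1 / R) * ((1 - 1 / R) / (real r - 2)) = 1"
              using ex(6) a by (simp del: less_divide_eq_1_pos divide_less_eq_1_pos)
            then show ?thesis unfolding powr_powr using c0 by simp
          qed
          also have "\<dots> \<le> \<theta> powr ((1 - 1 / R) / (real r - 2))" using th(3) a by (intro powr_mono2) auto
          also have "\<dots> = M0" unfolding M0_def B_def powr_powr by simp
          finally show ?thesis unfolding c2_def .
        qed
      qed
      have t1: "1 / (M0 * B) \<le> \<tau>"
      proof -
        have "1 / (M0 * B) \<le> 1 / \<theta>" using ex(1,5) B1 th(1) by (intro divide_left_mono mult_pos_pos) auto
        then show ?thesis using tau1 by linarith
      qed
      have t2: "1 / (M0 ^ (2 * l - 2) * B ^ (2 * l - 1)) \<le> \<tau> ^ (2 * l - 1)"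
      proof -
        have "(1 / \<theta>) ^ (2 * l - 1) \<le> \<tau> ^ (2 * l - 1)" using tau1 th(1) by (intro power_mono) auto
        then show ?thesis unfolding ex(4) by (simp add: power_divide)
      qed
      obtain w where w: "spread (2 * l) K2 \<tau> X w"
        "\<And>F. w F > 0 \<Longrightarrow> (\<exists>ds. length ds = 2 * l \<and> set ds \<subseteq> {d. lab d \<in> X \<and> src d \<in> lab d \<and> tgt d \<in> lab d} \<and>
          distinct (map src ds) \<and> distinct (map lab ds) \<and> map tgt ds = rotate1 (map src ds) \<and> F = set (map lab ds))"
        using ff.fat_case[OF t1 t2] unfolding K2_def by blast
      have "F \<in> berge_cycles r (2 * l)" if wF: "0 < w F" for F
      proof -
        obtain ds where ds: "length ds = 2 * l" "set ds \<subseteq> {d. lab d \<in> X \<and> src d \<in> lab d \<and> tgt d \<in> lab d}"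
          "distinct (map src ds)" "distinct (map lab ds)" "map tgt ds = rotate1 (map src ds)" "F = set (map lab ds)"
          using w(2)[OF wF] by blast
        show ?thesis unfolding ds(6) by (rule berge_of_rotation[OF l ds(1) ds(2) X ds(3,4,5)])
      qed
      then show ?thesis using w(1) by blast
    qed
    then obtain w where w: "spread (2 * l) K1 \<tau> X w \<or> spread (2 * l) K2 \<tau> X w" "\<forall>F. w F > 0 \<longrightarrow> F \<in> berge_cycles r (2 * l)"
      by blast
    have "spread (2 * l) (max 1 (max K1 K2)) \<tau> X w"
      using w(1) by (elim disjE) (rule spread_mono_K[OF _ _ \<tau>0], assumption, simp)+
    then show "\<exists>w. spread (2 * l) (max 1 (max K1 K2)) \<tau> X w \<and> (\<forall>F. w F > 0 \<longrightarrow> F \<in> berge_cycles r (2 * l))"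
      using w(2) by blast
  qed
qed

section \<open>The random hypergraph\<close>

text \<open>One term of the exponential series at \<open>M\<close>; it stands in for Stirling's
  formula when binomial coefficients are estimated.\<close>

lemma power_self_le_exp_fact: "real M ^ M \<le> exp M * fact M"
proof -
  have s: "(\<lambda>n. inverse (fact n) * real M ^ n) sums exp (real M)" using exp_converges[of "real M"] by (simp add: scaleR_conv_of_real)
  have "(\<Sum>n\<in>{M}. inverse (fact n) * real M ^ n) \<le> (\<Sum>n. inverse (fact n) * real M ^ n)"
    by (rule sum_le_suminf) (use s sums_summable in auto)
  then have "inverse (fact M) * real M ^ M \<le> exp (real M)" using sums_unique[OF s] by simp
  then show ?thesis by (simp add: field_simps)
qed

lemma prob_contains:
  assumes "0 \<le> p" "p \<le> 1" and J: "J \<subseteq> nsets {1..n} r"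
  shows "measure_pmf.prob (random_hypergraph r n p) {G. J \<subseteq> G} = p ^ card J"
proof -
  let ?V = "nsets {1..n} r"
  let ?P = "Pi_pmf ?V False (\<lambda>_. bernoulli_pmf p)"
  have fV: "finite ?V" by (simp add: finite_imp_finite_nsets)
  have "measure_pmf.prob (random_hypergraph r n p) {G. J \<subseteq> G} = measure_pmf.prob ?P {f. J \<subseteq> {e\<in>?V. f e}}"
    unfolding random_hypergraph_def measure_map_pmf by (simp add: vimage_def)
  also have "{f. J \<subseteq> {e\<in>?V. f e}} = Pi ?V (\<lambda>e. if e \<in> J then {True} else UNIV)"
    using J by (auto simp: Pi_def split: if_splits)
  also have "measure_pmf.prob ?P (Pi ?V (\<lambda>e. if e \<in> J then {True} else UNIV))
      = (\<Prod>e\<in>?V. measure_pmf.prob (bernoulli_pmf p) (if e \<in> J then {True} else UNIV))"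
    by (rule measure_Pi_pmf_Pi[OF fV])
  also have "\<dots> = (\<Prod>e\<in>?V. if e \<in> J then p else 1)"
    by (intro prod.cong refl) (use assms in \<open>simp add: measure_pmf_single\<close>)
  also have "\<dots> = p ^ card J" using J fV by (simp add: prod.If_cases Int_absorb1)
  finally show ?thesis .
qed

lemma random_hypergraph_subset: "G \<in> set_pmf (random_hypergraph r n p) \<Longrightarrow> G \<subseteq> nsets {1..n} r"
  unfolding random_hypergraph_def by auto

text \<open>The maximum is attained, and the identity embedding turns freeness from copies into the
  absence of members of \<open>\<F>\<close> as subsets, which is the form that containers speak
  about.\<close>

lemma ex_rel_witness:
  assumes G: "finite G" and ne: "{} \<notin> \<F>"
  shows "\<exists>H\<subseteq>G. (\<forall>F\<in>\<F>. \<not> F \<subseteq> H) \<and> card H = ex_rel G \<F>"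
proof -
  let ?S = "{card H | H. H \<subseteq> G \<and> (\<forall>F\<in>\<F>. \<not> contains_copy H F)}"
  have "?S \<subseteq> {..card G}" using G by (auto intro: card_mono)
  then have fin: "finite ?S" using finite_subset by blast
  have "\<not> contains_copy {} F" if "F \<in> \<F>" for F using that ne unfolding contains_copy_def by auto
  then have "card ({} :: hypergraph) \<in> ?S" by (intro CollectI exI[of _ "{}"]) auto
  then have "Max ?S \<in> ?S" using fin by (intro Max_in) auto
  then obtain H where H: "H \<subseteq> G" "\<forall>F\<in>\<F>. \<not> contains_copy H F" "card H = Max ?S" by auto
  have "\<not> F \<subseteq> H" if F: "F \<in> \<F>" for F
  proof
    assume "F \<subseteq> H"
    then have "contains_copy H F" unfolding contains_copy_def by (intro exI[of _ id]) auto
    then show False using H(2) F by blast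
  qed
  then show ?thesis using H unfolding ex_rel_def by blast
qed

text \<open>If the bound fails, some container has \<open>M > m\<close> edges that all belong to the
  random hypergraph. For one container the expected number of such subsets is at most
  \<open>(exp 1 * E * p / M) ^ M\<close>, and \<open>2 * exp 1 * E * p \<le> m\<close> makes the
  base at most \<open>1 / 2\<close>.\<close>

lemma prob_ex_rel_le:
  assumes ne: "{} \<notin> \<F>" and \<C>: "finite \<C>" "\<And>C. C \<in> \<C> \<Longrightarrow> C \<subseteq> nsets {1..n} r \<and> real (card C) \<le> E"
    and cover: "\<And>I. I \<subseteq> nsets {1..n} r \<Longrightarrow> (\<forall>F\<in>\<F>. \<not> F \<subseteq> I) \<Longrightarrow> \<exists>C\<in>\<C>. I \<subseteq> C"
    and p: "0 \<le> p" "p \<le> 1" "0 < m" "2 * exp 1 * E * p \<le> m"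
  shows "1 - card \<C> * (1 / 2) powr m \<le> measure_pmf.prob (random_hypergraph r n p) {G. real (ex_rel G \<F>) \<le> m}"
proof -
  let ?V = "nsets {1..n} r" and ?P = "measure_pmf.prob (random_hypergraph r n p)"
  have fV: "finite ?V" by (simp add: finite_imp_finite_nsets)
  define M where "M = Suc (nat \<lfloor>m\<rfloor>)"
  have M: "m < real M" unfolding M_def using p(3) by linarith
  have M1: "nat \<lfloor>m\<rfloor> < M" unfolding M_def by simp
  define JS where "JS C = {J. J \<subseteq> C \<and> card J = M}" for C :: hypergraph
  have finC: "finite C" if "C \<in> \<C>" for C using \<C>(2)[OF that] fV finite_subset by blast
  have finJ: "finite (JS C)" if "C \<in> \<C>" for C unfolding JS_def using finC[OF that] by simp
  have "?P {G. \<not> real (ex_rel G \<F>) \<le> m} \<le> ?P (\<Union>C\<in>\<C>. \<Union>J\<in>JS C. {G. J \<subseteq> G})"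
  proof -
    have "?P {G. \<not> real (ex_rel G \<F>) \<le> m} = ?P ({G. \<not> real (ex_rel G \<F>) \<le> m} \<inter> set_pmf (random_hypergraph r n p))"
      by (rule measure_Int_set_pmf[symmetric])
    also have "\<dots> \<le> ?P (\<Union>C\<in>\<C>. \<Union>J\<in>JS C. {G. J \<subseteq> G})"
    proof (rule measure_pmf.finite_measure_mono)
      show "{G. \<not> real (ex_rel G \<F>) \<le> m} \<inter> set_pmf (random_hypergraph r n p) \<subseteq> (\<Union>C\<in>\<C>. \<Union>J\<in>JS C. {G. J \<subseteq> G})"
      proof
        fix G assume G: "G \<in> {G. \<not> real (ex_rel G \<F>) \<le> m} \<inter> set_pmf (random_hypergraph r n p)"
        then have GV: "G \<subseteq> ?V" using random_hypergraph_subset by blast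
        then have fG: "finite G" using fV finite_subset by blast
        obtain H where H: "H \<subseteq> G" "\<forall>F\<in>\<F>. \<not> F \<subseteq> H" "card H = ex_rel G \<F>" using ex_rel_witness[OF fG ne] by blast
        have "H \<subseteq> ?V" using H(1) GV by blast
        from cover[OF this H(2)] obtain C where C: "C \<in> \<C>" "H \<subseteq> C" by blast
        have "m < real (card H)" using G H(3) by simp
        then have "M \<le> card H" unfolding M_def using p(3) by linarith
        then obtain J where J: "J \<subseteq> H" "card J = M" by (meson obtain_subset_with_card_n)
        then have "J \<in> JS C" "J \<subseteq> G" unfolding JS_def using C(2) H(1) by auto
        then show "G \<in> (\<Union>C\<in>\<C>. \<Union>J\<in>JS C. {G. J \<subseteq> G})" using C(1) by blast
      qed
    qed simp
    finally show ?thesis .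
  qed
  also have "\<dots> \<le> (\<Sum>C\<in>\<C>. ?P (\<Union>J\<in>JS C. {G. J \<subseteq> G}))"
    by (rule measure_pmf.finite_measure_subadditive_finite[OF \<C>(1)]) simp
  also have "\<dots> \<le> (\<Sum>C\<in>\<C>. (1 / 2) powr m)"
  proof (rule sum_mono)
    fix C assume C: "C \<in> \<C>"
    have "?P (\<Union>J\<in>JS C. {G. J \<subseteq> G}) \<le> (\<Sum>J\<in>JS C. ?P {G. J \<subseteq> G})"
      by (rule measure_pmf.finite_measure_subadditive_finite[OF finJ[OF C]]) simp
    also have "\<dots> = (\<Sum>J\<in>JS C. p ^ M)"
    proof (rule sum.cong[OF refl])
      fix J assume J: "J \<in> JS C"
      then have "J \<subseteq> ?V" using \<C>(2)[OF C] unfolding JS_def by blast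
      from prob_contains[OF p(1,2) this] show "?P {G. J \<subseteq> G} = p ^ M" using J unfolding JS_def by simp
    qed
    also have "\<dots> = real (card C choose M) * p ^ M" unfolding JS_def using n_subsets[OF finC[OF C], of M] by simp
    also have "\<dots> \<le> (exp 1 * real (card C) * p / M) ^ M"
    proof -
      have "real (card C choose M) * fact M \<le> real (card C) ^ M"
        using binomial_fact_pow[of "card C" M] by (metis of_nat_fact of_nat_le_iff of_nat_mult of_nat_power)
      then have "real (card C choose M) * fact M * real M ^ M \<le> real (card C) ^ M * (exp M * fact M)"
        by (intro mult_mono power_self_le_exp_fact) auto
      then have "real (card C choose M) * real M ^ M \<le> real (card C) ^ M * exp M" by (simp add: mult_ac)
      moreover have "exp (real M) = exp 1 ^ M" by (simp add: exp_of_nat_mult[symmetric])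
      ultimately have "real (card C choose M) * real M ^ M \<le> (exp 1 * real (card C)) ^ M" by (simp add: power_mult_distrib mult.commute)
      then have "real (card C choose M) * real M ^ M * p ^ M \<le> (exp 1 * real (card C)) ^ M * p ^ M"
        using p(1) by (intro mult_right_mono) auto
      moreover have "0 < real M ^ M" using M_def by simp
      ultimately show ?thesis by (simp add: power_divide power_mult_distrib field_simps)
    qed
    also have "\<dots> \<le> (1 / 2) ^ M"
    proof (rule power_mono)
      have "2 * exp 1 * real (card C) * p \<le> 2 * exp 1 * E * p" using \<C>(2)[OF C] p(1) by (intro mult_right_mono mult_left_mono) auto
      then have "2 * exp 1 * real (card C) * p \<le> M" using p(4) M by linarith
      moreover have "0 < real M" unfolding M_def by simp
      ultimately show "exp 1 * real (card C) * p / M \<le> 1 / 2" by (simp add: field_simps)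
    qed (use p(1) in simp)
    also have "\<dots> = (1 / 2) powr M" by (simp add: powr_realpow)
    also have "\<dots> \<le> (1 / 2) powr m" using M by (intro powr_mono') auto
    finally show "?P (\<Union>J\<in>JS C. {G. J \<subseteq> G}) \<le> (1 / 2) powr m" .
  qed
  also have "\<dots> = card \<C> * (1 / 2) powr m" by simp
  finally have "?P {G. \<not> real (ex_rel G \<F>) \<le> m} \<le> card \<C> * (1 / 2) powr m" .
  moreover have "?P {G. \<not> real (ex_rel G \<F>) \<le> m} = 1 - ?P {G. real (ex_rel G \<F>) \<le> m}"
    using measure_pmf.prob_compl[of "{G. real (ex_rel G \<F>) \<le> m}" "random_hypergraph r n p"]
    by (simp add: Compl_eq_Diff_UNIV[symmetric] Collect_neg_eq)
  ultimately show ?thesis by linarith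
qed

text \<open>The two lower bounds on \<open>L\<close> are the two conditions on
  \<open>\<tau> = L / card X\<close>. For the largest admissible \<theta> the quotient
  \<open>card X / \<theta>\<close> decreases in \<open>card X\<close>, so the first condition is
  hardest at \<open>card X = E\<close>; in the second one \<open>card X\<close> cancels.\<close>

theorem hypergraph_containers:
  fixes l r :: nat and R :: real
  assumes l: "2 \<le> l" and r: "2 \<le> r" and R: "R = real r - 1 + (real r - 2) / (2 * real l - 2)"
  shows "\<exists>c>0. c \<le> 1 \<and> (\<exists>\<theta>0\<ge>1. \<forall>n E L Q. 0 < n \<longrightarrow> 0 < E \<longrightarrow> 0 < L \<longrightarrow>
    2 * real n * \<theta>0 powr (l - 1 / R) \<le> (E / (4 * real n)) ^ l \<longrightarrow>
    4 * real n * ((2 * real n) powr R / (E / (4 * real n))) powr (1 / (l * R - 1)) \<le> real L \<longrightarrow>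
    4 * real n * (2 * real n) powr (1 / (2 * real l - 1)) \<le> real L \<longrightarrow>
    (1 - c) ^ Q * real n ^ r < E \<longrightarrow>
    (\<exists>\<C>. finite \<C> \<and> card \<C> \<le> (2 * (n ^ r + 1) ^ L) ^ (2 * l * Q) \<and>
      (\<forall>C\<in>\<C>. C \<subseteq> nsets {1..n} r \<and> real (card C) \<le> E) \<and>
      (\<forall>I\<subseteq>nsets {1..n} r. (\<forall>F\<in>berge_cycles r (2 * l). \<not> F \<subseteq> I) \<longrightarrow> (\<exists>C\<in>\<C>. I \<subseteq> C))))"
proof -
  obtain K \<theta>0 where K: "1 \<le> K" and th0: "1 \<le> \<theta>0" and sup: "\<And>n X \<theta> \<tau>. X \<subseteq> nsets {1..n} r \<Longrightarrow> \<theta>0 \<le> \<theta> \<Longrightarrow> \<theta> \<le> card X / (4 * real n) \<Longrightarrow>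
    2 * real n * (\<theta> ^ (l - 1) * \<theta> powr (1 - 1 / R)) \<le> (card X / (4 * real n)) ^ l \<Longrightarrow> 1 / \<theta> \<le> \<tau> \<Longrightarrow>
    1 / ((card X / (4 * real n)) ^ (l - 1) * \<theta> ^ (l - 1) * \<theta> powr (1 - 1 / R)) \<le> \<tau> ^ (2 * l - 1) \<Longrightarrow>
    (\<exists>w. spread (2 * l) K \<tau> X w \<and> (\<forall>F. w F > 0 \<longrightarrow> F \<in> berge_cycles r (2 * l)))"
    using supersaturation[OF l r R] by (elim exE conjE) (simp only: that)
  obtain c :: real where c: "0 < c" "c \<le> 1" and cont: "\<And>(V :: nat set set) L E (Q::nat) \<F>. finite V \<Longrightarrow> 0 < L \<Longrightarrow>
    (\<forall>X\<subseteq>V. E \<le> real (card X) \<longrightarrow> (\<exists>w. spread (2 * l) K (real L / card X) X w \<and> (\<forall>e. w e > 0 \<longrightarrow> e \<in> \<F>))) \<Longrightarrow>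
    (1 - c) ^ Q * card V < E \<Longrightarrow>
    (\<exists>\<C>. finite \<C> \<and> card \<C> \<le> (2 * (card V + 1) ^ L) ^ (2 * l * Q) \<and>
      (\<forall>C\<in>\<C>. C \<subseteq> V \<and> real (card C) < E) \<and>
      (\<forall>I\<subseteq>V. (\<forall>e\<in>\<F>. \<not> e \<subseteq> I) \<longrightarrow> (\<exists>C\<in>\<C>. I \<subseteq> C)))"
    using containers[where 'a = "nat set" and k = "2 * l", OF K]
  proof (elim exE conjE, goal_cases)
    case (1 c)
    show ?case
      by (rule 1(1)[OF 1(2,3)])
        (rule 1(4)[THEN spec, THEN spec, THEN spec, THEN spec, THEN spec, THEN mp, THEN mp, THEN mp, THEN mp])
  qed
  have l': "2 \<le> real l" using l by simp
  have R1: "real r - 1 \<le> R" "1 \<le> R"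
  proof -
    have "0 \<le> (real r - 2) / (2 * real l - 2)" using l r by simp
    then show "real r - 1 \<le> R" "1 \<le> R" unfolding R using r by linarith+
  qed
  define \<beta> where "\<beta> = l - 1 / R"
  define s where "s = l * R - 1"
  have s1: "1 \<le> s"
  proof -
    have "2 * 1 \<le> l * R" using l' R1 by (intro mult_mono) auto
    then show ?thesis unfolding s_def by simp
  qed
  have \<beta>: "\<beta> = s / R" "0 < \<beta>" unfolding \<beta>_def using R1 s1 by (simp_all add: s_def field_simps)
  have main: "\<exists>w. spread (2 * l) K (real L / card X) X w \<and> (\<forall>F. w F > 0 \<longrightarrow> F \<in> berge_cycles r (2 * l))"
    if n: "0 < n" and E: "0 < E" and X: "X \<subseteq> nsets {1..n} r" "E \<le> card X"
      and h1: "2 * real n * \<theta>0 powr \<beta> \<le> (E / (4 * real n)) ^ l"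
      and h2: "4 * real n * ((2 * real n) powr R / (E / (4 * real n))) powr (1 / s) \<le> real L"
      and h3: "4 * real n * (2 * real n) powr (1 / (2 * real l - 1)) \<le> real L" for n L :: nat and E :: real and X
  proof -
    define D where "D = card X / (4 * real n)"
    \<comment> \<open>The largest value allowed by \<open>supersaturation\<close>: the condition
      \<open>2 * n * \<theta> powr \<beta> \<le> D ^ l\<close> becomes an equality.\<close>
    define \<theta> where "\<theta> = (D ^ l / (2 * real n)) powr (1 / \<beta>)"
    have n1: "1 \<le> real n" using n by simp
    have X0: "0 < real (card X)" using X(2) E by linarith
    have D0: "0 < D" unfolding D_def using X0 n1 by simp
    have ED: "E / (4 * real n) \<le> D" unfolding D_def using X(2) n1 by (intro divide_right_mono) auto
    have Y0: "0 < D ^ l / (2 * real n)" using D0 n1 by simp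
    have th_pos: "0 < \<theta>" unfolding \<theta>_def using Y0 D0 n1 by simp
    have th\<beta>: "\<theta> powr \<beta> = D ^ l / (2 * real n)" unfolding \<theta>_def powr_powr using \<beta>(2) D0 by simp
    have th_split: "\<theta> ^ (l - 1) * \<theta> powr (1 - 1 / R) = D ^ l / (2 * real n)"
    proof -
      have "\<theta> ^ (l - 1) = \<theta> powr real (l - 1)" using th_pos by (simp add: powr_realpow)
      then have "\<theta> ^ (l - 1) * \<theta> powr (1 - 1 / R) = \<theta> powr (real (l - 1) + (1 - 1 / R))" by (simp add: powr_add)
      also have "real (l - 1) + (1 - 1 / R) = \<beta>" unfolding \<beta>_def using l by (simp add: of_nat_diff)
      finally show ?thesis using th\<beta> by simp
    qed
    have Dn: "D \<le> (2 * real n) powr R"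
    proof -
      have "card X \<le> card (nsets {1..n} r)" using X(1) by (intro card_mono finite_imp_finite_nsets) auto
      also have "\<dots> = n choose r" by simp
      also have "\<dots> \<le> n ^ r" by (cases "r \<le> n") (simp_all add: binomial_le_pow binomial_eq_0)
      finally have "D \<le> real (n ^ r) / (4 * real n)" unfolding D_def using n1 by (intro divide_right_mono of_nat_mono) auto
      also have "\<dots> \<le> real n ^ (r - 1)"
      proof -
        have "real (n ^ r) = real n ^ Suc (r - 1)" using r by simp
        then have "real (n ^ r) = real n * real n ^ (r - 1)" by (simp only: power_Suc)
        then have "real (n ^ r) / (4 * real n) = real n ^ (r - 1) / 4" using n1 by simp
        moreover have "0 \<le> real n ^ (r - 1)" by simp
        ultimately show ?thesis by linarith
      qed
      also have "\<dots> = real n powr real (r - 1)" by (rule powr_realpow[symmetric]) (use n1 in simp)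
      also have "real (r - 1) = real r - 1" using r by (simp add: of_nat_diff)
      also have "real n powr (real r - 1) \<le> real n powr R" using R1 n1 by (intro powr_mono) auto
      also have "\<dots> \<le> (2 * real n) powr R" using R1 n1 by (intro powr_mono2) auto
      finally show ?thesis .
    qed
    \<comment> \<open>By the choice of \<open>\<theta>\<close> this amounts to
      \<open>D powr (1 / R) \<le> 2 * n\<close>, which holds because \<open>X\<close> has at most
      \<open>n ^ r\<close> edges and \<open>r - 1 \<le> R\<close>.\<close>
    have thD: "\<theta> \<le> D"
    proof -
      have "D powr (1 / R) \<le> ((2 * real n) powr R) powr (1 / R)" using Dn R1 D0 by (intro powr_mono2) auto
      also have "\<dots> = 2 * real n" unfolding powr_powr using R1 n1 by simp
      finally have "D powr \<beta> * D powr (1 / R) \<le> D powr \<beta> * (2 * real n)" by (intro mult_left_mono) auto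
      moreover have "D powr \<beta> * D powr (1 / R) = D ^ l" unfolding powr_add[symmetric] \<beta>_def using D0 by (simp add: powr_realpow)
      ultimately have "D ^ l / (2 * real n) \<le> D powr \<beta>" using n1 by (simp add: field_simps)
      then have "\<theta> \<le> (D powr \<beta>) powr (1 / \<beta>)" unfolding \<theta>_def using Y0 \<beta>(2) by (intro powr_mono2) auto
      also have "\<dots> = D" unfolding powr_powr using \<beta>(2) D0 by simp
      finally show ?thesis .
    qed
    have th_ge: "\<theta>0 \<le> \<theta>"
    proof -
      have "(E / (4 * real n)) ^ l \<le> D ^ l" using ED E n1 by (intro power_mono) auto
      then have "2 * real n * \<theta>0 powr \<beta> \<le> D ^ l" using h1 by linarith
      then have "\<theta>0 powr \<beta> \<le> D ^ l / (2 * real n)" using n1 by (simp add: pos_le_divide_eq mult.commute)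
      then have "(\<theta>0 powr \<beta>) powr (1 / \<beta>) \<le> \<theta>" unfolding \<theta>_def using \<beta>(2) by (intro powr_mono2) auto
      then show ?thesis unfolding powr_powr using \<beta>(2) th0 by simp
    qed
    have cX: "real (card X) = 4 * real n * D" unfolding D_def using n1 by simp
    show ?thesis
    proof (rule sup[OF X(1) th_ge], unfold D_def[symmetric], unfold cX)
      show "\<theta> \<le> D" by (rule thD)
      show "2 * real n * (\<theta> ^ (l - 1) * \<theta> powr (1 - 1 / R)) \<le> D ^ l" unfolding th_split using n1 by simp
      show "1 / \<theta> \<le> real L / (4 * real n * D)"
      proof -
        have "D / \<theta> = ((2 * real n) powr R / D) powr (1 / s)"
        proof -
          have "\<theta> = (D powr l / (2 * real n)) powr (R / s)" unfolding \<theta>_def \<beta>(1) using D0 by (simp add: powr_realpow)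
          also have "\<dots> = D powr (l * R / s) / (2 * real n) powr (R / s)"
            using D0 n1 by (simp add: powr_divide powr_powr)
          finally have "D / \<theta> = D powr 1 / D powr (l * R / s) * (2 * real n) powr (R / s)" using D0 by simp
          also have "D powr 1 / D powr (l * R / s) = D powr (1 - l * R / s)" by (simp only: powr_diff)
          also have "1 - l * R / s = - (1 / s)" using s1 unfolding s_def by (simp add: field_simps)
          finally show ?thesis using D0 n1 by (simp add: powr_divide powr_powr powr_minus field_simps)
        qed
        also have "\<dots> \<le> ((2 * real n) powr R / (E / (4 * real n))) powr (1 / s)"
          using ED E n1 D0 s1 by (intro powr_mono2 divide_left_mono mult_pos_pos) auto
        finally have "4 * real n * (D / \<theta>) \<le> 4 * real n * ((2 * real n) powr R / (E / (4 * real n))) powr (1 / s)"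
          using n1 by (intro mult_left_mono) auto
        then have "4 * real n * (D / \<theta>) \<le> L" using h2 by linarith
        then show ?thesis using n1 D0 th_pos by (simp add: field_simps)
      qed
      show "1 / (D ^ (l - 1) * \<theta> ^ (l - 1) * \<theta> powr (1 - 1 / R)) \<le> (real L / (4 * real n * D)) ^ (2 * l - 1)"
      proof -
        have "2 * real n = ((2 * real n) powr (1 / (2 * real l - 1))) ^ (2 * l - 1)"
        proof -
          have e: "real (2 * l - 1) = 2 * real l - 1" using l by (simp add: of_nat_diff)
          have "((2 * real n) powr (1 / (2 * real l - 1))) ^ (2 * l - 1) = ((2 * real n) powr (1 / (2 * real l - 1))) powr (2 * real l - 1)"
            unfolding e[symmetric] using n1 by (subst powr_realpow) auto
          also have "\<dots> = 2 * real n" unfolding powr_powr using n1 l' by simp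
          finally show ?thesis ..
        qed
        also have "\<dots> \<le> (real L / (4 * real n)) ^ (2 * l - 1)" using h3 n1 by (intro power_mono) (auto simp: field_simps)
        finally have "2 * real n / D ^ (2 * l - 1) \<le> (real L / (4 * real n)) ^ (2 * l - 1) / D ^ (2 * l - 1)"
          using D0 by (intro divide_right_mono) auto
        moreover have "D ^ (l - 1) * D ^ l = D ^ (2 * l - 1)"
        proof -
          have "l - 1 + l = 2 * l - 1" using l by simp
          then show ?thesis by (simp only: power_add[symmetric])
        qed
        ultimately show ?thesis unfolding mult.assoc th_split by (simp add: power_divide power_mult_distrib mult.assoc)
      qed
    qed
  qed
  show ?thesis
  proof (rule exI[of _ c], intro conjI c, rule exI[of _ \<theta>0], intro conjI th0 allI impI)
    fix n L Q :: nat and E :: real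
    assume n: "0 < n" and E: "0 < E" and L: "0 < L" and h1: "2 * real n * \<theta>0 powr (l - 1 / R) \<le> (E / (4 * real n)) ^ l"
      and h2: "4 * real n * ((2 * real n) powr R / (E / (4 * real n))) powr (1 / (l * R - 1)) \<le> real L"
      and h3: "4 * real n * (2 * real n) powr (1 / (2 * real l - 1)) \<le> real L"
      and Q: "(1 - c) ^ Q * real n ^ r < E"
    let ?V = "nsets {1..n} r"
    have "card ?V = n choose r" by simp
    then have cV: "card ?V \<le> n ^ r" by (cases "r \<le> n") (simp_all add: binomial_le_pow binomial_eq_0)
    have "\<exists>\<C>. finite \<C> \<and> card \<C> \<le> (2 * (card ?V + 1) ^ L) ^ (2 * l * Q) \<and>
      (\<forall>C\<in>\<C>. C \<subseteq> ?V \<and> real (card C) < E) \<and>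
      (\<forall>I\<subseteq>?V. (\<forall>e\<in>berge_cycles r (2 * l). \<not> e \<subseteq> I) \<longrightarrow> (\<exists>C\<in>\<C>. I \<subseteq> C))"
    proof (rule cont[OF _ L])
      show "finite ?V" by (simp add: finite_imp_finite_nsets)
      show "\<forall>X\<subseteq>?V. E \<le> real (card X) \<longrightarrow> (\<exists>w. spread (2 * l) K (real L / card X) X w \<and> (\<forall>F. w F > 0 \<longrightarrow> F \<in> berge_cycles r (2 * l)))"
        by (intro allI impI, rule main[OF n E _ _ h1[folded \<beta>_def] h2[folded s_def] h3])
      have "(1 - c) ^ Q * real (card ?V) \<le> (1 - c) ^ Q * real (n ^ r)" using cV c by (intro mult_left_mono of_nat_mono) auto
      then show "(1 - c) ^ Q * real (card ?V) < E" using Q by simp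
    qed
    then obtain \<C> where \<C>: "finite \<C>" "card \<C> \<le> (2 * (card ?V + 1) ^ L) ^ (2 * l * Q)"
      "\<forall>C\<in>\<C>. C \<subseteq> ?V \<and> real (card C) < E" "\<forall>I\<subseteq>?V. (\<forall>e\<in>berge_cycles r (2 * l). \<not> e \<subseteq> I) \<longrightarrow> (\<exists>C\<in>\<C>. I \<subseteq> C)"
      by (elim exE conjE) (simp only: that)
    show "\<exists>\<C>. finite \<C> \<and> card \<C> \<le> (2 * (n ^ r + 1) ^ L) ^ (2 * l * Q) \<and>
      (\<forall>C\<in>\<C>. C \<subseteq> ?V \<and> real (card C) \<le> E) \<and>
      (\<forall>I\<subseteq>?V. (\<forall>F\<in>berge_cycles r (2 * l). \<not> F \<subseteq> I) \<longrightarrow> (\<exists>C\<in>\<C>. I \<subseteq> C))"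
    proof (intro exI[of _ \<C>] conjI)
      show "finite \<C>" by (rule \<C>(1))
      have "(2 * (card ?V + 1) ^ L) ^ (2 * l * Q) \<le> (2 * (n ^ r + 1) ^ L) ^ (2 * l * Q)"
        using cV by (intro power_mono mult_left_mono) auto
      then show "card \<C> \<le> (2 * (n ^ r + 1) ^ L) ^ (2 * l * Q)" using \<C>(2) by linarith
      show "\<forall>C\<in>\<C>. C \<subseteq> ?V \<and> real (card C) \<le> E" using \<C>(3) less_imp_le by blast
      show "\<forall>I\<subseteq>?V. (\<forall>F\<in>berge_cycles r (2 * l). \<not> F \<subseteq> I) \<longrightarrow> (\<exists>C\<in>\<C>. I \<subseteq> C)" by (rule \<C>(4))
    qed
  qed
qed

section \<open>The choice of the parameters\<close>

lemma berge_cycles_nonempty: "0 < k \<Longrightarrow> {} \<notin> berge_cycles r k"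
  unfolding berge_cycles_def by auto

text \<open>Containers, \<open>E\<close> and \<open>m\<close> are chosen for \<open>q\<close>; the
  union bound then works for every \<open>p \<le> q\<close>. With \<open>q\<close> at the lower end
  of its range, all smaller \<open>p\<close> receive the same bound, which is how the part that is
  constant in \<open>p\<close> arises.\<close>

lemma ex_rel_berge_bound:
  fixes l r :: nat and R \<epsilon> :: real
  assumes l: "2 \<le> l" and r: "2 \<le> r" and R: "R = real r - 1 + (real r - 2) / (2 * real l - 2)" and \<epsilon>: "0 < \<epsilon>"
  shows "\<forall>\<^sub>F n in sequentially. \<forall>p q. 0 \<le> p \<and> p \<le> q \<and> q \<le> 1 \<and> real n powr (- (R * (real l - 1) / (2 * real l - 1))) \<le> q \<longrightarrow>
    1 - \<epsilon> \<le> measure_pmf.prob (random_hypergraph r n p)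
      {G. real (ex_rel G (berge_cycles r (2 * l))) \<le> real n powr \<epsilon> * (q powr (1 / (R * real l)) * real n powr (1 + 1 / real l))}"
proof -
  obtain c \<theta>0 where c: "0 < (c :: real)" "c \<le> 1" and th0: "1 \<le> (\<theta>0 :: real)" and cont: "\<And>n E L Q. 0 < n \<Longrightarrow> 0 < E \<Longrightarrow> 0 < L \<Longrightarrow>
    2 * real n * \<theta>0 powr (l - 1 / R) \<le> (E / (4 * real n)) ^ l \<Longrightarrow>
    4 * real n * ((2 * real n) powr R / (E / (4 * real n))) powr (1 / (l * R - 1)) \<le> real L \<Longrightarrow>
    4 * real n * (2 * real n) powr (1 / (2 * real l - 1)) \<le> real L \<Longrightarrow>
    (1 - c) ^ Q * real n ^ r < E \<Longrightarrow>
    (\<exists>\<C>. finite \<C> \<and> card \<C> \<le> (2 * (n ^ r + 1) ^ L) ^ (2 * l * Q) \<and>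
      (\<forall>C\<in>\<C>. C \<subseteq> nsets {1..n} r \<and> real (card C) \<le> E) \<and>
      (\<forall>I\<subseteq>nsets {1..n} r. (\<forall>F\<in>berge_cycles r (2 * l). \<not> F \<subseteq> I) \<longrightarrow> (\<exists>C\<in>\<C>. I \<subseteq> C)))"
    using hypergraph_containers[OF l r R]
  proof (elim exE conjE, goal_cases)
    case (1 c \<theta>0)
    show ?case
      by (rule 1(1)[OF 1(2,3,4)])
        (rule 1(5)[THEN spec, THEN spec, THEN spec, THEN spec, THEN mp, THEN mp, THEN mp, THEN mp, THEN mp, THEN mp, THEN mp])
  qed
  have l': "2 \<le> real l" and r': "2 \<le> real r" using l r by simp_all
  have R1: "1 \<le> R"
  proof -
    have "0 \<le> (real r - 2) / (2 * real l - 2)" using l' r' by simp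
    then show ?thesis unfolding R using r' by linarith
  qed
  define \<beta> where "\<beta> = l - 1 / R"
  define s where "s = l * R - 1"
  have lR: "2 \<le> l * R"
  proof -
    have "2 * 1 \<le> l * R" using l' R1 by (intro mult_mono) auto
    then show ?thesis by simp
  qed
  then have s1: "1 \<le> s" unfolding s_def by simp
  \<comment> \<open>The entry \<open>8\<close> serves the lower bound \<open>h3\<close> on
    \<open>L\<close>, the other entry serves \<open>h2\<close>.\<close>
  define C1 where "C1 = max 8 (4 * (2 powr R * (8 * exp 1)) powr (1 / s))"
  define CQ where "CQ = (real r + 2) / c + 1"
  define C2 where "C2 = (real r + 2) * (C1 + 1) * (2 * real l) * CQ"
  have C1: "8 \<le> C1" "4 * (2 powr R * (8 * exp 1)) powr (1 / s) \<le> C1" unfolding C1_def by auto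
  have CQ: "0 < CQ" unfolding CQ_def using c by (simp add: add_pos_pos)
  have C2: "0 < C2" unfolding C2_def using CQ C1 l' r' by simp
  have ln2: "0 < ln (2 :: real) / 2" by simp
  have ev1: "\<forall>\<^sub>F n in sequentially. 2 * \<theta>0 powr \<beta> * (8 * exp 1) ^ l \<le> real n powr (\<epsilon> * l)"
  proof -
    have "filterlim (\<lambda>n. real n powr (\<epsilon> * l)) at_top sequentially" using \<epsilon> l' by real_asymp
    then show ?thesis unfolding filterlim_at_top by blast
  qed
  have ev2: "\<forall>\<^sub>F n in sequentially. C2 * ln (real n) ^ 2 \<le> ln 2 / 2 * real n powr \<epsilon>"
  proof -
    have "(\<lambda>n. ln (real n) ^ 2 / real n powr \<epsilon>) \<longlonglongrightarrow> 0" using \<epsilon> by real_asymp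
    then have "\<forall>\<^sub>F n in sequentially. ln (real n) ^ 2 / real n powr \<epsilon> < ln 2 / 2 / C2"
      by (rule order_tendstoD(2)) (use ln2 C2 in simp)
    then show ?thesis
      using eventually_gt_at_top[of 0]
    proof eventually_elim
      case (elim n)
      have "0 < real n powr \<epsilon>" using elim(2) by simp
      then show ?case using elim(1) C2 by (simp add: field_simps)
    qed
  qed
  have ev3: "\<forall>\<^sub>F n in sequentially. exp (- (ln 2 / 2) * real n) \<le> \<epsilon>"
  proof -
    have "(\<lambda>n. exp (- (ln 2 / 2) * real n)) \<longlonglongrightarrow> 0" by real_asymp
    then have "\<forall>\<^sub>F n in sequentially. exp (- (ln 2 / 2) * real n) < \<epsilon>" by (rule order_tendstoD(2)) (rule \<epsilon>)
    then show ?thesis by (rule eventually_mono) simp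
  qed
  show ?thesis
    using eventually_ge_at_top[of 3] ev1 ev2 ev3
  proof eventually_elim
    case (elim n)
    have n1: "3 \<le> real n" using elim(1) by simp
    show ?case
    proof (intro allI impI)
      fix p q :: real
      assume "0 \<le> p \<and> p \<le> q \<and> q \<le> 1 \<and> real n powr (- (R * (real l - 1) / (2 * real l - 1))) \<le> q"
      then have p: "0 \<le> p" "p \<le> q" "q \<le> 1" and qn: "real n powr (- (R * (real l - 1) / (2 * real l - 1))) \<le> q" by auto
      have q0: "0 < q"
      proof -
        have "0 < real n powr (- (R * (real l - 1) / (2 * real l - 1)))" using n1 by simp
        then show ?thesis using qn by linarith
      qed
      \<comment> \<open>The common order of the fingerprint length \<open>L\<close> and, up to
        \<open>n powr \<epsilon>\<close>, of the bound \<open>m\<close>. At the least admissible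
        \<open>q\<close> it equals \<open>n powr (1 + 1 / (2 * l - 1))\<close>, which is the order
        demanded by \<open>h3\<close>.\<close>
      define A where "A = q powr (1 / (R * real l)) * real n powr (1 + 1 / real l)"
      define m where "m = real n powr \<epsilon> * A"
      \<comment> \<open>The largest container size with
        \<open>2 * exp 1 * E * q \<le> m\<close>.\<close>
      define E where "E = m / (2 * exp 1 * q)"
      define L where "L = nat \<lceil>C1 * A\<rceil>"
      \<comment> \<open>Brings \<open>(1 - c) ^ Q * n ^ r\<close> down to \<open>exp (- 2)\<close>,
        which is below the lower bound \<open>1 / (2 * exp 1)\<close> for \<open>E\<close>.\<close>
      define Q where "Q = nat \<lceil>(r * ln n + 2) / c\<rceil>"
      have A_ge: "real n powr (1 + 1 / (2 * real l - 1)) \<le> A"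
      proof -
        have "real n powr (- (R * (real l - 1) / (2 * real l - 1)) * (1 / (R * real l))) \<le> q powr (1 / (R * real l))"
          unfolding powr_powr[symmetric] using qn R1 l' by (intro powr_mono2) auto
        then have "real n powr (- (R * (real l - 1) / (2 * real l - 1)) * (1 / (R * real l))) * real n powr (1 + 1 / real l) \<le> A"
          unfolding A_def by (intro mult_right_mono) auto
        moreover have "- (R * (real l - 1) / (2 * real l - 1)) * (1 / (R * real l)) + (1 + 1 / real l) = 1 + 1 / (2 * real l - 1)"
        proof -
          have nz: "2 * real l - 1 \<noteq> 0" "real l \<noteq> 0" "R \<noteq> 0" using l' R1 by auto
          have "- (R * (real l - 1) / (2 * real l - 1)) * (1 / (R * real l)) = - ((real l - 1) / ((2 * real l - 1) * real l))"
            using nz by (simp add: field_simps)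
          also have "\<dots> + (1 + 1 / real l) = 1 + 1 / (2 * real l - 1)" using nz by (simp add: field_simps)
          finally show ?thesis .
        qed
        ultimately show ?thesis unfolding powr_add[symmetric] by (simp only:)
      qed
      have nA: "real n \<le> A"
      proof -
        have "real n powr 1 \<le> real n powr (1 + 1 / (2 * real l - 1))" using n1 l' by (intro powr_mono) auto
        then show ?thesis using A_ge n1 by simp
      qed
      then have A1: "1 \<le> A" using n1 by linarith
      have ne1: "1 \<le> real n powr \<epsilon>" using n1 \<epsilon> by (intro ge_one_powr_ge_zero) auto
      have mA: "A \<le> m" unfolding m_def using ne1 A1 by simp
      then have m0: "0 < m" using A1 by linarith
      have E0: "0 < E" unfolding E_def using m0 q0 by simp
      have qexp: "q powr (1 / (R * real l)) / q = q powr (1 / (R * real l) - 1)" using q0 by (simp add: powr_diff)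
      have E_ge: "1 / (2 * exp 1) \<le> E"
      proof -
        have "1 / (2 * exp 1) \<le> m / (2 * exp 1 * 1)" using mA A1 by (intro frac_le) auto
        also have "\<dots> \<le> E" unfolding E_def using p q0 m0 by (intro divide_left_mono mult_pos_pos) auto
        finally show ?thesis .
      qed
      have L_ge: "C1 * A \<le> real L" unfolding L_def using real_nat_ceiling_ge by blast
      have L_le: "real L \<le> (C1 + 1) * A"
      proof -
        have "0 \<le> C1 * A" using C1 A1 by simp
        then have "real L \<le> C1 * A + 1" unfolding L_def by linarith
        then show ?thesis using A1 by (simp add: algebra_simps)
      qed
      have L0: "0 < L"
      proof -
        have "0 < C1 * A" using C1 A1 by simp
        then show ?thesis using L_ge by linarith
      qed
      have lnn: "1 \<le> ln (real n)"
      proof -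
        have "exp 1 \<le> real n" using exp_le n1 by linarith
        then show ?thesis using n1 by (simp add: ln_ge_iff)
      qed
      have Q_ge: "(r * ln n + 2) / c \<le> real Q" unfolding Q_def using real_nat_ceiling_ge by blast
      have Q_le: "real Q \<le> CQ * ln n"
      proof -
        have "0 \<le> (r * ln n + 2) / c" using lnn c by simp
        then have "real Q \<le> (r * ln n + 2) / c + 1" unfolding Q_def by linarith
        also have "\<dots> \<le> (r * ln n + 2 * ln n) / c + ln n" using lnn c by (intro add_mono divide_right_mono) auto
        also have "\<dots> = CQ * ln n" unfolding CQ_def by (simp add: field_simps)
        finally show ?thesis .
      qed
      have h1: "2 * real n * \<theta>0 powr (l - 1 / R) \<le> (E / (4 * real n)) ^ l"
      proof -
        have "real n powr \<epsilon> * real n powr (1 / real l) / (8 * exp 1) \<le> E / (4 * real n)"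
        proof -
          have "1 \<le> q powr (1 / (R * real l)) / q"
          proof -
            have "q \<le> q powr (1 / (R * real l))"
              using powr_mono'[of "1 / (R * real l)" 1 q] q0 p lR by (simp add: mult.commute)
            then show ?thesis using q0 by simp
          qed
          then have "real n powr \<epsilon> * real n powr (1 / real l) / (8 * exp 1) * 1
            \<le> real n powr \<epsilon> * real n powr (1 / real l) / (8 * exp 1) * (q powr (1 / (R * real l)) / q)"
            by (intro mult_left_mono) auto
          also have "\<dots> = E / (4 * real n)" unfolding E_def m_def A_def using n1 q0 by (simp add: powr_add mult_ac)
          finally show ?thesis by simp
        qed
        then have "(real n powr \<epsilon> * real n powr (1 / real l) / (8 * exp 1)) ^ l \<le> (E / (4 * real n)) ^ l" by (intro power_mono) auto
        moreover have "(real n powr \<epsilon> * real n powr (1 / real l) / (8 * exp 1)) ^ l = real n powr (\<epsilon> * l) * real n / (8 * exp 1) ^ l"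
        proof -
          have "(real n powr \<epsilon>) ^ l = real n powr (\<epsilon> * l)" "(real n powr (1 / real l)) ^ l = real n"
            using n1 l' by (simp_all add: powr_powr flip: powr_realpow)
          then show ?thesis by (simp add: power_divide power_mult_distrib)
        qed
        moreover have "2 * real n * \<theta>0 powr (l - 1 / R) \<le> real n powr (\<epsilon> * l) * real n / (8 * exp 1) ^ l"
        proof -
          have pos: "0 < (8 * exp 1 :: real) ^ l" by simp
          have "2 * \<theta>0 powr \<beta> * (8 * exp 1) ^ l * real n \<le> real n powr (\<epsilon> * l) * real n" using elim(2) by (intro mult_right_mono) auto
          then show ?thesis unfolding \<beta>_def pos_le_divide_eq[OF pos] by (simp add: mult_ac)
        qed
        ultimately show ?thesis by linarith
      qed
      have h2: "4 * real n * ((2 * real n) powr R / (E / (4 * real n))) powr (1 / (l * R - 1)) \<le> real L"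
      proof -
        have "(2 * real n) powr R / (E / (4 * real n)) = 2 powr R * (8 * exp 1) * (real n powr R * real n * q / (real n powr \<epsilon> * A))"
          unfolding E_def m_def using n1 by (simp add: powr_mult field_simps)
        also have "\<dots> \<le> 2 powr R * (8 * exp 1) * (real n powr R * real n * q / (1 * A))"
          using ne1 A1 q0 n1 by (intro mult_left_mono divide_left_mono mult_right_mono) auto
        also have "real n powr R * real n * q / (1 * A) = q powr (s / (R * l)) * real n powr (s / l)"
        proof -
          have nz: "real l \<noteq> 0" "R \<noteq> 0" using l' R1 by auto
          have "real n powr R * real n * q / (1 * A) = q powr 1 / q powr (1 / (R * real l)) * (real n powr (R + 1) / real n powr (1 + 1 / real l))"
            unfolding A_def using q0 n1 by (simp add: powr_add)
          also have "\<dots> = q powr (1 - 1 / (R * real l)) * real n powr (R + 1 - (1 + 1 / real l))" by (simp only: powr_diff)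
          also have "1 - 1 / (R * real l) = s / (R * l)" unfolding s_def using nz by (simp add: field_simps)
          also have "R + 1 - (1 + 1 / real l) = s / l" unfolding s_def using nz by (simp add: field_simps)
          finally show ?thesis .
        qed
        finally have "((2 * real n) powr R / (E / (4 * real n))) powr (1 / s)
          \<le> (2 powr R * (8 * exp 1) * (q powr (s / (R * l)) * real n powr (s / l))) powr (1 / s)"
          using s1 E0 n1 by (intro powr_mono2) auto
        also have "\<dots> = (2 powr R * (8 * exp 1)) powr (1 / s) * (q powr (1 / (R * l)) * real n powr (1 / l))"
        proof -
          have "(q powr (s / (R * l)) * real n powr (s / l)) powr (1 / s) = q powr (1 / (R * l)) * real n powr (1 / l)"
            using q0 n1 s1 by (simp add: powr_mult powr_powr)
          then show ?thesis by (subst powr_mult) simp_all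
        qed
        finally have "4 * real n * ((2 * real n) powr R / (E / (4 * real n))) powr (1 / s)
          \<le> 4 * real n * ((2 powr R * (8 * exp 1)) powr (1 / s) * (q powr (1 / (R * l)) * real n powr (1 / l)))"
          by (intro mult_left_mono) auto
        also have "\<dots> = 4 * (2 powr R * (8 * exp 1)) powr (1 / s) * A"
          unfolding A_def using n1 by (simp add: powr_add)
        also have "\<dots> \<le> C1 * A" using C1(2) A1 by (intro mult_right_mono) auto
        also have "\<dots> \<le> real L" by (rule L_ge)
        finally show ?thesis unfolding s_def .
      qed
      have h3: "4 * real n * (2 * real n) powr (1 / (2 * real l - 1)) \<le> real L"
      proof -
        have "(2 :: real) powr (1 / (2 * real l - 1)) \<le> 2 powr 1" using l' by (intro powr_mono) auto
        then have "4 * real n * ((2 :: real) powr (1 / (2 * real l - 1)) * real n powr (1 / (2 * real l - 1)))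
          \<le> 4 * real n * (2 * real n powr (1 / (2 * real l - 1)))" using n1 by (intro mult_left_mono mult_right_mono) auto
        also have "\<dots> = 8 * real n powr (1 + 1 / (2 * real l - 1))" using n1 by (simp add: powr_add)
        also have "\<dots> \<le> C1 * A" using A_ge C1 A1 by (intro mult_mono) auto
        also have "\<dots> \<le> real L" by (rule L_ge)
        finally show ?thesis using n1 by (simp add: powr_mult)
      qed
      have h4: "(1 - c) ^ Q * real n ^ r < E"
      proof -
        have "(1 - c) ^ Q \<le> exp (- c) ^ Q" using c exp_ge_add_one_self[of "- c"] by (intro power_mono) auto
        also have "\<dots> = exp (- (c * real Q))" by (simp add: exp_of_nat_mult[symmetric] mult.commute)
        also have "\<dots> \<le> exp (- (r * ln n + 2))" using Q_ge c by (simp add: field_simps)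
        finally have "(1 - c) ^ Q * real n ^ r \<le> exp (- (r * ln n + 2)) * real n ^ r" by (intro mult_right_mono) auto
        also have "exp (- (r * ln n + 2)) * real n ^ r = exp (- 2)"
        proof -
          have "real n ^ r = exp (r * ln n)" using n1 by (simp add: exp_of_nat_mult)
          then show ?thesis by (simp add: exp_add[symmetric])
        qed
        also have "exp (- 2) < 1 / (2 * exp (1 :: real))"
        proof -
          have "(2 :: real) < exp 1" using exp_lower_Taylor_quadratic[of 1] by simp
          moreover have "exp (2 :: real) = exp 1 * exp 1" by (simp add: exp_add[symmetric])
          ultimately show ?thesis by (simp add: exp_minus field_simps)
        qed
        also have "\<dots> \<le> E" by (rule E_ge)
        finally show ?thesis .
      qed
      obtain \<C> where \<C>: "finite \<C>" "card \<C> \<le> (2 * (n ^ r + 1) ^ L) ^ (2 * l * Q)"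
        "\<forall>C\<in>\<C>. C \<subseteq> nsets {1..n} r \<and> real (card C) \<le> E"
        "\<forall>I\<subseteq>nsets {1..n} r. (\<forall>F\<in>berge_cycles r (2 * l). \<not> F \<subseteq> I) \<longrightarrow> (\<exists>C\<in>\<C>. I \<subseteq> C)"
      proof -
        have "0 < n" using elim(1) by simp
        from cont[OF this E0 L0 h1 h2 h3 h4] show thesis
          by (elim exE conjE) (rule that)
      qed
      have cC: "real (card \<C>) \<le> exp (C2 * ln n ^ 2 * A)"
      proof -
        have n2: "2 \<le> n" using elim(1) by simp
        have "2 * (n ^ r + 1) ^ L \<le> n ^ L * (n ^ (r + 1)) ^ L"
        proof (rule mult_mono)
          show "2 \<le> n ^ L" using n2 L0 by (metis One_nat_def Suc_leI le_trans numeral_le_iff one_le_numeral order_trans self_le_power)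
          have "n ^ r + 1 \<le> n ^ r + n ^ r" using n2 by simp
          also have "\<dots> = 2 * n ^ r" by simp
          also have "\<dots> \<le> n * n ^ r" using n2 by (intro mult_right_mono) auto
          finally show "(n ^ r + 1) ^ L \<le> (n ^ (r + 1)) ^ L" by (intro power_mono) auto
        qed auto
        also have "\<dots> = n ^ ((r + 2) * L)"
        proof -
          have "L + (r + 1) * L = (r + 2) * L" by simp
          then show ?thesis by (simp only: power_mult[symmetric] power_add[symmetric])
        qed
        finally have "(2 * (n ^ r + 1) ^ L) ^ (2 * l * Q) \<le> (n ^ ((r + 2) * L)) ^ (2 * l * Q)" by (intro power_mono) auto
        then have "card \<C> \<le> n ^ ((r + 2) * L * (2 * l * Q))" using \<C>(2) by (simp only: power_mult order_trans)
        then have "real (card \<C>) \<le> real (n ^ ((r + 2) * L * (2 * l * Q)))" by (rule of_nat_mono)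
        also have "\<dots> = exp (real ((r + 2) * L * (2 * l * Q)) * ln n)" using n1 by (simp only: exp_of_nat_mult of_nat_power exp_ln)
        also have "\<dots> \<le> exp (C2 * ln n ^ 2 * A)"
        proof -
          have "real ((r + 2) * L * (2 * l * Q)) * ln n = (real r + 2) * (2 * real l) * ln n * (real L * real Q)" by (simp add: algebra_simps)
          also have "\<dots> \<le> (real r + 2) * (2 * real l) * ln n * (((C1 + 1) * A) * (CQ * ln n))"
            using L_le Q_le C1 A1 lnn l' by (intro mult_left_mono mult_mono) auto
          also have "\<dots> = C2 * ln n ^ 2 * A" unfolding C2_def by (simp add: power2_eq_square)
          finally show ?thesis by simp
        qed
        finally show ?thesis .
      qed
      \<comment> \<open>The logarithm of the number of containers is of order at most
        \<open>A * ln n ^ 2\<close>: \<open>L\<close> is of order \<open>A\<close>, \<open>Q\<close>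
        at most of order \<open>ln n\<close>, and each element of a fingerprint costs another
        \<open>ln n\<close>. The factor \<open>n powr \<epsilon>\<close> in \<open>m\<close>
        outgrows \<open>ln n ^ 2\<close>.\<close>
      have small: "real (card \<C>) * (1 / 2) powr m \<le> \<epsilon>"
      proof -
        have "(1 / 2 :: real) powr m = exp (- (ln 2 * m))" by (simp add: powr_def ln_div)
        then have "real (card \<C>) * (1 / 2) powr m \<le> exp (C2 * ln n ^ 2 * A) * exp (- (ln 2 * m))"
          using cC by (intro mult_mono) auto
        also have "\<dots> = exp (C2 * ln n ^ 2 * A - ln 2 * m)" by (simp add: exp_diff exp_minus field_simps)
        also have "\<dots> \<le> exp (- (ln 2 / 2) * real n)"
        proof -
          have "C2 * ln n ^ 2 * A \<le> ln 2 / 2 * real n powr \<epsilon> * A" using elim(3) A1 by (intro mult_right_mono) auto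
          then have "C2 * ln n ^ 2 * A \<le> ln 2 / 2 * m" unfolding m_def by (simp add: mult.assoc)
          moreover have "ln 2 / 2 * real n \<le> ln 2 / 2 * m" using nA mA by (intro mult_left_mono) auto
          ultimately have "C2 * ln n ^ 2 * A - ln 2 * m \<le> - (ln 2 / 2) * real n" by linarith
          then show ?thesis by simp
        qed
        also have "\<dots> \<le> \<epsilon>" by (rule elim(4))
        finally show ?thesis .
      qed
      have "1 - card \<C> * (1 / 2) powr m \<le> measure_pmf.prob (random_hypergraph r n p) {G. real (ex_rel G (berge_cycles r (2 * l))) \<le> m}"
      proof (rule prob_ex_rel_le[OF _ \<C>(1)])
        show "{} \<notin> berge_cycles r (2 * l)" by (rule berge_cycles_nonempty) (use l in simp)
        show "C \<subseteq> nsets {1..n} r \<and> real (card C) \<le> E" if "C \<in> \<C>" for C using \<C>(3) that by blast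
        show "\<exists>C\<in>\<C>. I \<subseteq> C" if "I \<subseteq> nsets {1..n} r" "\<forall>F\<in>berge_cycles r (2 * l). \<not> F \<subseteq> I" for I using \<C>(4) that by blast
        have "2 * exp 1 * E * p \<le> 2 * exp 1 * E * q" using p E0 by (intro mult_left_mono) auto
        also have "\<dots> = m" unfolding E_def using q0 by simp
        finally show "2 * exp 1 * E * p \<le> m" .
      qed (use p m0 in auto)
      then show "1 - \<epsilon> \<le> measure_pmf.prob (random_hypergraph r n p)
        {G. real (ex_rel G (berge_cycles r (2 * l))) \<le> real n powr \<epsilon> * (q powr (1 / (R * real l)) * real n powr (1 + 1 / real l))}"
        using small unfolding m_def A_def by linarith
    qed
  qed
qed

text \<open>At \<open>n\<close> the value \<open>1 / (k + 1)\<close> is used for the largest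
  \<open>k \<le> n\<close> whose own property is already valid from some point up to
  \<open>n\<close> on; this \<open>k\<close> tends to infinity with \<open>n\<close>.\<close>

lemma eventually_diagonal:
  fixes P :: "real \<Rightarrow> nat \<Rightarrow> bool"
  assumes P: "\<And>\<epsilon>. 0 < \<epsilon> \<Longrightarrow> \<forall>\<^sub>F n in sequentially. P \<epsilon> n"
  shows "\<exists>e. e \<longlonglongrightarrow> 0 \<and> (\<forall>\<^sub>F n in sequentially. P (e n) n)"
proof -
  have "\<forall>k. \<exists>N. \<forall>n\<ge>N. P (1 / real (Suc k)) n" using P unfolding eventually_sequentially by simp
  from choice[OF this] obtain N where N: "\<And>k n. N k \<le> n \<Longrightarrow> P (1 / real (Suc k)) n" by blast
  define S where "S n = {k. k \<le> n \<and> N k \<le> n}" for n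
  define \<kappa> where "\<kappa> n = Max (insert 0 (S n))" for n
  have fin: "finite (S n)" for n unfolding S_def by simp
  have ge: "k \<le> \<kappa> n" if "max k (N k) \<le> n" for k n unfolding \<kappa>_def by (rule Max_ge) (use fin that in \<open>auto simp: S_def\<close>)
  have "P (1 / real (Suc (\<kappa> n))) n" if "N 0 \<le> n" for n
  proof -
    have "\<kappa> n \<in> insert 0 (S n)" unfolding \<kappa>_def by (rule Max_in) (use fin in auto)
    then have "N (\<kappa> n) \<le> n" using that unfolding S_def by auto
    then show ?thesis by (rule N)
  qed
  then have "\<forall>\<^sub>F n in sequentially. P (1 / real (Suc (\<kappa> n))) n" unfolding eventually_sequentially by blast
  moreover have "(\<lambda>n. 1 / real (Suc (\<kappa> n))) \<longlonglongrightarrow> 0"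
  proof -
    have "filterlim \<kappa> at_top sequentially"
      unfolding filterlim_at_top eventually_sequentially using ge by blast
    then have "filterlim (\<lambda>n. real (\<kappa> n)) at_top sequentially" by (rule filterlim_compose[OF filterlim_real_sequentially])
    then have "(\<lambda>n. inverse (real (\<kappa> n) + 1)) \<longlonglongrightarrow> 0"
      by (intro tendsto_inverse_0_at_top) (auto intro: filterlim_at_top_mono)
    then show ?thesis by (simp add: inverse_eq_divide add.commute)
  qed
  ultimately show ?thesis by (intro exI[of _ "\<lambda>n. 1 / real (Suc (\<kappa> n))"]) simp
qed

theorem theorem1p11:
  fixes l r :: nat and lam :: real and \<delta>\<^sub>1 \<delta>\<^sub>2 :: "nat \<Rightarrow> real"
  assumes "l \<ge> 2" and "r \<ge> 2"
    and "lam = (real r - 2) / (2 * real l - 2)"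
    and "\<delta>\<^sub>1 \<longlonglongrightarrow> 0" and "\<delta>\<^sub>2 \<longlonglongrightarrow> 0"
  shows "\<exists>\<epsilon>\<^sub>1 \<epsilon>\<^sub>2 :: nat \<Rightarrow> real. \<epsilon>\<^sub>1 \<longlonglongrightarrow> 0 \<and> \<epsilon>\<^sub>2 \<longlonglongrightarrow> 0 \<and>
    (\<forall>p :: nat \<Rightarrow> real. (\<forall>n. 0 \<le> p n \<and> p n \<le> 1) \<longrightarrow>
      ((\<forall>\<^sub>F n in sequentially.
          real n powr (- real r + 1 + 1 / (2 * real l - 1)) \<le> p n \<and>
          p n \<le> real n powr (- ((real r - 1 + lam) * (real l - 1) / (2 * real l - 1)) + \<delta>\<^sub>1 n))
        \<longrightarrow> (\<lambda>n. measure_pmf.prob (random_hypergraph r n (p n))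
               {G. real (ex_rel G (berge_cycles r (2 * l)))
                     \<le> real n powr (1 + 1 / (2 * real l - 1) + \<epsilon>\<^sub>1 n)}) \<longlonglongrightarrow> 1) \<and>
      ((\<forall>\<^sub>F n in sequentially.
          real n powr (- ((real r - 1 + lam) * (real l - 1) / (2 * real l - 1)) + \<delta>\<^sub>2 n) \<le> p n \<and>
          p n \<le> 1)
        \<longrightarrow> (\<lambda>n. measure_pmf.prob (random_hypergraph r n (p n))
               {G. real (ex_rel G (berge_cycles r (2 * l)))
                     \<le> p n powr (1 / ((real r - 1 + lam) * real l))
                        * real n powr (1 + 1 / real l + \<epsilon>\<^sub>2 n)}) \<longlonglongrightarrow> 1))"
proof -
  define R where "R = real r - 1 + lam"
  have R: "R = real r - 1 + (real r - 2) / (2 * real l - 2)" unfolding R_def assms(3) ..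
  have l': "2 \<le> real l" and r': "2 \<le> real r" using assms(1,2) by simp_all
  have R1: "1 \<le> R"
  proof -
    have "0 \<le> (real r - 2) / (2 * real l - 2)" using l' r' by simp
    then show ?thesis unfolding R using r' by linarith
  qed
  define \<kappa> where "\<kappa> = R * (real l - 1) / (2 * real l - 1)"
  define \<mu> where "\<mu> = 1 / (R * real l)"
  have \<kappa>0: "0 \<le> \<kappa>" unfolding \<kappa>_def using R1 l' by simp
  have \<mu>0: "0 \<le> \<mu>" unfolding \<mu>_def using R1 l' by simp
  \<comment> \<open>The two bounds agree at the edge probability
    \<open>n powr (- \<kappa>)\<close>.\<close>
  have exponent: "1 + 1 / real l - \<kappa> * \<mu> = 1 + 1 / (2 * real l - 1)"
  proof -
    have nz: "2 * real l - 1 \<noteq> 0" "real l \<noteq> 0" "R \<noteq> 0" using l' R1 by auto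
    have "\<kappa> * \<mu> = (real l - 1) / ((2 * real l - 1) * real l)" unfolding \<kappa>_def \<mu>_def using nz by (simp add: field_simps)
    then show ?thesis using nz by (simp add: field_simps)
  qed
  define ev where "ev n b = {G. real (ex_rel G (berge_cycles r (2 * l))) \<le> b}" for n :: nat and b :: real
  \<comment> \<open>\<open>P\<close> quantifies over all \<open>p\<close> and \<open>q\<close>, so
    the sequence \<open>e\<close> extracted by the diagonal argument, and with it
    \<open>\<epsilon>1\<close> and \<open>\<epsilon>2\<close>, does not depend on the edge
    probability.\<close>
  define P where "P \<epsilon> n \<longleftrightarrow> (\<forall>p q. 0 \<le> p \<and> p \<le> q \<and> q \<le> 1 \<and> real n powr (- \<kappa>) \<le> q \<longrightarrow>
    1 - \<epsilon> \<le> measure_pmf.prob (random_hypergraph r n p) (ev n (real n powr \<epsilon> * (q powr \<mu> * real n powr (1 + 1 / real l)))))" for \<epsilon> n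
  have "\<forall>\<^sub>F n in sequentially. P \<epsilon> n" if "0 < \<epsilon>" for \<epsilon>
    unfolding P_def ev_def \<kappa>_def \<mu>_def by (rule ex_rel_berge_bound[OF assms(1,2) R that])
  then have "\<exists>e. e \<longlonglongrightarrow> 0 \<and> (\<forall>\<^sub>F n in sequentially. P (e n) n)" by (rule eventually_diagonal)
  then obtain e where e: "e \<longlonglongrightarrow> 0" "\<forall>\<^sub>F n in sequentially. P (e n) n" by (elim exE conjE) (rule that)
  \<comment> \<open>Moving the end point of a range by \<open>\<delta>\<^sub>1 n\<close> changes the
    probability there by a factor of at most \<open>n powr \<bar>\<delta>\<^sub>1 n\<bar>\<close>,
    and the bound by the \<open>\<mu>\<close>-th power of it.\<close>
  define \<epsilon>1 where "\<epsilon>1 n = e n + \<bar>\<delta>\<^sub>1 n\<bar> * \<mu>" for n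
  define \<epsilon>2 where "\<epsilon>2 n = e n + \<bar>\<delta>\<^sub>2 n\<bar> * \<mu>" for n
  have lim: "(\<lambda>n. e n + \<bar>\<delta> n\<bar> * \<mu>) \<longlonglongrightarrow> 0" if "\<delta> \<longlonglongrightarrow> 0" for \<delta> :: "nat \<Rightarrow> real"
    using tendsto_add[OF e(1) tendsto_mult_right[OF tendsto_rabs[OF that], of \<mu>]] by simp
  \<comment> \<open>Both ranges are instances with \<open>q\<close> the maximum of
    \<open>p n\<close> and \<open>n powr (- \<kappa>)\<close>. What remains for each range is to
    compare the resulting bound with the required one.\<close>
  have tend: "(\<lambda>n. measure_pmf.prob (random_hypergraph r n (p n)) (ev n (b n))) \<longlonglongrightarrow> 1"
    if p: "\<And>n. 0 \<le> p n \<and> p n \<le> 1"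
      and b: "\<forall>\<^sub>F n in sequentially. real n powr e n * (max (p n) (real n powr (- \<kappa>)) powr \<mu> * real n powr (1 + 1 / real l)) \<le> b n" for p b
  proof (rule tendsto_sandwich)
    show "\<forall>\<^sub>F n in sequentially. 1 - e n \<le> measure_pmf.prob (random_hypergraph r n (p n)) (ev n (b n))"
      using e(2) b eventually_gt_at_top[of 0]
    proof eventually_elim
      case (elim n)
      have "real n powr (- \<kappa>) \<le> real n powr 0" using elim(3) \<kappa>0 by (intro powr_mono) auto
      then have "max (p n) (real n powr (- \<kappa>)) \<le> 1" using p[of n] elim(3) by simp
      then have "1 - e n \<le> measure_pmf.prob (random_hypergraph r n (p n))
          (ev n (real n powr e n * (max (p n) (real n powr (- \<kappa>)) powr \<mu> * real n powr (1 + 1 / real l))))"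
        using elim(1)[unfolded P_def, rule_format, of "p n" "max (p n) (real n powr (- \<kappa>))"] p[of n] by simp
      also have "\<dots> \<le> measure_pmf.prob (random_hypergraph r n (p n)) (ev n (b n))"
        by (rule measure_pmf.finite_measure_mono) (use elim(2) in \<open>auto simp: ev_def\<close>)
      finally show ?case .
    qed
    show "\<forall>\<^sub>F n in sequentially. measure_pmf.prob (random_hypergraph r n (p n)) (ev n (b n)) \<le> 1" by simp
    show "(\<lambda>n. 1 - e n) \<longlonglongrightarrow> 1" using tendsto_diff[OF tendsto_const[of 1] e(1)] by simp
  qed simp
  show ?thesis
    unfolding R_def[symmetric] \<kappa>_def[symmetric] \<mu>_def[symmetric]
  proof (rule exI[of _ \<epsilon>1], rule exI[of _ \<epsilon>2], intro conjI allI impI)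
    show "\<epsilon>1 \<longlonglongrightarrow> 0" "\<epsilon>2 \<longlonglongrightarrow> 0" unfolding \<epsilon>1_def \<epsilon>2_def by (rule lim, fact)+
  next
    fix p :: "nat \<Rightarrow> real"
    assume p: "\<forall>n. 0 \<le> p n \<and> p n \<le> 1"
      and h: "\<forall>\<^sub>F n in sequentially. real n powr (- real r + 1 + 1 / (2 * real l - 1)) \<le> p n \<and> p n \<le> real n powr (- \<kappa> + \<delta>\<^sub>1 n)"
    show "(\<lambda>n. measure_pmf.prob (random_hypergraph r n (p n))
      {G. real (ex_rel G (berge_cycles r (2 * l))) \<le> real n powr (1 + 1 / (2 * real l - 1) + \<epsilon>1 n)}) \<longlonglongrightarrow> 1"
    proof (rule tend[unfolded ev_def])
      show "\<forall>\<^sub>F n in sequentially. real n powr e n * (max (p n) (real n powr (- \<kappa>)) powr \<mu> * real n powr (1 + 1 / real l))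
        \<le> real n powr (1 + 1 / (2 * real l - 1) + \<epsilon>1 n)"
        using h eventually_gt_at_top[of 0]
      proof eventually_elim
        case (elim n)
        have n1: "1 \<le> real n" using elim(2) by simp
        have "real n powr (- \<kappa> + \<delta>\<^sub>1 n) \<le> real n powr (- \<kappa> + \<bar>\<delta>\<^sub>1 n\<bar>)" "real n powr (- \<kappa>) \<le> real n powr (- \<kappa> + \<bar>\<delta>\<^sub>1 n\<bar>)"
          using n1 by (intro powr_mono; simp)+
        then have "max (p n) (real n powr (- \<kappa>)) \<le> real n powr (- \<kappa> + \<bar>\<delta>\<^sub>1 n\<bar>)" using elim(1) by simp
        then have "max (p n) (real n powr (- \<kappa>)) powr \<mu> \<le> (real n powr (- \<kappa> + \<bar>\<delta>\<^sub>1 n\<bar>)) powr \<mu>"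
          using \<mu>0 by (intro powr_mono2) (auto simp: le_max_iff_disj)
        then have "real n powr e n * (max (p n) (real n powr (- \<kappa>)) powr \<mu> * real n powr (1 + 1 / real l))
          \<le> real n powr e n * ((real n powr (- \<kappa> + \<bar>\<delta>\<^sub>1 n\<bar>)) powr \<mu> * real n powr (1 + 1 / real l))"
          by (intro mult_left_mono mult_right_mono) auto
        also have "\<dots> = real n powr (e n + ((- \<kappa> + \<bar>\<delta>\<^sub>1 n\<bar>) * \<mu> + (1 + 1 / real l)))" by (simp only: powr_powr powr_add[symmetric])
        also have "e n + ((- \<kappa> + \<bar>\<delta>\<^sub>1 n\<bar>) * \<mu> + (1 + 1 / real l)) = 1 + 1 / (2 * real l - 1) + \<epsilon>1 n"
          unfolding exponent[symmetric] \<epsilon>1_def by (simp add: algebra_simps)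
        finally show ?case .
      qed
    qed (use p in blast)
  next
    fix p :: "nat \<Rightarrow> real"
    assume p: "\<forall>n. 0 \<le> p n \<and> p n \<le> 1"
      and h: "\<forall>\<^sub>F n in sequentially. real n powr (- \<kappa> + \<delta>\<^sub>2 n) \<le> p n \<and> p n \<le> 1"
    show "(\<lambda>n. measure_pmf.prob (random_hypergraph r n (p n))
      {G. real (ex_rel G (berge_cycles r (2 * l))) \<le> p n powr \<mu> * real n powr (1 + 1 / real l + \<epsilon>2 n)}) \<longlonglongrightarrow> 1"
    proof (rule tend[unfolded ev_def])
      show "\<forall>\<^sub>F n in sequentially. real n powr e n * (max (p n) (real n powr (- \<kappa>)) powr \<mu> * real n powr (1 + 1 / real l))
        \<le> p n powr \<mu> * real n powr (1 + 1 / real l + \<epsilon>2 n)"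
        using h eventually_gt_at_top[of 0]
      proof eventually_elim
        case (elim n)
        have n1: "1 \<le> real n" using elim(2) by simp
        have one: "1 \<le> real n powr \<bar>\<delta>\<^sub>2 n\<bar>" using n1 by (intro ge_one_powr_ge_zero) auto
        have "real n powr (- \<kappa>) \<le> real n powr ((- \<kappa> + \<delta>\<^sub>2 n) + \<bar>\<delta>\<^sub>2 n\<bar>)" using n1 by (intro powr_mono) auto
        also have "\<dots> = real n powr (- \<kappa> + \<delta>\<^sub>2 n) * real n powr \<bar>\<delta>\<^sub>2 n\<bar>" by (rule powr_add)
        also have "\<dots> \<le> p n * real n powr \<bar>\<delta>\<^sub>2 n\<bar>" using elim(1) by (intro mult_right_mono) auto
        finally have "real n powr (- \<kappa>) \<le> p n * real n powr \<bar>\<delta>\<^sub>2 n\<bar>" .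
        moreover have "p n * 1 \<le> p n * real n powr \<bar>\<delta>\<^sub>2 n\<bar>" using p one by (intro mult_left_mono) auto
        ultimately have "max (p n) (real n powr (- \<kappa>)) \<le> p n * real n powr \<bar>\<delta>\<^sub>2 n\<bar>" by simp
        then have "max (p n) (real n powr (- \<kappa>)) powr \<mu> \<le> (p n * real n powr \<bar>\<delta>\<^sub>2 n\<bar>) powr \<mu>"
          using \<mu>0 p by (intro powr_mono2) (auto simp: le_max_iff_disj)
        also have "\<dots> = p n powr \<mu> * real n powr (\<bar>\<delta>\<^sub>2 n\<bar> * \<mu>)" using p by (simp add: powr_mult powr_powr)
        finally have "real n powr e n * (max (p n) (real n powr (- \<kappa>)) powr \<mu> * real n powr (1 + 1 / real l))
          \<le> real n powr e n * (p n powr \<mu> * real n powr (\<bar>\<delta>\<^sub>2 n\<bar> * \<mu>) * real n powr (1 + 1 / real l))"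
          by (intro mult_left_mono mult_right_mono) auto
        also have "\<dots> = p n powr \<mu> * real n powr (1 + 1 / real l + \<epsilon>2 n)" unfolding \<epsilon>2_def by (simp add: powr_add)
        finally show ?case .
      qed
    qed (use p in blast)
  qed
qed

end
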